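(* Let $\bm\mu=(\mu^{(1)},\dots,\mu^{(d)})$ be a $d$-type offspring distribution satisfying the Main Assumptions of the context. For $i\in[d]$, let $F$ be a $d$-type Galton--Watson forest distributed according to $\mathbf{P}^{\mathbf{i}}$, where $\mathbf{i}=(i,i,\dots)$. Then, under $\mathbf{P}^{\mathbf{i}}$, the following convergence in distribution holds in $\mathbb{D}(\mathbb{R}_+,\mathbb{R})$, the space of right-continuous functions with left limits (with the Skorohod topology): $$\left(\frac{1}{n^{1-1/\underline{\alpha}}}\Upsilon^{F}_{\lfloor ns\rfloor},\ s\ge 0\right)\xrightarrow[n\to\infty]{d}\left(-\frac{\bar c}{b_i}I_s,\ s\ge 0\right),$$ where $I_s$ is the infimum at time $s$ of the strictly stable spectrally positive L\'evy process $Y^{(\underline{\alpha})}$.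
   Context: **Trees and forests.** $\mathbb{N}=\{1,2,\dots\}$, $\mathbb{Z}_+=\{0,1,2,\dots\}$, $[d]=\{1,\dots,d\}$. Let $U=\bigcup_{n\ge0}\mathbb{N}^n$ be the set of finite words, with $\mathbb{N}^0=\{\varnothing\}$; $|u|$ is the length of $u$; $u$ is an ancestor (prefix) of $v$ if $v=uw$ for some $w\in U$. The depth-first order $\prec$ on $U$ is the lexicographical order (prefixes come first). A rooted planar tree is a finite set $\mathbf{t}\subset U$ with $\varnothing\in\mathbf{t}$ and such that $ui\in\mathbf{t}$ ($i\in\mathbb{N}$) implies $u\in\mathbf{t}$ and $uj\in\mathbf{t}$ for $1\le j\le i$. A forest is a set $\mathbf{f}=\bigcup_k k\mathbf{t}_{(k)}$, with $(\mathbf{t}_{(k)})$ a finite or infinite sequence of trees (its components). A $d$-type tree (forest) is a tree (forest) together with a type function from its vertices to $[d]$. $c(u)$ is the number of children of $u$, $c^{(j)}(u)$ the number of children of type $j$. **Galton--Watson (GW) laws.** A $d$-type offspring distribution $\bm\mu=(\mu^{(1)},\dots,\mu^{(d)})$ is a family of probability distributions on $\mathbb{Z}_+^d$. $\mathbf{P}^{(i)}$ is the law of the $d$-type GW tree with root of type $i$: a tree $\mathbf{t}$ with root of type $i$ and type function $e$ has probability $\prod_{u\in\mathbf{t}}\frac{c^{(1)}(u)!\cdots c^{(d)}(u)!}{c(u)!}\,\mu^{(e(u))}(\{(c^{(1)}(u),\dots,c^{(d)}(u))\})$. For a finite or infinite sequence $\mathbf{x}=(x_1,x_2,\dots)$ in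 $[d]$, $\mathbf{P}^{\mathbf{x}}$ is the law of the forest whose components are independent with respective laws $\mathbf{P}^{(x_1)},\mathbf{P}^{(x_2)},\dots$ **Means.** $m_{ij}=\sum_{\mathbf{z}}z_j\mu^{(i)}(\{\mathbf{z}\})$, $\mathbf{m}_i=(m_{i1},\dots,m_{id})$, $\mathbf{M}=(m_{ij})$. $\bm\mu$ is irreducible if for all $i,j$ some power $\mathbf{M}^n$ has positive $ij$-entry; then $\mathbf{M}$ has Perron--Frobenius eigenvalue $\rho$, and $\bm\mu$ is critical if $\rho=1$. $\bm\mu$ is non-degenerate if for some $i$, $\mu^{(i)}(\{\mathbf{z}:\sum_j z_j\ne1\})>0$. When $\bm\mu$ is critical and irreducible, $\mathbf{a}$ and $\mathbf{b}$ denote the left and right eigenvectors of $\mathbf{M}$ for eigenvalue $1$ with positive entries ($\mathbf{a}\mathbf{M}=\mathbf{a}$, $\mathbf{M}\mathbf{b}=\mathbf{b}$), normalized by $\langle\mathbf{a},\mathbf{1}\rangle=\langle\mathbf{a},\mathbf{b}\rangle=1$. **Main Assumptions.** Put $\psi^{(i)}(\mathbf{s})=-\log\sum_{\mathbf{z}}\mu^{(i)}(\{\mathbf{z}\})e^{-\langle\mathbf{z},\mathbf{s}\rangle}$, $\mathbf{s}\in\mathbb{R}_+^d$; $|\cdot|$ is the Euclidean norm and $\mathbf{S}^d=\{\mathbf{y}\in\mathbb{R}^d:|\mathbf{y}|=1\}$. (1) $\bm\mu$ is irreducible, non-degenerate and critical. (2) There is a nonempty $\Delta\subseteq[d]$ such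 that for every $i\in\Delta$ there are $\alpha_i\in(1,2]$ and a finite non-zero Borel measure $\lambda_i$ on $\mathbf{S}^d$, supported in $\mathbf{S}^d\cap\mathbb{R}_+^d$ if $\alpha_i\in(1,2)$, with $\psi^{(i)}(\mathbf{s})=\langle\mathbf{m}_i,\mathbf{s}\rangle+|\mathbf{s}|^{\alpha_i}\Theta^{(i)}(\mathbf{s}/|\mathbf{s}|)+o(|\mathbf{s}|^{\alpha_i})$ as $|\mathbf{s}|\downarrow0$, where $\Theta^{(i)}(\mathbf{s})=\int_{\mathbf{S}^d}|\langle\mathbf{s},\mathbf{y}\rangle|^{\alpha_i}\lambda_i(d\mathbf{y})$. (3) For $i\in[d]\setminus\Delta$, set $\alpha_i=\min_{j\in\Delta}\alpha_j$, $\lambda_i\equiv0$, $\Theta^{(i)}\equiv0$; then $\psi^{(i)}(\mathbf{s})=\langle\mathbf{m}_i,\mathbf{s}\rangle+o(|\mathbf{s}|^{\alpha_i})$ as $|\mathbf{s}|\downarrow0$. Set $\underline{\alpha}=\min_{i\in[d]}\alpha_i$ and $\bar c=\Big(\sum_{i\in[d]:\,\alpha_i=\underline{\alpha}}a_i\Theta^{(i)}(\mathbf{b})\Big)^{1/\underline{\alpha}}$. **Component index.** List the vertices of a forest $\mathbf{f}$ in depth-first order $u_{\mathbf{f}}(0)\prec u_{\mathbf{f}}(1)\prec\cdots$. $\Upsilon^{\mathbf{f}}_n$ is the first letter of the word $u_{\mathbf{f}}(n)$, i.e. the index of the tree component containing $u_{\mathbf{f}}(n)$ (for $n\ge\#\mathbf{f}$,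 the total number of vertices, it is the number of components of $\mathbf{f}$). **Limit process.** $Y^{(\underline{\alpha})}=(Y_s,s\ge0)$ is the strictly stable spectrally positive L\'evy process of index $\underline{\alpha}\in(1,2]$ with Laplace exponent given by $\mathbb{E}[\exp(-\lambda Y_s)]=\exp(-s\lambda^{\underline{\alpha}})$, $\lambda\in\mathbb{R}_+$, and $I_s=\inf_{0\le r\le s}Y_r$.
   Formalization: As printed, no μ or Y meets the hypotheses. Corrected: ψ^{(i)}(s)=⟨m_i,s⟩−|s|^{α_i}Θ^{(i)}(s/|s|)+o(|s|^{α_i}) in the Main Assumptions, E[exp(−λY_s)]=exp(+sλ^α) for the Lévy process, and Υ is divided by n^{1/α} instead of n^{1−1/α}. *)

theory Defs
  imports "HOL-Probability.Probability" "HOL-Library.Landau_Symbols"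
begin

section \<open>Words, planar trees, forests\<close>

text \<open>
  A word is a list of letters in \<open>{1..}\<close>; the child \<open>ui\<close> of \<open>u\<close> is \<open>u @ [i]\<close>. The empty word is
  the root. On words, \<open>lexord less_than\<close> is the strict lexicographical order in which
  a proper prefix precedes its extensions.
\<close>

definition planar_tree :: "nat list set \<Rightarrow> bool" where
  "planar_tree t \<longleftrightarrow> finite t \<and> t \<subseteq> lists {1..} \<and> [] \<in> t \<and>
     (\<forall>u i. u @ [i] \<in> t \<longrightarrow> u \<in> t \<and> (\<forall>j\<in>{1..i}. u @ [j] \<in> t))"

text \<open>
  A \<open>d\<close>-type tree or forest is encoded as a partial map: its domain is the set of vertices and
  its values are the types. The set \<open>[d]\<close> of types is a finite type \<open>'d\<close>.
\<close>

definition typed_trees :: "(nat list \<rightharpoonup> 'd) set" where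
  "typed_trees = {t. planar_tree (dom t)}"

definition num_children :: "(nat list \<rightharpoonup> 'd) \<Rightarrow> nat list \<Rightarrow> nat" where
  "num_children t u = card {k. u @ [k] \<in> dom t}"

definition type_children :: "(nat list \<rightharpoonup> 'd) \<Rightarrow> nat list \<Rightarrow> nat ^ 'd::finite" where
  "type_children t u = (\<chi> j. card {k. t (u @ [k]) = Some j})"

definition forest_of :: "(nat \<Rightarrow> nat list \<rightharpoonup> 'd) \<Rightarrow> (nat list \<rightharpoonup> 'd)" where
  "forest_of T = (\<lambda>w. case w of [] \<Rightarrow> None | k # u \<Rightarrow> if 1 \<le> k then T k u else None)"

text \<open>
  The vertex \<open>u\<^sub>f(n)\<close> of rank \<open>n\<close> (counted from 0) in depth-first order is the vertex with
  exactly \<open>n\<close> predecessors.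
\<close>

definition depth_first_vertex :: "nat list set \<Rightarrow> nat \<Rightarrow> nat list" where
  "depth_first_vertex f n = (THE u. u \<in> f \<and>
     finite {v \<in> f. (v, u) \<in> lexord less_than} \<and> card {v \<in> f. (v, u) \<in> lexord less_than} = n)"

definition component_index :: "(nat list \<rightharpoonup> 'd) \<Rightarrow> nat \<Rightarrow> nat" where
  "component_index f n =
     (if finite (dom f) \<and> card (dom f) \<le> n then card (hd ` dom f)
      else hd (depth_first_vertex (dom f) n))"

section \<open>Multitype Galton--Watson laws\<close>

definition GW_weight :: "('d::finite \<Rightarrow> (nat ^ 'd) pmf) \<Rightarrow> (nat list \<rightharpoonup> 'd) \<Rightarrow> real" where
  "GW_weight \<mu> t = (\<Prod>u\<in>dom t.
     (\<Prod>j\<in>UNIV. fact (type_children t u $ j)) / fact (num_children t u)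
       * pmf (\<mu> (the (t u))) (type_children t u))"

text \<open>
  The law \<open>P\<^sup>i\<close> on finite trees. It has total mass 1 exactly when the Galton--Watson tree with root
  type \<open>i\<close> is almost surely finite, as it is for critical, irreducible and non-degenerate \<open>\<mu>\<close>.
\<close>

definition GW_tree_law :: "('d::finite \<Rightarrow> (nat ^ 'd) pmf) \<Rightarrow> 'd \<Rightarrow> (nat list \<rightharpoonup> 'd) measure" where
  "GW_tree_law \<mu> i = density (count_space typed_trees)
     (\<lambda>t. if t [] = Some i then ennreal (GW_weight \<mu> t) else 0)"

definition forest_space :: "(nat list \<rightharpoonup> 'd) measure" where
  "forest_space = Pi\<^sub>M UNIV (\<lambda>_. count_space UNIV)"

definition GW_forest_law ::
    "('d::finite \<Rightarrow> (nat ^ 'd) pmf) \<Rightarrow> (nat \<Rightarrow> 'd) \<Rightarrow> (nat list \<rightharpoonup> 'd) measure" where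
  "GW_forest_law \<mu> x = distr (Pi\<^sub>M {1..} (\<lambda>k. GW_tree_law \<mu> (x k))) forest_space forest_of"

section \<open>Means, irreducibility, criticality\<close>

definition finite_means :: "('d::finite \<Rightarrow> (nat ^ 'd) pmf) \<Rightarrow> bool" where
  "finite_means \<mu> \<longleftrightarrow> (\<forall>i j. integrable (measure_pmf (\<mu> i)) (\<lambda>z. real (z $ j)))"

definition mean_matrix :: "('d::finite \<Rightarrow> (nat ^ 'd) pmf) \<Rightarrow> real ^ 'd ^ 'd" where
  "mean_matrix \<mu> = (\<chi> i j. measure_pmf.expectation (\<mu> i) (\<lambda>z. real (z $ j)))"

text \<open>Powers are iterated matrix products: on \<open>real ^ 'd ^ 'd\<close>, \<open>*\<close> and \<open>^\<close> act entrywise.\<close>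

definition irreducible_dist :: "('d::finite \<Rightarrow> (nat ^ 'd) pmf) \<Rightarrow> bool" where
  "irreducible_dist \<mu> \<longleftrightarrow>
     (\<forall>i j. \<exists>n\<ge>1. ((\<lambda>A. mean_matrix \<mu> ** A) ^^ n) (mat 1) $ i $ j > 0)"

text \<open>
  The Perron--Frobenius eigenvalue of a nonnegative matrix is its spectral radius: the largest
  modulus of its complex eigenvalues.
\<close>

definition perron_frobenius :: "real ^ 'd ^ 'd::finite \<Rightarrow> real" where
  "perron_frobenius A =
     Max (cmod ` {z. \<exists>v. v \<noteq> 0 \<and> (\<chi> i j. complex_of_real (A $ i $ j)) *v v = z *s v})"

definition critical_dist :: "('d::finite \<Rightarrow> (nat ^ 'd) pmf) \<Rightarrow> bool" where
  "critical_dist \<mu> \<longleftrightarrow> perron_frobenius (mean_matrix \<mu>) = 1"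

definition nondegenerate_dist :: "('d::finite \<Rightarrow> (nat ^ 'd) pmf) \<Rightarrow> bool" where
  "nondegenerate_dist \<mu> \<longleftrightarrow>
     (\<exists>i. measure_pmf.prob (\<mu> i) {z. (\<Sum>j\<in>UNIV. z $ j) \<noteq> 1} > 0)"

section \<open>The Main Assumptions\<close>

definition nonneg_orthant :: "(real ^ 'd::finite) set" where
  "nonneg_orthant = {s. \<forall>j. 0 \<le> s $ j}"

definition psi :: "('d::finite \<Rightarrow> (nat ^ 'd) pmf) \<Rightarrow> 'd \<Rightarrow> real ^ 'd \<Rightarrow> real" where
  "psi \<mu> i s =
     - ln (measure_pmf.expectation (\<mu> i) (\<lambda>z. exp (- (\<Sum>j\<in>UNIV. real (z $ j) * s $ j))))"

definition Theta :: "real \<Rightarrow> (real ^ 'd::finite) measure \<Rightarrow> real ^ 'd \<Rightarrow> real" where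
  "Theta \<alpha> \<Lambda> s = (\<integral>y. \<bar>s \<bullet> y\<bar> powr \<alpha> \<partial>\<Lambda>)"

text \<open>
  Sign convention: \<open>psi\<close> is minus a log-Laplace transform, so \<open>psi \<mu> i s \<le> \<langle>m\<^sub>i, s\<rangle>\<close> by Jensen's
  inequality, and the term \<open>|s|\<^sup>\<alpha> \<Theta>(s/|s|) \<ge> 0\<close> has to be subtracted in the expansion below. With
  the opposite sign no offspring distribution and non-zero \<open>\<Lambda>\<^sub>i\<close> satisfy the assumptions.

  The values \<open>\<alpha> i\<close> and \<open>\<Lambda> i\<close> for \<open>i \<notin> \<Delta>\<close> are determined by \<open>\<Delta>\<close> and by the values on \<open>\<Delta>\<close>.
\<close>

definition main_assumptions ::
    "('d::finite \<Rightarrow> (nat ^ 'd) pmf) \<Rightarrow> 'd set \<Rightarrow> ('d \<Rightarrow> real) \<Rightarrow> ('d \<Rightarrow> (real ^ 'd) measure) \<Rightarrow> bool"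
  where
  "main_assumptions \<mu> \<Delta> \<alpha> \<Lambda> \<longleftrightarrow>
     finite_means \<mu> \<and> irreducible_dist \<mu> \<and> nondegenerate_dist \<mu> \<and> critical_dist \<mu> \<and>
     \<Delta> \<noteq> {} \<and>
     (\<forall>i\<in>\<Delta>.
        1 < \<alpha> i \<and> \<alpha> i \<le> 2 \<and>
        sets (\<Lambda> i) = sets (restrict_space borel (sphere 0 1)) \<and>
        finite_measure (\<Lambda> i) \<and> emeasure (\<Lambda> i) (space (\<Lambda> i)) \<noteq> 0 \<and>
        (\<alpha> i < 2 \<longrightarrow> (AE y in \<Lambda> i. y \<in> nonneg_orthant)) \<and>
        (\<lambda>s. psi \<mu> i s -
              (mean_matrix \<mu> $ i \<bullet> s - norm s powr \<alpha> i * Theta (\<alpha> i) (\<Lambda> i) (s /\<^sub>R norm s)))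
          \<in> o[at 0 within nonneg_orthant](\<lambda>s. norm s powr \<alpha> i)) \<and>
     (\<forall>i\<in>- \<Delta>.
        \<alpha> i = Min (\<alpha> ` \<Delta>) \<and>
        \<Lambda> i = null_measure (restrict_space borel (sphere 0 1)) \<and>
        (\<lambda>s. psi \<mu> i s - mean_matrix \<mu> $ i \<bullet> s)
          \<in> o[at 0 within nonneg_orthant](\<lambda>s. norm s powr \<alpha> i))"

definition alpha_min :: "('d::finite \<Rightarrow> real) \<Rightarrow> real" where
  "alpha_min \<alpha> = Min (range \<alpha>)"

text \<open>The left and right eigenvectors of \<open>M\<close> for the eigenvalue 1, normalised.\<close>

definition normalized_eigenvectors ::
    "real ^ 'd ^ 'd::finite \<Rightarrow> real ^ 'd \<Rightarrow> real ^ 'd \<Rightarrow> bool" where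
  "normalized_eigenvectors M a b \<longleftrightarrow>
     a v* M = a \<and> M *v b = b \<and> (\<forall>j. 0 < a $ j) \<and> (\<forall>j. 0 < b $ j) \<and> a \<bullet> 1 = 1 \<and> a \<bullet> b = 1"

definition c_bar ::
    "('d::finite \<Rightarrow> real) \<Rightarrow> ('d \<Rightarrow> (real ^ 'd) measure) \<Rightarrow> real ^ 'd \<Rightarrow> real ^ 'd \<Rightarrow> real" where
  "c_bar \<alpha> \<Lambda> a b =
     (\<Sum>i | \<alpha> i = alpha_min \<alpha>. a $ i * Theta (\<alpha> i) (\<Lambda> i) b) powr (1 / alpha_min \<alpha>)"

section \<open>The Skorohod space on the half-line\<close>

text \<open>Functions on \<open>{0..}\<close> are represented by the extensional ones of type \<open>real \<Rightarrow> real\<close>.\<close>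

definition cadlag :: "(real \<Rightarrow> real) \<Rightarrow> bool" where
  "cadlag x \<longleftrightarrow> (\<forall>t\<ge>0. continuous (at_right t) x) \<and> (\<forall>t>0. \<exists>l. (x \<longlongrightarrow> l) (at_left t))"

definition skorohod_space :: "(real \<Rightarrow> real) set" where
  "skorohod_space = {x \<in> extensional {0..}. cadlag x}"

text \<open>Increasing bijections of \<open>{0..}\<close>; they are homeomorphisms.\<close>

definition time_change :: "(real \<Rightarrow> real) \<Rightarrow> bool" where
  "time_change h \<longleftrightarrow> strict_mono_on {0..} h \<and> h ` {0..} = {0..}"

text \<open>
  The Skorohod (J1) topology is the one with neighbourhood bases \<open>skorohod_nbhd x T e\<close>,
  \<open>T \<ge> 0\<close>, \<open>e > 0\<close>. Its convergent sequences are characterised in the usual way in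
  \<open>limitin_skorohod_iff\<close> below.
\<close>

definition skorohod_nbhd :: "(real \<Rightarrow> real) \<Rightarrow> real \<Rightarrow> real \<Rightarrow> (real \<Rightarrow> real) set" where
  "skorohod_nbhd x T e = {y \<in> skorohod_space. \<exists>h \<delta>. time_change h \<and> \<delta> < e \<and>
     (\<forall>t\<in>{0..}. \<bar>h t - t\<bar> \<le> \<delta>) \<and> (\<forall>t\<in>{0..T}. \<bar>y (h t) - x t\<bar> \<le> \<delta>)}"

definition skorohod_topology :: "(real \<Rightarrow> real) topology" where
  "skorohod_topology = topology (\<lambda>U. U \<subseteq> skorohod_space \<and>
     (\<forall>x\<in>U. \<exists>T\<ge>0. \<exists>e>0. skorohod_nbhd x T e \<subseteq> U))"

lemma skorohod_nbhdI:
  assumes "y \<in> skorohod_space" "time_change h" "\<delta> < e"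
    "\<And>t. 0 \<le> t \<Longrightarrow> \<bar>h t - t\<bar> \<le> \<delta>" "\<And>t. 0 \<le> t \<Longrightarrow> t \<le> T \<Longrightarrow> \<bar>y (h t) - x t\<bar> \<le> \<delta>"
  shows "y \<in> skorohod_nbhd x T e"
proof -
  have "(\<forall>t\<in>{0..}. \<bar>h t - t\<bar> \<le> \<delta>) \<and> (\<forall>t\<in>{0..T}. \<bar>y (h t) - x t\<bar> \<le> \<delta>)"
    using assms(4,5) by simp
  then show ?thesis unfolding skorohod_nbhd_def using assms(1-3) by blast
qed

lemma skorohod_nbhdE:
  assumes "y \<in> skorohod_nbhd x T e"
  obtains h \<delta> where "y \<in> skorohod_space" "time_change h" "\<delta> < e"
    "\<And>t. 0 \<le> t \<Longrightarrow> \<bar>h t - t\<bar> \<le> \<delta>" "\<And>t. 0 \<le> t \<Longrightarrow> t \<le> T \<Longrightarrow> \<bar>y (h t) - x t\<bar> \<le> \<delta>"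
proof -
  obtain h \<delta> where "y \<in> skorohod_space" "time_change h" "\<delta> < e"
    "\<forall>t\<in>{0..}. \<bar>h t - t\<bar> \<le> \<delta>" "\<forall>t\<in>{0..T}. \<bar>y (h t) - x t\<bar> \<le> \<delta>"
    using assms unfolding skorohod_nbhd_def by blast
  then show ?thesis using that by simp
qed

lemma skorohod_nbhd_mono:
  assumes "T \<le> T'" "e' \<le> e" shows "skorohod_nbhd x T' e' \<subseteq> skorohod_nbhd x T e"
proof
  fix y assume "y \<in> skorohod_nbhd x T' e'"
  then obtain h \<delta> where *: "y \<in> skorohod_space" "time_change h" "\<delta> < e'"
    "\<And>t. 0 \<le> t \<Longrightarrow> \<bar>h t - t\<bar> \<le> \<delta>" "\<And>t. 0 \<le> t \<Longrightarrow> t \<le> T' \<Longrightarrow> \<bar>y (h t) - x t\<bar> \<le> \<delta>"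
    by (rule skorohod_nbhdE) (rule that; simp)
  have "\<delta> < e" using *(3) assms(2) by linarith
  moreover have "\<bar>y (h t) - x t\<bar> \<le> \<delta>" if "0 \<le> t" "t \<le> T" for t
    using *(5)[of t] that assms(1) by linarith
  ultimately show "y \<in> skorohod_nbhd x T e"
    using *(4) by (intro skorohod_nbhdI[OF *(1,2)])
qed

lemma openin_skorohod_topology:
  "openin skorohod_topology U \<longleftrightarrow> U \<subseteq> skorohod_space \<and>
     (\<forall>x\<in>U. \<exists>T\<ge>0. \<exists>e>0. skorohod_nbhd x T e \<subseteq> U)"
proof -
  define P where "P = (\<lambda>U. U \<subseteq> skorohod_space \<and>
     (\<forall>x\<in>U. \<exists>T\<ge>0. \<exists>e>0. skorohod_nbhd x T e \<subseteq> U))"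
  have "istopology P"
    unfolding istopology_def
  proof (intro conjI allI impI)
    fix S S' assume S: "P S" and S': "P S'"
    show "P (S \<inter> S')"
      unfolding P_def
    proof (intro conjI ballI)
      show "S \<inter> S' \<subseteq> skorohod_space" using S by (auto simp: P_def)
      fix x assume x: "x \<in> S \<inter> S'"
      obtain T e where 1: "T \<ge> 0" "e > 0" "skorohod_nbhd x T e \<subseteq> S"
        using S x unfolding P_def by blast
      obtain T' e' where 2: "T' \<ge> 0" "e' > 0" "skorohod_nbhd x T' e' \<subseteq> S'"
        using S' x unfolding P_def by blast
      have "skorohod_nbhd x (max T T') (min e e') \<subseteq> S \<inter> S'"
        using 1(3) 2(3) skorohod_nbhd_mono[of T "max T T'" "min e e'" e x]
          skorohod_nbhd_mono[of T' "max T T'" "min e e'" e' x] by auto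
      then show "\<exists>T\<ge>0. \<exists>e>0. skorohod_nbhd x T e \<subseteq> S \<inter> S'"
        using 1 2 by (intro exI[of _ "max T T'"] conjI exI[of _ "min e e'"]) auto
    qed
  next
    fix K assume K: "\<forall>S\<in>K. P S"
    show "P (\<Union>K)"
      unfolding P_def
    proof (intro conjI ballI)
      show "\<Union>K \<subseteq> skorohod_space" using K by (auto simp: P_def)
      fix x assume "x \<in> \<Union>K"
      then obtain S where S: "S \<in> K" "x \<in> S" by blast
      then obtain T e where "T \<ge> 0" "e > 0" "skorohod_nbhd x T e \<subseteq> S"
        using K unfolding P_def by blast
      then show "\<exists>T\<ge>0. \<exists>e>0. skorohod_nbhd x T e \<subseteq> \<Union>K"
        using S by blast
    qed
  qed
  then show ?thesis
    unfolding skorohod_topology_def P_def[symmetric] by (simp add: P_def)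
qed

lemma topspace_skorohod_topology: "topspace skorohod_topology = skorohod_space"
proof (rule antisym)
  show "topspace skorohod_topology \<subseteq> skorohod_space"
    using openin_skorohod_topology[THEN iffD1, OF openin_topspace] by (rule conjunct1)
  have "skorohod_nbhd x 0 1 \<subseteq> skorohod_space" for x by (auto simp: skorohod_nbhd_def)
  then have "openin skorohod_topology skorohod_space"
    by (intro openin_skorohod_topology[THEN iffD2] conjI ballI order_refl
        exI[of _ "0::real"] exI[of _ "1::real"]) simp_all
  then show "skorohod_space \<subseteq> topspace skorohod_topology"
    by (rule openin_subset)
qed

lemma time_change_id: "time_change (\<lambda>t. t)"
  by (auto simp: time_change_def strict_mono_on_def)

lemma time_change_nonneg: "time_change h \<Longrightarrow> t \<ge> 0 \<Longrightarrow> h t \<ge> 0"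
  unfolding time_change_def by force

lemma time_change_comp:
  assumes h: "time_change h" and g: "time_change g"
  shows "time_change (\<lambda>t. g (h t))"
  unfolding time_change_def
proof (intro conjI)
  show "strict_mono_on {0..} (\<lambda>t. g (h t))"
  proof (rule strict_mono_onI)
    fix r s :: real assume "r \<in> {0..}" "s \<in> {0..}" "r < s"
    then have "h r < h s" "h r \<in> {0..}" "h s \<in> {0..}"
      using h time_change_nonneg[OF h] by (simp_all add: time_change_def strict_mono_on_def)
    then show "g (h r) < g (h s)"
      using g by (simp add: time_change_def strict_mono_on_def)
  qed
  have "(\<lambda>t. g (h t)) ` {0..} = g ` (h ` {0..})" by (simp add: image_image)
  then show "(\<lambda>t. g (h t)) ` {0..} = {0..}" using h g by (simp add: time_change_def)
qed

lemma skorohod_nbhd_self: "x \<in> skorohod_space \<Longrightarrow> 0 < e \<Longrightarrow> x \<in> skorohod_nbhd x T e"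
  by (rule skorohod_nbhdI[where h = "\<lambda>t. t" and \<delta> = 0]) (simp_all add: time_change_id)

lemma openin_skorohod_nbhd:
  assumes "T \<ge> 0" shows "openin skorohod_topology (skorohod_nbhd x T e)"
  unfolding openin_skorohod_topology
proof (intro conjI ballI)
  show "skorohod_nbhd x T e \<subseteq> skorohod_space" by (auto simp: skorohod_nbhd_def)
  fix y assume "y \<in> skorohod_nbhd x T e"
  then obtain h d where h: "y \<in> skorohod_space" "time_change h" "d < e" "\<And>t. 0 \<le> t \<Longrightarrow> \<bar>h t - t\<bar> \<le> d"
      "\<And>t. 0 \<le> t \<Longrightarrow> t \<le> T \<Longrightarrow> \<bar>y (h t) - x t\<bar> \<le> d"
    by (rule skorohod_nbhdE) (rule that; simp)
  have d0: "0 \<le> d" using h(4)[of 0] by simp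
  have "skorohod_nbhd y (T + d) (e - d) \<subseteq> skorohod_nbhd x T e"
  proof
    fix z assume "z \<in> skorohod_nbhd y (T + d) (e - d)"
    then obtain g d' where g: "z \<in> skorohod_space" "time_change g" "d' < e - d"
        "\<And>t. 0 \<le> t \<Longrightarrow> \<bar>g t - t\<bar> \<le> d'" "\<And>t. 0 \<le> t \<Longrightarrow> t \<le> T + d \<Longrightarrow> \<bar>z (g t) - y t\<bar> \<le> d'"
      by (rule skorohod_nbhdE) (rule that; simp)
    show "z \<in> skorohod_nbhd x T e"
    proof (rule skorohod_nbhdI[OF g(1) time_change_comp[OF h(2) g(2)]])
      show "d + d' < e" using g(3) by linarith
      fix t :: real assume t: "0 \<le> t"
      have ht: "0 \<le> h t" by (rule time_change_nonneg[OF h(2) t])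
      show "\<bar>g (h t) - t\<bar> \<le> d + d'"
        using g(4)[OF ht] h(4)[OF t] by linarith
      assume t': "t \<le> T"
      have "h t \<le> T + d" using h(4)[OF t] t' by linarith
      from g(5)[OF ht this] h(5)[OF t t'] show "\<bar>z (g (h t)) - x t\<bar> \<le> d + d'" by linarith
    qed
  qed
  then show "\<exists>T'\<ge>0. \<exists>e'>0. skorohod_nbhd y T' e' \<subseteq> skorohod_nbhd x T e"
    using assms d0 h(3) by (intro exI[of _ "T + d"] conjI exI[of _ "e - d"]) auto
qed

lemma limitin_skorohod_iff_nbhd:
  "limitin skorohod_topology X x F \<longleftrightarrow> x \<in> skorohod_space \<and>
     (\<forall>T\<ge>0. \<forall>e>0. \<forall>\<^sub>F n in F. X n \<in> skorohod_nbhd x T e)"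
proof (intro iffI conjI allI impI)
  assume L: "limitin skorohod_topology X x F"
  then show x: "x \<in> skorohod_space" by (simp add: limitin_def topspace_skorohod_topology)
  fix T e :: real assume T: "T \<ge> 0" and e: "e > 0"
  have "\<forall>U. openin skorohod_topology U \<and> x \<in> U \<longrightarrow> (\<forall>\<^sub>F n in F. X n \<in> U)"
    using L by (simp add: limitin_def)
  then show "\<forall>\<^sub>F n in F. X n \<in> skorohod_nbhd x T e"
    using openin_skorohod_nbhd[OF T, of x e] skorohod_nbhd_self[OF x e, of T] by simp
next
  assume R: "x \<in> skorohod_space \<and> (\<forall>T\<ge>0. \<forall>e>0. \<forall>\<^sub>F n in F. X n \<in> skorohod_nbhd x T e)"
  show "limitin skorohod_topology X x F"
    unfolding limitin_def topspace_skorohod_topology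
  proof (intro conjI allI impI)
    show "x \<in> skorohod_space" using R by (rule conjunct1)
    fix U assume U: "openin skorohod_topology U \<and> x \<in> U"
    then have "\<forall>x\<in>U. \<exists>T\<ge>0. \<exists>e>0. skorohod_nbhd x T e \<subseteq> U"
      by (simp add: openin_skorohod_topology)
    then obtain T e where T: "T \<ge> 0" "e > 0" and sub: "skorohod_nbhd x T e \<subseteq> U"
      using U by blast
    have "\<forall>\<^sub>F n in F. X n \<in> skorohod_nbhd x T e" using R T by simp
    then show "\<forall>\<^sub>F n in F. X n \<in> U" by (rule eventually_mono) (rule subsetD[OF sub])
  qed
qed

lemma limitin_skorohod_iff:
  assumes X: "\<And>n. X n \<in> skorohod_space" and x: "x \<in> skorohod_space"
  shows "limitin skorohod_topology X x sequentially \<longleftrightarrow>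
    (\<exists>h. (\<forall>n. time_change (h n)) \<and> uniform_limit {0..} h (\<lambda>t. t) sequentially \<and>
         (\<forall>T\<ge>0. uniform_limit {0..T} (\<lambda>n t. X n (h n t)) x sequentially))"
    (is "?L \<longleftrightarrow> ?R")
proof
  assume ?R
  then obtain h where h: "\<And>n. time_change (h n)" "uniform_limit {0..} h (\<lambda>t. t) sequentially"
     "\<And>T. T \<ge> 0 \<Longrightarrow> uniform_limit {0..T} (\<lambda>n t. X n (h n t)) x sequentially" by blast
  show ?L
    unfolding limitin_skorohod_iff_nbhd
  proof (intro conjI allI impI x)
    fix T e :: real assume T: "T \<ge> 0" and e: "e > 0"
    have "\<forall>\<^sub>F n in sequentially. \<forall>t\<in>{0..}. dist (h n t) t < e / 2"
      using h(2) e unfolding uniform_limit_iff by (meson half_gt_zero)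
    moreover have "\<forall>\<^sub>F n in sequentially. \<forall>t\<in>{0..T}. dist (X n (h n t)) (x t) < e / 2"
      using h(3)[OF T] e unfolding uniform_limit_iff by (meson half_gt_zero)
    ultimately show "\<forall>\<^sub>F n in sequentially. X n \<in> skorohod_nbhd x T e"
    proof eventually_elim
      case (elim n)
      show ?case
      proof (rule skorohod_nbhdI[OF X h(1)])
        show "e / 2 < e" using e by simp
        fix t :: real assume t: "0 \<le> t"
        show "\<bar>h n t - t\<bar> \<le> e / 2"
          using bspec[OF elim(1), of t] t by (simp add: dist_real_def)
        assume "t \<le> T"
        then show "\<bar>X n (h n t) - x t\<bar> \<le> e / 2"
          using bspec[OF elim(2), of t] t by (simp add: dist_real_def)
      qed
    qed
  qed
next
  assume L: ?L
  define A where "A n = {k. k \<le> n \<and> X n \<in> skorohod_nbhd x (real k) (1 / (1 + real k))}" for n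
  define good where "good n k g \<longleftrightarrow> time_change g \<and>
     (\<forall>t. 0 \<le> t \<longrightarrow> \<bar>g t - t\<bar> < 1 / (1 + real k)) \<and>
     (\<forall>t. 0 \<le> t \<longrightarrow> t \<le> real k \<longrightarrow> \<bar>X n (g t) - x t\<bar> < 1 / (1 + real k))" for n k g
  have A: "\<exists>g. good n k g" if "k \<in> A n" for n k
  proof -
    have "X n \<in> skorohod_nbhd x (real k) (1 / (1 + real k))"
      using that by (simp add: A_def)
    then obtain g \<delta> where "X n \<in> skorohod_space" "time_change g" "\<delta> < 1 / (1 + real k)"
      "\<And>t. 0 \<le> t \<Longrightarrow> \<bar>g t - t\<bar> \<le> \<delta>"
      "\<And>t. 0 \<le> t \<Longrightarrow> t \<le> real k \<Longrightarrow> \<bar>X n (g t) - x t\<bar> \<le> \<delta>"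
      by (rule skorohod_nbhdE) (rule that; simp)
    then have "good n k g"
      unfolding good_def by (meson le_less_trans)
    then show ?thesis by blast
  qed
  define h where
    "h n = (if A n = {} then (\<lambda>t. t) else (SOME g. good n (Max (A n)) g))" for n
  have finA: "finite (A n)" for n unfolding A_def by simp
  have h_good: "good n (Max (A n)) (h n)" if "A n \<noteq> {}" for n
    unfolding h_def using that A[OF Max_in[OF finA that]] by (simp add: someI_ex)
  have tc: "time_change (h n)" for n
    using h_good[of n] time_change_id by (cases "A n = {}") (auto simp: h_def good_def)
  have ev: "\<forall>\<^sub>F n in sequentially. good n k (h n)" for k
  proof -
    have "\<forall>\<^sub>F n in sequentially. X n \<in> skorohod_nbhd x (real k) (1 / (1 + real k))"
      using L unfolding limitin_skorohod_iff_nbhd by auto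
    then show ?thesis
      using eventually_ge_at_top[of k]
    proof eventually_elim
      case (elim n)
      then have k: "k \<in> A n" by (simp add: A_def)
      then have le: "k \<le> Max (A n)" using finA by (simp add: Max_ge)
      then have "1 / (1 + real (Max (A n))) \<le> 1 / (1 + real k)"
        by (simp add: frac_le)
      moreover have "good n (Max (A n)) (h n)" using h_good k by blast
      moreover have "t \<le> real (Max (A n))" if "t \<le> real k" for t :: real
        using that le by linarith
      ultimately show ?case unfolding good_def by (meson less_le_trans)
    qed
  qed
  have small: "\<exists>k. T \<le> real k \<and> 1 / (1 + real k) < e" if "e > 0" for e T :: real
  proof -
    obtain k1 where k1: "T \<le> real k1" using real_arch_simple by blast
    obtain k2 where k2: "1 / e < real k2" using reals_Archimedean2 by blast
    let ?k = "max k1 k2"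
    have "1 / e < 1 + real ?k" using k2 by linarith
    then have "1 / (1 + real ?k) < e" using that by (simp add: field_simps)
    then show ?thesis using k1 by (intro exI[of _ ?k]) auto
  qed
  have "uniform_limit {0..} h (\<lambda>t. t) sequentially"
    unfolding uniform_limit_iff
  proof (intro allI impI)
    fix e :: real assume "e > 0"
    then obtain k where k: "1 / (1 + real k) < e" using small by blast
    show "\<forall>\<^sub>F n in sequentially. \<forall>t\<in>{0..}. dist (h n t) t < e"
      using ev[of k]
    proof eventually_elim
      case (elim n)
      then have "\<bar>h n t - t\<bar> < 1 / (1 + real k)" if "0 \<le> t" for t
        using that by (simp add: good_def)
      then show ?case using k by (force simp: dist_real_def)
    qed
  qed
  moreover have "uniform_limit {0..T} (\<lambda>n t. X n (h n t)) x sequentially" for T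
    unfolding uniform_limit_iff
  proof (intro allI impI)
    fix e :: real assume "e > 0"
    then obtain k where k: "T \<le> real k" "1 / (1 + real k) < e" using small by blast
    show "\<forall>\<^sub>F n in sequentially. \<forall>t\<in>{0..T}. dist (X n (h n t)) (x t) < e"
      using ev[of k]
    proof eventually_elim
      case (elim n)
      then have "\<bar>X n (h n t) - x t\<bar> < 1 / (1 + real k)" if "0 \<le> t" "t \<le> T" for t
        using that k(1) by (simp add: good_def)
      then show ?case using k(2) by (force simp: dist_real_def)
    qed
  qed
  ultimately show ?R using tc by blast
qed

section \<open>Convergence in distribution\<close>

definition borel_of_topology :: "'a topology \<Rightarrow> 'a measure" where
  "borel_of_topology T = sigma (topspace T) {U. openin T U}"

definition converges_in_distribution ::
    "'b topology \<Rightarrow> 'a measure \<Rightarrow> (nat \<Rightarrow> 'a \<Rightarrow> 'b) \<Rightarrow> 'c measure \<Rightarrow> ('c \<Rightarrow> 'b) \<Rightarrow> bool" where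
  "converges_in_distribution T M X N Z \<longleftrightarrow>
     (\<forall>n. X n \<in> M \<rightarrow>\<^sub>M borel_of_topology T) \<and> Z \<in> N \<rightarrow>\<^sub>M borel_of_topology T \<and>
     (\<forall>f. continuous_map T euclideanreal f \<and> bounded (f ` topspace T) \<longrightarrow>
        (\<lambda>n. \<integral>\<omega>. f (X n \<omega>) \<partial>M) \<longlonglongrightarrow> (\<integral>\<omega>. f (Z \<omega>) \<partial>N))"

section \<open>The stable process\<close>

definition levy_process :: "'a measure \<Rightarrow> (real \<Rightarrow> 'a \<Rightarrow> real) \<Rightarrow> bool" where
  "levy_process N Y \<longleftrightarrow> prob_space N \<and>
     (\<forall>t\<ge>0. Y t \<in> borel_measurable N) \<and>
     (AE \<omega> in N. Y 0 \<omega> = 0) \<and>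
     (\<forall>\<omega>\<in>space N. cadlag (\<lambda>t. Y t \<omega>)) \<and>
     (\<forall>(n::nat) t. 0 \<le> t 0 \<and> (\<forall>k<n. t k \<le> t (Suc k)) \<longrightarrow>
        prob_space.indep_vars N (\<lambda>_. borel) (\<lambda>k \<omega>. Y (t (Suc k)) \<omega> - Y (t k) \<omega>) {..<n}) \<and>
     (\<forall>s\<ge>0. \<forall>t\<ge>0. distr N borel (\<lambda>\<omega>. Y (s + t) \<omega> - Y s \<omega>) = distr N borel (Y t))"

definition strictly_stable :: "'a measure \<Rightarrow> (real \<Rightarrow> 'a \<Rightarrow> real) \<Rightarrow> real \<Rightarrow> bool" where
  "strictly_stable N Y \<alpha> \<longleftrightarrow>
     (\<forall>c>0. \<forall>t\<ge>0. distr N borel (Y (c * t)) = distr N borel (\<lambda>\<omega>. c powr (1 / \<alpha>) * Y t \<omega>))"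

text \<open>No negative jumps.\<close>

definition spectrally_positive :: "'a measure \<Rightarrow> (real \<Rightarrow> 'a \<Rightarrow> real) \<Rightarrow> bool" where
  "spectrally_positive N Y \<longleftrightarrow>
     (AE \<omega> in N. \<forall>t>0. \<forall>l. ((\<lambda>s. Y s \<omega>) \<longlongrightarrow> l) (at_left t) \<longrightarrow> l \<le> Y t \<omega>)"

text \<open>
  For \<open>1 < \<alpha> \<le> 2\<close>. By convexity of \<open>q \<mapsto> log E[exp(-q Y\<^sub>s)]\<close> the exponent is \<open>+s q\<^sup>\<alpha>\<close>; no process
  has \<open>E[exp(-q Y\<^sub>s)] = exp(-s q\<^sup>\<alpha>)\<close> in this range of \<open>\<alpha>\<close>. For \<open>\<alpha> = 2\<close> the process is \<open>\<surd>2\<close> times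
  Brownian motion.
\<close>

definition stable_spectrally_positive_process ::
    "'a measure \<Rightarrow> (real \<Rightarrow> 'a \<Rightarrow> real) \<Rightarrow> real \<Rightarrow> bool" where
  "stable_spectrally_positive_process N Y \<alpha> \<longleftrightarrow>
     levy_process N Y \<and> strictly_stable N Y \<alpha> \<and> spectrally_positive N Y \<and>
     (\<forall>s\<ge>0. \<forall>q\<ge>0. integrable N (\<lambda>\<omega>. exp (- q * Y s \<omega>)) \<and>
        (\<integral>\<omega>. exp (- q * Y s \<omega>) \<partial>N) = exp (s * q powr \<alpha>))"

definition running_infimum :: "(real \<Rightarrow> 'a \<Rightarrow> real) \<Rightarrow> real \<Rightarrow> 'a \<Rightarrow> real" where
  "running_infimum Y s \<omega> = (INF r\<in>{0..s}. Y r \<omega>)"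

text \<open>
  The running infimum of a strictly stable process of index \<open>\<alpha>\<close> is self-similar with exponent
  \<open>1/\<alpha>\<close>. If \<open>n\<^sup>-\<^sup>\<beta> \<Upsilon>(\<lfloor>ns\<rfloor>)\<close> converges in distribution to a non-zero multiple of it, then the
  limit is also self-similar with exponent \<open>\<beta>\<close>, so the norming of the component index has to be
  \<open>n\<^sup>1\<^sup>/\<^sup>\<alpha>\<close>; it coincides with \<open>n\<^sup>1\<^sup>-\<^sup>1\<^sup>/\<^sup>\<alpha>\<close>, the norming of the height process, only for \<open>\<alpha> = 2\<close>.
\<close>

end

theory Submission
  imports Defs "HOL-Combinatorics.Multiset_Permutations"
begin

text \<open>
  Why the convergence holds. The components of the forest are independent copies of one almost
  surely finite tree, and the depth-first order exhausts them one after the other. If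
  \<open>S\<^sub>K\<close> is the total number of vertices of the first \<open>K\<close> components, then
  \<open>K < \<Upsilon>\<^sub>n\<close> holds exactly when \<open>S\<^sub>K \<le> n\<close>: the component index is the inverse of an increasing
  random walk (\<open>less_component_index_iff\<close>). All that matters about the trees is therefore the law of
  their total progeny, and of this law only the behaviour of its Laplace transform at 0.

  By the branching property the vector \<open>s = s(q)\<close> of Laplace exponents of the total progeny, indexed
  by the root type, solves \<open>s\<^sub>i = q + \<psi>\<^sub>i(s)\<close>. Pairing this with the left eigenvector \<open>a\<close> cancels the
  linear part of \<open>\<psi>\<close>, so that \<open>q\<close> equals \<open>\<Sum>\<^sub>i a\<^sub>i |s|\<^sup>\<alpha>\<^sup>i \<Theta>\<^sub>i(s/|s|)\<close> up to smaller terms. In particular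
  \<open>q\<close> is negligible against \<open>|s|\<close>, hence \<open>s/|s|\<close> is asymptotically fixed by the mean matrix and
  converges to \<open>b/|b|\<close>. Together this gives \<open>s\<^sub>i(q) \<sim> (b\<^sub>i/c) q\<^sup>\<beta>\<close> with \<open>\<beta> = 1/\<alpha>\<close>, \<open>\<alpha>\<close> the smallest
  index and \<open>c\<close> the constant \<open>c_bar\<close> (\<open>progeny_laplace_asymptotics\<close>). The partial sums \<open>S\<^sub>K\<close> at
  \<open>K = x n\<^sup>\<beta>\<close>, divided by \<open>n\<close>, then have joint Laplace transforms that converge to those of a stable
  subordinator of index \<open>\<beta>\<close> (\<open>passage_laplace_limit\<close>).

  On the side of the limit, let \<open>T\<^sub>x\<close> be the first time at which \<open>Y\<close> is below \<open>-x\<close>. Since \<open>Y\<close> has no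
  negative jumps, \<open>Y\<close> equals \<open>-x\<close> at that time, and exponential martingales give the joint Laplace
  transforms of the \<open>T\<^sub>x\<close> (\<open>hitting_times_laplace\<close>); they are those of the same subordinator, whose
  inverse is minus the running infimum.

  It remains to pass from first passage times to the Skorohod topology. The numbers \<open>exp(-\<tau>)\<close>, with
  \<open>\<tau>\<close> the first passage time of a nondecreasing path above a rational level, form a point of the cube
  \<open>[0,1]\<^sup>\<rat>\<close>. Joint Laplace transforms are expectations of monomials in this point, so by the
  Stone--Weierstrass theorem the expectations of all continuous functions on the cube converge. If the
  points of nondecreasing paths converge to the point of a continuous path, then the paths converge
  to it. Hence a bounded Skorohod-continuous \<open>f\<close> is approximated from below, at continuous paths, by
  the functions \<open>inf\<^sub>y (f(y) + k d(u, u(y)))\<close> of the point \<open>u\<close>, which are Lipschitz on the cube. This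
  gives convergence in distribution (\<open>converges_in_distribution_passage\<close>).
\<close>

section \<open>Borel measurability in the Skorohod space\<close>

text \<open>
  Right-continuous step functions on a grid serve twice: the rescaled component index is one, and
  cadlag paths are approximated by them.
\<close>

definition step_path :: "nat \<Rightarrow> (nat \<Rightarrow> real) \<Rightarrow> real \<Rightarrow> real" where
  "step_path n g = (\<lambda>s\<in>{0..}. g (nat \<lfloor>real n * s\<rfloor>))"

lemma eventually_floor_at_right:
  assumes "c \<ge> (0::real)"
  shows "\<forall>\<^sub>F s in at_right t. \<lfloor>c * s\<rfloor> = \<lfloor>c * t\<rfloor>"
proof (cases "c = 0")
  case False
  then have c: "c > 0" using assms by simp
  show ?thesis
  proof (rule eventually_at_rightI)
    show "t < (of_int \<lfloor>c * t\<rfloor> + 1) / c"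
      using c by (simp add: pos_less_divide_eq mult.commute)
    fix s assume "s \<in> {t<..<(of_int \<lfloor>c * t\<rfloor> + 1) / c}"
    then have "c * t < c * s" "c * s < of_int \<lfloor>c * t\<rfloor> + 1"
      using c by (simp_all add: pos_less_divide_eq mult.commute)
    then show "\<lfloor>c * s\<rfloor> = \<lfloor>c * t\<rfloor>" by linarith
  qed
qed simp

lemma eventually_floor_at_left:
  assumes "c \<ge> (0::real)"
  shows "\<forall>\<^sub>F s in at_left t. \<lfloor>c * s\<rfloor> = (if c = 0 then 0 else \<lceil>c * t\<rceil> - 1)"
proof (cases "c = 0")
  case False
  then have c: "c > 0" using assms by simp
  have "\<forall>\<^sub>F s in at_left t. \<lfloor>c * s\<rfloor> = \<lceil>c * t\<rceil> - 1"
  proof (rule eventually_at_leftI)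
    have "of_int \<lceil>c * t\<rceil> - 1 < c * t" by linarith
    then show "(of_int \<lceil>c * t\<rceil> - 1) / c < t"
      using c by (simp add: pos_divide_less_eq mult.commute)
    fix s assume "s \<in> {(of_int \<lceil>c * t\<rceil> - 1) / c<..<t}"
    then have "c * s < c * t" "of_int \<lceil>c * t\<rceil> - 1 < c * s"
      using c by (simp_all add: pos_divide_less_eq mult.commute)
    then show "\<lfloor>c * s\<rfloor> = \<lceil>c * t\<rceil> - 1" by linarith
  qed
  then show ?thesis using False by simp
qed simp

lemma step_path_in_skorohod: "step_path n g \<in> skorohod_space"
proof -
  have "continuous (at_right t) (step_path n g)" if t: "t \<ge> 0" for t
  proof -
    have "\<forall>\<^sub>F s in at_right t. step_path n g s = step_path n g t"
      using eventually_floor_at_right[OF of_nat_0_le_iff, of n t] eventually_at_right_less[of t]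
    proof eventually_elim
      case (elim s)
      then show ?case using t by (simp add: step_path_def)
    qed
    then show ?thesis
      unfolding continuous_within by (rule tendsto_eventually)
  qed
  moreover have "\<exists>l. (step_path n g \<longlongrightarrow> l) (at_left t)" if t: "t > 0" for t
  proof -
    define m where "m = (if real n = 0 then 0 else \<lceil>real n * t\<rceil> - 1)"
    have "\<forall>\<^sub>F s in at_left t. s \<in> {0<..<t}"
      by (rule eventually_at_leftI[of 0]) (use t in auto)
    then have "\<forall>\<^sub>F s in at_left t. step_path n g s = g (nat m)"
      using eventually_floor_at_left[OF of_nat_0_le_iff, of n t] unfolding m_def[symmetric]
    proof eventually_elim
      case (elim s)
      then show ?case by (simp add: step_path_def)
    qed
    then show ?thesis by (blast intro: tendsto_eventually)
  qed
  ultimately show ?thesis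
    by (auto simp: skorohod_space_def cadlag_def step_path_def)
qed

text \<open>
  A Skorohod neighbourhood constrains a path on a bounded interval only, which sees finitely many
  values of the grid function. Hence the product topology suffices, and Borel measurability of random
  step functions follows from that of their values.
\<close>

lemma continuous_map_step_path: "continuous_map euclidean skorohod_topology (step_path n)"
  unfolding continuous_map
proof (intro conjI allI impI)
  show "step_path n ` topspace euclidean \<subseteq> topspace skorohod_topology"
    using step_path_in_skorohod by (auto simp: topspace_skorohod_topology)
  fix U assume U: "openin skorohod_topology U"
  have "open {g. step_path n g \<in> U}"
    unfolding open_subopen[of "{g. step_path n g \<in> U}"]
  proof (rule ballI)
    fix g assume "g \<in> {g. step_path n g \<in> U}"
    then obtain T e where T: "T \<ge> 0" "e > 0" and sub: "skorohod_nbhd (step_path n g) T e \<subseteq> U"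
      using U unfolding openin_skorohod_topology by blast
    define W where "W = (\<Inter>j\<le>nat \<lfloor>real n * T\<rfloor>. {g'. \<bar>g' j - g j\<bar> < e / 2})"
    have "open {g' :: nat \<Rightarrow> real. \<bar>g' j - g j\<bar> < e / 2}" for j
      by (intro open_Collect_less continuous_intros continuous_on_product_coordinates)
    then have "open W" unfolding W_def by (intro open_INT) auto
    moreover have "g \<in> W" using T by (simp add: W_def)
    moreover have "W \<subseteq> {g. step_path n g \<in> U}"
    proof safe
      fix g' assume g': "g' \<in> W"
      have "step_path n g' \<in> skorohod_nbhd (step_path n g) T e"
      proof (rule skorohod_nbhdI[OF step_path_in_skorohod time_change_id, where \<delta> = "e / 2"])
        show "e / 2 < e" using T by simp
        fix t :: real assume t: "0 \<le> t"
        show "\<bar>t - t\<bar> \<le> e / 2" using T by simp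
        assume "t \<le> T"
        then have "real n * t \<le> real n * T" by (simp add: mult_left_mono)
        then have le: "nat \<lfloor>real n * t\<rfloor> \<le> nat \<lfloor>real n * T\<rfloor>"
          by (intro nat_mono floor_mono)
        have "\<bar>g' (nat \<lfloor>real n * t\<rfloor>) - g (nat \<lfloor>real n * t\<rfloor>)\<bar> < e / 2"
          using g' le unfolding W_def by blast
        then show "\<bar>step_path n g' t - step_path n g t\<bar> \<le> e / 2"
          using t by (simp add: step_path_def)
      qed
      then show "step_path n g' \<in> U" using sub by blast
    qed
    ultimately show "\<exists>W. open W \<and> g \<in> W \<and> W \<subseteq> {g. step_path n g \<in> U}" by blast
  qed
  then show "openin euclidean {g \<in> topspace euclidean. step_path n g \<in> U}" by simp
qed

lemma sets_borel_of_topology_openin: "openin T U \<Longrightarrow> U \<in> sets (borel_of_topology T)"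
  unfolding borel_of_topology_def by (subst sets_measure_of) (auto dest: openin_subset)

lemma space_borel_of_topology: "space (borel_of_topology T) = topspace T"
  unfolding borel_of_topology_def by (simp add: space_measure_of_conv)

lemma measurable_borel_of_topologyI:
  assumes "\<And>\<omega>. \<omega> \<in> space N \<Longrightarrow> Z \<omega> \<in> topspace T"
    and "\<And>U. openin T U \<Longrightarrow> Z -` U \<inter> space N \<in> sets N"
  shows "Z \<in> N \<rightarrow>\<^sub>M borel_of_topology T"
  unfolding borel_of_topology_def
  by (rule measurable_measure_of) (use assms in \<open>auto dest: openin_subset\<close>)

lemma measurable_continuous_map_real:
  assumes "continuous_map T euclideanreal f"
  shows "f \<in> borel_of_topology T \<rightarrow>\<^sub>M borel"
proof (rule borel_measurableI)
  fix S :: "real set" assume "open S"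
  then have "openin T {x \<in> topspace T. f x \<in> S}"
    using assms by (simp add: continuous_map)
  moreover have "f -` S \<inter> space (borel_of_topology T) = {x \<in> topspace T. f x \<in> S}"
    by (auto simp: space_borel_of_topology)
  ultimately show "f -` S \<inter> space (borel_of_topology T) \<in> sets (borel_of_topology T)"
    by (simp add: sets_borel_of_topology_openin)
qed

lemma measurable_step_path:
  assumes "\<And>j. (\<lambda>\<omega>. g \<omega> j) \<in> borel_measurable N"
  shows "(\<lambda>\<omega>. step_path n (g \<omega>)) \<in> N \<rightarrow>\<^sub>M borel_of_topology skorohod_topology"
proof -
  have g: "g \<in> borel_measurable N"
    by (rule measurable_coordinatewise_then_product) (rule assms)
  show ?thesis
  proof (rule measurable_borel_of_topologyI)
    show "step_path n (g \<omega>) \<in> topspace skorohod_topology" for \<omega>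
      by (simp add: step_path_in_skorohod topspace_skorohod_topology)
    fix U assume "openin skorohod_topology U"
    then have "open {h. step_path n h \<in> U}"
      using continuous_map_step_path[of n] by (simp add: continuous_map)
    then have "g -` {h. step_path n h \<in> U} \<inter> space N \<in> sets N"
      using g by (intro measurable_sets) auto
    then show "(\<lambda>\<omega>. step_path n (g \<omega>)) -` U \<inter> space N \<in> sets N"
      by (simp add: vimage_def)
  qed
qed

text \<open>
  \<open>oscillation_chain x \<epsilon> b\<close> says that \<open>[0, b)\<close> is a finite union of consecutive half-open intervals on
  each of which \<open>x\<close> oscillates by at most \<open>\<epsilon>\<close>. As an inductive predicate it allows induction over
  the intervals without naming the partition.
\<close>

inductive oscillation_chain :: "(real \<Rightarrow> real) \<Rightarrow> real \<Rightarrow> real \<Rightarrow> bool" for x \<epsilon> where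
  start: "oscillation_chain x \<epsilon> 0"
| extend: "oscillation_chain x \<epsilon> a \<Longrightarrow> a < b \<Longrightarrow>
    (\<And>u v. a \<le> u \<Longrightarrow> u < b \<Longrightarrow> a \<le> v \<Longrightarrow> v < b \<Longrightarrow> \<bar>x u - x v\<bar> \<le> \<epsilon>) \<Longrightarrow> oscillation_chain x \<epsilon> b"

lemma oscillation_chain_nonneg: "oscillation_chain x \<epsilon> b \<Longrightarrow> 0 \<le> b"
  by (induction rule: oscillation_chain.induct) auto

text \<open>
  The supremum of the reachable end points is itself reachable because of the left limit there, and
  right-continuity then allows one more interval; so the end points are unbounded.
\<close>

lemma cadlag_oscillation_chain:
  assumes x: "cadlag x" and e: "\<epsilon> > 0"
  shows "\<exists>b>T. oscillation_chain x \<epsilon> b"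
proof (rule ccontr)
  assume "\<not> ?thesis"
  then have bd: "b \<le> T" if "oscillation_chain x \<epsilon> b" for b using that by force
  define S where "S = Collect (oscillation_chain x \<epsilon>)"
  have bdd: "bdd_above S" using bd by (auto simp: S_def bdd_above_def)
  have S0: "0 \<in> S" by (simp add: S_def oscillation_chain.start)
  define s where "s = Sup S"
  have s0: "0 \<le> s" using S0 bdd by (simp add: s_def cSup_upper)
  have chain_s: "oscillation_chain x \<epsilon> s"
  proof (cases "s = 0")
    case True then show ?thesis by (simp add: oscillation_chain.start)
  next
    case False
    then have "s > 0" using s0 by simp
    then obtain l where "(x \<longlongrightarrow> l) (at_left s)" using x by (auto simp: cadlag_def)
    then have "\<forall>\<^sub>F u in at_left s. dist (x u) l < \<epsilon> / 2"
      by (rule tendstoD) (use e in simp)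
    then obtain c where c: "c < s" "\<And>u. c < u \<Longrightarrow> u < s \<Longrightarrow> \<bar>x u - l\<bar> < \<epsilon> / 2"
      using \<open>s > 0\<close> unfolding eventually_at_left[OF \<open>s > 0\<close>] by (auto simp: dist_real_def)
    obtain a where a: "a \<in> S" "c < a"
      using less_cSupD[of S c] S0 c(1) by (auto simp: s_def)
    have "a \<le> s" using a(1) bdd by (simp add: s_def cSup_upper)
    show ?thesis
    proof (cases "a = s")
      case True then show ?thesis using a by (simp add: S_def)
    next
      case False
      show ?thesis
      proof (rule oscillation_chain.extend)
        show "oscillation_chain x \<epsilon> a" using a by (simp add: S_def)
        show "a < s" using False \<open>a \<le> s\<close> by simp
        fix u v assume "a \<le> u" "u < s" "a \<le> v" "v < s"
        then show "\<bar>x u - x v\<bar> \<le> \<epsilon>" using c(2)[of u] c(2)[of v] a(2) by linarith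
      qed
    qed
  qed
  have "(x \<longlongrightarrow> x s) (at_right s)" using x s0 by (auto simp: cadlag_def continuous_within)
  then have "\<forall>\<^sub>F u in at_right s. dist (x u) (x s) < \<epsilon> / 2"
    by (rule tendstoD) (use e in simp)
  then obtain b where b: "s < b" "\<And>u. s < u \<Longrightarrow> u < b \<Longrightarrow> \<bar>x u - x s\<bar> < \<epsilon> / 2"
    unfolding eventually_at_right_field by (auto simp: dist_real_def)
  have "oscillation_chain x \<epsilon> b"
  proof (rule oscillation_chain.extend[OF chain_s b(1)])
    fix u v assume u: "s \<le> u" "u < b" and v: "s \<le> v" "v < b"
    have "\<bar>x u - x s\<bar> < \<epsilon> / 2" using b(2)[of u] u e by (cases "u = s") auto
    moreover have "\<bar>x v - x s\<bar> < \<epsilon> / 2" using b(2)[of v] v e by (cases "v = s") auto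
    ultimately show "\<bar>x u - x v\<bar> \<le> \<epsilon>" by linarith
  qed
  then have "b \<le> s" using bdd by (simp add: s_def S_def cSup_upper)
  then show False using b(1) by simp
qed

text \<open>
  The displacement \<open>h t - t\<close> of the new piece interpolates between its values at the two end points,
  so the bound \<open>\<delta>\<close> is inherited.
\<close>

lemma time_change_extend_linear:
  assumes h: "time_change h" and ab: "0 \<le> a" "a < b" and B: "h a < B"
    and close: "\<And>t. 0 \<le> t \<Longrightarrow> \<bar>h t - t\<bar> \<le> \<delta>" "\<bar>B - b\<bar> \<le> \<delta>"
  obtains h' where "time_change h'" "\<And>t. 0 \<le> t \<Longrightarrow> \<bar>h' t - t\<bar> \<le> \<delta>" "\<And>t. t \<le> a \<Longrightarrow> h' t = h t"
    "h' b = B"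
proof -
  define r where "r = (B - h a) / (b - a)"
  have r: "r > 0" using ab B by (simp add: r_def)
  have rB: "h a + (b - a) * r = B" using ab by (simp add: r_def)
  define h' where "h' t = (if t \<le> a then h t else if t \<le> b then h a + (t - a) * r
    else B + (t - b))" for t
  have mono_h: "h u < h v" if "0 \<le> u" "u < v" for u v
    using h that by (auto simp: time_change_def strict_mono_on_def)
  have h0: "0 \<le> h t" if "0 \<le> t" for t using time_change_nonneg[OF h that] .
  have mono1: "h a + (t - a) * r \<le> B" if "t \<le> b" for t
  proof -
    have "(t - a) * r \<le> (b - a) * r" using that r by (intro mult_right_mono) auto
    then show ?thesis using rB by linarith
  qed
  have "strict_mono_on {0..} h'"
  proof (rule strict_mono_onI)
    fix u v :: real assume uv: "u \<in> {0..}" "v \<in> {0..}" "u < v"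
    have 1: "h u \<le> h a" if "u \<le> a" using mono_h[of u a] uv that by (cases "u = a") auto
    have 2: "(v - a) * r > 0" if "a < v" using that r by simp
    have 3: "(u - a) * r < (v - a) * r" using r uv by simp
    show "h' u < h' v"
      using mono_h[of u v] uv 1 2 3 mono1[of u] B unfolding h'_def by (auto split: if_splits)
  qed
  moreover have "h' ` {0..} = {0..}"
  proof (intro equalityI subsetI)
    fix y assume "y \<in> h' ` {0..}"
    then obtain t where t: "t \<ge> 0" "y = h' t" by auto
    have "(t - a) * r \<ge> 0" if "t > a" using that r by simp
    then show "y \<in> {0..}" using t h0[of t] h0[of a] ab B by (auto simp: h'_def)
  next
    fix y :: real assume y: "y \<in> {0..}"
    consider "y \<le> h a" | "h a < y" "y \<le> B" | "B < y" by linarith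
    then show "y \<in> h' ` {0..}"
    proof cases
      case 1
      obtain t where t: "t \<ge> 0" "h t = y" using h y by (force simp: time_change_def)
      then have "t \<le> a" using mono_h[of a t] 1 ab by force
      then show ?thesis using t by (intro image_eqI[of _ _ t]) (auto simp: h'_def)
    next
      case 2
      define t where "t = a + (y - h a) / r"
      have "t > a" using 2 r by (simp add: t_def)
      moreover have "y - h a \<le> (b - a) * r" using rB 2 by linarith
      then have "t \<le> b" using r by (simp add: t_def pos_divide_le_eq field_simps)
      ultimately show ?thesis using r ab
        by (intro image_eqI[of _ _ t]) (auto simp: h'_def t_def)
    next
      case 3
      then show ?thesis using ab by (intro image_eqI[of _ _ "b + (y - B)"]) (auto simp: h'_def)
    qed
  qed
  ultimately have tc: "time_change h'" by (simp add: time_change_def)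
  have "\<bar>h' t - t\<bar> \<le> \<delta>" if t: "0 \<le> t" for t
  proof -
    consider "t \<le> a" | "a < t" "t \<le> b" | "b < t" by linarith
    then show ?thesis
    proof cases
      case 1 then show ?thesis using close(1)[OF t] by (simp add: h'_def)
    next
      case 2
      define w where "w = (t - a) / (b - a)"
      have w: "0 \<le> w" "w \<le> 1" using 2 ab by (simp_all add: w_def)
      have "h' t - t = (1 - w) * (h a - a) + w * (B - b)"
      proof -
        have 1: "(t - a) * r = w * (B - h a)" by (simp add: w_def r_def)
        have 3: "t = a + w * (b - a)" using ab by (simp add: w_def)
        have "h' t - t = h a + w * (B - h a) - (a + w * (b - a))"
          using 2 1 3 by (simp add: h'_def)
        then show ?thesis by (simp add: algebra_simps)
      qed
      moreover have "\<bar>(1 - w) * (h a - a) + w * (B - b)\<bar> \<le> (1 - w) * \<delta> + w * \<delta>"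
        using w close(1)[OF ab(1)] close(2)
        by (intro order_trans[OF abs_triangle_ineq] add_mono)
           (simp_all add: abs_mult mult_left_mono)
      ultimately show ?thesis by (simp add: algebra_simps)
    next
      case 3 then show ?thesis using close(2) ab by (simp add: h'_def)
    qed
  qed
  moreover have "h' b = B" using ab rB by (simp add: h'_def)
  ultimately show ?thesis using tc by (intro that[of h']) (auto simp: h'_def)
qed

text \<open>
  The time change sends each end point \<open>a\<close> of the chain to the first grid point \<open>\<lceil>k a\<rceil>/k\<close> after it. A
  time in \<open>[a, b)\<close> is then sent to a time whose preceding grid point also lies in \<open>[a, b)\<close>, where the
  path oscillates by at most \<open>\<epsilon>\<close>.
\<close>

lemma oscillation_chain_time_change:
  assumes "oscillation_chain x \<epsilon> b" and "\<epsilon> \<ge> 0"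
  shows "\<forall>\<^sub>F k in sequentially. \<exists>h. time_change h \<and> (\<forall>t\<ge>0. \<bar>h t - t\<bar> \<le> 1 / real k) \<and>
    h b = of_int \<lceil>real k * b\<rceil> / real k \<and>
    (\<forall>t. 0 \<le> t \<longrightarrow> t < b \<longrightarrow> \<bar>x (real (nat \<lfloor>real k * h t\<rfloor>) / real k) - x t\<bar> \<le> \<epsilon>)"
  using assms(1)
proof (induction rule: oscillation_chain.induct)
  case start
  show ?case
    by (intro always_eventually allI exI[of _ "\<lambda>t. t"]) (simp add: time_change_id)
next
  case (extend a b)
  have a0: "0 \<le> a" by (rule oscillation_chain_nonneg[OF extend.hyps(1)])
  \<comment> \<open>For \<open>k > 1/(b - a)\<close> the images of \<open>a\<close> and \<open>b\<close> are distinct, as strict monotonicity requires.\<close>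
  obtain K where K: "1 / (b - a) < real K" using reals_Archimedean2 by blast
  show ?case
    using extend.IH eventually_ge_at_top[of "K + 1"]
  proof eventually_elim
    case (elim k)
    then obtain h where h: "time_change h" "\<And>t. t \<ge> 0 \<Longrightarrow> \<bar>h t - t\<bar> \<le> 1 / real k"
      "h a = of_int \<lceil>real k * a\<rceil> / real k"
      "\<And>t. 0 \<le> t \<Longrightarrow> t < a \<Longrightarrow> \<bar>x (real (nat \<lfloor>real k * h t\<rfloor>) / real k) - x t\<bar> \<le> \<epsilon>"
      by blast
    have k: "real k > 0" "1 / (b - a) < real k" using elim K by auto
    have "1 < real k * (b - a)" using k(2) extend.hyps(2) by (simp add: pos_divide_less_eq)
    then have "\<lceil>real k * a\<rceil> < \<lceil>real k * b\<rceil>" by (simp add: right_diff_distrib) linarith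
    then have "h a < of_int \<lceil>real k * b\<rceil> / real k"
      using k h(3) by (simp add: divide_strict_right_mono)
    moreover have "\<bar>of_int \<lceil>real k * b\<rceil> / real k - b\<bar> \<le> 1 / real k"
    proof -
      have "\<bar>of_int \<lceil>real k * b\<rceil> - real k * b\<bar> \<le> 1" by linarith
      then have "\<bar>(of_int \<lceil>real k * b\<rceil> - real k * b) / real k\<bar> \<le> 1 / real k"
        using k by (simp add: divide_right_mono)
      then show ?thesis using k by (simp add: diff_divide_distrib)
    qed
    ultimately have B: "h a < of_int \<lceil>real k * b\<rceil> / real k"
      "\<bar>of_int \<lceil>real k * b\<rceil> / real k - b\<bar> \<le> 1 / real k" by blast+
    obtain h' where h': "time_change h'" "\<And>t. 0 \<le> t \<Longrightarrow> \<bar>h' t - t\<bar> \<le> 1 / real k"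
      "\<And>t. t \<le> a \<Longrightarrow> h' t = h t" "h' b = of_int \<lceil>real k * b\<rceil> / real k"
      by (rule time_change_extend_linear[OF h(1) a0 extend.hyps(2) B(1), of "1 / real k"])
         (use h(2) B(2) in blast)+
    have "\<bar>x (real (nat \<lfloor>real k * h' t\<rfloor>) / real k) - x t\<bar> \<le> \<epsilon>" if t: "0 \<le> t" "t < b" for t
    proof (cases "t < a")
      case True then show ?thesis using h(4)[OF t(1)] h'(3) by simp
    next
      case False
      have mono: "h' u < h' v" if "0 \<le> u" "u < v" for u v
        using h'(1) that by (auto simp: time_change_def strict_mono_on_def)
      have "h a \<le> h' t" using mono[of a t] h'(3)[of a] a0 False by (cases "t = a") auto
      moreover have "h' t < h' b" using mono t by simp
      ultimately have "of_int \<lceil>real k * a\<rceil> \<le> real k * h' t"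
        "real k * h' t < of_int \<lceil>real k * b\<rceil>"
        using h(3) h'(4) k by (simp_all add: field_simps)
      moreover define m where "m = \<lfloor>real k * h' t\<rfloor>"
      ultimately have m: "\<lceil>real k * a\<rceil> \<le> m" "m < \<lceil>real k * b\<rceil>" by linarith+
      have "0 \<le> real k * a" using k a0 by simp
      then have "0 \<le> \<lceil>real k * a\<rceil>" by linarith
      then have "0 \<le> m" using m by linarith
      then have mn: "real (nat m) = of_int m" by simp
      have "real k * a \<le> of_int m" "of_int m < real k * b" using m by linarith+
      then have "a \<le> of_int m / real k" "of_int m / real k < b"
        using k by (simp_all add: field_simps)
      then show ?thesis
        using extend.hyps(3)[of "of_int m / real k" t] False t
        unfolding m_def[symmetric] mn by simp
    qed
    then show ?case using h' by blast
  qed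
qed

lemma discretised_path_converges:
  assumes x: "x \<in> skorohod_space" and T: "T \<ge> 0" and e: "e > 0"
  shows "\<forall>\<^sub>F k in sequentially. step_path k (\<lambda>j. x (real j / real k)) \<in> skorohod_nbhd x T e"
proof -
  have cx: "cadlag x" using x by (simp add: skorohod_space_def)
  obtain b where b: "b > T" "oscillation_chain x (e / 2) b"
    using cadlag_oscillation_chain[OF cx, of "e / 2" T] e by auto
  obtain K where K: "2 / e < real K" using reals_Archimedean2 by blast
  have "e / 2 \<ge> 0" using e by simp
  from oscillation_chain_time_change[OF b(2) this] eventually_ge_at_top[of "K + 1"]
  show ?thesis
  proof eventually_elim
    case (elim k)
    then obtain h where h: "time_change h" "\<And>t. t \<ge> 0 \<Longrightarrow> \<bar>h t - t\<bar> \<le> 1 / real k"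
      "\<And>t. 0 \<le> t \<Longrightarrow> t < b \<Longrightarrow> \<bar>x (real (nat \<lfloor>real k * h t\<rfloor>) / real k) - x t\<bar> \<le> e / 2"
      by blast
    have "2 / e < real k" "real k > 0" using elim K by auto
    then have k: "1 / real k \<le> e / 2" using e by (simp add: field_simps)
    show ?case
    proof (rule skorohod_nbhdI[OF step_path_in_skorohod h(1)])
      show "e / 2 < e" using e by simp
      fix t :: real assume t: "0 \<le> t"
      show "\<bar>h t - t\<bar> \<le> e / 2" using h(2)[OF t] k by linarith
      assume "t \<le> T"
      then show "\<bar>step_path k (\<lambda>j. x (real j / real k)) (h t) - x t\<bar> \<le> e / 2"
        using h(3)[OF t] b(1) time_change_nonneg[OF h(1) t] by (simp add: step_path_def)
    qed
  qed
qed

lemma time_change_inverse: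
  assumes h: "time_change h"
  obtains g where "time_change g" "\<And>t. 0 \<le> t \<Longrightarrow> h (g t) = t"
proof -
  have inj: "inj_on h {0..}" and im: "h ` {0..} = {0..}"
    using h strict_mono_on_imp_inj_on unfolding time_change_def by auto
  define g where "g = the_inv_into {0..} h"
  have hg: "h (g t) = t" if "0 \<le> t" for t
    unfolding g_def by (rule f_the_inv_into_f[OF inj]) (use im that in auto)
  have g0: "g t \<ge> 0" if "0 \<le> t" for t
    using the_inv_into_into[OF inj, of t "{0..}"] im that by (auto simp: g_def)
  have gh: "g (h t) = t" if "0 \<le> t" for t
    unfolding g_def by (rule the_inv_into_f_f[OF inj]) (use that in auto)
  have "strict_mono_on {0..} g"
  proof (rule strict_mono_onI, rule ccontr)
    fix u v :: real assume uv: "u \<in> {0..}" "v \<in> {0..}" "u < v" "\<not> g u < g v"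
    then have "g v = g u \<or> g v < g u" by linarith
    then have "h (g v) \<le> h (g u)"
      using h g0[of v] g0[of u] uv by (auto simp: time_change_def strict_mono_on_def less_imp_le)
    then show False using hg[of u] hg[of v] uv by simp
  qed
  moreover have "g ` {0..} = {0..}"
  proof (intro equalityI subsetI)
    fix t assume "t \<in> {0::real..}"
    then show "t \<in> g ` {0..}"
      using gh[of t] time_change_nonneg[OF h, of t] by (intro image_eqI[of _ g "h t"]) auto
  qed (use g0 in auto)
  ultimately show ?thesis using hg by (intro that[of g]) (auto simp: time_change_def)
qed

lemma skorohod_nbhd_sym:
  assumes x: "x \<in> skorohod_space" and y: "y \<in> skorohod_nbhd x (T + e) e"
  shows "x \<in> skorohod_nbhd y T e"
proof -
  obtain h \<delta> where h: "y \<in> skorohod_space" "time_change h" "\<delta> < e"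
    "\<And>t. 0 \<le> t \<Longrightarrow> \<bar>h t - t\<bar> \<le> \<delta>" "\<And>t. 0 \<le> t \<Longrightarrow> t \<le> T + e \<Longrightarrow> \<bar>y (h t) - x t\<bar> \<le> \<delta>"
    using y by (rule skorohod_nbhdE) (rule that; simp)
  obtain g where g: "time_change g" "\<And>t. 0 \<le> t \<Longrightarrow> h (g t) = t"
    using time_change_inverse[OF h(2)] by blast
  show ?thesis
  proof (rule skorohod_nbhdI[OF x g(1) h(3)])
    fix t :: real assume t: "0 \<le> t"
    have gt: "0 \<le> g t" by (rule time_change_nonneg[OF g(1) t])
    show 1: "\<bar>g t - t\<bar> \<le> \<delta>" using h(4)[OF gt] g(2)[OF t] by (simp add: abs_minus_commute)
    assume "t \<le> T"
    then have "g t \<le> T + e" using 1 h(3) by linarith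
    from h(5)[OF gt this] show "\<bar>x (g t) - y t\<bar> \<le> \<delta>"
      using g(2)[OF t] by (simp add: abs_minus_commute)
  qed
qed

lemma skorohod_nbhd_trans:
  assumes y: "y \<in> skorohod_nbhd x T e1" and z: "z \<in> skorohod_nbhd y (T + e1) e2"
  shows "z \<in> skorohod_nbhd x T (e1 + e2)"
proof -
  obtain h d where h: "y \<in> skorohod_space" "time_change h" "d < e1" "\<And>t. 0 \<le> t \<Longrightarrow> \<bar>h t - t\<bar> \<le> d"
      "\<And>t. 0 \<le> t \<Longrightarrow> t \<le> T \<Longrightarrow> \<bar>y (h t) - x t\<bar> \<le> d"
    using y by (rule skorohod_nbhdE) (rule that; simp)
  obtain g d' where g: "z \<in> skorohod_space" "time_change g" "d' < e2"
      "\<And>t. 0 \<le> t \<Longrightarrow> \<bar>g t - t\<bar> \<le> d'" "\<And>t. 0 \<le> t \<Longrightarrow> t \<le> T + e1 \<Longrightarrow> \<bar>z (g t) - y t\<bar> \<le> d'"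
    using z by (rule skorohod_nbhdE) (rule that; simp)
  show ?thesis
  proof (rule skorohod_nbhdI[OF g(1) time_change_comp[OF h(2) g(2)]])
    show "d + d' < e1 + e2" using g(3) h(3) by linarith
    fix t :: real assume t: "0 \<le> t"
    have ht: "0 \<le> h t" by (rule time_change_nonneg[OF h(2) t])
    show "\<bar>g (h t) - t\<bar> \<le> d + d'" using g(4)[OF ht] h(4)[OF t] by linarith
    assume t': "t \<le> T"
    have "h t \<le> T + e1" using h(3) h(4)[OF t] t' by linarith
    from g(5)[OF ht this] h(5)[OF t t'] show "\<bar>z (g (h t)) - x t\<bar> \<le> d + d'" by linarith
  qed
qed

text \<open>
  The Borel sets of the Skorohod topology are thus generated by the coordinates. The discretised paths
  are measurable and converge, so only the openness of \<open>U\<close> has to be expressed uniformly: \<open>V m\<close> below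
  is the set of paths that have a neighbourhood of fixed size \<open>m\<close> inside \<open>U\<close>, uniformly near them. A
  path is in \<open>U\<close> exactly when its discretisations are eventually in one \<open>V m\<close>.
\<close>

lemma measurable_skorohodI:
  assumes Z: "\<And>\<omega>. \<omega> \<in> space N \<Longrightarrow> Z \<omega> \<in> skorohod_space"
    and m: "\<And>t. 0 \<le> t \<Longrightarrow> (\<lambda>\<omega>. Z \<omega> t) \<in> borel_measurable N"
  shows "Z \<in> N \<rightarrow>\<^sub>M borel_of_topology skorohod_topology"
proof (rule measurable_borel_of_topologyI)
  show "Z \<omega> \<in> topspace skorohod_topology" if "\<omega> \<in> space N" for \<omega>
    using Z that by (simp add: topspace_skorohod_topology)
  fix U assume U: "openin skorohod_topology U"
  define Zk where "Zk k \<omega> = step_path k (\<lambda>j. Z \<omega> (real j / real k))" for k \<omega>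
  define V where "V m = \<Union>{W. openin skorohod_topology W \<and>
    (\<forall>y\<in>W. skorohod_nbhd y (real m) (1 / real (Suc m)) \<subseteq> U)}" for m :: nat
  have V: "openin skorohod_topology (V m)" for m unfolding V_def by (intro openin_Union) auto
  have V_sub: "skorohod_nbhd y (real m) (1 / real (Suc m)) \<subseteq> U" if "y \<in> V m" for y m
    using that unfolding V_def by blast
  have Zk: "Zk k \<in> N \<rightarrow>\<^sub>M borel_of_topology skorohod_topology" for k
    unfolding Zk_def by (rule measurable_step_path) (auto intro!: m)
  have iff: "Z \<omega> \<in> U \<longleftrightarrow> (\<exists>m K. \<forall>k\<ge>K. Zk k \<omega> \<in> V m)" if \<omega>: "\<omega> \<in> space N" for \<omega>
  proof
    assume "Z \<omega> \<in> U"
    then obtain T e where T: "T \<ge> 0" "e > 0" "skorohod_nbhd (Z \<omega>) T e \<subseteq> U"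
      using U unfolding openin_skorohod_topology by blast
    define W where "W = skorohod_nbhd (Z \<omega>) T (e / 2)"
    have W: "openin skorohod_topology W" unfolding W_def by (rule openin_skorohod_nbhd[OF T(1)])
    obtain m1 where "T + e / 2 \<le> real m1" using real_arch_simple by blast
    obtain m2 where "2 / e < real m2" using reals_Archimedean2 by blast
    define m where "m = max m1 m2"
    have m: "T + e / 2 \<le> real m" "2 / e < real (Suc m)"
      using \<open>T + e / 2 \<le> real m1\<close> \<open>2 / e < real m2\<close> by (auto simp: m_def)
    have m': "1 / real (Suc m) \<le> e / 2" using m(2) T(2) by (simp add: field_simps)
    have "skorohod_nbhd y (real m) (1 / real (Suc m)) \<subseteq> U" if y: "y \<in> W" for y
    proof
      fix z assume "z \<in> skorohod_nbhd y (real m) (1 / real (Suc m))"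
      then have "z \<in> skorohod_nbhd y (T + e / 2) (e / 2)"
        using skorohod_nbhd_mono[OF m(1) m'] by blast
      then have "z \<in> skorohod_nbhd (Z \<omega>) T (e / 2 + e / 2)"
        using y unfolding W_def by (intro skorohod_nbhd_trans)
      then show "z \<in> U" using T(3) by auto
    qed
    then have "W \<subseteq> V m" using W unfolding V_def by blast
    moreover have "\<forall>\<^sub>F k in sequentially. Zk k \<omega> \<in> W"
      unfolding Zk_def W_def using T by (intro discretised_path_converges Z \<omega>) auto
    ultimately show "\<exists>m K. \<forall>k\<ge>K. Zk k \<omega> \<in> V m"
      unfolding eventually_sequentially by blast
  next
    assume "\<exists>m K. \<forall>k\<ge>K. Zk k \<omega> \<in> V m"
    then obtain m K where K: "\<And>k. k \<ge> K \<Longrightarrow> Zk k \<omega> \<in> V m" by blast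
    have "\<forall>\<^sub>F k in sequentially.
        Zk k \<omega> \<in> skorohod_nbhd (Z \<omega>) (real m + 1 / real (Suc m)) (1 / real (Suc m))"
      unfolding Zk_def by (intro discretised_path_converges Z \<omega>) auto
    then obtain K' where
      "\<And>k. k \<ge> K' \<Longrightarrow> Zk k \<omega> \<in> skorohod_nbhd (Z \<omega>) (real m + 1 / real (Suc m)) (1 / real (Suc m))"
      unfolding eventually_sequentially by blast
    from skorohod_nbhd_sym[OF Z[OF \<omega>] this[of "max K K'"]] V_sub[OF K[of "max K K'"]]
    show "Z \<omega> \<in> U" by auto
  qed
  have "{\<omega> \<in> space N. Zk k \<omega> \<in> V m} \<in> sets N" for k m
  proof -
    have "Zk k -` V m \<inter> space N \<in> sets N"
      by (rule measurable_sets[OF Zk sets_borel_of_topology_openin[OF V]])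
    then show ?thesis by (simp add: vimage_def Int_def conj_commute)
  qed
  then have "{\<omega> \<in> space N. \<exists>m K. \<forall>k\<ge>K. Zk k \<omega> \<in> V m} \<in> sets N" by measurable
  also have "{\<omega> \<in> space N. \<exists>m K. \<forall>k\<ge>K. Zk k \<omega> \<in> V m} = Z -` U \<inter> space N"
    using iff by auto
  finally show "Z -` U \<inter> space N \<in> sets N" .
qed

section \<open>Convergence of expectations on the unit cube\<close>

lemma compact_unit_cube: "compact {u :: 'i::countable \<Rightarrow> real. \<forall>r. u r \<in> {0..1}}"
proof -
  have "compactin (product_topology (\<lambda>_. euclidean) UNIV) (PiE (UNIV :: 'i set) (\<lambda>_. {0..1::real}))"
    by (subst compactin_PiE) auto
  moreover have "PiE (UNIV :: 'i set) (\<lambda>_. {0..1::real}) = {u. \<forall>r. u r \<in> {0..1}}"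
    by (auto simp: PiE_def extensional_def)
  ultimately show ?thesis by (simp add: euclidean_product_topology)
qed

text \<open>
  The subalgebra to which the Stone--Weierstrass theorem is applied. A list of coordinates represents a
  monomial, so products of monomials are concatenations.
\<close>

inductive cube_polynomial :: "(('i::countable \<Rightarrow> real) \<Rightarrow> real) \<Rightarrow> bool" where
  monomial: "cube_polynomial (\<lambda>u. c * prod_list (map u js))"
| add: "cube_polynomial f \<Longrightarrow> cube_polynomial g \<Longrightarrow> cube_polynomial (\<lambda>u. f u + g u)"

lemma cube_polynomial_mult:
  assumes "cube_polynomial f" "cube_polynomial g"
  shows "cube_polynomial (\<lambda>u. f u * g u)"
  using assms(1)
proof induction
  case (monomial c js)
  show ?case using assms(2)
  proof induction
    case (monomial c' js')
    have "cube_polynomial (\<lambda>u. (c * c') * prod_list (map u (js @ js')))"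
      by (rule cube_polynomial.monomial)
    then show ?case by (simp add: mult_ac)
  next
    case (add f g)
    from cube_polynomial.add[OF add.IH] show ?case by (simp add: distrib_left)
  qed
next
  case (add f g)
  from cube_polynomial.add[OF add.IH] show ?case by (simp add: distrib_right)
qed

lemma continuous_on_prod_list_coordinates:
  "continuous_on A (\<lambda>u :: 'i::countable \<Rightarrow> real. prod_list (map u js))"
proof (induction js)
  case (Cons j js)
  have "continuous_on A (\<lambda>u :: 'i \<Rightarrow> real. u j)"
    by (rule continuous_on_subset[OF continuous_on_product_coordinates]) simp
  then show ?case using Cons by (auto intro: continuous_on_mult)
qed simp

lemma cube_polynomial_continuous: "cube_polynomial f \<Longrightarrow> continuous_on A f"
  by (induction rule: cube_polynomial.induct)
     (auto intro!: continuous_intros continuous_on_prod_list_coordinates)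

lemma unit_cube_polynomial_dense:
  fixes g :: "('i::countable \<Rightarrow> real) \<Rightarrow> real"
  assumes g: "continuous_on UNIV g" and e: "e > 0"
  obtains p where "cube_polynomial p" "\<And>u. (\<And>r. u r \<in> {0..1}) \<Longrightarrow> \<bar>g u - p u\<bar> < e"
proof -
  interpret function_ring_on "Collect cube_polynomial" "{u :: 'i \<Rightarrow> real. \<forall>r. u r \<in> {0..1}}"
  proof
    show "compact {u :: 'i \<Rightarrow> real. \<forall>r. u r \<in> {0..1}}" by (rule compact_unit_cube)
    show "(\<lambda>_. c) \<in> Collect cube_polynomial" for c
      using cube_polynomial.monomial[of c "[]"] by simp
    fix x y :: "'i \<Rightarrow> real" assume "x \<noteq> y"
    then obtain j where "x j \<noteq> y j" by auto
    moreover have "cube_polynomial (\<lambda>u. u j)"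
      using cube_polynomial.monomial[of 1 "[j]"] by simp
    ultimately show "\<exists>f\<in>Collect cube_polynomial. f x \<noteq> f y" by (intro bexI[of _ "\<lambda>u. u j"]) auto
  qed (auto intro: cube_polynomial_continuous cube_polynomial.add cube_polynomial_mult)
  have "continuous_on {u :: 'i \<Rightarrow> real. \<forall>r. u r \<in> {0..1}} g"
    by (rule continuous_on_subset[OF g]) simp
  from Stone_Weierstrass_basic[OF this e] show ?thesis using that by auto
qed

lemma integrable_continuous_unit_cube:
  fixes u :: "'w \<Rightarrow> 'i::countable \<Rightarrow> real"
  assumes "prob_space M" and g: "continuous_on UNIV g"
    and u: "\<And>r. (\<lambda>\<omega>. u \<omega> r) \<in> borel_measurable M" "\<And>\<omega> r. u \<omega> r \<in> {0..1}"
  shows "integrable M (\<lambda>\<omega>. g (u \<omega>) :: real)"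
proof -
  interpret prob_space M by fact
  have um: "u \<in> borel_measurable M" by (rule measurable_coordinatewise_then_product) (rule u(1))
  have gm: "g \<in> borel_measurable borel" by (rule borel_measurable_continuous_onI[OF g])
  have "bounded (g ` {u :: 'i \<Rightarrow> real. \<forall>r. u r \<in> {0..1}})"
    by (intro compact_imp_bounded compact_continuous_image compact_unit_cube
        continuous_on_subset[OF g]) simp
  then obtain B where B: "\<And>x. (\<forall>r. x r \<in> {0..1}) \<Longrightarrow> norm (g x) \<le> B"
    unfolding bounded_iff by auto
  show ?thesis
    by (rule integrable_const_bound[of _ B]) (use B u(2) measurable_compose[OF um gm] in auto)
qed

text \<open>
  Monomials determine the limit of all expectations, because polynomials are uniformly dense in the
  continuous functions on the compact cube.
\<close>

lemma unit_cube_convergence: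
  fixes u :: "nat \<Rightarrow> 'w \<Rightarrow> 'i::countable \<Rightarrow> real" and v :: "'v \<Rightarrow> 'i \<Rightarrow> real" and g :: "('i \<Rightarrow> real) \<Rightarrow> real"
  assumes M: "prob_space M" and N: "prob_space N"
    and u: "\<And>n r. (\<lambda>\<omega>. u n \<omega> r) \<in> borel_measurable M" "\<And>n \<omega> r. u n \<omega> r \<in> {0..1}"
    and v: "\<And>r. (\<lambda>\<omega>. v \<omega> r) \<in> borel_measurable N" "\<And>\<omega> r. v \<omega> r \<in> {0..1}"
    and lim: "\<And>js. (\<lambda>n. \<integral>\<omega>. prod_list (map (u n \<omega>) js) \<partial>M) \<longlonglongrightarrow> (\<integral>\<omega>. prod_list (map (v \<omega>) js) \<partial>N)"
    and g: "continuous_on UNIV g"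
  shows "(\<lambda>n. \<integral>\<omega>. g (u n \<omega>) \<partial>M) \<longlonglongrightarrow> (\<integral>\<omega>. g (v \<omega>) \<partial>N)"
proof (rule LIMSEQ_I)
  interpret M: prob_space M by fact
  interpret N: prob_space N by fact
  fix e :: real assume e: "0 < e"
  note Mint = integrable_continuous_unit_cube[OF M _ u]
  note Nint = integrable_continuous_unit_cube[OF N _ v]
  have e3: "e / 3 > 0" using e by simp
  obtain p where p: "cube_polynomial p" "\<And>u. (\<And>r. u r \<in> {0..1}) \<Longrightarrow> \<bar>g u - p u\<bar> < e / 3"
    using unit_cube_polynomial_dense[OF g e3] by blast
  note pc = cube_polynomial_continuous[OF p(1), of UNIV]
  have "(\<lambda>n. \<integral>\<omega>. p (u n \<omega>) \<partial>M) \<longlonglongrightarrow> (\<integral>\<omega>. p (v \<omega>) \<partial>N)"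
    using p(1)
  proof induction
    case (monomial c js)
    then show ?case using tendsto_mult_left[OF lim[of js], of c] by simp
  next
    case (add f g)
    note c = cube_polynomial_continuous[OF add.hyps(1), of UNIV]
      cube_polynomial_continuous[OF add.hyps(2), of UNIV]
    from tendsto_add[OF add.IH] show ?case
      by (simp add: Bochner_Integration.integral_add[OF Mint[OF c(1)] Mint[OF c(2)]]
          Bochner_Integration.integral_add[OF Nint[OF c(1)] Nint[OF c(2)]])
  qed
  from LIMSEQ_D[OF this e3] obtain n0 where
    n0: "\<And>n. n \<ge> n0 \<Longrightarrow> norm ((\<integral>\<omega>. p (u n \<omega>) \<partial>M) - (\<integral>\<omega>. p (v \<omega>) \<partial>N)) < e / 3" by blast
  have 1: "\<bar>(\<integral>\<omega>. g (u n \<omega>) \<partial>M) - (\<integral>\<omega>. p (u n \<omega>) \<partial>M)\<bar> \<le> e / 3" for n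
  proof -
    have "\<bar>\<integral>\<omega>. g (u n \<omega>) - p (u n \<omega>) \<partial>M\<bar> \<le> (\<integral>\<omega>. e / 3 \<partial>M)"
      using p(2)[OF u(2)]
      by (intro order_trans[OF integral_abs_bound] integral_mono integrable_abs
          Bochner_Integration.integrable_diff Mint g pc) (auto simp: less_imp_le)
    then show ?thesis
      by (simp add: Bochner_Integration.integral_diff[OF Mint[OF g] Mint[OF pc]] M.prob_space)
  qed
  have 2: "\<bar>(\<integral>\<omega>. g (v \<omega>) \<partial>N) - (\<integral>\<omega>. p (v \<omega>) \<partial>N)\<bar> \<le> e / 3"
  proof -
    have "\<bar>\<integral>\<omega>. g (v \<omega>) - p (v \<omega>) \<partial>N\<bar> \<le> (\<integral>\<omega>. e / 3 \<partial>N)"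
      using p(2)[OF v(2)]
      by (intro order_trans[OF integral_abs_bound] integral_mono integrable_abs
          Bochner_Integration.integrable_diff Nint g pc) (auto simp: less_imp_le)
    then show ?thesis
      by (simp add: Bochner_Integration.integral_diff[OF Nint[OF g] Nint[OF pc]] N.prob_space)
  qed
  have "norm ((\<integral>\<omega>. g (u n \<omega>) \<partial>M) - (\<integral>\<omega>. g (v \<omega>) \<partial>N)) < e" if "n \<ge> n0" for n
    using 1[of n] 2 n0[OF that] unfolding real_norm_def by linarith
  then show "\<exists>no. \<forall>n\<ge>no. norm ((\<integral>\<omega>. g (u n \<omega>) \<partial>M) - (\<integral>\<omega>. g (v \<omega>) \<partial>N)) < e" by blast
qed

section \<open>Convergence of increasing processes through passage times\<close>

text \<open>
  Levels are indexed by all rationals, through the absolute value, to have a countable index type.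
\<close>

definition level :: "rat \<Rightarrow> real" where
  "level r = \<bar>of_rat r\<bar>"

text \<open>
  For a nondecreasing path this is \<open>exp(-\<tau>)\<close> with \<open>\<tau>\<close> the first passage time above the level, and 0 if
  there is none. The supremum makes sense for every path and needs no infinite times.
\<close>

definition passage :: "(real \<Rightarrow> real) \<Rightarrow> rat \<Rightarrow> real" where
  "passage y r = (SUP s\<in>{0..}. if level r < y s then exp (- s) else 0)"

definition increasing_paths :: "(real \<Rightarrow> real) set" where
  "increasing_paths = {y \<in> skorohod_space. mono_on {0..} y \<and> (\<forall>s\<ge>0. 0 \<le> y s)}"

lemma level_nonneg [simp]: "0 \<le> level r"
  by (simp add: level_def)

lemma level_dense:
  assumes "0 \<le> a" "a < b" obtains r where "a < level r" "level r < b"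
proof -
  obtain q where "q \<in> \<rat>" "a < q" "q < b" using Rats_dense_in_real[OF assms(2)] by blast
  then obtain r where "q = of_rat r" by (auto elim: Rats_cases)
  then have "level r = q" using \<open>a < q\<close> assms(1) by (simp only: level_def)
  then show ?thesis using that[of r] \<open>a < q\<close> \<open>q < b\<close> by simp
qed

lemma passage_bdd: "bdd_above ((\<lambda>s. if level r < y s then exp (- s) else (0::real)) ` (S \<inter> {0..}))"
  by (rule bdd_aboveI[of _ 1]) auto

lemma passage_ge:
  assumes "0 \<le> s" "level r < y s" shows "exp (- s) \<le> passage y r"
  unfolding passage_def
  by (rule cSUP_upper2[where x = s]) (use assms passage_bdd[of r y UNIV] in auto)

lemma passage_le:
  assumes "0 \<le> c" "\<And>s. 0 \<le> s \<Longrightarrow> level r < y s \<Longrightarrow> exp (- s) \<le> c" shows "passage y r \<le> c"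
  unfolding passage_def by (rule cSUP_least) (use assms in auto)

lemma passage_unit: "passage y r \<in> {0..1}"
proof -
  have "0 \<le> passage y r" unfolding passage_def
    by (rule cSUP_upper2[where x = 0]) (use passage_bdd[of r y UNIV] in auto)
  moreover have "passage y r \<le> 1" by (rule passage_le) auto
  ultimately show ?thesis by simp
qed

lemma passage_greater:
  assumes y: "mono_on {0..} y" and s: "0 \<le> s" and "exp (- s) < passage y r"
  shows "level r < y s"
proof (rule ccontr)
  assume "\<not> level r < y s"
  have "passage y r \<le> exp (- s)"
  proof (rule passage_le)
    fix t assume t: "0 \<le> t" "level r < y t"
    then have "s < t" using y s \<open>\<not> level r < y s\<close> by (force simp: mono_on_def not_less)
    then show "exp (- t) \<le> exp (- s)" by simp
  qed simp
  then show False using assms(3) by simp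
qed

lemma passage_eq_SUP_rational:
  assumes "cadlag y"
  shows "passage y r = (SUP s\<in>\<rat> \<inter> {0..}. if level r < y s then exp (- s) else 0)"
proof (rule antisym)
  let ?f = "\<lambda>s. if level r < y s then exp (- s) else (0::real)"
  show "(SUP s\<in>\<rat> \<inter> {0..}. ?f s) \<le> passage y r"
    unfolding passage_def
    by (rule cSUP_subset_mono) (use passage_bdd[of r y UNIV] in auto)
  have nn: "0 \<le> (SUP s\<in>\<rat> \<inter> {0..}. ?f s)"
    by (rule cSUP_upper2[where x = 0]) (use passage_bdd[of r y \<rat>] in auto)
  show "passage y r \<le> (SUP s\<in>\<rat> \<inter> {0..}. ?f s)"
  proof (rule passage_le[OF nn])
    fix s assume s: "0 \<le> s" "level r < y s"
    have "(y \<longlongrightarrow> y s) (at_right s)"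
      using assms s by (auto simp: cadlag_def continuous_within)
    then have "\<forall>\<^sub>F t in at_right s. level r < y t" using s(2) by (rule order_tendstoD)
    then obtain b where b: "b > s" "\<And>t. s < t \<Longrightarrow> t < b \<Longrightarrow> level r < y t"
      unfolding eventually_at_right_field by blast
    show "exp (- s) \<le> (SUP s\<in>\<rat> \<inter> {0..}. ?f s)"
    proof (rule dense_le)
      fix c assume c: "c < exp (- s)"
      have "((\<lambda>t. exp (- t)) \<longlongrightarrow> exp (- s)) (at_right s)"
        by (intro tendsto_intros)
      then have "\<forall>\<^sub>F t in at_right s. c < exp (- t)" using c by (rule order_tendstoD)
      then obtain b' where b': "b' > s" "\<And>t. s < t \<Longrightarrow> t < b' \<Longrightarrow> c < exp (- t)"
        unfolding eventually_at_right_field by blast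
      obtain t where t: "t \<in> \<rat>" "s < t" "t < min b b'"
        using Rats_dense_in_real[of s "min b b'"] b(1) b'(1) by auto
      have "exp (- t) \<le> (SUP s\<in>\<rat> \<inter> {0..}. ?f s)"
        by (rule cSUP_upper2[where x = t]) (use passage_bdd[of r y \<rat>] t s b(2) in auto)
      then show "c \<le> (SUP s\<in>\<rat> \<inter> {0..}. ?f s)" using b'(2)[of t] t by simp
    qed
  qed
qed

lemma measurable_passage:
  assumes Z: "\<And>\<omega>. \<omega> \<in> space N \<Longrightarrow> cadlag (Z \<omega>)"
    and m: "\<And>t. 0 \<le> t \<Longrightarrow> (\<lambda>\<omega>. Z \<omega> t) \<in> borel_measurable N"
  shows "(\<lambda>\<omega>. passage (Z \<omega>) r) \<in> borel_measurable N"
proof -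
  have "(\<lambda>\<omega>. SUP s\<in>\<rat> \<inter> {0..}. if level r < Z \<omega> s then exp (- s) else 0) \<in> borel_measurable N"
  proof (rule borel_measurable_cSUP)
    show "countable (\<rat> \<inter> {0::real..})" by (simp add: countable_rat)
    fix s :: real assume "s \<in> \<rat> \<inter> {0..}"
    then have [measurable]: "(\<lambda>\<omega>. Z \<omega> s) \<in> borel_measurable N" by (intro m) simp
    show "(\<lambda>\<omega>. if level r < Z \<omega> s then exp (- s) else 0) \<in> borel_measurable N" by measurable
  qed (rule passage_bdd)
  then show ?thesis
    by (rule measurable_cong[THEN iffD1, rotated]) (simp add: passage_eq_SUP_rational[OF Z])
qed

text \<open>
  If \<open>Z s\<close> is below a level, then by continuity \<open>Z\<close> stays below it for a while longer, so its passage
  is strictly later than \<open>s\<close>, and eventually so is that of \<open>y m\<close>. If \<open>Z s\<close> is above a level, then by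
  continuity its passage is strictly earlier than \<open>s\<close>. The strict inequalities are where continuity
  of the limit enters.
\<close>

lemma passage_convergence_pointwise:
  assumes y: "\<And>m. y m \<in> increasing_paths" and Z: "continuous_on {0..} Z" "mono_on {0..} Z" "Z 0 = 0"
    and lim: "\<And>r. (\<lambda>m. passage (y m) r) \<longlonglongrightarrow> passage Z r" and s: "0 \<le> s"
  shows "(\<lambda>m. y m s) \<longlonglongrightarrow> Z s"
proof (rule order_tendstoI)
  have ym: "mono_on {0..} (y m)" and y0: "\<And>s. 0 \<le> s \<Longrightarrow> 0 \<le> y m s" for m
    using y[of m] by (auto simp: increasing_paths_def)
  have Z0: "0 \<le> Z s" if "0 \<le> s" for s using Z(2,3) that by (force simp: mono_on_def)
  have cont: "(Z \<longlongrightarrow> Z s) (at s within {0..})" using Z(1) s by (simp add: continuous_on_def)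
  fix a assume a: "Z s < a"
  then obtain r where r: "Z s < level r" "level r < a" using level_dense[OF Z0[OF s]] by blast
  have "\<forall>\<^sub>F t in at s within {0..}. Z t < level r" using cont r(1) by (rule order_tendstoD)
  then obtain d where d: "d > 0" "\<And>t. 0 \<le> t \<Longrightarrow> t \<noteq> s \<Longrightarrow> dist t s < d \<Longrightarrow> Z t < level r"
    unfolding eventually_at by auto
  define t where "t = s + d / 2"
  have t: "s < t" "Z t < level r" using d s by (auto simp: t_def dist_real_def)
  have "passage Z r \<le> exp (- t)"
  proof (rule passage_le)
    fix u assume u: "0 \<le> u" "level r < Z u"
    have "t < u"
    proof (rule ccontr)
      assume "\<not> t < u"
      then have "Z u \<le> Z t" using Z(2) u(1) t(1) s by (simp add: mono_on_def)
      then show False using u(2) t(2) by simp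
    qed
    then show "exp (- u) \<le> exp (- t)" by simp
  qed simp
  then have "passage Z r < exp (- s)" using t(1) by (smt (verit) exp_less_cancel_iff)
  then have "\<forall>\<^sub>F m in sequentially. passage (y m) r < exp (- s)" using lim by (rule order_tendstoD(2)[rotated])
  then show "\<forall>\<^sub>F m in sequentially. y m s < a"
  proof eventually_elim
    case (elim m)
    then have "\<not> level r < y m s" using passage_ge[OF s, of r "y m"] by force
    then show ?case using r(2) by simp
  qed
next
  have ym: "mono_on {0..} (y m)" and y0: "\<And>s. 0 \<le> s \<Longrightarrow> 0 \<le> y m s" for m
    using y[of m] by (auto simp: increasing_paths_def)
  fix a assume a: "a < Z s"
  show "\<forall>\<^sub>F m in sequentially. a < y m s"
  proof (cases "a < 0")
    case True
    then have "a < y m s" for m using y0[OF s, of m] by simp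
    then show ?thesis by simp
  next
    case False
    then obtain r where r: "a < level r" "level r < Z s" using level_dense[of a "Z s"] a by auto
    have "s \<noteq> 0" using r(2) Z(3) level_nonneg[of r] by force
    then have s0: "0 < s" using s by simp
    have "(Z \<longlongrightarrow> Z s) (at s within {0..})" using Z(1) s by (simp add: continuous_on_def)
    then have "\<forall>\<^sub>F t in at s within {0..}. level r < Z t" using r(2) by (rule order_tendstoD)
    then obtain d where d: "d > 0" "\<And>t. 0 \<le> t \<Longrightarrow> t \<noteq> s \<Longrightarrow> dist t s < d \<Longrightarrow> level r < Z t"
      unfolding eventually_at by auto
    define t where "t = max 0 (s - d / 2)"
    have t: "0 \<le> t" "t < s" "level r < Z t"
      using d s0 by (auto simp: t_def dist_real_def max_def)
    have "exp (- s) < passage Z r" using passage_ge[of t r Z] t by (smt (verit) exp_less_cancel_iff)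
    with lim have "\<forall>\<^sub>F m in sequentially. exp (- s) < passage (y m) r" by (rule order_tendstoD)
    then show ?thesis
    proof eventually_elim
      case (elim m)
      from passage_greater[OF ym s elim] show ?case using r(1) by simp
    qed
  qed
qed

text \<open>
  Pointwise convergence of monotone functions to a continuous one is locally uniform: it suffices to
  compare the values on a grid fine enough for the modulus of continuity of the limit.
\<close>

lemma passage_convergence_skorohod:
  assumes y: "\<And>m. y m \<in> increasing_paths" and Z: "continuous_on {0..} Z" "Z \<in> increasing_paths" "Z 0 = 0"
    and lim: "\<And>r. (\<lambda>m. passage (y m) r) \<longlonglongrightarrow> passage Z r"
  shows "limitin skorohod_topology y Z sequentially"
  unfolding limitin_skorohod_iff_nbhd
proof (intro conjI allI impI)
  show "Z \<in> skorohod_space" using Z by (simp add: increasing_paths_def)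
  have mZ: "mono_on {0..} Z" using Z by (simp add: increasing_paths_def)
  note pw = passage_convergence_pointwise[OF y Z(1) mZ Z(3) lim]
  fix T e :: real assume T: "0 \<le> T" and e: "0 < e"
  have "uniformly_continuous_on {0..T + 1} Z"
    by (rule compact_uniformly_continuous) (use Z(1) in \<open>auto intro: continuous_on_subset\<close>)
  moreover have "e / 4 > 0" using e by simp
  ultimately have "\<exists>d>0. \<forall>s\<in>{0..T + 1}. \<forall>t\<in>{0..T + 1}. dist t s < d \<longrightarrow> dist (Z t) (Z s) < e / 4"
    unfolding uniformly_continuous_on_def by blast
  then obtain d where d: "d > 0"
    "\<And>s t. s \<in> {0..T + 1} \<Longrightarrow> t \<in> {0..T + 1} \<Longrightarrow> dist t s < d \<Longrightarrow> dist (Z t) (Z s) < e / 4"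
    by blast
  define h where "h = min (d / 2) 1"
  have h: "0 < h" "h < d" "h \<le> 1" using d(1) by (auto simp: h_def)
  define K where "K = nat \<lceil>T / h\<rceil>"
  have "\<forall>\<^sub>F m in sequentially. \<forall>j\<in>{..K}. \<bar>y m (real j * h) - Z (real j * h)\<bar> < e / 4"
  proof (intro eventually_ball_finite ballI)
    fix j
    from tendstoD[OF pw[of "real j * h"], of "e / 4"] h e
    show "\<forall>\<^sub>F m in sequentially. \<bar>y m (real j * h) - Z (real j * h)\<bar> < e / 4"
      by (simp add: dist_real_def)
  qed simp
  moreover have "\<forall>\<^sub>F m in sequentially. \<bar>y m (T + h) - Z (T + h)\<bar> < e / 4"
    using tendstoD[OF pw[of "T + h"], of "e / 4"] h e T by (simp add: dist_real_def)
  ultimately show "\<forall>\<^sub>F m in sequentially. y m \<in> skorohod_nbhd Z T e"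
  proof eventually_elim
    case (elim m)
    have ym: "mono_on {0..} (y m)" "y m \<in> skorohod_space"
      using y[of m] by (auto simp: increasing_paths_def)
    show ?case
    proof (rule skorohod_nbhdI[OF ym(2) time_change_id, where \<delta> = "e / 2"])
      show "e / 2 < e" using e by simp
      fix t :: real assume t: "0 \<le> t"
      show "\<bar>t - t\<bar> \<le> e / 2" using e by simp
      assume tT: "t \<le> T"
      define j where "j = nat \<lfloor>t / h\<rfloor>"
      define lo where "lo = real j * h"
      define hi where "hi = min (real (Suc j) * h) (T + h)"
      have jr: "real j \<le> t / h" "t / h < real j + 1" using t h by (simp_all add: j_def)
      have lo: "0 \<le> lo" "lo \<le> t" using jr h by (auto simp: lo_def field_simps)
      have hi: "t \<le> hi" "hi \<le> lo + h" "hi \<le> T + h" using jr h tT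
        by (auto simp: hi_def lo_def field_simps min_def)
      have "t / h \<le> T / h" using tT h by (simp add: divide_right_mono)
      then have "\<lfloor>t / h\<rfloor> \<le> \<lceil>T / h\<rceil>" by linarith
      then have jK: "j \<le> K" unfolding j_def K_def by (rule nat_mono)
      have close_lo: "\<bar>y m lo - Z lo\<bar> < e / 4" using elim(1) jK by (simp add: lo_def)
      have close_hi: "\<bar>y m hi - Z hi\<bar> < e / 4"
      proof (cases "real (Suc j) * h < T + h")
        case True
        then have "real j * h < T" by (simp add: algebra_simps)
        then have "real j < T / h" using h by (simp add: pos_less_divide_eq)
        then have "Suc j \<le> K" unfolding K_def by linarith
        then have "\<bar>y m (real (Suc j) * h) - Z (real (Suc j) * h)\<bar> < e / 4"
          using elim(1) by blast
        then show ?thesis using True by (simp add: hi_def min_def)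
      next
        case False
        then have "hi = T + h" by (simp add: hi_def)
        then show ?thesis using elim(2) by simp
      qed
      have "dist (Z hi) (Z t) < e / 4" "dist (Z lo) (Z t) < e / 4"
        by (rule d(2); use lo hi h t tT in \<open>simp add: dist_real_def\<close>)+
      moreover have "y m lo \<le> y m t" "y m t \<le> y m hi"
        using ym(1) lo hi t by (auto simp: mono_on_def)
      ultimately show "\<bar>y m t - Z t\<bar> \<le> e / 2"
        using close_lo close_hi unfolding dist_real_def by linarith
    qed
  qed
qed

text \<open>
  The inf-convolution of \<open>f\<close>, carried from paths to points of the cube. It is \<open>k\<close>-Lipschitz and at most
  \<open>f\<close> on the points of paths, whatever the continuity of \<open>f\<close>.
\<close>

definition passage_envelope :: "((real \<Rightarrow> real) \<Rightarrow> real) \<Rightarrow> real \<Rightarrow> (rat \<Rightarrow> real) \<Rightarrow> real" where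
  "passage_envelope f k u = (INF y\<in>increasing_paths. f y + k * dist u (passage y))"

context
  fixes f :: "(real \<Rightarrow> real) \<Rightarrow> real" and B :: real
  assumes fB: "\<forall>y\<in>skorohod_space. \<bar>f y\<bar> \<le> B"
begin

lemma passage_envelope_bdd:
  assumes "0 \<le> k" shows "bdd_below ((\<lambda>y. f y + k * dist u (passage y)) ` increasing_paths)"
proof (rule bdd_belowI[of _ "- B"])
  fix x assume "x \<in> (\<lambda>y. f y + k * dist u (passage y)) ` increasing_paths"
  then obtain y where y: "y \<in> skorohod_space" "x = f y + k * dist u (passage y)"
    by (auto simp: increasing_paths_def)
  have "0 \<le> k * dist u (passage y)" using assms by simp
  then show "- B \<le> x" using bspec[OF fB y(1)] y(2) by linarith
qed

lemma increasing_paths_nonempty: "increasing_paths \<noteq> {}"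
proof -
  have "step_path 0 (\<lambda>_. 0) \<in> increasing_paths"
    using step_path_in_skorohod
    by (auto simp: increasing_paths_def step_path_def mono_on_def)
  then show ?thesis by blast
qed

lemma passage_envelope_le:
  assumes "0 \<le> k" "y \<in> increasing_paths" shows "passage_envelope f k (passage y) \<le> f y"
  unfolding passage_envelope_def
  by (rule cINF_lower2[OF passage_envelope_bdd[OF assms(1)] assms(2)]) simp

lemma passage_envelope_ge:
  assumes "0 \<le> k" shows "- B \<le> passage_envelope f k u"
  unfolding passage_envelope_def
proof (rule cINF_greatest[OF increasing_paths_nonempty])
  fix y assume "y \<in> increasing_paths"
  then have "y \<in> skorohod_space" by (simp add: increasing_paths_def)
  moreover have "0 \<le> k * dist u (passage y)" using assms by simp
  ultimately show "- B \<le> f y + k * dist u (passage y)" using bspec[OF fB, of y] by linarith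
qed

lemma passage_envelope_mono:
  assumes "0 \<le> k" "k \<le> l" shows "passage_envelope f k u \<le> passage_envelope f l u"
  unfolding passage_envelope_def
  by (rule cINF_mono[OF increasing_paths_nonempty passage_envelope_bdd[OF assms(1)]])
     (use assms in \<open>auto intro!: bexI mult_right_mono\<close>)

lemma passage_envelope_continuous:
  assumes k: "0 \<le> k" shows "continuous_on UNIV (passage_envelope f k)"
proof -
  have *: "passage_envelope f k u \<le> passage_envelope f k v + k * dist u v" for u v
  proof -
    have "passage_envelope f k u - k * dist u v \<le> passage_envelope f k v"
      unfolding passage_envelope_def[of f k v]
    proof (rule cINF_greatest[OF increasing_paths_nonempty])
      fix y assume y: "y \<in> increasing_paths"
      have "passage_envelope f k u \<le> f y + k * dist u (passage y)"
        unfolding passage_envelope_def by (rule cINF_lower[OF passage_envelope_bdd[OF k] y])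
      also have "k * dist u (passage y) \<le> k * (dist u v + dist v (passage y))"
        by (intro mult_left_mono dist_triangle k)
      finally show "passage_envelope f k u - k * dist u v \<le> f y + k * dist v (passage y)"
        by (simp add: distrib_left)
    qed
    then show ?thesis by simp
  qed
  have "dist (passage_envelope f k u) (passage_envelope f k v) \<le> k * dist u v" for u v
    using *[of u v] *[of v u] by (auto simp: dist_real_def dist_commute[of v u])
  then have "k-lipschitz_on UNIV (passage_envelope f k)"
    by (intro lipschitz_onI k) auto
  then show ?thesis by (rule lipschitz_on_continuous_on)
qed

text \<open>
  If the increasing limit stayed below \<open>f Z\<close>, near-minimisers \<open>y k\<close> would have points at distance
  \<open>O(1/k)\<close> from that of \<open>Z\<close>, as \<open>f\<close> is bounded. Then \<open>y k\<close> converges to \<open>Z\<close>, and \<open>f (y k)\<close> to \<open>f Z\<close>.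
\<close>

lemma passage_envelope_tendsto:
  assumes f: "continuous_map skorohod_topology euclideanreal f"
    and Z: "continuous_on {0..} Z" "Z \<in> increasing_paths" "Z 0 = 0"
  shows "(\<lambda>k. passage_envelope f (real k) (passage Z)) \<longlonglongrightarrow> f Z"
proof (rule order_tendstoI)
  fix a assume "f Z < a"
  then show "\<forall>\<^sub>F k in sequentially. passage_envelope f (real k) (passage Z) < a"
    using passage_envelope_le[OF _ Z(2)] by (intro always_eventually allI) (meson le_less_trans of_nat_0_le_iff)
next
  fix a assume a: "a < f Z"
  have "\<exists>k. a < passage_envelope f (real k) (passage Z)"
  proof (rule ccontr)
    assume no: "\<not> ?thesis"
    define c where "c = (a + f Z) / 2"
    have c: "a < c" "c < f Z" using a by (auto simp: c_def)
    have "\<exists>y\<in>increasing_paths. f y + real k * dist (passage Z) (passage y) < c" for k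
    proof -
      have "passage_envelope f (real k) (passage Z) < c" using no c(1) by (metis le_less_trans not_le)
      then show ?thesis
        unfolding passage_envelope_def
          cINF_less_iff[OF increasing_paths_nonempty passage_envelope_bdd[OF of_nat_0_le_iff]] .
    qed
    then have "\<exists>y. \<forall>k. y k \<in> increasing_paths \<and>
        f (y k) + real k * dist (passage Z) (passage (y k)) < c"
      by (intro choice allI) blast
    then obtain y where y: "\<And>k. y k \<in> increasing_paths"
      "\<And>k. f (y k) + real k * dist (passage Z) (passage (y k)) < c" by blast
    have ys: "y k \<in> skorohod_space" for k using y(1)[of k] by (simp add: increasing_paths_def)
    have "(\<lambda>k. passage (y k)) \<longlonglongrightarrow> passage Z"
    proof (rule tendstoI)
      fix e :: real assume e: "e > 0"
      obtain K where K: "(c + B) / e < real K" using reals_Archimedean2 by blast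
      show "\<forall>\<^sub>F k in sequentially. dist (passage (y k)) (passage Z) < e"
        using eventually_ge_at_top[of "Suc K"]
      proof eventually_elim
        case (elim k)
        have "real k * dist (passage Z) (passage (y k)) < c + B" using y(2)[of k] bspec[OF fB ys[of k]] by linarith
        also have "\<dots> < real K * e" using K e by (simp add: pos_divide_less_eq)
        also have "\<dots> \<le> real k * e" using elim e by (intro mult_right_mono) auto
        finally have "dist (passage Z) (passage (y k)) < e" using elim by simp
        then show ?case by (simp add: dist_commute)
      qed
    qed
    then have "(\<lambda>k. passage (y k) r) \<longlonglongrightarrow> passage Z r" for r
      using continuous_on_tendsto_compose[OF continuous_on_product_coordinates[of r],
          of "\<lambda>k. passage (y k)" "passage Z"] by simp
    from passage_convergence_skorohod[OF y(1) Z this]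
    have "limitin euclideanreal (f \<circ> y) (f Z) sequentially"
      by (rule continuous_map_limit[OF f])
    then have "(\<lambda>k. f (y k)) \<longlonglongrightarrow> f Z" by (simp add: o_def)
    then have "\<forall>\<^sub>F k in sequentially. c < f (y k)" using c(2) by (rule order_tendstoD)
    then obtain k where "c < f (y k)" by (auto simp: eventually_sequentially)
    moreover have "0 \<le> real k * dist (passage Z) (passage (y k))" by simp
    ultimately show False using y(2)[of k] by linarith
  qed
  then obtain k where k: "a < passage_envelope f (real k) (passage Z)" ..
  show "\<forall>\<^sub>F k in sequentially. a < passage_envelope f (real k) (passage Z)"
    using eventually_ge_at_top[of k]
  proof eventually_elim
    case (elim l)
    then show ?case using k passage_envelope_mono[of "real k" "real l" "passage Z"] by simp
  qed
qed

end

text \<open>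
  One half of the convergence of expectations: \<open>f\<close> dominates its envelopes, the expectations of
  the envelopes converge for each \<open>k\<close>, and in the limit \<open>k \<rightarrow> \<infinity>\<close> they exhaust the expectation of \<open>f (Z)\<close>.
  The other half is the same statement for \<open>-f\<close>.
\<close>

lemma passage_convergence_liminf:
  fixes X :: "nat \<Rightarrow> 'w \<Rightarrow> real \<Rightarrow> real" and Z :: "'v \<Rightarrow> real \<Rightarrow> real"
  assumes M: "prob_space M" and N: "prob_space N"
    and X: "\<And>n \<omega>. \<omega> \<in> space M \<Longrightarrow> X n \<omega> \<in> skorohod_space"
      "\<And>n t. 0 \<le> t \<Longrightarrow> (\<lambda>\<omega>. X n \<omega> t) \<in> borel_measurable M"
      "\<And>n. AE \<omega> in M. X n \<omega> \<in> increasing_paths"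
    and Z: "\<And>\<omega>. \<omega> \<in> space N \<Longrightarrow> Z \<omega> \<in> skorohod_space"
      "\<And>t. 0 \<le> t \<Longrightarrow> (\<lambda>\<omega>. Z \<omega> t) \<in> borel_measurable N"
      "AE \<omega> in N. Z \<omega> \<in> increasing_paths \<and> continuous_on {0..} (Z \<omega>) \<and> Z \<omega> 0 = 0"
    and lim: "\<And>js. (\<lambda>n. \<integral>\<omega>. prod_list (map (passage (X n \<omega>)) js) \<partial>M)
      \<longlonglongrightarrow> (\<integral>\<omega>. prod_list (map (passage (Z \<omega>)) js) \<partial>N)"
    and f: "continuous_map skorohod_topology euclideanreal f" "\<forall>y\<in>skorohod_space. \<bar>f y\<bar> \<le> B"
    and a: "a < (\<integral>\<omega>. f (Z \<omega>) \<partial>N)"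
  shows "\<forall>\<^sub>F n in sequentially. a < (\<integral>\<omega>. f (X n \<omega>) \<partial>M)"
proof -
  interpret M: prob_space M by fact
  interpret N: prob_space N by fact
  define g where "g k = passage_envelope f (real k)" for k
  have gc: "continuous_on UNIV (g k)" for k
    unfolding g_def by (rule passage_envelope_continuous[OF f(2)]) auto
  have Xp: "(\<lambda>\<omega>. passage (X n \<omega>) r) \<in> borel_measurable M" for n r
    by (rule measurable_passage) (use X in \<open>auto simp: skorohod_space_def\<close>)
  have Zp: "(\<lambda>\<omega>. passage (Z \<omega>) r) \<in> borel_measurable N" for r
    by (rule measurable_passage) (use Z in \<open>auto simp: skorohod_space_def\<close>)
  have fX: "integrable M (\<lambda>\<omega>. f (X n \<omega>))" for n
    by (rule M.integrable_const_bound[of _ B])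
       (use f(2) X(1) measurable_compose[OF measurable_skorohodI[OF X(1,2)]
         measurable_continuous_map_real[OF f(1)]] in auto)
  have fZ: "(\<lambda>\<omega>. f (Z \<omega>)) \<in> borel_measurable N"
    by (rule measurable_compose[OF measurable_skorohodI[OF Z(1,2)] measurable_continuous_map_real[OF f(1)]])
  note gX = integrable_continuous_unit_cube[OF M gc Xp passage_unit]
  note gZ = integrable_continuous_unit_cube[OF N gc Zp passage_unit]
  have "(\<lambda>k. \<integral>\<omega>. g k (passage (Z \<omega>)) \<partial>N) \<longlonglongrightarrow> (\<integral>\<omega>. f (Z \<omega>) \<partial>N)"
  proof (rule integral_dominated_convergence[where w = "\<lambda>_. B"])
    show "AE \<omega> in N. (\<lambda>k. g k (passage (Z \<omega>))) \<longlonglongrightarrow> f (Z \<omega>)"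
      using Z(3) by eventually_elim (unfold g_def, rule passage_envelope_tendsto[OF f(2) f(1)], auto)
    show "AE \<omega> in N. norm (g k (passage (Z \<omega>))) \<le> B" for k
      using Z(3)
    proof eventually_elim
      case (elim \<omega>)
      have "Z \<omega> \<in> skorohod_space" using elim by (simp add: increasing_paths_def)
      then show ?case
        using bspec[OF f(2), of "Z \<omega>"] passage_envelope_le[OF f(2), of "real k" "Z \<omega>"] elim
          passage_envelope_ge[OF f(2), of "real k" "passage (Z \<omega>)"]
        by (auto simp: g_def)
    qed
  qed (use fZ gZ in auto)
  then have "\<forall>\<^sub>F k in sequentially. a < (\<integral>\<omega>. g k (passage (Z \<omega>)) \<partial>N)"
    using a by (rule order_tendstoD)
  then obtain k where k: "a < (\<integral>\<omega>. g k (passage (Z \<omega>)) \<partial>N)" by (auto simp: eventually_sequentially)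
  have "(\<lambda>n. \<integral>\<omega>. g k (passage (X n \<omega>)) \<partial>M) \<longlonglongrightarrow> (\<integral>\<omega>. g k (passage (Z \<omega>)) \<partial>N)"
    by (rule unit_cube_convergence[OF M N Xp passage_unit Zp passage_unit lim gc])
  then have "\<forall>\<^sub>F n in sequentially. a < (\<integral>\<omega>. g k (passage (X n \<omega>)) \<partial>M)"
    using k by (rule order_tendstoD)
  then show ?thesis
  proof eventually_elim
    case (elim n)
    have "(\<integral>\<omega>. g k (passage (X n \<omega>)) \<partial>M) \<le> (\<integral>\<omega>. f (X n \<omega>) \<partial>M)"
    proof (rule integral_mono_AE[OF gX fX])
      show "AE \<omega> in M. g k (passage (X n \<omega>)) \<le> f (X n \<omega>)"
        using X(3)[of n] by eventually_elim (unfold g_def, rule passage_envelope_le[OF f(2)], auto)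
    qed
    then show ?case using elim by simp
  qed
qed

lemma converges_in_distribution_passage:
  fixes X :: "nat \<Rightarrow> 'w \<Rightarrow> real \<Rightarrow> real" and Z :: "'v \<Rightarrow> real \<Rightarrow> real"
  assumes M: "prob_space M" and N: "prob_space N"
    and X: "\<And>n \<omega>. \<omega> \<in> space M \<Longrightarrow> X n \<omega> \<in> skorohod_space"
      "\<And>n t. 0 \<le> t \<Longrightarrow> (\<lambda>\<omega>. X n \<omega> t) \<in> borel_measurable M"
      "\<And>n. AE \<omega> in M. X n \<omega> \<in> increasing_paths"
    and Z: "\<And>\<omega>. \<omega> \<in> space N \<Longrightarrow> Z \<omega> \<in> skorohod_space"
      "\<And>t. 0 \<le> t \<Longrightarrow> (\<lambda>\<omega>. Z \<omega> t) \<in> borel_measurable N"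
      "AE \<omega> in N. Z \<omega> \<in> increasing_paths \<and> continuous_on {0..} (Z \<omega>) \<and> Z \<omega> 0 = 0"
    and lim: "\<And>js. (\<lambda>n. \<integral>\<omega>. prod_list (map (passage (X n \<omega>)) js) \<partial>M)
      \<longlonglongrightarrow> (\<integral>\<omega>. prod_list (map (passage (Z \<omega>)) js) \<partial>N)"
  shows "converges_in_distribution skorohod_topology M X N Z"
  unfolding converges_in_distribution_def
proof (intro conjI allI impI)
  show "X n \<in> M \<rightarrow>\<^sub>M borel_of_topology skorohod_topology" for n
    by (rule measurable_skorohodI[OF X(1,2)])
  show "Z \<in> N \<rightarrow>\<^sub>M borel_of_topology skorohod_topology"
    by (rule measurable_skorohodI[OF Z(1,2)])
  fix f assume "continuous_map skorohod_topology euclideanreal f \<and> bounded (f ` topspace skorohod_topology)"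
  then obtain B where f: "continuous_map skorohod_topology euclideanreal f"
      "\<forall>y\<in>skorohod_space. \<bar>f y\<bar> \<le> B"
    by (auto simp: bounded_iff topspace_skorohod_topology)
  have L: "\<forall>\<^sub>F n in sequentially. a < (\<integral>\<omega>. f (X n \<omega>) \<partial>M)"
    if "continuous_map skorohod_topology euclideanreal f" "\<forall>y\<in>skorohod_space. \<bar>f y\<bar> \<le> B"
      "a < (\<integral>\<omega>. f (Z \<omega>) \<partial>N)" for f a B
    by (rule passage_convergence_liminf[OF M N _ _ X(3) _ _ Z(3) lim that]) (use X Z in auto)
  have f': "continuous_map skorohod_topology euclideanreal (\<lambda>y. - f y)"
    using f(1) by (intro continuous_map_minus)
  show "(\<lambda>n. \<integral>\<omega>. f (X n \<omega>) \<partial>M) \<longlonglongrightarrow> (\<integral>\<omega>. f (Z \<omega>) \<partial>N)"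
  proof (rule order_tendstoI)
    fix a assume "a < (\<integral>\<omega>. f (Z \<omega>) \<partial>N)"
    then show "\<forall>\<^sub>F n in sequentially. a < (\<integral>\<omega>. f (X n \<omega>) \<partial>M)" by (rule L[OF f(1) f(2)])
  next
    fix a assume "(\<integral>\<omega>. f (Z \<omega>) \<partial>N) < a"
    then have "- a < (\<integral>\<omega>. - f (Z \<omega>) \<partial>N)" by simp
    from L[OF f' _ this, of B] f(2) show "\<forall>\<^sub>F n in sequentially. (\<integral>\<omega>. f (X n \<omega>) \<partial>M) < a" by simp
  qed
qed

section \<open>Exponential functionals with predictable coefficients\<close>

lemma (in prob_space) indep_var_nn_integral_mult:
  fixes f g :: "_ \<Rightarrow> ennreal"
  assumes ind: "indep_var S X T Y" and f: "f \<in> borel_measurable S" and g: "g \<in> borel_measurable T"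
  shows "(\<integral>\<^sup>+\<omega>. f (X \<omega>) * g (Y \<omega>) \<partial>M) = (\<integral>\<^sup>+\<omega>. f (X \<omega>) \<partial>M) * (\<integral>\<^sup>+\<omega>. g (Y \<omega>) \<partial>M)"
proof -
  have X: "X \<in> M \<rightarrow>\<^sub>M S" and Y: "Y \<in> M \<rightarrow>\<^sub>M T"
    and eq: "distr M S X \<Otimes>\<^sub>M distr M T Y = distr M (S \<Otimes>\<^sub>M T) (\<lambda>x. (X x, Y x))"
    using ind unfolding indep_var_distribution_eq by auto
  interpret dY: prob_space "distr M T Y" by (rule prob_space_distr[OF Y])
  note [measurable] = X Y f g
  have "(\<integral>\<^sup>+\<omega>. f (X \<omega>) * g (Y \<omega>) \<partial>M)
      = (\<integral>\<^sup>+z. f (fst z) * g (snd z) \<partial>distr M (S \<Otimes>\<^sub>M T) (\<lambda>x. (X x, Y x)))"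
    by (subst nn_integral_distr) simp_all
  also have "\<dots> = (\<integral>\<^sup>+x. \<integral>\<^sup>+y. f x * g y \<partial>distr M T Y \<partial>distr M S X)"
    unfolding eq[symmetric] by (subst dY.nn_integral_fst[symmetric]) simp_all
  also have "\<dots> = (\<integral>\<^sup>+\<omega>. f (X \<omega>) \<partial>M) * (\<integral>\<^sup>+\<omega>. g (Y \<omega>) \<partial>M)"
    by (simp add: nn_integral_cmult nn_integral_multc nn_integral_distr)
  finally show ?thesis .
qed

text \<open>
  A discrete exponential martingale whose coefficient at step \<open>l\<close> depends on the past only. Since it takes
  finitely many values, the last factor can be integrated out value by value with independence, which
  replaces conditional expectations.
\<close>

lemma (in prob_space) predictable_exponential:
  fixes D :: "nat \<Rightarrow> 'a \<Rightarrow> real" and \<phi> :: "nat \<Rightarrow> (nat \<Rightarrow> real) \<Rightarrow> real"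
  assumes indep: "indep_vars (\<lambda>_. borel) D {..<K}"
    and exp1: "\<And>l v. l < K \<Longrightarrow> v \<in> V \<Longrightarrow> (\<integral>\<^sup>+\<omega>. ennreal (exp (- (v * D l \<omega> + g v))) \<partial>M) = 1"
    and V: "finite V" and g: "g \<in> borel_measurable borel"
    and \<phi>: "\<And>l. l < K \<Longrightarrow> \<phi> l \<in> borel_measurable (Pi\<^sub>M {..<l} (\<lambda>_. borel))" "\<And>l x. \<phi> l x \<in> V"
  shows "(\<integral>\<^sup>+\<omega>. ennreal (exp (- (\<Sum>l<K. \<phi> l (\<lambda>i\<in>{..<l}. D i \<omega>) * D l \<omega>
      + g (\<phi> l (\<lambda>i\<in>{..<l}. D i \<omega>))))) \<partial>M) = 1"
proof -
  define S where "S k x = (\<Sum>l<k. \<phi> l (restrict x {..<l}) * x l + g (\<phi> l (restrict x {..<l})))"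
    for k and x :: "nat \<Rightarrow> real"
  have S_meas: "S k \<in> borel_measurable (Pi\<^sub>M {..<k} (\<lambda>_. borel))" if "k \<le> K" for k
  proof -
    have "(\<lambda>x. \<phi> l (restrict x {..<l})) \<in> borel_measurable (Pi\<^sub>M {..<k} (\<lambda>_. borel))" if "l < k" for l
      by (rule measurable_compose[OF measurable_restrict_subset \<phi>(1)]) (use that \<open>k \<le> K\<close> in auto)
    moreover have "(\<lambda>x. x l) \<in> borel_measurable (Pi\<^sub>M {..<k} (\<lambda>_. borel))" if "l < k" for l
      by (rule measurable_component_singleton) (use that in auto)
    ultimately show ?thesis
      unfolding S_def
      by (intro borel_measurable_sum borel_measurable_add borel_measurable_times
          measurable_compose[OF _ g]) auto
  qed
  have S_restrict: "S k (restrict x {..<k}) = S k x" for k x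
    unfolding S_def by (intro sum.cong refl) (auto simp: Int_absorb1 lessThan_subset_iff)
  have "(\<integral>\<^sup>+\<omega>. ennreal (exp (- S k (\<lambda>i. D i \<omega>))) \<partial>M) = 1" if "k \<le> K" for k
    using that
  proof (induction k)
    case 0
    then show ?case by (simp add: S_def emeasure_space_1)
  next
    case (Suc k)
    then have k: "k < K" by simp
    define R where "R \<omega> = (\<lambda>i\<in>{..<k}. D i \<omega>)" for \<omega>
    have "indep_var (Pi\<^sub>M {..<k} (\<lambda>_. borel)) (\<lambda>\<omega>. restrict (\<lambda>i. D i \<omega>) {..<k})
        (Pi\<^sub>M {k} (\<lambda>_. borel)) (\<lambda>\<omega>. restrict (\<lambda>i. D i \<omega>) {k})"
      by (rule indep_var_restrict[OF indep]) (use k in auto)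
    then have ind: "indep_var (Pi\<^sub>M {..<k} (\<lambda>_. borel)) R (Pi\<^sub>M {k} (\<lambda>_. borel)) (\<lambda>\<omega>. \<lambda>i\<in>{k}. D i \<omega>)"
      unfolding R_def .
    define A where "A v x = ennreal (exp (- S k x)) * indicator {x. \<phi> k x = v} x" for v x
    define B where "B v x = ennreal (exp (- (v * x k + g v)))" for v and x :: "nat \<Rightarrow> real"
    have [measurable]: "\<phi> k \<in> borel_measurable (Pi\<^sub>M {..<k} (\<lambda>_. borel))"
      "S k \<in> borel_measurable (Pi\<^sub>M {..<k} (\<lambda>_. borel))"
      using \<phi>(1)[OF k] S_meas[of k] k by auto
    have A: "A v \<in> borel_measurable (Pi\<^sub>M {..<k} (\<lambda>_. borel))" for v
      unfolding A_def by measurable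
    have B: "B v \<in> borel_measurable (Pi\<^sub>M {k} (\<lambda>_. borel))" for v
      unfolding B_def by measurable
    have R: "R \<in> M \<rightarrow>\<^sub>M Pi\<^sub>M {..<k} (\<lambda>_. borel)"
      by (rule indep_var_rv1[OF ind])
    have R2: "(\<lambda>\<omega>. \<lambda>i\<in>{k}. D i \<omega>) \<in> M \<rightarrow>\<^sub>M Pi\<^sub>M {k} (\<lambda>_. borel)"
      by (rule indep_var_rv2[OF ind])
    have AR: "(\<lambda>\<omega>. A v (R \<omega>)) \<in> borel_measurable M" for v
      by (rule measurable_compose[OF R A])
    have BR: "(\<lambda>\<omega>. B v (\<lambda>i\<in>{k}. D i \<omega>)) \<in> borel_measurable M" for v
      by (rule measurable_compose[OF R2 B])
    have split: "(\<Sum>v\<in>V. indicator {x. \<phi> k x = v} x * c v) = (c (\<phi> k x) :: ennreal)" for x c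
    proof -
      have "(\<Sum>v\<in>V. indicator {x. \<phi> k x = v} x * c v) = (\<Sum>v\<in>{\<phi> k x}. indicator {x. \<phi> k x = v} x * c v)"
        by (rule sum.mono_neutral_right) (use V \<phi>(2) in \<open>auto simp: indicator_def\<close>)
      then show ?thesis by (simp add: indicator_def)
    qed
    have "ennreal (exp (- S (Suc k) (\<lambda>i. D i \<omega>))) = (\<Sum>v\<in>V. A v (R \<omega>) * B v (\<lambda>i\<in>{k}. D i \<omega>))" for \<omega>
    proof -
      have "(\<Sum>v\<in>V. A v (R \<omega>) * B v (\<lambda>i\<in>{k}. D i \<omega>))
          = ennreal (exp (- S k (R \<omega>))) * (\<Sum>v\<in>V. indicator {x. \<phi> k x = v} (R \<omega>) * ennreal (exp (- (v * D k \<omega> + g v))))"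
        by (simp add: A_def B_def sum_distrib_left mult.assoc)
      also have "\<dots> = ennreal (exp (- S k (R \<omega>)) * exp (- (\<phi> k (R \<omega>) * D k \<omega> + g (\<phi> k (R \<omega>)))))"
        by (simp add: split ennreal_mult)
      also have "S k (R \<omega>) = S k (\<lambda>i. D i \<omega>)" unfolding R_def by (rule S_restrict)
      finally have eq: "(\<Sum>v\<in>V. A v (R \<omega>) * B v (\<lambda>i\<in>{k}. D i \<omega>))
          = ennreal (exp (- S k (\<lambda>i. D i \<omega>)) * exp (- (\<phi> k (R \<omega>) * D k \<omega> + g (\<phi> k (R \<omega>)))))" .
      have S_Suc: "S (Suc k) (\<lambda>i. D i \<omega>) = S k (\<lambda>i. D i \<omega>) + (\<phi> k (R \<omega>) * D k \<omega> + g (\<phi> k (R \<omega>)))"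
        unfolding S_def R_def by simp
      show ?thesis unfolding eq S_Suc mult_exp_exp by simp
    qed
    then have "(\<integral>\<^sup>+\<omega>. ennreal (exp (- S (Suc k) (\<lambda>i. D i \<omega>))) \<partial>M)
        = (\<Sum>v\<in>V. \<integral>\<^sup>+\<omega>. A v (R \<omega>) * B v (\<lambda>i\<in>{k}. D i \<omega>) \<partial>M)"
      using AR BR by (simp add: nn_integral_sum)
    also have "\<dots> = (\<Sum>v\<in>V. (\<integral>\<^sup>+\<omega>. A v (R \<omega>) \<partial>M) * (\<integral>\<^sup>+\<omega>. B v (\<lambda>i\<in>{k}. D i \<omega>) \<partial>M))"
      by (intro sum.cong refl indep_var_nn_integral_mult[OF ind A B])
    also have "\<dots> = (\<Sum>v\<in>V. (\<integral>\<^sup>+\<omega>. A v (R \<omega>) \<partial>M))"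
      using exp1[OF k] by (intro sum.cong refl) (simp add: B_def)
    also have "\<dots> = (\<integral>\<^sup>+\<omega>. (\<Sum>v\<in>V. A v (R \<omega>)) \<partial>M)"
      using AR by (simp add: nn_integral_sum)
    also have "\<dots> = (\<integral>\<^sup>+\<omega>. ennreal (exp (- S k (\<lambda>i. D i \<omega>))) \<partial>M)"
    proof (rule nn_integral_cong)
      fix \<omega>
      have "(\<Sum>v\<in>V. A v (R \<omega>)) = ennreal (exp (- S k (R \<omega>))) * (\<Sum>v\<in>V. indicator {x. \<phi> k x = v} (R \<omega>) * 1)"
        by (simp add: A_def sum_distrib_left)
      also have "\<dots> = ennreal (exp (- S k (R \<omega>)))" by (subst split) simp
      also have "S k (R \<omega>) = S k (\<lambda>i. D i \<omega>)" unfolding R_def by (rule S_restrict)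
      finally show "(\<Sum>v\<in>V. A v (R \<omega>)) = ennreal (exp (- S k (\<lambda>i. D i \<omega>)))" .
    qed
    also have "\<dots> = 1" using Suc by simp
    finally show ?case .
  qed
  from this[of K] show ?thesis by (simp add: S_def restrict_def)
qed

text \<open>
  An upward closed \<open>J \<subseteq> {..<r}\<close> is a final segment, so the sum telescopes. In this way a function of the
  number of elements of \<open>J\<close> becomes a sum over \<open>J\<close>; in both uses below, \<open>J\<close> consists of the levels not
  yet passed at a given time.
\<close>

lemma sum_tail_increments:
  fixes h :: "nat \<Rightarrow> real"
  assumes J: "J \<subseteq> {..<r}" and up: "\<And>i j. i \<in> J \<Longrightarrow> i \<le> j \<Longrightarrow> j < r \<Longrightarrow> j \<in> J"
  shows "(\<Sum>j\<in>J. h (r - j) - h (r - Suc j)) = h (card J) - h 0"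
proof (cases "J = {}")
  case False
  have tail: "(\<Sum>j\<in>{i..<r}. h (r - j) - h (r - Suc j)) = h (r - i) - h 0" if "i \<le> r" for i
    using that
  proof (induction i rule: inc_induct)
    case (step n)
    then have "{n..<r} = insert n {Suc n..<r}" by auto
    then show ?case using step by simp
  qed simp
  have fin: "finite J" using J finite_subset by blast
  have eq: "J = {Min J..<r}"
  proof (intro equalityI subsetI)
    fix j assume "j \<in> {Min J..<r}"
    then show "j \<in> J" using up[OF Min_in[OF fin False], of j] by simp
  qed (use J fin in auto)
  have le: "Min J \<le> r" using Min_in[OF fin False] J by auto
  have "card J = r - Min J" using arg_cong[OF eq, of card] by simp
  then show ?thesis using tail[OF le] eq by simp
qed simp

text \<open>
  With \<open>\<beta> = 1/\<alpha>\<close> this is the coefficient of the \<open>j\<close>-th level: while \<open>c\<close> levels are still ahead, the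
  exponential functional runs with parameter \<open>c\<^sup>\<beta>\<close>, and passing a level lowers the parameter by one such
  increment.
\<close>

definition power_increment :: "real \<Rightarrow> nat \<Rightarrow> nat \<Rightarrow> real" where
  "power_increment \<beta> r j = real (r - j) powr \<beta> - real (r - Suc j) powr \<beta>"

lemma power_increment_nonneg: "0 \<le> \<beta> \<Longrightarrow> 0 \<le> power_increment \<beta> r j"
  unfolding power_increment_def by (simp add: powr_mono2)

lemma sum_power_increment_upward_closed:
  assumes J: "J \<subseteq> {..<r}" and up: "\<And>i j. i \<in> J \<Longrightarrow> i \<le> j \<Longrightarrow> j < r \<Longrightarrow> j \<in> J"
  shows "(\<Sum>j\<in>J. power_increment \<beta> r j) = real (card J) powr \<beta>"
proof -
  have "(\<Sum>j\<in>J. real (r - j) powr \<beta> - real (r - Suc j) powr \<beta>) = real (card J) powr \<beta> - real 0 powr \<beta>"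
    by (rule sum_tail_increments[where h = "\<lambda>m. real m powr \<beta>", OF J]) (rule up)
  then show ?thesis by (simp add: power_increment_def)
qed

text \<open>
  The discrete counterpart of the hitting time. Capping it at the last index \<open>K\<close> makes it a bounded
  stopping time of the walk.
\<close>

definition grid_hit :: "nat \<Rightarrow> (nat \<Rightarrow> real) \<Rightarrow> real \<Rightarrow> nat" where
  "grid_hit K w x = (LEAST l. l = K \<or> w l < - x)"

lemma grid_hit_le: "grid_hit K w x \<le> K"
  unfolding grid_hit_def by (rule Least_le) simp

lemma less_grid_hit_iff: "l < grid_hit K w x \<longleftrightarrow> l < K \<and> (\<forall>i\<le>l. - x \<le> w i)"
proof
  assume l: "l < grid_hit K w x"
  have "\<not> (i = K \<or> w i < - x)" if "i \<le> l" for i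
    using not_less_Least[of i "\<lambda>l. l = K \<or> w l < - x"] l that unfolding grid_hit_def by simp
  moreover have "l < K" using l grid_hit_le[of K w x] by simp
  ultimately show "l < K \<and> (\<forall>i\<le>l. - x \<le> w i)" by force
next
  assume l: "l < K \<and> (\<forall>i\<le>l. - x \<le> w i)"
  have "grid_hit K w x = K \<or> w (grid_hit K w x) < - x"
    unfolding grid_hit_def by (rule LeastI[of "\<lambda>l. l = K \<or> w l < - x" K]) simp
  then show "l < grid_hit K w x" using l by (metis leI not_le)
qed

lemma grid_hit_cases: "grid_hit K w x = K \<or> grid_hit K w x < K \<and> w (grid_hit K w x) < - x"
proof -
  have "grid_hit K w x = K \<or> w (grid_hit K w x) < - x"
    unfolding grid_hit_def by (rule LeastI[of "\<lambda>l. l = K \<or> w l < - x" K]) simp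
  then show ?thesis using grid_hit_le[of K w x] by (metis le_neq_implies_less)
qed

text \<open>
  Exchanging the sums turns a stochastic integral with piecewise constant coefficients into the values
  of the walk at the hitting times.
\<close>

lemma predictable_sum_telescopes:
  fixes w :: "nat \<Rightarrow> real"
  assumes "w 0 = 0"
  shows "(\<Sum>l<K. (\<kappa> * (\<Sum>j<r. if l < grid_hit K w (x j) then \<mu> j else 0)) * (w (Suc l) - w l))
    = \<kappa> * (\<Sum>j<r. \<mu> j * w (grid_hit K w (x j)))"
proof -
  have 1: "(\<Sum>l<K. (if l < T then m else 0) * (w (Suc l) - w l)) = m * w T" if "T \<le> K" for T m
  proof -
    have "(\<Sum>l<K. (if l < T then m else 0) * (w (Suc l) - w l)) = (\<Sum>l<T. m * (w (Suc l) - w l))"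
      by (rule sum.mono_neutral_cong_right) (use that in auto)
    also have "\<dots> = m * w T" by (simp add: sum_distrib_left[symmetric] sum_lessThan_telescope assms)
    finally show ?thesis .
  qed
  have "(\<Sum>l<K. (\<kappa> * (\<Sum>j<r. if l < grid_hit K w (x j) then \<mu> j else 0)) * (w (Suc l) - w l))
      = \<kappa> * (\<Sum>l<K. \<Sum>j<r. (if l < grid_hit K w (x j) then \<mu> j else 0) * (w (Suc l) - w l))"
    by (simp add: sum_distrib_left sum_distrib_right mult.assoc)
  also have "(\<Sum>l<K. \<Sum>j<r. (if l < grid_hit K w (x j) then \<mu> j else 0) * (w (Suc l) - w l))
      = (\<Sum>j<r. \<Sum>l<K. (if l < grid_hit K w (x j) then \<mu> j else 0) * (w (Suc l) - w l))"
    by (rule sum.swap)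
  also have "\<dots> = (\<Sum>j<r. \<mu> j * w (grid_hit K w (x j)))"
    by (intro sum.cong refl 1 grid_hit_le)
  finally show ?thesis .
qed

text \<open>
  The levels not yet hit at time \<open>l\<close> are upward closed as the levels are sorted. The parameter is chosen
  such that its \<open>\<alpha>\<close>-th power, the growth rate of the exponential moment, is their number.
\<close>

lemma grid_multiplicity_powr:
  assumes x: "mono_on {..<r} x" and \<alpha>: "0 < \<alpha>" and \<kappa>: "0 < \<kappa>"
  shows "(\<kappa> * (\<Sum>j<r. if l < grid_hit K w (x j) then power_increment (1 / \<alpha>) r j else 0)) powr \<alpha>
    = \<kappa> powr \<alpha> * real (card {j\<in>{..<r}. l < grid_hit K w (x j)})"
proof -
  let ?J = "{j\<in>{..<r}. l < grid_hit K w (x j)}"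
  have "(\<Sum>j<r. if l < grid_hit K w (x j) then power_increment (1 / \<alpha>) r j else 0)
      = (\<Sum>j\<in>?J. power_increment (1 / \<alpha>) r j)"
    by (rule sum.inter_filter[symmetric]) simp
  also have "\<dots> = real (card ?J) powr (1 / \<alpha>)"
  proof (rule sum_power_increment_upward_closed)
    fix i j assume ij: "i \<in> ?J" "i \<le> j" "j < r"
    then have "x i \<le> x j" using x by (auto simp: mono_on_def)
    then show "j \<in> ?J" using ij unfolding less_grid_hit_iff by force
  qed auto
  finally show ?thesis using \<alpha> \<kappa> by (simp add: powr_mult powr_powr)
qed

lemma sum_card_grid_hit:
  fixes r :: nat
  shows "(\<Sum>l<K. real (card {j\<in>{..<r}. l < grid_hit K w (x j)})) = (\<Sum>j<r. real (grid_hit K w (x j)))"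
proof -
  have "real (card {j\<in>{..<r}. l < grid_hit K w (x j)}) = (\<Sum>j<r. if l < grid_hit K w (x j) then 1 else 0)" for l
    using sum.inter_filter[of "{..<r}" "\<lambda>_. 1::real" "\<lambda>j. l < grid_hit K w (x j)"] by simp
  then have "(\<Sum>l<K. real (card {j\<in>{..<r}. l < grid_hit K w (x j)}))
      = (\<Sum>j<r. \<Sum>l<K. if l < grid_hit K w (x j) then 1 else 0)"
    by (simp add: sum.swap[of _ "{..<K}"])
  also have "\<dots> = (\<Sum>j<r. real (grid_hit K w (x j)))"
  proof (rule sum.cong[OF refl])
    fix j
    have "{l \<in> {..<K}. l < grid_hit K w (x j)} = {..<grid_hit K w (x j)}"
      using grid_hit_le[of K w "x j"] by auto
    then show "(\<Sum>l<K. if l < grid_hit K w (x j) then 1 else (0::real)) = real (grid_hit K w (x j))"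
      using sum.inter_filter[of "{..<K}" "\<lambda>_. 1::real" "\<lambda>l. l < grid_hit K w (x j)"] by simp
  qed
  finally show ?thesis .
qed

section \<open>Hitting times of the stable process\<close>

locale stable_process =
  fixes N :: "'v measure" and Y :: "real \<Rightarrow> 'v \<Rightarrow> real" and \<alpha> :: real
  assumes stable: "stable_spectrally_positive_process N Y \<alpha>" and \<alpha>: "1 < \<alpha>" "\<alpha> \<le> 2"
begin

sublocale prob_space N
  using stable by (simp add: stable_spectrally_positive_process_def levy_process_def)

lemma Y_measurable [measurable]: "0 \<le> t \<Longrightarrow> Y t \<in> borel_measurable N"
  and Y_0: "AE \<omega> in N. Y 0 \<omega> = 0"
  and Y_cadlag: "\<omega> \<in> space N \<Longrightarrow> cadlag (\<lambda>t. Y t \<omega>)"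
  and Y_stationary: "0 \<le> s \<Longrightarrow> 0 \<le> t \<Longrightarrow> distr N borel (\<lambda>\<omega>. Y (s + t) \<omega> - Y s \<omega>) = distr N borel (Y t)"
  and Y_no_negative_jumps: "AE \<omega> in N. \<forall>t>0. \<forall>l. ((\<lambda>s. Y s \<omega>) \<longlongrightarrow> l) (at_left t) \<longrightarrow> l \<le> Y t \<omega>"
  using stable by (auto simp: stable_spectrally_positive_process_def levy_process_def spectrally_positive_def)

lemma Y_exp_nn:
  assumes "0 \<le> q" "0 \<le> s"
  shows "(\<integral>\<^sup>+\<omega>. ennreal (exp (- (q * Y s \<omega>))) \<partial>N) = ennreal (exp (s * q powr \<alpha>))"
  using stable assms by (subst nn_integral_eq_integral)
    (auto simp: stable_spectrally_positive_process_def)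

lemma Y_increment_exp:
  assumes "0 \<le> q" "0 \<le> s" "0 \<le> h"
  shows "(\<integral>\<^sup>+\<omega>. ennreal (exp (- (q * (Y (s + h) \<omega> - Y s \<omega>) + h * q powr \<alpha>))) \<partial>N) = 1"
proof -
  let ?g = "\<lambda>y. ennreal (exp (- (q * y + h * q powr \<alpha>)))"
  have [measurable]: "(\<lambda>\<omega>. Y (s + h) \<omega> - Y s \<omega>) \<in> borel_measurable N" "Y h \<in> borel_measurable N"
    using assms by (auto intro!: borel_measurable_diff)
  have "(\<integral>\<^sup>+\<omega>. ?g (Y (s + h) \<omega> - Y s \<omega>) \<partial>N) = (\<integral>\<^sup>+y. ?g y \<partial>distr N borel (\<lambda>\<omega>. Y (s + h) \<omega> - Y s \<omega>))"
    by (subst nn_integral_distr) auto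
  also have "\<dots> = (\<integral>\<^sup>+y. ?g y \<partial>distr N borel (Y h))"
    using assms by (simp add: Y_stationary)
  also have "\<dots> = (\<integral>\<^sup>+\<omega>. ?g (Y h \<omega>) \<partial>N)"
    by (subst nn_integral_distr) auto
  also have "\<dots> = (\<integral>\<^sup>+\<omega>. ennreal (exp (- (h * q powr \<alpha>))) * ennreal (exp (- (q * Y h \<omega>))) \<partial>N)"
    by (intro nn_integral_cong) (simp add: ennreal_mult'[symmetric] mult_exp_exp algebra_simps)
  also have "\<dots> = ennreal (exp (- (h * q powr \<alpha>))) * ennreal (exp (h * q powr \<alpha>))"
    using assms by (subst nn_integral_cmult) (auto simp: Y_exp_nn)
  also have "\<dots> = 1" by (simp add: ennreal_mult'[symmetric] mult_exp_exp)
  finally show ?thesis .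
qed

definition grid :: "real \<Rightarrow> nat \<Rightarrow> 'v \<Rightarrow> nat \<Rightarrow> real" where
  "grid t K \<omega> l = Y (t / real K * real l) \<omega>"

abbreviation "mu \<equiv> power_increment (1 / \<alpha>)"

lemma grid_measurable: "0 \<le> t \<Longrightarrow> (\<lambda>\<omega>. grid t K \<omega> l) \<in> borel_measurable N"
  unfolding grid_def by (rule Y_measurable) simp

lemma grid_hit_measurable:
  assumes "0 \<le> t" shows "(\<lambda>\<omega>. grid_hit K (grid t K \<omega>) x) \<in> N \<rightarrow>\<^sub>M count_space UNIV"
proof -
  have [measurable]: "(\<lambda>\<omega>. grid t K \<omega> l) \<in> borel_measurable N" for l by (rule grid_measurable[OF assms])
  show ?thesis unfolding grid_hit_def by measurable
qed

lemma grid_at_hit_measurable: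
  assumes "0 \<le> t" shows "(\<lambda>\<omega>. grid t K \<omega> (grid_hit K (grid t K \<omega>) x)) \<in> borel_measurable N"
  by (rule measurable_compose_countable[OF grid_measurable[OF assms] grid_hit_measurable[OF assms]])

text \<open>
  The functional for the process observed on the grid of mesh \<open>t/K\<close>. The case \<open>\<kappa> = 1\<close> is the identity
  to be passed to the limit, and \<open>\<kappa> = 2\<close> bounds its second moment uniformly in the mesh.
\<close>

lemma grid_exponential_martingale:
  assumes t: "0 \<le> t" and K: "0 < K" and x: "mono_on {..<r} x" and \<kappa>: "0 < \<kappa>"
  defines "T \<equiv> \<lambda>\<omega> j. grid_hit K (grid t K \<omega>) (x j)"
  shows "(\<integral>\<^sup>+\<omega>. ennreal (exp (- (\<kappa> * (\<Sum>j<r. mu r j * grid t K \<omega> (T \<omega> j))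
      + \<kappa> powr \<alpha> * (t / real K) * (\<Sum>j<r. real (T \<omega> j))))) \<partial>N) = 1"
proof -
  define h where "h = t / real K"
  have h: "0 \<le> h" using t by (simp add: h_def)
  define D where "D l \<omega> = Y (h * real (Suc l)) \<omega> - Y (h * real l) \<omega>" for l \<omega>
  define V where "V = (\<lambda>J. \<kappa> * (\<Sum>j<r. if j \<in> J then mu r j else 0)) ` Pow {..<r}"
  define \<phi> where "\<phi> l d = \<kappa> * (\<Sum>j<r. if \<forall>i\<le>l. - x j \<le> (\<Sum>i'<i. d i') then mu r j else 0)"
    for l and d :: "nat \<Rightarrow> real"
  define g where "g v = h * v powr \<alpha>" for v :: real
  have mu0: "0 \<le> mu r j" for j using \<alpha> by (simp add: power_increment_nonneg)
  have V0: "0 \<le> v" if "v \<in> V" for v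
    using that \<kappa> mu0 by (auto simp: V_def intro!: mult_nonneg_nonneg sum_nonneg)
  have main: "(\<integral>\<^sup>+\<omega>. ennreal (exp (- (\<Sum>l<K. \<phi> l (\<lambda>i\<in>{..<l}. D i \<omega>) * D l \<omega>
      + g (\<phi> l (\<lambda>i\<in>{..<l}. D i \<omega>))))) \<partial>N) = 1"
  proof (rule predictable_exponential)
    show "indep_vars (\<lambda>_. borel) D {..<K}"
    proof -
      have "\<forall>(n::nat) t. 0 \<le> t 0 \<and> (\<forall>k<n. t k \<le> t (Suc k)) \<longrightarrow>
          indep_vars (\<lambda>_. borel) (\<lambda>k \<omega>. Y (t (Suc k)) \<omega> - Y (t k) \<omega>) {..<n}"
        using stable by (simp add: stable_spectrally_positive_process_def levy_process_def)
      from this[rule_format, of "\<lambda>l. h * real l" K] show ?thesis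
        unfolding D_def using h by (simp add: mult_left_mono)
    qed
    show "(\<integral>\<^sup>+\<omega>. ennreal (exp (- (v * D l \<omega> + g v))) \<partial>N) = 1" if "l < K" "v \<in> V" for l v
      using Y_increment_exp[OF V0[OF that(2)] _ h, of "h * real l"] h
      by (simp add: D_def g_def algebra_simps)
    show "finite V" by (simp add: V_def)
    show "g \<in> borel_measurable borel" unfolding g_def by measurable
    show "\<phi> l \<in> borel_measurable (Pi\<^sub>M {..<l} (\<lambda>_. borel))" for l
    proof -
      have [measurable]: "(\<lambda>d. \<Sum>i'<i. d i') \<in> borel_measurable (Pi\<^sub>M {..<l} (\<lambda>_. borel :: real measure))"
        if "i \<in> {..l}" for i
        by (intro borel_measurable_sum measurable_component_singleton) (use that in auto)
      have "Measurable.pred (Pi\<^sub>M {..<l} (\<lambda>_. borel)) (\<lambda>d. \<forall>i\<in>{..l}. - x j \<le> (\<Sum>i'<i. d i'))" for j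
        by measurable
      then have [measurable]: "Measurable.pred (Pi\<^sub>M {..<l} (\<lambda>_. borel)) (\<lambda>d. \<forall>i\<le>l. - x j \<le> (\<Sum>i'<i. d i'))" for j
        by (simp add: atMost_def)
      show ?thesis unfolding \<phi>_def by measurable
    qed
    show "\<phi> l d \<in> V" for l d
      unfolding \<phi>_def V_def
      by (rule image_eqI[of _ _ "{j\<in>{..<r}. \<forall>i\<le>l. - x j \<le> (\<Sum>i'<i. d i')}"])
         (auto intro!: sum.cong)
  qed
  have "(\<integral>\<^sup>+\<omega>. ennreal (exp (- (\<kappa> * (\<Sum>j<r. mu r j * grid t K \<omega> (T \<omega> j))
      + \<kappa> powr \<alpha> * h * (\<Sum>j<r. real (T \<omega> j))))) \<partial>N)
    = (\<integral>\<^sup>+\<omega>. ennreal (exp (- (\<Sum>l<K. \<phi> l (\<lambda>i\<in>{..<l}. D i \<omega>) * D l \<omega>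
      + g (\<phi> l (\<lambda>i\<in>{..<l}. D i \<omega>))))) \<partial>N)"
  proof (rule nn_integral_cong_AE)
    show "AE \<omega> in N. ennreal (exp (- (\<kappa> * (\<Sum>j<r. mu r j * grid t K \<omega> (T \<omega> j))
      + \<kappa> powr \<alpha> * h * (\<Sum>j<r. real (T \<omega> j)))))
      = ennreal (exp (- (\<Sum>l<K. \<phi> l (\<lambda>i\<in>{..<l}. D i \<omega>) * D l \<omega> + g (\<phi> l (\<lambda>i\<in>{..<l}. D i \<omega>)))))"
      using Y_0
    proof eventually_elim
      case (elim \<omega>)
      define w where "w = grid t K \<omega>"
      have w0: "w 0 = 0" using elim by (simp add: w_def grid_def)
      have wD: "D l \<omega> = w (Suc l) - w l" for l by (simp add: D_def w_def grid_def h_def)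
      have wsum: "(\<Sum>i'<i. D i' \<omega>) = w i" for i
        by (simp add: wD sum_lessThan_telescope w0)
      have \<phi>w: "\<phi> l (\<lambda>i\<in>{..<l}. D i \<omega>) = \<kappa> * (\<Sum>j<r. if l < grid_hit K w (x j) then mu r j else 0)"
        if "l < K" for l
      proof -
        have "(\<Sum>i'<i. (\<lambda>i\<in>{..<l}. D i \<omega>) i') = w i" if "i \<le> l" for i
          using that by (subst wsum[symmetric]) (intro sum.cong, auto)
        then have "(\<forall>i\<le>l. - x j \<le> (\<Sum>i'<i. (\<lambda>i\<in>{..<l}. D i \<omega>) i')) \<longleftrightarrow> l < grid_hit K w (x j)" for j
          using that by (auto simp: less_grid_hit_iff)
        then show ?thesis unfolding \<phi>_def by simp
      qed
      have "(\<Sum>l<K. \<phi> l (\<lambda>i\<in>{..<l}. D i \<omega>) * D l \<omega> + g (\<phi> l (\<lambda>i\<in>{..<l}. D i \<omega>)))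
        = (\<Sum>l<K. (\<kappa> * (\<Sum>j<r. if l < grid_hit K w (x j) then mu r j else 0)) * (w (Suc l) - w l)
            + h * (\<kappa> powr \<alpha> * real (card {j\<in>{..<r}. l < grid_hit K w (x j)})))"
      proof (rule sum.cong[OF refl])
        fix l assume "l \<in> {..<K}"
        then have l: "l < K" by simp
        have "0 < \<alpha>" using \<alpha> by simp
        from grid_multiplicity_powr[OF x this \<kappa>, of l K w]
        show "\<phi> l (\<lambda>i\<in>{..<l}. D i \<omega>) * D l \<omega> + g (\<phi> l (\<lambda>i\<in>{..<l}. D i \<omega>))
          = (\<kappa> * (\<Sum>j<r. if l < grid_hit K w (x j) then mu r j else 0)) * (w (Suc l) - w l)
            + h * (\<kappa> powr \<alpha> * real (card {j\<in>{..<r}. l < grid_hit K w (x j)}))"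
          unfolding \<phi>w[OF l] unfolding g_def wD by simp
      qed
      also have "\<dots> = \<kappa> * (\<Sum>j<r. mu r j * w (T \<omega> j)) + \<kappa> powr \<alpha> * h * (\<Sum>j<r. real (T \<omega> j))"
        unfolding sum.distrib predictable_sum_telescopes[where w = w, OF w0] sum_distrib_left[symmetric]
          sum_card_grid_hit T_def w_def[symmetric] by (simp add: mult_ac)
      finally show ?case by (simp add: w_def)
    qed
  qed
  then show ?thesis using main by (simp add: h_def)
qed

end

text \<open>
  The hitting time of the half line below \<open>-x\<close>, capped at \<open>t\<close> so that the path can always be evaluated
  there.
\<close>

definition first_below :: "(real \<Rightarrow> real) \<Rightarrow> real \<Rightarrow> real \<Rightarrow> real" where
  "first_below y t x = Inf (insert t {s\<in>{0..<t}. y s < - x})"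

text \<open>
  \<open>exp(-T)\<close> for \<open>T\<close> the first time at which the path is below \<open>-x\<close>, and 0 if there is none: the same
  functional as \<open>passage\<close>, for downward passage and real levels.
\<close>

definition hit_discount :: "(real \<Rightarrow> real) \<Rightarrow> real \<Rightarrow> real" where
  "hit_discount y x = (SUP s\<in>{0..}. if y s < - x then exp (- s) else 0)"

lemma first_below_bdd: "0 \<le> t \<Longrightarrow> bdd_below (insert t {s\<in>{0..<t}. y s < - x})"
  by (rule bdd_belowI[of _ 0]) auto

lemma first_below_le: "0 \<le> t \<Longrightarrow> first_below y t x \<le> t"
  unfolding first_below_def by (rule cInf_lower[OF _ first_below_bdd]) auto

lemma first_below_nonneg: "0 \<le> t \<Longrightarrow> 0 \<le> first_below y t x"
  unfolding first_below_def by (rule cInf_greatest) auto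

lemma first_below_le_hit: "0 \<le> s \<Longrightarrow> s < t \<Longrightarrow> y s < - x \<Longrightarrow> first_below y t x \<le> s"
  unfolding first_below_def by (rule cInf_lower[OF _ first_below_bdd]) auto

lemma cadlag_right:
  assumes "cadlag y" "0 \<le> t" shows "(y \<longlongrightarrow> y t) (at_right t)"
  using assms by (auto simp: cadlag_def continuous_within)

lemma cadlag_tendsto_from_right:
  assumes y: "cadlag y" "0 \<le> \<sigma>" and s: "s \<longlonglongrightarrow> \<sigma>" "\<And>m. \<sigma> \<le> s m"
  shows "(\<lambda>m. y (s m)) \<longlonglongrightarrow> y \<sigma>"
proof (rule tendstoI)
  fix e :: real assume e: "0 < e"
  from tendstoD[OF cadlag_right[OF y] e] obtain b where
    b: "b > \<sigma>" "\<And>u. \<sigma> < u \<Longrightarrow> u < b \<Longrightarrow> dist (y u) (y \<sigma>) < e"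
    unfolding eventually_at_right_field by blast
  have "\<forall>\<^sub>F m in sequentially. s m < b" using s(1) b(1) by (rule order_tendstoD)
  then show "\<forall>\<^sub>F m in sequentially. dist (y (s m)) (y \<sigma>) < e"
  proof eventually_elim
    case (elim m)
    then show ?case using b(2)[of "s m"] s(2)[of m] e by (cases "s m = \<sigma>") auto
  qed
qed

text \<open>
  Grid hitting times are never earlier than the true one. The path is below the level on a whole interval
  to the right of any hit, which contains a point of every fine grid. Convergence from the right then
  carries over to the values of the path.
\<close>

lemma grid_hit_tendsto:
  fixes x :: real
  assumes y: "cadlag y" and t: "0 < t"
  defines "s \<equiv> \<lambda>m. t / real (Suc m) * real (grid_hit (Suc m) (\<lambda>l. y (t / real (Suc m) * real l)) x)"
  shows "s \<longlonglongrightarrow> first_below y t x" "(\<lambda>m. y (s m)) \<longlonglongrightarrow> y (first_below y t x)"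
proof -
  define \<sigma> where "\<sigma> = first_below y t x"
  have st: "s m \<le> t" for m
  proof -
    have "real (grid_hit (Suc m) (\<lambda>l. y (t / real (Suc m) * real l)) x) \<le> real (Suc m)"
      using grid_hit_le by (rule of_nat_mono)
    then have "t / real (Suc m) * real (grid_hit (Suc m) (\<lambda>l. y (t / real (Suc m) * real l)) x)
        \<le> t / real (Suc m) * real (Suc m)"
      using t by (intro mult_left_mono) auto
    then show ?thesis unfolding s_def by simp
  qed
  have lower: "\<sigma> \<le> s m" for m
  proof -
    let ?w = "\<lambda>l. y (t / real (Suc m) * real l)"
    consider "grid_hit (Suc m) ?w x = Suc m" |
      "grid_hit (Suc m) ?w x < Suc m" "?w (grid_hit (Suc m) ?w x) < - x"
      using grid_hit_cases by blast
    then show ?thesis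
    proof cases
      case 1
      then have "s m = t" by (simp add: s_def)
      then show ?thesis using first_below_le[of t y x] t by (simp add: \<sigma>_def)
    next
      case 2
      have "t / real (Suc m) * real (grid_hit (Suc m) ?w x) < t / real (Suc m) * real (Suc m)"
        using 2(1) t by (intro mult_strict_left_mono) auto
      then have "s m < t" unfolding s_def by simp
      moreover have "0 \<le> s m" using t by (simp add: s_def)
      ultimately show ?thesis using 2(2) unfolding \<sigma>_def by (intro first_below_le_hit) (auto simp: s_def)
    qed
  qed
  have "s \<longlonglongrightarrow> \<sigma>"
  proof (rule order_tendstoI)
    fix a assume "a < \<sigma>"
    then show "\<forall>\<^sub>F m in sequentially. a < s m"
      using lower by (intro always_eventually allI) (meson less_le_trans)
  next
    fix a assume a: "\<sigma> < a"
    then obtain p where p: "p \<in> insert t {s\<in>{0..<t}. y s < - x}" "p < a"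
      using cInf_lessD[of "insert t {s\<in>{0..<t}. y s < - x}" a]
      unfolding \<sigma>_def first_below_def by auto
    show "\<forall>\<^sub>F m in sequentially. s m < a"
    proof (cases "p = t")
      case True
      then show ?thesis using p st by (intro always_eventually allI) (meson le_less_trans)
    next
      case False
      then have p': "0 \<le> p" "p < t" "y p < - x" using p by auto
      have "\<forall>\<^sub>F u in at_right p. y u < - x"
        using cadlag_right[OF y p'(1)] p'(3) by (rule order_tendstoD)
      then obtain b where b: "b > p" "\<And>u. p < u \<Longrightarrow> u < b \<Longrightarrow> y u < - x"
        unfolding eventually_at_right_field by blast
      define c where "c = min b (min a t)"
      have c: "p < c" "c \<le> b" "c \<le> a" "c \<le> t" using b(1) p(2) p'(2) by (auto simp: c_def)
      obtain M where M: "t / (c - p) < real M" using reals_Archimedean2 by blast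
      show ?thesis using eventually_ge_at_top[of M]
      proof eventually_elim
        case (elim m)
        define h where "h = t / real (Suc m)"
        have h: "0 < h" using t by (simp add: h_def)
        have "t / (c - p) < real (Suc m)" using M elim by simp
        then have hc: "h < c - p" using c(1) t by (simp add: h_def field_simps)
        define l where "l = nat \<lceil>p / h\<rceil>"
        have "p / h \<ge> 0" using p' h by simp
        then have "p / h \<le> real l" "real l < p / h + 1" unfolding l_def by linarith+
        then have l: "p \<le> h * real l" "h * real l < p + h"
          using h by (simp_all add: field_simps)
        then have lc: "h * real l < c" using hc by simp
        have yl: "y (h * real l) < - x"
          using b(2)[of "h * real l"] l(1) lc c(2) p'(3) by (cases "h * real l = p") auto
        have "\<not> l < grid_hit (Suc m) (\<lambda>l. y (t / real (Suc m) * real l)) x"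
          unfolding less_grid_hit_iff using yl by (force simp: h_def)
        then have "s m \<le> h * real l" unfolding s_def h_def[symmetric] using h by simp
        then show ?case using lc c(3) by linarith
      qed
    qed
  qed
  then show lim: "s \<longlonglongrightarrow> first_below y t x" unfolding \<sigma>_def .
  have "0 \<le> first_below y t x" using t by (intro first_below_nonneg) simp
  from cadlag_tendsto_from_right[OF y this lim lower[unfolded \<sigma>_def]]
  show "(\<lambda>m. y (s m)) \<longlonglongrightarrow> y (first_below y t x)" .
qed

text \<open>
  Before the hitting time the path is above \<open>-x\<close>, hence so is its left limit at that time, and an
  upward jump only helps.
\<close>

lemma first_below_value_ge:
  assumes y: "cadlag y" "y 0 = 0" and jumps: "\<forall>t>0. \<forall>l. (y \<longlongrightarrow> l) (at_left t) \<longrightarrow> l \<le> y t"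
    and x: "0 \<le> x" and t: "0 < t"
  shows "- x \<le> y (first_below y t x)"
proof -
  define \<sigma> where "\<sigma> = first_below y t x"
  have \<sigma>: "0 \<le> \<sigma>" "\<sigma> \<le> t" using first_below_nonneg first_below_le t by (simp_all add: \<sigma>_def)
  have above: "- x \<le> y s" if "0 \<le> s" "s < \<sigma>" for s
    using first_below_le_hit[of s t y x] that \<sigma> by (force simp: \<sigma>_def)
  show ?thesis
  proof (cases "\<sigma> = 0")
    case True
    then show ?thesis using y(2) x by (simp add: \<sigma>_def)
  next
    case False
    then have s0: "0 < \<sigma>" using \<sigma> by simp
    then obtain l where l: "(y \<longlongrightarrow> l) (at_left \<sigma>)" using y(1) by (auto simp: cadlag_def)
    have "\<forall>\<^sub>F s in at_left \<sigma>. - x \<le> y s"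
      by (rule eventually_at_leftI[OF _ s0]) (auto intro: above)
    then have "- x \<le> l" by (intro tendsto_lowerbound[OF l]) auto
    moreover have "l \<le> y \<sigma>" using jumps s0 l by blast
    ultimately show ?thesis by (simp add: \<sigma>_def)
  qed
qed

lemma first_below_value_le:
  assumes y: "cadlag y" and hit: "0 \<le> p" "p < t" "y p < - x"
  shows "y (first_below y t x) \<le> - x"
proof (rule ccontr)
  define \<sigma> where "\<sigma> = first_below y t x"
  assume "\<not> ?thesis"
  then have s: "- x < y \<sigma>" by (simp add: \<sigma>_def)
  have \<sigma>: "0 \<le> \<sigma>" "\<sigma> \<le> p" using first_below_nonneg first_below_le_hit hit by (simp_all add: \<sigma>_def)
  have "\<forall>\<^sub>F u in at_right \<sigma>. - x < y u" using cadlag_right[OF y \<sigma>(1)] s by (rule order_tendstoD)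
  then obtain b where b: "b > \<sigma>" "\<And>u. \<sigma> < u \<Longrightarrow> u < b \<Longrightarrow> - x < y u"
    unfolding eventually_at_right_field by blast
  have "min b t \<le> Inf (insert t {s\<in>{0..<t}. y s < - x})"
  proof (rule cInf_greatest)
    fix s' assume s': "s' \<in> insert t {s\<in>{0..<t}. y s < - x}"
    show "min b t \<le> s'"
    proof (cases "s' = t")
      case False
      then have s2: "0 \<le> s'" "s' < t" "y s' < - x" using s' by auto
      then have "\<sigma> \<le> s'" unfolding \<sigma>_def by (intro first_below_le_hit)
      moreover have "s' \<noteq> \<sigma>" using s s2 by auto
      ultimately have "\<not> s' < b" using b(2)[of s'] s2(3) by fastforce
      then show ?thesis by simp
    qed simp
  qed simp
  then have "min b t \<le> \<sigma>" by (simp add: \<sigma>_def first_below_def)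
  then show False using b(1) \<sigma> hit by (simp add: min_def split: if_splits)
qed

lemma hit_discount_bdd: "bdd_above ((\<lambda>s. if y s < - x then exp (- s) else (0::real)) ` {0..})"
  by (rule bdd_aboveI[of _ 1]) auto

lemma hit_discount_eq:
  assumes hit: "0 \<le> p" "y p < - x"
  shows "hit_discount y x = exp (- Inf {s\<in>{0..}. y s < - x})"
proof (rule antisym)
  let ?S = "{s\<in>{0..}. y s < - x}"
  have bdd: "bdd_below ?S" by (rule bdd_belowI[of _ 0]) auto
  show "hit_discount y x \<le> exp (- Inf ?S)"
    unfolding hit_discount_def
    by (rule cSUP_least) (auto intro!: cInf_lower bdd)
  have D: "exp (- s) \<le> hit_discount y x" if "s \<in> ?S" for s
    unfolding hit_discount_def
    by (rule cSUP_upper2[where x = s, OF hit_discount_bdd]) (use that in auto)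
  have D0: "0 < hit_discount y x" using D[of p] hit by (simp add: less_le_trans[OF exp_gt_zero])
  have "- ln (hit_discount y x) \<le> Inf ?S"
  proof (rule cInf_greatest)
    show "?S \<noteq> {}" using hit by auto
    fix s assume "s \<in> ?S"
    from D[OF this] have "- s \<le> ln (hit_discount y x)" using D0 by (simp add: ln_ge_iff)
    then show "- ln (hit_discount y x) \<le> s" by simp
  qed
  then have "exp (- Inf ?S) \<le> exp (ln (hit_discount y x))" by simp
  then show "exp (- Inf ?S) \<le> hit_discount y x" using D0 by simp
qed

text \<open>
  If the path falls below \<open>-x\<close>, the expression is eventually constant with the path equal to \<open>-x\<close> at the
  hitting time. Otherwise the time is \<open>n + 1\<close> and the path is bounded below, so the expression vanishes
  in the limit.
\<close>

lemma first_below_limit: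
  assumes y: "cadlag y" "y 0 = 0" and jumps: "\<forall>t>0. \<forall>l. (y \<longlongrightarrow> l) (at_left t) \<longrightarrow> l \<le> y t"
    and x: "0 \<le> x" and \<mu>: "0 \<le> \<mu>"
  shows "(\<lambda>n. exp (- (\<mu> * y (first_below y (real (Suc n)) x) + first_below y (real (Suc n)) x)))
    \<longlonglongrightarrow> exp (\<mu> * x) * hit_discount y x"
proof (cases "\<exists>p\<ge>0. y p < - x")
  case True
  then obtain p where p: "0 \<le> p" "y p < - x" by blast
  let ?S = "{s\<in>{0..}. y s < - x}"
  have bdd: "bdd_below ?S" by (rule bdd_belowI[of _ 0]) auto
  have eq: "first_below y t x = Inf ?S" if "p < t" for t
    unfolding first_below_def
  proof (rule antisym)
    have t0: "0 \<le> t" using that p by simp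
    show "Inf (insert t {s\<in>{0..<t}. y s < - x}) \<le> Inf ?S"
    proof (rule cInf_greatest)
      show "?S \<noteq> {}" using p by auto
      fix s assume s: "s \<in> ?S"
      show "Inf (insert t {s\<in>{0..<t}. y s < - x}) \<le> s"
      proof (cases "s < t")
        case True
        then show ?thesis using s by (intro cInf_lower first_below_bdd t0) auto
      next
        case False
        have "Inf (insert t {s\<in>{0..<t}. y s < - x}) \<le> t" by (intro cInf_lower first_below_bdd t0) auto
        then show ?thesis using False by simp
      qed
    qed
    show "Inf ?S \<le> Inf (insert t {s\<in>{0..<t}. y s < - x})"
    proof (rule cInf_greatest)
      fix s assume s: "s \<in> insert t {s\<in>{0..<t}. y s < - x}"
      show "Inf ?S \<le> s"
      proof (cases "s = t")
        case True
        have "Inf ?S \<le> p" by (rule cInf_lower[OF _ bdd]) (use p in auto)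
        then show ?thesis using True that by simp
      next
        case False
        then show ?thesis using s by (intro cInf_lower bdd) auto
      qed
    qed simp
  qed
  obtain n0 where n0: "p < real n0" using reals_Archimedean2 by blast
  have "\<forall>\<^sub>F n in sequentially. exp (- (\<mu> * y (first_below y (real (Suc n)) x)
      + first_below y (real (Suc n)) x)) = exp (\<mu> * x) * hit_discount y x"
    using eventually_ge_at_top[of n0]
  proof eventually_elim
    case (elim n)
    then have n: "p < real (Suc n)" using n0 by simp
    have "y (first_below y (real (Suc n)) x) = - x"
      using first_below_value_le[OF y(1) p(1) n p(2)] first_below_value_ge[OF y jumps x, of "real (Suc n)"]
      by simp
    then show ?case
      unfolding hit_discount_eq[of p y x, OF p] eq[OF n, symmetric] by (simp add: mult_exp_exp)
  qed
  then show ?thesis by (rule tendsto_eventually)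
next
  case False
  have above: "- x \<le> y s" if "0 \<le> s" for s
  proof (rule ccontr)
    assume "\<not> - x \<le> y s"
    then have "y s < - x" by simp
    then show False using False that by blast
  qed
  have "(\<lambda>s. if y s < - x then exp (- s) else 0) ` {0..} = (\<lambda>s::real. 0::real) ` {0..}"
  proof (rule image_cong[OF refl])
    fix s :: real assume "s \<in> {0..}"
    then show "(if y s < - x then exp (- s) else 0) = 0" using above[of s] by simp
  qed
  then have "hit_discount y x = (SUP s\<in>{0::real..}. (0::real))" unfolding hit_discount_def by (rule arg_cong)
  then have h0: "hit_discount y x = 0" by simp
  have fb: "first_below y (real (Suc n)) x = real (Suc n)" for n
  proof -
    have "{s\<in>{0..<real (Suc n)}. y s < - x} = {}"
    proof (intro equals0I)
      fix s assume "s \<in> {s\<in>{0..<real (Suc n)}. y s < - x}"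
      then show False using above[of s] by simp
    qed
    then show ?thesis unfolding first_below_def by (simp only: cInf_singleton)
  qed
  have lim: "(\<lambda>n. exp (\<mu> * x) * exp (- real (Suc n))) \<longlonglongrightarrow> exp (\<mu> * x) * 0"
  proof (rule tendsto_mult_left)
    have "(\<lambda>n. (exp (-1) :: real) ^ n) \<longlonglongrightarrow> 0" by (rule LIMSEQ_power_zero) simp
    from LIMSEQ_Suc[OF this] have "(\<lambda>n. (exp (-1) :: real) ^ Suc n) \<longlonglongrightarrow> 0" .
    moreover have "exp (- real (Suc n)) = exp (-1) ^ Suc n" for n
      using exp_of_nat_mult[of "Suc n" "-1::real"] by (simp only: mult_minus_right mult_1_right)
    ultimately show "(\<lambda>n. exp (- real (Suc n))) \<longlonglongrightarrow> 0" by (simp only:)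
  qed
  have "exp (- (\<mu> * y (real (Suc n)) + real (Suc n))) \<le> exp (\<mu> * x) * exp (- real (Suc n))" for n
  proof -
    have "\<mu> * (- x) \<le> \<mu> * y (real (Suc n))" by (intro mult_left_mono above \<mu>) simp
    then show ?thesis unfolding mult_exp_exp by simp
  qed
  then have le: "\<forall>\<^sub>F n in sequentially. exp (- (\<mu> * y (real (Suc n)) + real (Suc n)))
      \<le> exp (\<mu> * x) * exp (- real (Suc n))"
    by (rule always_eventually[OF allI])
  have nn: "\<forall>\<^sub>F n in sequentially. 0 \<le> exp (- (\<mu> * y (real (Suc n)) + real (Suc n)))"
    by (rule always_eventually[OF allI]) simp
  have lim0: "(\<lambda>n. exp (\<mu> * x) * exp (- real (Suc n))) \<longlonglongrightarrow> 0"
    using lim by (simp only: mult_zero_right)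
  have "(\<lambda>n. exp (- (\<mu> * y (real (Suc n)) + real (Suc n)))) \<longlonglongrightarrow> 0"
    by (rule tendsto_sandwich[OF nn le tendsto_const lim0])
  then show ?thesis unfolding fb h0 by simp
qed

context stable_process
begin

abbreviation stopped_exponential :: "(nat \<Rightarrow> real) \<Rightarrow> nat \<Rightarrow> real \<Rightarrow> 'v \<Rightarrow> real" where
  "stopped_exponential x r t \<omega> \<equiv> (\<Prod>j<r. exp (- (mu r j * Y (first_below (\<lambda>s. Y s \<omega>) t (x j)) \<omega>
      + first_below (\<lambda>s. Y s \<omega>) t (x j))))"

lemma stopped_exponential_bound:
  assumes x: "\<And>j. j < r \<Longrightarrow> 0 \<le> x j" and t: "0 < t"
  shows "AE \<omega> in N. stopped_exponential x r t \<omega> \<le> exp (\<Sum>j<r. mu r j * x j)"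
  using Y_0 Y_no_negative_jumps AE_space
proof eventually_elim
  case (elim \<omega>)
  have "exp (- (mu r j * Y (first_below (\<lambda>s. Y s \<omega>) t (x j)) \<omega> + first_below (\<lambda>s. Y s \<omega>) t (x j)))
      \<le> exp (mu r j * x j)" if "j < r" for j
  proof -
    have "- x j \<le> Y (first_below (\<lambda>s. Y s \<omega>) t (x j)) \<omega>"
      using first_below_value_ge[OF Y_cadlag[OF elim(3)] elim(1,2) x[OF that] t] .
    then have "mu r j * (- x j) \<le> mu r j * Y (first_below (\<lambda>s. Y s \<omega>) t (x j)) \<omega>"
      using \<alpha> by (intro mult_left_mono power_increment_nonneg) auto
    then show ?thesis using first_below_nonneg[of t "\<lambda>s. Y s \<omega>" "x j"] t by simp
  qed
  then have "stopped_exponential x r t \<omega> \<le> (\<Prod>j<r. exp (mu r j * x j))"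
    by (intro prod_mono) auto
  then show ?case by (simp add: exp_sum)
qed

text \<open>
  Overshoots of the grid walks are not bounded, so the passage to the limit uses uniform integrability:
  the second moments are bounded by \<open>exp(4 r t)\<close>, and truncation at height \<open>R\<close> costs at most that bound
  divided by \<open>R\<close>. The limit itself is bounded.
\<close>

lemma stopped_exponential_integral:
  assumes x: "\<And>j. j < r \<Longrightarrow> 0 \<le> x j" "mono_on {..<r} x" and t: "0 < t"
  shows "stopped_exponential x r t \<in> borel_measurable N"
    and "(\<integral>\<omega>. stopped_exponential x r t \<omega> \<partial>N) = 1"
proof -
  define T where "T m \<omega> j = grid_hit (Suc m) (grid t (Suc m) \<omega>) (x j)" for m \<omega> j
  define G where "G m \<omega> = exp (- ((\<Sum>j<r. mu r j * grid t (Suc m) \<omega> (T m \<omega> j))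
      + t / real (Suc m) * (\<Sum>j<r. real (T m \<omega> j))))" for m \<omega>
  have t0: "0 \<le> t" using t by simp
  have [measurable]: "(\<lambda>\<omega>. grid t (Suc m) \<omega> (T m \<omega> j)) \<in> borel_measurable N" for m j
    unfolding T_def by (rule grid_at_hit_measurable[OF t0])
  have [measurable]: "(\<lambda>\<omega>. T m \<omega> j) \<in> N \<rightarrow>\<^sub>M count_space UNIV" for m j
    unfolding T_def by (rule grid_hit_measurable[OF t0])
  have Gm [measurable]: "G m \<in> borel_measurable N" for m unfolding G_def by measurable
  have Glim: "(\<lambda>m. G m \<omega>) \<longlonglongrightarrow> stopped_exponential x r t \<omega>" if "\<omega> \<in> space N" for \<omega>
  proof -
    have "G m \<omega> = (\<Prod>j<r. exp (- (mu r j * Y (t / real (Suc m) * real (T m \<omega> j)) \<omega>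
        + t / real (Suc m) * real (T m \<omega> j))))" for m
      by (simp add: G_def exp_sum[symmetric] sum_negf[symmetric] sum.distrib[symmetric] grid_def
          sum_distrib_left del: of_nat_Suc)
    moreover have "(\<lambda>m. \<Prod>j<r. exp (- (mu r j * Y (t / real (Suc m) * real (T m \<omega> j)) \<omega>
        + t / real (Suc m) * real (T m \<omega> j)))) \<longlonglongrightarrow> stopped_exponential x r t \<omega>"
      using grid_hit_tendsto[OF Y_cadlag[OF that] t] unfolding T_def grid_def
      by (intro tendsto_intros)
    ultimately show ?thesis by simp
  qed
  show sm: "stopped_exponential x r t \<in> borel_measurable N"
    by (rule borel_measurable_LIMSEQ_real[OF Glim Gm])
  have G1: "(\<integral>\<^sup>+\<omega>. ennreal (G m \<omega>) \<partial>N) = 1" for m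
    using grid_exponential_martingale[OF t0 _ x(2), of "Suc m" 1]
    by (simp add: G_def T_def del: of_nat_Suc)
  have G2: "(\<integral>\<^sup>+\<omega>. ennreal (G m \<omega> * G m \<omega>) \<partial>N) \<le> ennreal (exp (4 * (real r * t)))" for m
  proof -
    define H where "H \<omega> = exp (- (2 * (\<Sum>j<r. mu r j * grid t (Suc m) \<omega> (T m \<omega> j))
      + 2 powr \<alpha> * (t / real (Suc m)) * (\<Sum>j<r. real (T m \<omega> j))))" for \<omega>
    have [measurable]: "H \<in> borel_measurable N" unfolding H_def by measurable
    have H1: "(\<integral>\<^sup>+\<omega>. ennreal (H \<omega>) \<partial>N) = 1"
      using grid_exponential_martingale[OF t0 _ x(2), of "Suc m" 2]
      by (simp add: H_def T_def del: of_nat_Suc)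
    have "G m \<omega> * G m \<omega> \<le> exp (4 * (real r * t)) * H \<omega>" for \<omega>
    proof -
      define u where "u = t / real (Suc m) * (\<Sum>j<r. real (T m \<omega> j))"
      have "(\<Sum>j<r. real (T m \<omega> j)) \<le> (\<Sum>j<r. real (Suc m))"
        unfolding T_def by (intro sum_mono of_nat_mono grid_hit_le)
      then have "u \<le> t / real (Suc m) * (real r * real (Suc m))"
        unfolding u_def using t by (intro mult_left_mono) auto
      also have "\<dots> = real r * t" by simp
      finally have u: "u \<le> real r * t" "0 \<le> u" using t by (auto simp: u_def sum_nonneg)
      have "(2::real) powr \<alpha> \<le> 2 powr 2" using \<alpha> by (intro powr_mono) auto
      then have p4: "(2::real) powr \<alpha> \<le> 4" by simp
      have "2 powr \<alpha> * u \<le> 4 * u" by (intro mult_right_mono p4 u)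
      also have "\<dots> \<le> 4 * (real r * t) + 2 * u" using u by linarith
      finally have "- (2 * u) \<le> 4 * (real r * t) - 2 powr \<alpha> * u" by simp
      moreover define v where "v = (\<Sum>j<r. mu r j * grid t (Suc m) \<omega> (T m \<omega> j))"
      have "G m \<omega> = exp (- (v + u))" "H \<omega> = exp (- (2 * v + 2 powr \<alpha> * u))"
        by (simp_all only: G_def H_def u_def v_def mult.assoc)
      ultimately show ?thesis by (simp add: mult_exp_exp)
    qed
    then have "(\<integral>\<^sup>+\<omega>. ennreal (G m \<omega> * G m \<omega>) \<partial>N) \<le> (\<integral>\<^sup>+\<omega>. ennreal (exp (4 * (real r * t))) * ennreal (H \<omega>) \<partial>N)"
      by (intro nn_integral_mono) (simp add: ennreal_mult'[symmetric] ennreal_leI)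
    then show ?thesis by (simp add: nn_integral_cmult H1)
  qed
  have G0: "0 \<le> G m \<omega>" for m \<omega> by (simp add: G_def)
  have Gint: "integrable N (G m)" and GI: "(\<integral>\<omega>. G m \<omega> \<partial>N) = 1" for m
    using G1[of m] G0 by (auto intro!: integrableI_nonneg simp: integral_eq_nn_integral)
  have GGint: "integrable N (\<lambda>\<omega>. G m \<omega> * G m \<omega>)" for m
    using G2[of m] G0 by (intro integrableI_nonneg) (auto simp: le_less_trans)
  have GG: "(\<integral>\<omega>. G m \<omega> * G m \<omega> \<partial>N) \<le> exp (4 * (real r * t))" for m
    using G2[of m] by (simp add: nn_integral_eq_integral[OF GGint] G0)
  define C where "C = exp (4 * (real r * t))"
  define B where "B = exp (\<Sum>j<r. mu r j * x j)"
  let ?I = "\<integral>\<omega>. stopped_exponential x r t \<omega> \<partial>N"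
  \<comment> \<open>The limit does not see the truncation once \<open>R\<close> exceeds its bound \<open>B\<close>.\<close>
  have key: "\<bar>1 - ?I\<bar> \<le> C / R" if R: "B \<le> R" "0 < R" for R
  proof -
    have minI: "integrable N (\<lambda>\<omega>. min (G m \<omega>) R)" for m
      by (rule integrable_const_bound[of _ R]) (use G0 R in auto)
    have "(\<lambda>m. \<integral>\<omega>. min (G m \<omega>) R \<partial>N) \<longlonglongrightarrow> ?I"
    proof (rule integral_dominated_convergence[where w = "\<lambda>_. R"])
      show "AE \<omega> in N. (\<lambda>m. min (G m \<omega>) R) \<longlonglongrightarrow> stopped_exponential x r t \<omega>"
      proof -
        have "AE \<omega> in N. stopped_exponential x r t \<omega> \<le> B"
          unfolding B_def by (rule stopped_exponential_bound) (use x t in auto)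
        then show ?thesis using AE_space
      proof eventually_elim
        case (elim \<omega>)
        have "(\<lambda>m. min (G m \<omega>) R) \<longlonglongrightarrow> min (stopped_exponential x r t \<omega>) R"
          by (intro tendsto_min Glim elim tendsto_const)
        then show ?case using elim R by (simp add: min_def)
      qed
      qed
    qed (use sm G0 R in auto)
    then have lim: "(\<lambda>m. \<bar>1 - (\<integral>\<omega>. min (G m \<omega>) R \<partial>N)\<bar>) \<longlonglongrightarrow> \<bar>1 - ?I\<bar>"
      by (intro tendsto_intros)
    have "\<bar>1 - (\<integral>\<omega>. min (G m \<omega>) R \<partial>N)\<bar> \<le> C / R" for m
    proof -
      have "1 - (\<integral>\<omega>. min (G m \<omega>) R \<partial>N) = (\<integral>\<omega>. G m \<omega> - min (G m \<omega>) R \<partial>N)"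
        by (simp add: Bochner_Integration.integral_diff[OF Gint minI] GI)
      moreover have "(\<integral>\<omega>. G m \<omega> - min (G m \<omega>) R \<partial>N) \<le> (\<integral>\<omega>. G m \<omega> * G m \<omega> / R \<partial>N)"
      proof (rule integral_mono)
        show "integrable N (\<lambda>\<omega>. G m \<omega> - min (G m \<omega>) R)"
          by (rule Bochner_Integration.integrable_diff[OF Gint minI])
        show "integrable N (\<lambda>\<omega>. G m \<omega> * G m \<omega> / R)" using GGint by simp
        fix \<omega>
        show "G m \<omega> - min (G m \<omega>) R \<le> G m \<omega> * G m \<omega> / R"
        proof (cases "G m \<omega> \<le> R")
          case False
          then have "G m \<omega> * R \<le> G m \<omega> * G m \<omega>" using G0 by (intro mult_left_mono) auto
          then have "G m \<omega> \<le> G m \<omega> * G m \<omega> / R" using R by (simp add: field_simps)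
          then show ?thesis using False R by simp
        qed (use G0 R in auto)
      qed
      moreover have "(\<integral>\<omega>. G m \<omega> * G m \<omega> / R \<partial>N) \<le> C / R"
        using GG[of m] R by (simp add: C_def divide_right_mono)
      moreover have "0 \<le> (\<integral>\<omega>. G m \<omega> - min (G m \<omega>) R \<partial>N)"
        by (rule integral_nonneg_AE) auto
      ultimately show ?thesis by simp
    qed
    then show ?thesis by (intro LIMSEQ_le_const2[OF lim]) auto
  qed
  have "\<bar>1 - ?I\<bar> \<le> 0"
  proof (rule field_le_epsilon)
    fix e :: real assume e: "0 < e"
    define R where "R = max B (C / e)"
    have R: "B \<le> R" "0 < R" by (auto simp: R_def B_def max_def less_le_trans[OF exp_gt_zero])
    have "C / e \<le> R" by (simp add: R_def)
    then have "C / R \<le> e" using e R by (simp add: field_simps)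
    then show "\<bar>1 - ?I\<bar> \<le> 0 + e" using key[OF R] by simp
  qed
  then show "?I = 1" by simp
qed

text \<open>
  The horizon of the stopped functional tends to infinity; each factor tends to \<open>exp(\<mu>\<^sub>j x\<^sub>j)\<close> times the
  discount factor of the \<open>j\<close>-th hitting time.
\<close>

lemma hitting_times_laplace:
  assumes x: "\<And>j. j < r \<Longrightarrow> 0 \<le> x j" "mono_on {..<r} x"
    and m: "\<And>j. j < r \<Longrightarrow> (\<lambda>\<omega>. hit_discount (\<lambda>s. Y s \<omega>) (x j)) \<in> borel_measurable N"
  shows "(\<integral>\<omega>. (\<Prod>j<r. hit_discount (\<lambda>s. Y s \<omega>) (x j)) \<partial>N) = exp (- (\<Sum>j<r. mu r j * x j))"
proof -
  define B where "B = exp (\<Sum>j<r. mu r j * x j)"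
  have meas: "stopped_exponential x r (real (Suc n)) \<in> borel_measurable N" for n
    by (rule stopped_exponential_integral(1)) (use x in auto)
  have lim: "AE \<omega> in N. (\<lambda>n. stopped_exponential x r (real (Suc n)) \<omega>)
      \<longlonglongrightarrow> B * (\<Prod>j<r. hit_discount (\<lambda>s. Y s \<omega>) (x j))"
    using Y_0 Y_no_negative_jumps AE_space
  proof eventually_elim
    case (elim \<omega>)
    have mu0: "0 \<le> mu r j" for j using \<alpha> by (simp add: power_increment_nonneg)
    have "(\<lambda>n. stopped_exponential x r (real (Suc n)) \<omega>)
        \<longlonglongrightarrow> (\<Prod>j<r. exp (mu r j * x j) * hit_discount (\<lambda>s. Y s \<omega>) (x j))"
    proof (rule tendsto_prod)
      fix j assume "j \<in> {..<r}"
      then have "0 \<le> x j" using x(1) by simp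
      from first_below_limit[OF Y_cadlag[OF elim(3)] elim(1,2) this mu0]
      show "(\<lambda>n. exp (- (mu r j * Y (first_below (\<lambda>s. Y s \<omega>) (real (Suc n)) (x j)) \<omega>
          + first_below (\<lambda>s. Y s \<omega>) (real (Suc n)) (x j))))
        \<longlonglongrightarrow> exp (mu r j * x j) * hit_discount (\<lambda>s. Y s \<omega>) (x j)" .
    qed
    moreover have "(\<Prod>j<r. exp (mu r j * x j) * hit_discount (\<lambda>s. Y s \<omega>) (x j))
        = B * (\<Prod>j<r. hit_discount (\<lambda>s. Y s \<omega>) (x j))"
      unfolding B_def by (simp only: exp_sum[OF finite_lessThan] prod.distrib)
    ultimately show ?case by (simp only:)
  qed
  \<comment> \<open>The almost sure limit is replaced by a version that is measurable by construction.\<close>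
  define L where "L \<omega> = lim (\<lambda>n. stopped_exponential x r (real (Suc n)) \<omega>)" for \<omega>
  have Lm: "L \<in> borel_measurable N" unfolding L_def
    by (rule borel_measurable_lim_metric[OF meas])
  have L: "AE \<omega> in N. L \<omega> = B * (\<Prod>j<r. hit_discount (\<lambda>s. Y s \<omega>) (x j))"
    using lim by eventually_elim (simp add: L_def limI)
  have "(\<lambda>n. \<integral>\<omega>. stopped_exponential x r (real (Suc n)) \<omega> \<partial>N) \<longlonglongrightarrow> (\<integral>\<omega>. L \<omega> \<partial>N)"
  proof (rule integral_dominated_convergence[where w = "\<lambda>_. B"])
    show "AE \<omega> in N. (\<lambda>n. stopped_exponential x r (real (Suc n)) \<omega>) \<longlonglongrightarrow> L \<omega>"
      using lim L by eventually_elim simp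
    show "AE \<omega> in N. norm (stopped_exponential x r (real (Suc n)) \<omega>) \<le> B" for n
    proof -
      have "AE \<omega> in N. stopped_exponential x r (real (Suc n)) \<omega> \<le> B"
        unfolding B_def by (rule stopped_exponential_bound) (use x in auto)
      then show ?thesis by eventually_elim (simp add: prod_nonneg)
    qed
  qed (use Lm meas in auto)
  moreover have "(\<integral>\<omega>. stopped_exponential x r (real (Suc n)) \<omega> \<partial>N) = 1" for n
    by (rule stopped_exponential_integral(2)) (use x in auto)
  ultimately have "(\<integral>\<omega>. L \<omega> \<partial>N) = 1" by (simp add: LIMSEQ_const_iff)
  have hm: "AE \<omega> in N. (\<Prod>j<r. hit_discount (\<lambda>s. Y s \<omega>) (x j)) = L \<omega> / B"
    using L by eventually_elim (simp add: B_def)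
  have "(\<integral>\<omega>. (\<Prod>j<r. hit_discount (\<lambda>s. Y s \<omega>) (x j)) \<partial>N) = (\<integral>\<omega>. L \<omega> / B \<partial>N)"
    using Lm m by (intro integral_cong_AE hm borel_measurable_prod) auto
  then show ?thesis using \<open>(\<integral>\<omega>. L \<omega> \<partial>N) = 1\<close> by (simp add: B_def exp_minus inverse_eq_divide)
qed

end

section \<open>Sums over lists\<close>

lemma nn_integral_count_space_Cons:
  "(\<integral>\<^sup>+xs. (if length xs = Suc n then f xs else 0) \<partial>count_space UNIV)
    = (\<integral>\<^sup>+x. \<integral>\<^sup>+xs. (if length xs = n then f (x # xs) else 0) \<partial>count_space UNIV \<partial>count_space UNIV)"
proof -
  let ?g = "\<lambda>xs. if length xs = Suc n then f xs else 0"
  have bij: "bij_betw (\<lambda>(x, xs). x # xs) UNIV (- {[]})"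
    by (rule bij_betwI[where g = "\<lambda>xs. (hd xs, tl xs)"]) auto
  have "(\<integral>\<^sup>+xs. ?g xs \<partial>count_space UNIV) = (\<integral>\<^sup>+xs. ?g xs \<partial>count_space (- {[]}))"
    by (rule nn_integral_count_space_eq) auto
  also have "\<dots> = (\<integral>\<^sup>+p. ?g (case p of (x, xs) \<Rightarrow> x # xs) \<partial>count_space UNIV)"
    using nn_integral_bij_count_space[OF bij, of ?g] by simp
  also have "\<dots> = (\<integral>\<^sup>+x. \<integral>\<^sup>+xs. ?g (x # xs) \<partial>count_space UNIV \<partial>count_space UNIV)"
    by (subst nn_integral_fst_count_space[symmetric]) (simp only: prod.case)
  finally show ?thesis by simp
qed

lemma nn_integral_count_space_group_finite:
  fixes root :: "'t \<Rightarrow> 'd::finite"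
  shows "(\<integral>\<^sup>+t. v t * H (root t) \<partial>count_space UNIV)
    = (\<Sum>j\<in>UNIV. (\<integral>\<^sup>+t. (if root t = j then v t else 0) \<partial>count_space UNIV) * H j)"
proof -
  have "(\<integral>\<^sup>+t. v t * H (root t) \<partial>count_space UNIV)
      = (\<integral>\<^sup>+t. (\<Sum>j\<in>UNIV. (if root t = j then v t else 0) * H j) \<partial>count_space UNIV)"
  proof (rule nn_integral_cong)
    fix t
    have "(\<Sum>j\<in>UNIV. (if root t = j then v t else 0) * H j)
        = (\<Sum>j\<in>UNIV. if root t = j then v t * H j else 0)" by (rule sum.cong) auto
    then show "v t * H (root t) = (\<Sum>j\<in>UNIV. (if root t = j then v t else 0) * H j)" by simp
  qed
  also have "\<dots> = (\<Sum>j\<in>UNIV. (\<integral>\<^sup>+t. (if root t = j then v t else 0) \<partial>count_space UNIV) * H j)"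
    by (subst nn_integral_sum) (auto simp: nn_integral_multc)
  finally show ?thesis .
qed

text \<open>
  Summing out the trees of a list with prescribed root types leaves, by distributivity, one factor
  \<open>V\<close> per root type.
\<close>

lemma nn_integral_lists_by_root:
  fixes root :: "'t \<Rightarrow> 'd::finite" and v :: "'t \<Rightarrow> ennreal" and g :: "'d list \<Rightarrow> ennreal"
  defines "V \<equiv> \<lambda>j. \<integral>\<^sup>+t. (if root t = j then v t else 0) \<partial>count_space UNIV"
  shows "(\<integral>\<^sup>+ts. g (map root ts) * prod_list (map v ts) \<partial>count_space UNIV)
    = (\<integral>\<^sup>+e. g e * prod_list (map V e) \<partial>count_space UNIV)"
proof -
  have fixed: "(\<integral>\<^sup>+ts. (if length ts = n then g (map root ts) * prod_list (map v ts) else 0) \<partial>count_space UNIV)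
      = (\<integral>\<^sup>+e. (if length e = n then g e * prod_list (map V e) else 0) \<partial>count_space UNIV)" for n g
  proof (induction n arbitrary: g)
    case 0
    have "(\<integral>\<^sup>+ts. (if length ts = 0 then c ts else 0) \<partial>count_space UNIV) = c []" for c :: "'z list \<Rightarrow> ennreal"
    proof -
      have "(\<integral>\<^sup>+ts. (if length ts = 0 then c ts else 0) \<partial>count_space UNIV)
          = (\<integral>\<^sup>+ts. (if length ts = 0 then c ts else 0) \<partial>count_space {[]})"
        by (rule nn_integral_count_space_eq) auto
      then show ?thesis by (simp add: nn_integral_count_space_finite)
    qed
    note this[of "\<lambda>ts. g (map root ts) * prod_list (map v ts)"] this[of "\<lambda>e. g e * prod_list (map V e)"]
    then show ?case by simp
  next
    case (Suc n)
    define H where "H j = (\<integral>\<^sup>+e. (if length e = n then g (j # e) * prod_list (map V e) else 0) \<partial>count_space UNIV)" for j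
    have "(\<integral>\<^sup>+ts. (if length ts = Suc n then g (map root ts) * prod_list (map v ts) else 0) \<partial>count_space UNIV)
        = (\<integral>\<^sup>+t. \<integral>\<^sup>+ts. (if length ts = n then g (map root (t # ts)) * prod_list (map v (t # ts)) else 0)
            \<partial>count_space UNIV \<partial>count_space UNIV)"
      by (rule nn_integral_count_space_Cons)
    also have "\<dots> = (\<integral>\<^sup>+t. v t * H (root t) \<partial>count_space UNIV)"
    proof (rule nn_integral_cong)
      fix t
      have "(\<integral>\<^sup>+ts. (if length ts = n then g (map root (t # ts)) * prod_list (map v (t # ts)) else 0) \<partial>count_space UNIV)
        = (\<integral>\<^sup>+ts. v t * (if length ts = n then g (root t # map root ts) * prod_list (map v ts) else 0) \<partial>count_space UNIV)"
        by (rule nn_integral_cong) (simp add: mult_ac)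
      also have "\<dots> = v t * (\<integral>\<^sup>+ts. (if length ts = n then g (root t # map root ts) * prod_list (map v ts) else 0) \<partial>count_space UNIV)"
        by (rule nn_integral_cmult) simp
      also have "\<dots> = v t * H (root t)" unfolding H_def using Suc.IH[of "\<lambda>e. g (root t # e)"] by simp
      finally show "(\<integral>\<^sup>+ts. (if length ts = n then g (map root (t # ts)) * prod_list (map v (t # ts)) else 0) \<partial>count_space UNIV)
          = v t * H (root t)" .
    qed
    also have "\<dots> = (\<Sum>j\<in>UNIV. V j * H j)"
      unfolding V_def by (rule nn_integral_count_space_group_finite)
    also have "\<dots> = (\<integral>\<^sup>+j. V j * H j \<partial>count_space UNIV)"
      by (simp add: nn_integral_count_space_finite)
    also have "\<dots> = (\<integral>\<^sup>+j. \<integral>\<^sup>+e. (if length e = n then g (j # e) * prod_list (map V (j # e)) else 0) \<partial>count_space UNIV \<partial>count_space UNIV)"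
    proof (rule nn_integral_cong)
      fix j
      have "V j * H j = (\<integral>\<^sup>+e. V j * (if length e = n then g (j # e) * prod_list (map V e) else 0) \<partial>count_space UNIV)"
        unfolding H_def by (rule nn_integral_cmult[symmetric]) simp
      also have "\<dots> = (\<integral>\<^sup>+e. (if length e = n then g (j # e) * prod_list (map V (j # e)) else 0) \<partial>count_space UNIV)"
        by (rule nn_integral_cong) (simp add: mult_ac)
      finally show "V j * H j = (\<integral>\<^sup>+e. (if length e = n then g (j # e) * prod_list (map V (j # e)) else 0) \<partial>count_space UNIV)" .
    qed
    also have "\<dots> = (\<integral>\<^sup>+e. (if length e = Suc n then g e * prod_list (map V e) else 0) \<partial>count_space UNIV)"
      by (rule nn_integral_count_space_Cons[symmetric])
    finally show ?case .
  qed
  have split: "(\<integral>\<^sup>+ts. F ts \<partial>count_space UNIV)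
      = (\<Sum>n. \<integral>\<^sup>+ts. (if length ts = n then F ts else 0) \<partial>count_space UNIV)" for F :: "'z list \<Rightarrow> ennreal"
  proof -
    have "F ts = (\<Sum>n. if length ts = n then F ts else 0)" for ts
      using suminf_finite[of "{length ts}" "\<lambda>n. if length ts = n then F ts else 0"] by simp
    then have "(\<integral>\<^sup>+ts. F ts \<partial>count_space UNIV)
        = (\<integral>\<^sup>+ts. (\<Sum>n. if length ts = n then F ts else 0) \<partial>count_space UNIV)" by (rule nn_integral_cong)
    also have "\<dots> = (\<Sum>n. \<integral>\<^sup>+ts. (if length ts = n then F ts else 0) \<partial>count_space UNIV)"
      by (rule nn_integral_suminf) simp
    finally show ?thesis .
  qed
  show ?thesis unfolding split[of "\<lambda>ts. g (map root ts) * prod_list (map v ts)"]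
    split[of "\<lambda>e. g e * prod_list (map V e)"] fixed ..
qed

definition type_count :: "'d::finite list \<Rightarrow> nat ^ 'd" where
  "type_count e = (\<chi> j. count (mset e) j)"

lemma sum_type_count: "(\<Sum>j\<in>UNIV. type_count e $ j) = length e"
proof -
  have "(\<Sum>j\<in>UNIV. type_count e $ j) = (\<Sum>j\<in>set_mset (mset e). count (mset e) j)"
    unfolding type_count_def by (intro sum.mono_neutral_cong_right) (auto simp: not_in_iff)
  also have "\<dots> = size (mset e)" by (rule size_multiset_overloaded_eq[symmetric])
  finally show ?thesis by simp
qed

text \<open>
  A list with type counts \<open>z\<close> is a permutation of the multiset with multiplicities \<open>z\<close>; this is the
  multinomial coefficient that cancels the symmetry factor in the Galton--Watson weights.
\<close>

lemma card_type_count: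
  fixes z :: "nat ^ 'd::finite"
  shows "finite {e. type_count e = z}"
    and "real (card {e. type_count e = z}) * (\<Prod>j\<in>UNIV. fact (z $ j)) = fact (\<Sum>j\<in>UNIV. z $ j)"
proof -
  define A where "A = (\<Sum>j\<in>UNIV. replicate_mset (z $ j) j)"
  have cA: "count A j = z $ j" for j
    unfolding A_def by (simp add: count_sum)
  have eq: "{e. type_count e = z} = permutations_of_multiset A"
    by (auto simp: permutations_of_multiset_def type_count_def vec_eq_iff multiset_eq_iff cA)
  show "finite {e. type_count e = z}" unfolding eq by simp
  have size: "size A = (\<Sum>j\<in>UNIV. z $ j)"
    unfolding A_def by (simp add: size_multiset_sum)
  have "(\<Prod>j\<in>UNIV. fact (z $ j)) = (\<Prod>j\<in>set_mset A. fact (count A j) :: nat)"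
    by (intro prod.mono_neutral_cong_right) (auto simp: cA not_in_iff)
  then have "card {e. type_count e = z} * (\<Prod>j\<in>UNIV. fact (z $ j)) = fact (\<Sum>j\<in>UNIV. z $ j)"
    using card_permutations_of_multiset_aux[of A] by (simp add: eq size)
  from arg_cong[OF this, of real]
  show "real (card {e. type_count e = z}) * (\<Prod>j\<in>UNIV. fact (z $ j)) = fact (\<Sum>j\<in>UNIV. z $ j)"
    by (simp add: of_nat_prod)
qed

lemma prod_list_type_count:
  fixes V :: "'d::finite \<Rightarrow> 'b::comm_monoid_mult"
  shows "prod_list (map V e) = (\<Prod>j\<in>UNIV. V j ^ (type_count e $ j))"
proof (induction e)
  case (Cons a e)
  have "(\<Prod>j\<in>UNIV. V j ^ (type_count (a # e) $ j))
      = (\<Prod>j\<in>UNIV. (if j = a then V j else 1) * V j ^ (type_count e $ j))"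
    by (rule prod.cong) (auto simp: type_count_def)
  also have "\<dots> = V a * (\<Prod>j\<in>UNIV. V j ^ (type_count e $ j))"
    by (subst prod.distrib) simp
  finally show ?case using Cons by simp
qed (simp add: type_count_def)

lemma nn_integral_lists_by_type_count:
  fixes F :: "nat ^ 'd::finite \<Rightarrow> ennreal"
  shows "(\<integral>\<^sup>+e. F (type_count e) \<partial>count_space UNIV)
    = (\<integral>\<^sup>+z. ennreal (real (card {e :: 'd list. type_count e = z})) * F z \<partial>count_space UNIV)"
proof -
  have "(\<integral>\<^sup>+e. F (type_count e) \<partial>count_space UNIV)
      = (\<integral>\<^sup>+e. \<integral>\<^sup>+z. (if type_count e = z then F z else 0) \<partial>count_space UNIV \<partial>count_space UNIV)"
  proof (rule nn_integral_cong)
    fix e :: "'d list"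
    have "(\<integral>\<^sup>+z. (if type_count e = z then F z else 0) \<partial>count_space UNIV)
        = (\<integral>\<^sup>+z. (if type_count e = z then F z else 0) \<partial>count_space {type_count e})"
      by (rule nn_integral_count_space_eq) auto
    then show "F (type_count e) = (\<integral>\<^sup>+z. (if type_count e = z then F z else 0) \<partial>count_space UNIV)"
      by (simp add: nn_integral_count_space_finite)
  qed
  also have "\<dots> = (\<integral>\<^sup>+p. (case p of (e, z) \<Rightarrow> if type_count e = z then F z else 0) \<partial>count_space UNIV)"
    by (subst nn_integral_fst_count_space[symmetric]) simp
  also have "\<dots> = (\<integral>\<^sup>+z. \<integral>\<^sup>+e. (if type_count e = z then F z else 0) \<partial>count_space UNIV \<partial>count_space UNIV)"
    by (subst nn_integral_snd_count_space[symmetric]) simp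
  also have "\<dots> = (\<integral>\<^sup>+z. ennreal (real (card {e :: 'd list. type_count e = z})) * F z \<partial>count_space UNIV)"
  proof (rule nn_integral_cong)
    fix z :: "nat ^ 'd"
    have "(\<integral>\<^sup>+e. (if type_count e = z then F z else 0) \<partial>count_space UNIV)
        = (\<integral>\<^sup>+e. (if type_count e = z then F z else 0) \<partial>count_space {e. type_count e = z})"
      by (rule nn_integral_count_space_eq) auto
    also have "\<dots> = (\<Sum>e\<in>{e. type_count e = z}. F z)"
      by (subst nn_integral_count_space_finite[OF card_type_count(1)]) (auto intro!: sum.cong)
    also have "\<dots> = ennreal (real (card {e :: 'd list. type_count e = z})) * F z"
      by (simp add: ennreal_of_nat_eq_real_of_nat)
    finally show "(\<integral>\<^sup>+e. (if type_count e = z then F z else 0) \<partial>count_space UNIV)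
        = ennreal (real (card {e :: 'd list. type_count e = z})) * F z" .
  qed
  finally show ?thesis .
qed

section \<open>Trees as lists of subtrees\<close>

text \<open>
  The tree with root type \<open>i\<close> whose subtrees at the root are \<open>ts\<close>. Children are numbered from 1, list
  positions from 0.
\<close>

definition graft :: "'d \<Rightarrow> (nat list \<rightharpoonup> 'd) list \<Rightarrow> (nat list \<rightharpoonup> 'd)" where
  "graft i ts = (\<lambda>w. case w of [] \<Rightarrow> Some i
     | k # u \<Rightarrow> if 1 \<le> k \<and> k \<le> length ts then (ts ! (k - 1)) u else None)"

definition root_type :: "(nat list \<rightharpoonup> 'd) \<Rightarrow> 'd" where
  "root_type t = the (t [])"

lemma graft_simps [simp]:
  "graft i ts [] = Some i"
  "k < length ts \<Longrightarrow> graft i ts (Suc k # u) = (ts ! k) u"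
  "length ts \<le> k \<Longrightarrow> graft i ts (Suc k # u) = None"
  "graft i ts (0 # u) = None"
  by (auto simp: graft_def)

lemma planar_tree_Nil: "planar_tree t \<Longrightarrow> [] \<in> t" and planar_tree_finite: "planar_tree t \<Longrightarrow> finite t"
  by (simp_all add: planar_tree_def)

lemma typed_trees_root: "t \<in> typed_trees \<Longrightarrow> t [] = Some (root_type t)"
  using planar_tree_Nil[of "dom t"] by (auto simp: typed_trees_def root_type_def domIff)

lemma dom_graft: "dom (graft i ts) = insert [] (\<Union>k<length ts. (#) (Suc k) ` dom (ts ! k))"
proof (rule set_eqI)
  fix w show "w \<in> dom (graft i ts) \<longleftrightarrow> w \<in> insert [] (\<Union>k<length ts. (#) (Suc k) ` dom (ts ! k))"
  proof (cases w)
    case (Cons k u)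
    then show ?thesis
    proof (cases k)
      case (Suc k')
      then show ?thesis using Cons by (cases "k' < length ts") (auto simp: image_iff)
    qed auto
  qed auto
qed

lemma graft_typed_trees:
  assumes "ts \<in> lists typed_trees" shows "graft i ts \<in> typed_trees"
proof -
  have ts: "planar_tree (dom (ts ! k))" if "k < length ts" for k
    using assms that by (auto simp: typed_trees_def)
  have "u \<in> dom (graft i ts) \<and> (\<forall>j\<in>{1..l}. u @ [j] \<in> dom (graft i ts))"
    if ul: "u @ [l] \<in> dom (graft i ts)" for u l
  proof (cases u)
    case Nil
    then have l: "1 \<le> l" "l \<le> length ts" using ul by (auto simp: graft_def dom_def split: if_splits)
    have "[j] \<in> dom (graft i ts)" if j: "j \<in> {1..l}" for j
    proof -
      obtain k where k: "j = Suc k" using j by (cases j) auto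
      then have "k < length ts" using j l by simp
      then show ?thesis using planar_tree_Nil[OF ts[of k]] k by (auto simp: domIff)
    qed
    then show ?thesis using Nil by auto
  next
    case (Cons k v)
    then obtain k' where k: "k = Suc k'" "k' < length ts" "v @ [l] \<in> dom (ts ! k')"
      using ul by (auto simp: dom_graft)
    then have "v \<in> dom (ts ! k') \<and> (\<forall>j\<in>{1..l}. v @ [j] \<in> dom (ts ! k'))"
      using ts[of k'] unfolding planar_tree_def by blast
    moreover have "Suc k' # w \<in> dom (graft i ts) \<longleftrightarrow> w \<in> dom (ts ! k')" for w
      using k(2) by (simp add: domIff)
    ultimately show ?thesis using Cons k(1) by simp
  qed
  moreover have "finite (dom (graft i ts))" unfolding dom_graft using ts planar_tree_finite by auto
  moreover have "dom (graft i ts) \<subseteq> lists {1..}"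
  proof
    fix w assume "w \<in> dom (graft i ts)"
    then consider "w = []" | k u where "k < length ts" "u \<in> dom (ts ! k)" "w = Suc k # u"
      unfolding dom_graft by blast
    then show "w \<in> lists {1..}"
    proof cases
      case 2
      then have "u \<in> lists {1..}" using ts[of k] unfolding planar_tree_def by blast
      then show ?thesis using 2(3) by simp
    qed simp
  qed
  ultimately show ?thesis unfolding typed_trees_def planar_tree_def by (auto simp: dom_graft)
qed

lemma num_children_graft_root:
  assumes "ts \<in> lists typed_trees" shows "num_children (graft i ts) [] = length ts"
proof -
  have "{k. [k] \<in> dom (graft i ts)} = Suc ` {..<length ts}"
  proof -
    have nil: "(ts ! k) [] \<noteq> None" if "k < length ts" for k
    proof -
      have "ts ! k \<in> typed_trees" using assms that by auto
      then show ?thesis by (simp add: typed_trees_root)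
    qed
    have "[k] \<in> dom (graft i ts) \<longleftrightarrow> k \<in> Suc ` {..<length ts}" for k
    proof (cases k)
      case (Suc k')
      then show ?thesis using nil[of k'] by (cases "k' < length ts") (auto simp: domIff)
    qed (simp add: domIff)
    then show ?thesis by blast
  qed
  then show ?thesis by (simp add: num_children_def card_image)
qed

lemma type_children_graft_root:
  assumes "ts \<in> lists typed_trees"
  shows "type_children (graft i ts) [] = type_count (map root_type ts)"
proof -
  have "card {k. graft i ts [k] = Some j} = count (mset (map root_type ts)) j" for j
  proof -
    have "{k. graft i ts [k] = Some j} = Suc ` {k. k < length ts \<and> root_type (ts ! k) = j}"
    proof (rule set_eqI)
      fix k show "k \<in> {k. graft i ts [k] = Some j} \<longleftrightarrow> k \<in> Suc ` {k. k < length ts \<and> root_type (ts ! k) = j}"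
      proof (cases k)
        case (Suc k')
        show ?thesis
        proof (cases "k' < length ts")
          case True
          then have "ts ! k' \<in> typed_trees" using assms by auto
          from typed_trees_root[OF this] show ?thesis using Suc True by (auto simp: image_iff)
        qed (use Suc in auto)
      qed auto
    qed
    moreover have "count (mset (map root_type ts)) j = length (filter (\<lambda>t. root_type t = j) ts)"
      by (induction ts) auto
    ultimately show ?thesis by (simp add: card_image length_filter_conv_card)
  qed
  then show ?thesis by (simp add: type_children_def type_count_def)
qed

lemma children_graft_subtree:
  assumes "k < length ts"
  shows "num_children (graft i ts) (Suc k # u) = num_children (ts ! k) u"
    and "type_children (graft i ts) (Suc k # u) = type_children (ts ! k) u"
  using assms by (simp_all add: num_children_def type_children_def domIff)

lemma prod_dom_graft:
  assumes ts: "ts \<in> lists typed_trees"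
  shows "prod f (dom (graft i ts)) = f [] * (\<Prod>k<length ts. \<Prod>u\<in>dom (ts ! k). f (Suc k # u))"
proof -
  have fin: "finite (dom (ts ! k))" if "k < length ts" for k
    using ts that planar_tree_finite by (auto simp: typed_trees_def)
  have "prod f (dom (graft i ts)) = f [] * prod f (\<Union>k<length ts. (#) (Suc k) ` dom (ts ! k))"
    unfolding dom_graft using fin by (subst prod.insert) auto
  also have "prod f (\<Union>k<length ts. (#) (Suc k) ` dom (ts ! k)) = (\<Prod>k<length ts. prod f ((#) (Suc k) ` dom (ts ! k)))"
    by (rule prod.UNION_disjoint) (use fin in auto)
  also have "\<dots> = (\<Prod>k<length ts. \<Prod>u\<in>dom (ts ! k). f (Suc k # u))"
  proof (rule prod.cong[OF refl])
    fix k
    have "prod f ((#) (Suc k) ` dom (ts ! k)) = prod (f \<circ> (#) (Suc k)) (dom (ts ! k))"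
      by (rule prod.reindex) auto
    then show "prod f ((#) (Suc k) ` dom (ts ! k)) = (\<Prod>u\<in>dom (ts ! k). f (Suc k # u))"
      by (simp add: o_def)
  qed
  finally show ?thesis .
qed

lemma card_dom_graft:
  assumes ts: "ts \<in> lists typed_trees"
  shows "card (dom (graft i ts)) = Suc (sum_list (map (\<lambda>t. card (dom t)) ts))"
proof -
  have fin: "finite (dom (ts ! k))" if "k < length ts" for k
    using ts that planar_tree_finite by (auto simp: typed_trees_def)
  have "card (dom (graft i ts)) = Suc (card (\<Union>k<length ts. (#) (Suc k) ` dom (ts ! k)))"
    unfolding dom_graft using fin by (subst card_insert_disjoint) auto
  also have "card (\<Union>k<length ts. (#) (Suc k) ` dom (ts ! k)) = (\<Sum>k<length ts. card ((#) (Suc k) ` dom (ts ! k)))"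
    by (rule card_UN_disjoint) (use fin in auto)
  also have "\<dots> = (\<Sum>k<length ts. card (dom (ts ! k)))" by (simp add: card_image)
  also have "\<dots> = sum_list (map (\<lambda>t. card (dom t)) ts)"
    by (simp add: sum_list_sum_nth atLeast0LessThan)
  finally show ?thesis by simp
qed

lemma GW_weight_graft:
  assumes ts: "ts \<in> lists typed_trees"
  shows "GW_weight \<mu> (graft i ts)
    = (\<Prod>j\<in>UNIV. fact (type_count (map root_type ts) $ j)) / fact (length ts)
       * pmf (\<mu> i) (type_count (map root_type ts)) * prod_list (map (GW_weight \<mu>) ts)"
proof -
  have "(\<Prod>k<length ts. \<Prod>u\<in>dom (ts ! k).
      (\<Prod>j\<in>UNIV. fact (type_children (graft i ts) (Suc k # u) $ j)) / fact (num_children (graft i ts) (Suc k # u))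
       * pmf (\<mu> (the (graft i ts (Suc k # u)))) (type_children (graft i ts) (Suc k # u)))
    = (\<Prod>k<length ts. GW_weight \<mu> (ts ! k))"
    by (intro prod.cong refl) (simp add: GW_weight_def children_graft_subtree)
  also have "\<dots> = prod_list (map (GW_weight \<mu>) ts)"
    by (induction ts) (auto simp: prod.lessThan_Suc_shift simp del: prod.lessThan_Suc)
  finally show ?thesis
    unfolding GW_weight_def[of \<mu> "graft i ts"] prod_dom_graft[OF ts]
    by (simp add: num_children_graft_root[OF ts] type_children_graft_root[OF ts])
qed

lemma inj_on_graft: "inj_on (graft i) (lists typed_trees)"
proof (rule inj_onI)
  fix ts us :: "(nat list \<rightharpoonup> 'a) list"
  assume ts: "ts \<in> lists typed_trees" and us: "us \<in> lists typed_trees" and eq: "graft i ts = graft i us"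
  have len: "length ts = length us"
    using num_children_graft_root[OF ts, of i] num_children_graft_root[OF us, of i] eq by simp
  show "ts = us"
  proof (rule nth_equalityI[OF len])
    fix k assume k: "k < length ts"
    show "ts ! k = us ! k"
    proof
      fix u
      from fun_cong[OF eq, of "Suc k # u"] show "(ts ! k) u = (us ! k) u" using k len by simp
    qed
  qed
qed

lemma subtree_typed_trees:
  assumes t: "t \<in> typed_trees" and k: "[k] \<in> dom t" shows "(\<lambda>u. t (k # u)) \<in> typed_trees"
proof -
  have pt: "planar_tree (dom t)" using t by (simp add: typed_trees_def)
  have dom: "dom (\<lambda>u. t (k # u)) = {u. k # u \<in> dom t}" by (auto simp: dom_def)
  have "finite ((#) k -` dom t)" by (rule finite_vimageI) (use pt in \<open>auto simp: planar_tree_def\<close>)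
  then have "finite {u. k # u \<in> dom t}" by (simp add: vimage_def)
  moreover have "{u. k # u \<in> dom t} \<subseteq> lists {1..}"
  proof
    fix u assume "u \<in> {u. k # u \<in> dom t}"
    then have "k # u \<in> lists {1..}" using pt unfolding planar_tree_def by blast
    then show "u \<in> lists {1..}" by simp
  qed
  moreover have "\<forall>u i. u @ [i] \<in> {u. k # u \<in> dom t} \<longrightarrow> u \<in> {u. k # u \<in> dom t}
      \<and> (\<forall>j\<in>{1..i}. u @ [j] \<in> {u. k # u \<in> dom t})"
  proof (intro allI impI)
    fix u i assume "u @ [i] \<in> {u. k # u \<in> dom t}"
    then have "(k # u) @ [i] \<in> dom t" by simp
    then have "k # u \<in> dom t \<and> (\<forall>j\<in>{1..i}. (k # u) @ [j] \<in> dom t)"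
      using pt unfolding planar_tree_def by blast
    then show "u \<in> {u. k # u \<in> dom t} \<and> (\<forall>j\<in>{1..i}. u @ [j] \<in> {u. k # u \<in> dom t})" by simp
  qed
  ultimately show ?thesis using k unfolding typed_trees_def planar_tree_def mem_Collect_eq dom by auto
qed

lemma typed_trees_graft_cases:
  assumes t: "t \<in> typed_trees"
  obtains ts where "ts \<in> lists typed_trees" "t = graft (root_type t) ts"
proof -
  have pt: "planar_tree (dom t)" using t by (simp add: typed_trees_def)
  define S where "S = {k. [k] \<in> dom t}"
  have "finite ((\<lambda>k. [k]) -` dom t)"
    by (rule finite_vimageI) (use pt in \<open>auto simp: planar_tree_def inj_on_def\<close>)
  then have finS: "finite S" by (simp add: S_def vimage_def)
  have S1: "1 \<le> k" if "k \<in> S" for k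
    using that pt unfolding S_def planar_tree_def by fastforce
  have Sdown: "j \<in> S" if "k \<in> S" "1 \<le> j" "j \<le> k" for j k
  proof -
    have "[] @ [k] \<in> dom t" using that by (simp add: S_def)
    then have "\<forall>j\<in>{1..k}. [] @ [j] \<in> dom t" using pt unfolding planar_tree_def by blast
    then show ?thesis using that by (simp add: S_def)
  qed
  define c where "c = (if S = {} then 0 else Max S)"
  have Sc: "S = {1..c}"
  proof (cases "S = {}")
    case False
    then have "Max S \<in> S" using finS by simp
    have "S = {1..Max S}"
    proof (intro equalityI subsetI)
      fix j assume "j \<in> S"
      then show "j \<in> {1..Max S}" using S1[of j] Max_ge[OF finS, of j] by simp
    next
      fix j assume "j \<in> {1..Max S}"
      then show "j \<in> S" using Sdown[OF \<open>Max S \<in> S\<close>, of j] by simp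
    qed
    then show ?thesis using False by (simp add: c_def)
  qed (simp add: c_def)
  define ts where "ts = map (\<lambda>k u. t (Suc k # u)) [0..<c]"
  have "ts \<in> lists typed_trees"
  proof -
    have "(\<lambda>u. t (Suc k # u)) \<in> typed_trees" if "k < c" for k
    proof (rule subtree_typed_trees[OF t])
      have "Suc k \<in> S" using that Sc by simp
      then show "[Suc k] \<in> dom t" by (simp add: S_def)
    qed
    then show ?thesis by (auto simp: ts_def)
  qed
  moreover have "t w = graft (root_type t) ts w" for w
  proof (cases w)
    case Nil
    then show ?thesis using typed_trees_root[OF t] by simp
  next
    case (Cons k u)
    have pre: "[k] \<in> dom t" if "k # u \<in> dom t"
      using that
    proof (induction u rule: rev_induct)
      case (snoc l u)
      then have "(k # u) @ [l] \<in> dom t" by simp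
      then have "k # u \<in> dom t" using pt unfolding planar_tree_def by blast
      then show ?case by (rule snoc.IH)
    qed
    show ?thesis
    proof (cases "k \<in> S")
      case True
      then have "1 \<le> k" "k \<le> c" using Sc by auto
      then obtain k' where "k = Suc k'" "k' < c" by (cases k) auto
      then show ?thesis using Cons by (simp add: ts_def)
    next
      case False
      then have "[k] \<notin> dom t" by (simp only: S_def mem_Collect_eq not_False_eq_True)
      then have "k # u \<notin> dom t" using pre by blast
      then have "t w = None" using Cons by (simp add: domIff)
      moreover have "k = 0 \<or> c < k" using False Sc by auto
      then have "graft (root_type t) ts w = None" using Cons by (cases k) (auto simp: ts_def)
      ultimately show ?thesis by simp
    qed
  qed
  ultimately show ?thesis using that by blast
qed

text \<open>
  The recursive structure of trees, in the form used to resum over them.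
\<close>

lemma bij_betw_graft:
  "bij_betw (graft i) (lists typed_trees) {t \<in> typed_trees. t [] = Some i}"
  unfolding bij_betw_def
proof (intro conjI inj_on_graft equalityI subsetI)
  fix t :: "nat list \<rightharpoonup> 'a" assume t: "t \<in> {t \<in> typed_trees. t [] = Some i}"
  then obtain ts where ts: "ts \<in> lists typed_trees" "t = graft (root_type t) ts"
    using typed_trees_graft_cases[of t] by blast
  have "root_type t = i" using t by (simp add: root_type_def)
  then show "t \<in> graft i ` lists typed_trees" using ts by blast
next
  fix t :: "nat list \<rightharpoonup> 'a" assume "t \<in> graft i ` lists typed_trees"
  then obtain ts where "ts \<in> lists typed_trees" "t = graft i ts" by blast
  then show "t \<in> {t \<in> typed_trees. t [] = Some i}" using graft_typed_trees by simp
qed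

section \<open>The generating function of the total progeny\<close>

text \<open>
  The generating function at \<open>x\<close> of the total progeny, with root type \<open>i\<close> and restricted to trees in \<open>A\<close>.
  The restriction gives access to finite truncations; values are extended reals as no bound
  is known at first.
\<close>

definition progeny_gf :: "('d::finite \<Rightarrow> (nat ^ 'd) pmf) \<Rightarrow> real \<Rightarrow> (nat list \<rightharpoonup> 'd) set \<Rightarrow> 'd \<Rightarrow> ennreal" where
  "progeny_gf \<mu> x A i = (\<integral>\<^sup>+t. (if t \<in> A \<and> t \<in> typed_trees \<and> t [] = Some i
      then ennreal (GW_weight \<mu> t * x ^ card (dom t)) else 0) \<partial>count_space UNIV)"

lemma GW_weight_nonneg: "0 \<le> GW_weight \<mu> t"
  unfolding GW_weight_def by (intro prod_nonneg ballI mult_nonneg_nonneg divide_nonneg_nonneg) auto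

text \<open>
  The branching property. The weight of a tree is a function of the types of the children of the root times
  the weights of the subtrees. Summing out the subtrees, then the order of the types, leaves
  the offspring generating function.
\<close>

lemma progeny_gf_graft:
  fixes \<mu> :: "'d::finite \<Rightarrow> (nat ^ 'd) pmf"
  assumes x: "0 \<le> x"
  shows "progeny_gf \<mu> x (graft i ` lists (A \<inter> typed_trees)) i
    = ennreal x * (\<integral>\<^sup>+z. (\<Prod>j\<in>UNIV. progeny_gf \<mu> x A j ^ (z $ j)) \<partial>measure_pmf (\<mu> i))"
proof -
  define v where "v t = (if t \<in> A \<and> t \<in> typed_trees then ennreal (GW_weight \<mu> t * x ^ card (dom t)) else 0)"
    for t :: "nat list \<rightharpoonup> 'd"
  define g where "g z = (\<Prod>j\<in>UNIV. fact (z $ j)) / fact (\<Sum>j\<in>UNIV. z $ j) * pmf (\<mu> i) z" for z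
  have g0: "0 \<le> g z" for z
    unfolding g_def by (intro mult_nonneg_nonneg divide_nonneg_nonneg prod_nonneg) auto
  have Vv: "(\<integral>\<^sup>+t. (if root_type t = j then v t else 0) \<partial>count_space UNIV) = progeny_gf \<mu> x A j" for j
    unfolding progeny_gf_def v_def
  proof (rule nn_integral_cong)
    fix t :: "nat list \<rightharpoonup> 'd"
    have "t [] = Some j \<longleftrightarrow> root_type t = j" if "t \<in> typed_trees"
      using typed_trees_root[OF that] by simp
    then show "(if root_type t = j then if t \<in> A \<and> t \<in> typed_trees
          then ennreal (GW_weight \<mu> t * x ^ card (dom t)) else 0 else 0)
      = (if t \<in> A \<and> t \<in> typed_trees \<and> t [] = Some j
          then ennreal (GW_weight \<mu> t * x ^ card (dom t)) else 0)"
      by (cases "t \<in> typed_trees") simp_all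
  qed
  have weight: "ennreal (GW_weight \<mu> (graft i ts) * x ^ card (dom (graft i ts)))
      = ennreal x * (ennreal (g (type_count (map root_type ts))) * prod_list (map v ts))"
    if ts: "ts \<in> lists (A \<inter> typed_trees)" for ts
  proof -
    have ts': "ts \<in> lists typed_trees" using ts by auto
    have "prod_list (map v ts) = ennreal (prod_list (map (\<lambda>t. GW_weight \<mu> t * x ^ card (dom t)) ts))"
      using ts
    proof (induction ts)
      case (Cons t ts)
      have "0 \<le> prod_list (map (\<lambda>t. GW_weight \<mu> t * x ^ card (dom t)) ts)"
        using x GW_weight_nonneg[of \<mu>] by (intro prod_list_nonneg) auto
      then show ?case using Cons x GW_weight_nonneg[of \<mu> t] by (simp add: v_def ennreal_mult)
    qed simp
    also have "prod_list (map (\<lambda>t. GW_weight \<mu> t * x ^ card (dom t)) ts)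
        = prod_list (map (GW_weight \<mu>) ts) * x ^ sum_list (map (\<lambda>t. card (dom t)) ts)"
      by (induction ts) (simp_all add: power_add mult_ac)
    finally have pv: "prod_list (map v ts)
        = ennreal (prod_list (map (GW_weight \<mu>) ts) * x ^ sum_list (map (\<lambda>t. card (dom t)) ts))" .
    have len: "length ts = (\<Sum>j\<in>UNIV. type_count (map root_type ts) $ j)"
      by (simp add: sum_type_count)
    have "GW_weight \<mu> (graft i ts) * x ^ card (dom (graft i ts))
        = x * (g (type_count (map root_type ts)) * (prod_list (map (GW_weight \<mu>) ts)
            * x ^ sum_list (map (\<lambda>t. card (dom t)) ts)))"
      unfolding GW_weight_graft[OF ts'] card_dom_graft[OF ts'] g_def sum_type_count by simp
    moreover have "0 \<le> prod_list (map (GW_weight \<mu>) ts) * x ^ sum_list (map (\<lambda>t. card (dom t)) ts)"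
      using x by (intro mult_nonneg_nonneg prod_list_nonneg) (auto simp: GW_weight_nonneg)
    ultimately show ?thesis unfolding pv using x g0 by (simp add: ennreal_mult mult_nonneg_nonneg)
  qed
  have sub: "lists (A \<inter> typed_trees) \<subseteq> lists (typed_trees :: (nat list \<rightharpoonup> 'd) set)" by auto
  have bij: "bij_betw (graft i) (lists (A \<inter> typed_trees)) (graft i ` lists (A \<inter> typed_trees))"
    by (rule inj_on_imp_bij_betw[OF inj_on_subset[OF inj_on_graft sub]])
  have "progeny_gf \<mu> x (graft i ` lists (A \<inter> typed_trees)) i
      = (\<integral>\<^sup>+t. ennreal (GW_weight \<mu> t * x ^ card (dom t)) \<partial>count_space (graft i ` lists (A \<inter> typed_trees)))"
  proof -
    let ?S = "graft i ` lists (A \<inter> typed_trees)"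
    have S: "t \<in> typed_trees \<and> t [] = Some i" if tS: "t \<in> ?S" for t
    proof -
      obtain ts where ts: "t = graft i ts" "ts \<in> lists (A \<inter> typed_trees)"
        using tS by (rule imageE)
      have "ts \<in> lists typed_trees" using sub ts(2) by (rule subsetD)
      from graft_typed_trees[OF this] show ?thesis using ts(1) by simp
    qed
    have "progeny_gf \<mu> x ?S i = (\<integral>\<^sup>+t. (if t \<in> ?S \<and> t \<in> typed_trees \<and> t [] = Some i
        then ennreal (GW_weight \<mu> t * x ^ card (dom t)) else 0) \<partial>count_space ?S)"
      unfolding progeny_gf_def by (rule nn_integral_count_space_eq) auto
    also have "\<dots> = (\<integral>\<^sup>+t. ennreal (GW_weight \<mu> t * x ^ card (dom t)) \<partial>count_space ?S)"
      by (rule nn_integral_cong) (use S in \<open>simp only: space_count_space simp_thms if_True\<close>)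
    finally show ?thesis .
  qed
  also have "\<dots> = (\<integral>\<^sup>+ts. ennreal (GW_weight \<mu> (graft i ts) * x ^ card (dom (graft i ts))) \<partial>count_space (lists (A \<inter> typed_trees)))"
    by (rule nn_integral_bij_count_space[OF bij, symmetric])
  also have "\<dots> = (\<integral>\<^sup>+ts. ennreal x * (ennreal (g (type_count (map root_type ts))) * prod_list (map v ts)) \<partial>count_space (lists (A \<inter> typed_trees)))"
    by (rule nn_integral_cong) (simp add: weight)
  also have "\<dots> = (\<integral>\<^sup>+ts. ennreal x * (ennreal (g (type_count (map root_type ts))) * prod_list (map v ts)) \<partial>count_space UNIV)"
  proof (rule nn_integral_count_space_eq)
    fix ts :: "(nat list \<rightharpoonup> 'd) list" assume "ts \<in> UNIV - lists (A \<inter> typed_trees)"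
    then obtain t where t: "t \<in> set ts" "t \<notin> A \<inter> typed_trees"
      unfolding in_lists_conv_set by blast
    then have "v t = 0" by (auto simp: v_def)
    then have "0 \<in> set (map v ts)" using t(1) by (metis image_eqI set_map)
    then have "prod_list (map v ts) = 0" by (simp only: prod_list_zero_iff)
    then show "ennreal x * (ennreal (g (type_count (map root_type ts))) * prod_list (map v ts)) = 0" by simp
  qed auto
  also have "\<dots> = ennreal x * (\<integral>\<^sup>+ts. ennreal (g (type_count (map root_type ts))) * prod_list (map v ts) \<partial>count_space UNIV)"
    by (rule nn_integral_cmult) simp
  also have "(\<integral>\<^sup>+ts. ennreal (g (type_count (map root_type ts))) * prod_list (map v ts) \<partial>count_space UNIV)
      = (\<integral>\<^sup>+e. ennreal (g (type_count e)) * prod_list (map (progeny_gf \<mu> x A) e) \<partial>count_space UNIV)"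
    using nn_integral_lists_by_root[of "\<lambda>e. ennreal (g (type_count e))" root_type v] unfolding Vv .
  also have "\<dots> = (\<integral>\<^sup>+e. ennreal (g (type_count e)) * (\<Prod>j\<in>UNIV. progeny_gf \<mu> x A j ^ (type_count e $ j)) \<partial>count_space UNIV)"
    by (simp add: prod_list_type_count)
  also have "\<dots> = (\<integral>\<^sup>+z. ennreal (real (card {e :: 'd list. type_count e = z}))
      * (ennreal (g z) * (\<Prod>j\<in>UNIV. progeny_gf \<mu> x A j ^ (z $ j))) \<partial>count_space UNIV)"
    by (rule nn_integral_lists_by_type_count)
  also have "\<dots> = (\<integral>\<^sup>+z. ennreal (pmf (\<mu> i) z) * (\<Prod>j\<in>UNIV. progeny_gf \<mu> x A j ^ (z $ j)) \<partial>count_space UNIV)"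
  proof (rule nn_integral_cong)
    fix z :: "nat ^ 'd"
    have "real (card {e :: 'd list. type_count e = z}) * g z
        = (real (card {e :: 'd list. type_count e = z}) * (\<Prod>j\<in>UNIV. fact (z $ j))) / fact (\<Sum>j\<in>UNIV. z $ j) * pmf (\<mu> i) z"
      by (simp add: g_def)
    also have "\<dots> = pmf (\<mu> i) z" unfolding card_type_count(2) by simp
    finally have "ennreal (real (card {e :: 'd list. type_count e = z})) * ennreal (g z) = ennreal (pmf (\<mu> i) z)"
      using g0[of z] by (simp add: ennreal_mult[symmetric])
    then show "ennreal (real (card {e :: 'd list. type_count e = z}))
      * (ennreal (g z) * (\<Prod>j\<in>UNIV. progeny_gf \<mu> x A j ^ (z $ j)))
      = ennreal (pmf (\<mu> i) z) * (\<Prod>j\<in>UNIV. progeny_gf \<mu> x A j ^ (z $ j))"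
      by (simp add: mult.assoc[symmetric])
  qed
  also have "\<dots> = (\<integral>\<^sup>+z. (\<Prod>j\<in>UNIV. progeny_gf \<mu> x A j ^ (z $ j)) \<partial>measure_pmf (\<mu> i))"
    by (rule nn_integral_measure_pmf[symmetric])
  finally show ?thesis .
qed

lemma progeny_gf_fixed_point:
  assumes x: "0 \<le> x"
  shows "progeny_gf \<mu> x UNIV i
    = ennreal x * (\<integral>\<^sup>+z. (\<Prod>j\<in>UNIV. progeny_gf \<mu> x UNIV j ^ (z $ j)) \<partial>measure_pmf (\<mu> i))"
proof -
  have im: "graft i ` lists typed_trees = {t \<in> typed_trees. t [] = Some i}"
    using bij_betw_graft by (rule bij_betw_imp_surj_on)
  have "progeny_gf \<mu> x UNIV i = progeny_gf \<mu> x (graft i ` lists (UNIV \<inter> typed_trees)) i"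
    unfolding progeny_gf_def by (intro nn_integral_cong) (auto simp: im)
  then show ?thesis by (simp only: progeny_gf_graft[OF x])
qed

text \<open>
  Trees with at most \<open>n + 1\<close> vertices have subtrees with at most \<open>n\<close> vertices, so the bound follows by
  induction on the size from the branching property, and for all trees by monotone convergence.
\<close>

lemma progeny_gf_le_1:
  assumes x: "0 \<le> x" "x \<le> 1" shows "progeny_gf \<mu> x UNIV i \<le> 1"
proof -
  define A where "A n = {t :: nat list \<rightharpoonup> 'a. card (dom t) \<le> n}" for n
  have bound: "progeny_gf \<mu> x (A n) i \<le> 1" for n i
  proof (induction n arbitrary: i)
    case 0
    have no: "\<not> (t \<in> A 0 \<and> t \<in> typed_trees \<and> t [] = Some i)" for t
    proof
      assume t: "t \<in> A 0 \<and> t \<in> typed_trees \<and> t [] = Some i"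
      then have "finite (dom t)" "[] \<in> dom t" by (auto simp: typed_trees_def planar_tree_def)
      then have "0 < card (dom t)" by (auto simp: card_gt_0_iff)
      then show False using t by (simp add: A_def)
    qed
    have "progeny_gf \<mu> x (A 0) i = (\<integral>\<^sup>+t. 0 \<partial>count_space (UNIV :: (nat list \<rightharpoonup> 'a) set))"
      unfolding progeny_gf_def by (rule nn_integral_cong) (rule if_not_P[OF no])
    then show ?case by simp
  next
    case (Suc n)
    have "progeny_gf \<mu> x (A (Suc n)) i \<le> progeny_gf \<mu> x (graft i ` lists (A n \<inter> typed_trees)) i"
      unfolding progeny_gf_def
    proof (rule nn_integral_mono)
      fix t
      have "t \<in> graft i ` lists (A n \<inter> typed_trees)" if t: "t \<in> A (Suc n)" "t \<in> typed_trees" "t [] = Some i"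
      proof -
        obtain ts where ts: "ts \<in> lists typed_trees" "t = graft i ts"
          using typed_trees_graft_cases[OF t(2)] t(3) by (auto simp: root_type_def)
        have "card (dom s) \<le> n" if "s \<in> set ts" for s
        proof -
          have "card (dom s) \<le> sum_list (map (\<lambda>t. card (dom t)) ts)"
            using that by (intro member_le_sum_list) auto
          then show ?thesis using t(1) card_dom_graft[OF ts(1), of i] ts(2) by (simp add: A_def)
        qed
        then have "ts \<in> lists (A n \<inter> typed_trees)" using ts(1) by (auto simp: A_def)
        then show ?thesis using ts(2) by blast
      qed
      then show "(if t \<in> A (Suc n) \<and> t \<in> typed_trees \<and> t [] = Some i
          then ennreal (GW_weight \<mu> t * x ^ card (dom t)) else 0)
        \<le> (if t \<in> graft i ` lists (A n \<inter> typed_trees) \<and> t \<in> typed_trees \<and> t [] = Some i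
          then ennreal (GW_weight \<mu> t * x ^ card (dom t)) else 0)" by auto
    qed
    also have "\<dots> = ennreal x * (\<integral>\<^sup>+z. (\<Prod>j\<in>UNIV. progeny_gf \<mu> x (A n) j ^ (z $ j)) \<partial>measure_pmf (\<mu> i))"
      by (rule progeny_gf_graft[OF x(1)])
    also have "\<dots> \<le> 1 * (\<integral>\<^sup>+z. 1 \<partial>measure_pmf (\<mu> i))"
      using x Suc.IH by (intro mult_mono nn_integral_mono prod_le_1 conjI power_le_one) auto
    finally show ?case by simp
  qed
  have "progeny_gf \<mu> x UNIV i = (SUP n. progeny_gf \<mu> x (A n) i)"
    unfolding progeny_gf_def
  proof (subst nn_integral_monotone_convergence_SUP[symmetric])
    show "incseq (\<lambda>n t. if t \<in> A n \<and> t \<in> typed_trees \<and> t [] = Some i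
        then ennreal (GW_weight \<mu> t * x ^ card (dom t)) else 0)"
      by (auto simp: incseq_def le_fun_def A_def)
    show "(\<integral>\<^sup>+t. (if t \<in> UNIV \<and> t \<in> typed_trees \<and> t [] = Some i
          then ennreal (GW_weight \<mu> t * x ^ card (dom t)) else 0) \<partial>count_space UNIV)
      = (\<integral>\<^sup>+t. (SUP n. if t \<in> A n \<and> t \<in> typed_trees \<and> t [] = Some i
        then ennreal (GW_weight \<mu> t * x ^ card (dom t)) else 0) \<partial>count_space UNIV)"
    proof (rule nn_integral_cong)
      fix t
      show "(if t \<in> UNIV \<and> t \<in> typed_trees \<and> t [] = Some i
          then ennreal (GW_weight \<mu> t * x ^ card (dom t)) else 0)
        = (SUP n. if t \<in> A n \<and> t \<in> typed_trees \<and> t [] = Some i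
          then ennreal (GW_weight \<mu> t * x ^ card (dom t)) else 0)"
        by (intro antisym SUP_least SUP_upper2[of "card (dom t)"]) (auto simp: A_def)
    qed
  qed auto
  also have "\<dots> \<le> 1" by (rule SUP_least) (rule bound)
  finally show ?thesis .
qed

lemma nn_integral_GW_tree_law:
  "(\<integral>\<^sup>+t. ennreal (x ^ card (dom t)) \<partial>GW_tree_law \<mu> i) = progeny_gf \<mu> x UNIV i" if "0 \<le> x"
proof -
  have "(\<integral>\<^sup>+t. ennreal (x ^ card (dom t)) \<partial>GW_tree_law \<mu> i)
      = (\<integral>\<^sup>+t. (if t [] = Some i then ennreal (GW_weight \<mu> t) else 0) * ennreal (x ^ card (dom t)) \<partial>count_space typed_trees)"
    unfolding GW_tree_law_def by (subst nn_integral_density) auto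
  also have "\<dots> = (\<integral>\<^sup>+t. (if t \<in> UNIV \<and> t \<in> typed_trees \<and> t [] = Some i
      then ennreal (GW_weight \<mu> t * x ^ card (dom t)) else 0) \<partial>count_space typed_trees)"
    using that by (intro nn_integral_cong) (simp add: ennreal_mult GW_weight_nonneg)
  also have "\<dots> = progeny_gf \<mu> x UNIV i"
    unfolding progeny_gf_def by (rule nn_integral_count_space_eq) auto
  finally show ?thesis .
qed

section \<open>Fixed vectors of an irreducible mean matrix\<close>

context
  fixes \<mu> :: "'d::finite \<Rightarrow> (nat ^ 'd) pmf"
begin

lemma mean_matrix_nonneg: "0 \<le> mean_matrix \<mu> $ i $ j"
  by (simp add: mean_matrix_def)

lemma mean_matrix_power_fixed:
  assumes "mean_matrix \<mu> *v x = x"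
  shows "((\<lambda>A. mean_matrix \<mu> ** A) ^^ n) (mat 1) *v x = x"
proof (induction n)
  case (Suc n)
  then show ?case using assms by (simp add: matrix_vector_mul_assoc[symmetric])
qed simp

lemma mean_matrix_power_nonneg: "0 \<le> ((\<lambda>A. mean_matrix \<mu> ** A) ^^ n) (mat 1) $ i $ j"
proof (induction n arbitrary: i j)
  case 0
  then show ?case by (simp add: mat_def)
next
  case (Suc n)
  then show ?case
    by (simp add: matrix_matrix_mult_def sum_nonneg mean_matrix_nonneg)
qed

lemma irreducible_fixed_positive:
  assumes irr: "irreducible_dist \<mu>" and fx: "mean_matrix \<mu> *v x = x"
    and nn: "\<And>j. 0 \<le> x $ j" and pos: "0 < x $ j"
  shows "0 < x $ i"
proof -
  obtain n where n: "0 < ((\<lambda>A. mean_matrix \<mu> ** A) ^^ n) (mat 1) $ i $ j"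
    using irr unfolding irreducible_dist_def by blast
  let ?P = "((\<lambda>A. mean_matrix \<mu> ** A) ^^ n) (mat 1)"
  have "0 < ?P $ i $ j * x $ j" using n pos by simp
  also have "\<dots> \<le> (\<Sum>k\<in>UNIV. ?P $ i $ k * x $ k)"
    by (rule member_le_sum) (auto intro!: mult_nonneg_nonneg mean_matrix_power_nonneg nn)
  also have "\<dots> = (?P *v x) $ i" by (simp add: matrix_vector_mult_def)
  also have "\<dots> = x $ i" using mean_matrix_power_fixed[OF fx] by simp
  finally show ?thesis .
qed

text \<open>
  Subtract from \<open>x\<close> the largest multiple of \<open>b\<close> that leaves a nonnegative vector. The difference is fixed
  and has a zero entry, so by irreducibility it vanishes.
\<close>

lemma irreducible_fixed_proportional:
  assumes irr: "irreducible_dist \<mu>" and fx: "mean_matrix \<mu> *v x = x" and fb: "mean_matrix \<mu> *v b = b"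
    and nn: "\<And>j. 0 \<le> x $ j" and b: "\<And>j. 0 < b $ j"
  obtains c where "0 \<le> c" "x = c *\<^sub>R b"
proof -
  define c where "c = Min (range (\<lambda>j. x $ j / b $ j))"
  have c_le: "c \<le> x $ j / b $ j" for j unfolding c_def by (rule Min_le) auto
  have "c \<in> range (\<lambda>j. x $ j / b $ j)" unfolding c_def by (rule Min_in) auto
  then obtain j where j: "c = x $ j / b $ j" by blast
  define y where "y = x - c *\<^sub>R b"
  have y_fixed: "mean_matrix \<mu> *v y = y"
    unfolding y_def by (simp add: matrix_vector_mult_diff_distrib fx fb matrix_vector_mult_scaleR)
  have y0: "0 \<le> y $ k" for k
    using c_le[of k] b[of k] by (simp add: y_def pos_le_divide_eq)
  have "y $ j = 0" using j b[of j] by (simp add: y_def)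
  then have "y $ k = 0" for k
    using irreducible_fixed_positive[OF irr y_fixed y0, of k j] y0[of k] by linarith
  then have "x = c *\<^sub>R b" by (simp add: y_def vec_eq_iff)
  moreover have "0 \<le> c" using j nn[of j] b[of j] by simp
  ultimately show ?thesis using that by blast
qed

end

section \<open>Uniqueness of the fixed point of the offspring generating functions\<close>

lemma weierstrass_power_product:
  fixes p :: "'a \<Rightarrow> real"
  assumes "finite A" "\<And>j. j \<in> A \<Longrightarrow> 0 \<le> p j \<and> p j \<le> 1"
  shows "1 - (\<Sum>j\<in>A. real (z j) * (1 - p j)) \<le> (\<Prod>j\<in>A. p j ^ z j)"
  using assms
proof (induction A)
  case (insert a A)
  define u P s t where "u = p a ^ z a" and "P = (\<Prod>j\<in>A. p j ^ z j)"
    and "s = real (z a) * (1 - p a)" and "t = (\<Sum>j\<in>A. real (z j) * (1 - p j))"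
  have "1 + real (z a) * (p a - 1) \<le> (1 + (p a - 1)) ^ z a"
    by (rule Bernoulli_inequality) (use insert.prems[of a] in auto)
  then have u: "1 - s \<le> u" by (simp add: u_def s_def algebra_simps)
  have u1: "0 \<le> u" "u \<le> 1" using insert.prems[of a] by (auto simp: u_def power_le_one)
  have P: "1 - t \<le> P" using insert by (simp add: P_def t_def)
  have P1: "0 \<le> P" "P \<le> 1" unfolding P_def using insert.prems
    by (auto intro!: prod_nonneg prod_le_1 simp: power_le_one)
  have "(1 - u) * P \<le> (1 - u) * 1" using u1 P1 by (intro mult_left_mono) auto
  then have "u * P \<ge> P - (1 - u)" by (simp add: algebra_simps)
  then have "1 - (s + t) \<le> u * P" using u P by linarith
  then show ?case using insert.hyps by (simp add: u_def P_def s_def t_def)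
qed simp

text \<open>
  Splitting off one factor \<open>p j\<close> leaves a nonempty product, and the cross term
  \<open>(1 - p j) * S\<close> makes the inequality strict.
\<close>

lemma weierstrass_power_product_strict:
  fixes p :: "'d::finite \<Rightarrow> real"
  assumes p: "\<And>j. 0 \<le> p j \<and> p j < 1" and z: "2 \<le> (\<Sum>j\<in>UNIV. z j)"
  shows "1 - (\<Sum>j\<in>UNIV. real (z j) * (1 - p j)) < (\<Prod>j\<in>UNIV. p j ^ z j)"
proof -
  obtain j where j: "0 < z j" using z by (metis gr_zeroI not_numeral_le_zero sum.neutral)
  define z' where "z' k = (if k = j then z j - 1 else z k)" for k
  have zz: "z k = z' k + (if k = j then 1 else 0)" for k using j by (simp add: z'_def)
  have "(\<Sum>k\<in>UNIV. z k) = (\<Sum>k\<in>UNIV. z' k) + 1" by (simp add: zz sum.distrib)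
  then obtain l where l: "0 < z' l" using z by (metis gr_zeroI not_numeral_le_zero sum.neutral add.left_neutral numeral_le_one_iff semiring_norm(69))
  define S where "S = (\<Sum>k\<in>UNIV. real (z' k) * (1 - p k))"
  have pk: "0 \<le> 1 - p k" for k using p[of k] by simp
  have "0 < real (z' l) * (1 - p l)" using l p[of l] by simp
  also have "\<dots> \<le> S" unfolding S_def by (rule member_le_sum) (auto intro!: mult_nonneg_nonneg pk)
  finally have S: "0 < S" .
  have prod: "(\<Prod>k\<in>UNIV. p k ^ z k) = p j * (\<Prod>k\<in>UNIV. p k ^ z' k)"
  proof -
    have "(\<Prod>k\<in>UNIV. p k ^ z k) = (\<Prod>k\<in>UNIV. p k ^ z' k * (if k = j then p k else 1))"
      by (rule prod.cong) (auto simp: zz)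
    then show ?thesis by (simp add: prod.distrib mult.commute)
  qed
  have sum: "(\<Sum>k\<in>UNIV. real (z k) * (1 - p k)) = S + (1 - p j)"
  proof -
    have "(\<Sum>k\<in>UNIV. real (z k) * (1 - p k))
        = (\<Sum>k\<in>UNIV. real (z' k) * (1 - p k) + (if k = j then 1 - p k else 0))"
      by (rule sum.cong) (auto simp: zz algebra_simps)
    then show ?thesis by (simp add: sum.distrib S_def)
  qed
  have ge: "1 - S \<le> (\<Prod>k\<in>UNIV. p k ^ z' k)"
    unfolding S_def by (rule weierstrass_power_product) (use p in \<open>auto simp: less_imp_le\<close>)
  show ?thesis
  proof (cases "p j = 0")
    case True
    then show ?thesis unfolding prod sum using S by simp
  next
    case False
    have "p j * (1 - S) \<le> p j * (\<Prod>k\<in>UNIV. p k ^ z' k)" using ge p[of j] by (intro mult_left_mono) auto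
    moreover have "p j * S < S" using S p[of j] by simp
    ultimately show ?thesis unfolding prod sum by (simp add: algebra_simps)
  qed
qed

lemma finite_means_integrable:
  assumes "finite_means \<mu>" shows "integrable (measure_pmf (\<mu> i)) (\<lambda>z. real (z $ j))"
  using assms by (simp add: finite_means_def)

lemma expectation_linear_offspring:
  fixes c :: "'d::finite \<Rightarrow> real"
  assumes "finite_means \<mu>"
  shows "integrable (measure_pmf (\<mu> i)) (\<lambda>z. \<Sum>j\<in>UNIV. real (z $ j) * c j)"
    and "measure_pmf.expectation (\<mu> i) (\<lambda>z. \<Sum>j\<in>UNIV. real (z $ j) * c j) = (\<Sum>j\<in>UNIV. mean_matrix \<mu> $ i $ j * c j)"
  using finite_means_integrable[OF assms, of i] by (simp_all add: mean_matrix_def)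

lemma expectation_pmf_zero:
  assumes int: "integrable (measure_pmf p) f" and nn: "\<And>z. 0 \<le> (f z :: real)"
    and zero: "measure_pmf.expectation p f = 0" and z: "z \<in> set_pmf p"
  shows "f z = 0"
proof -
  have "AE z in measure_pmf p. f z = 0"
    using integral_nonneg_eq_0_iff_AE[OF int] nn zero by simp
  then show ?thesis using z by (simp add: AE_measure_pmf_iff)
qed

lemma left_eigenvector_sum:
  assumes "a v* M = a" shows "(\<Sum>i\<in>UNIV. a $ i * (\<Sum>j\<in>UNIV. M $ i $ j * c j)) = (\<Sum>j\<in>UNIV. a $ j * c j)"
proof -
  have "(\<Sum>i\<in>UNIV. a $ i * (\<Sum>j\<in>UNIV. M $ i $ j * c j)) = (\<Sum>i\<in>UNIV. \<Sum>j\<in>UNIV. a $ i * M $ i $ j * c j)"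
    by (simp add: sum_distrib_left mult.assoc)
  also have "\<dots> = (\<Sum>j\<in>UNIV. \<Sum>i\<in>UNIV. a $ i * M $ i $ j * c j)" by (rule sum.swap)
  also have "\<dots> = (\<Sum>j\<in>UNIV. (a v* M) $ j * c j)"
    by (simp add: vector_matrix_mult_def sum_distrib_right mult_ac)
  finally show ?thesis using assms by simp
qed

lemma positive_weights_zero:
  fixes a :: "real ^ 'd::finite"
  assumes "\<And>j. 0 < a $ j" "\<And>j. 0 \<le> e j" "(\<Sum>j\<in>UNIV. a $ j * e j) = 0"
  shows "e j = (0::real)"
proof -
  have "a $ j * e j = 0"
    using assms sum_nonneg_eq_0_iff[of UNIV "\<lambda>j. a $ j * e j"] by (simp add: less_imp_le)
  then show ?thesis using assms(1)[of j] by simp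
qed

text \<open>
  For a fixed point \<open>p\<close> the inequality of Weierstrass gives \<open>q \<le> M q\<close> for \<open>q = 1 - p\<close>, and pairing with
  the left eigenvector forces equality, almost surely under every offspring law. So \<open>q\<close> is fixed by
  the mean matrix and, if not zero, positive. But then equality means at most one child almost
  surely; pairing with the left eigenvector once more gives exactly one child, against
  non-degeneracy.
\<close>

lemma offspring_fixed_point_unique:
  fixes \<mu> :: "'d::finite \<Rightarrow> (nat ^ 'd) pmf" and p :: "'d \<Rightarrow> real"
  assumes fm: "finite_means \<mu>" and irr: "irreducible_dist \<mu>" and nd: "nondegenerate_dist \<mu>"
    and ab: "normalized_eigenvectors (mean_matrix \<mu>) a b"
    and p: "\<And>j. 0 \<le> p j \<and> p j \<le> 1"
    and fix_p: "\<And>i. p i = measure_pmf.expectation (\<mu> i) (\<lambda>z. \<Prod>j\<in>UNIV. p j ^ (z $ j))"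
  shows "p i = 1"
proof -
  have a: "a v* mean_matrix \<mu> = a" "\<And>j. 0 < a $ j"
    using ab by (auto simp: normalized_eigenvectors_def)
  define h where "h z = (\<Prod>j\<in>UNIV. p j ^ (z $ j)) - 1 + (\<Sum>j\<in>UNIV. real (z $ j) * (1 - p j))" for z :: "nat ^ 'd"
  have h0: "0 \<le> h z" for z
    using weierstrass_power_product[of UNIV p "\<lambda>j. z $ j"] p by (simp add: h_def)
  have prod01: "0 \<le> (\<Prod>j\<in>UNIV. p j ^ (z $ j)) \<and> (\<Prod>j\<in>UNIV. p j ^ (z $ j)) \<le> 1" for z :: "nat ^ 'd"
    using p by (auto intro!: prod_nonneg prod_le_1 simp: power_le_one)
  have intp: "integrable (measure_pmf (\<mu> i)) (\<lambda>z. \<Prod>j\<in>UNIV. p j ^ (z $ j))" for i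
    by (rule measure_pmf.integrable_const_bound[of _ 1]) (use prod01 in auto)
  note inth = expectation_linear_offspring[OF fm, of _ "\<lambda>j. 1 - p j"]
  have hint: "integrable (measure_pmf (\<mu> i)) h" for i
    unfolding h_def using intp[of i] inth(1)[of i] by auto
  have Eh: "measure_pmf.expectation (\<mu> i) h
      = (\<Sum>j\<in>UNIV. mean_matrix \<mu> $ i $ j * (1 - p j)) - (1 - p i)" for i
    unfolding h_def using intp[of i] inth[of i] by (simp add: fix_p[of i, symmetric])
  have Eh0: "0 \<le> measure_pmf.expectation (\<mu> i) h" for i
    by (rule integral_nonneg_AE) (simp add: h0)
  have "(\<Sum>i\<in>UNIV. a $ i * measure_pmf.expectation (\<mu> i) h) = 0"
    unfolding Eh right_diff_distrib sum_subtractf left_eigenvector_sum[OF a(1)] by simp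
  then have Ehz: "measure_pmf.expectation (\<mu> i) h = 0" for i
    by (rule positive_weights_zero[OF a(2) Eh0])
  define q where "q = (\<chi> j. 1 - p j)"
  have q_fixed: "mean_matrix \<mu> *v q = q"
    using Ehz unfolding Eh by (simp add: vec_eq_iff matrix_vector_mult_def q_def)
  have q0: "0 \<le> q $ j" for j using p by (simp add: q_def)
  show ?thesis
  proof (rule ccontr)
    assume "p i \<noteq> 1"
    then have "0 < q $ i" using p[of i] by (simp add: q_def)
    from irreducible_fixed_positive[OF irr q_fixed q0 this]
    have "0 < q $ j" for j .
    then have p1: "0 \<le> p j \<and> p j < 1" for j using p[of j] by (simp add: q_def)
    have le1: "(\<Sum>j\<in>UNIV. z $ j) \<le> 1" if "z \<in> set_pmf (\<mu> i)" for i z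
    proof (rule ccontr)
      assume "\<not> (\<Sum>j\<in>UNIV. z $ j) \<le> 1"
      then have "2 \<le> (\<Sum>j\<in>UNIV. z $ j)" by simp
      from weierstrass_power_product_strict[where p = p and z = "\<lambda>j. z $ j", OF p1 this] have "0 < h z" by (simp add: h_def)
      moreover have "h z = 0" by (rule expectation_pmf_zero[OF hint h0 Ehz that])
      ultimately show False by simp
    qed
    define r where "r z = 1 - (\<Sum>j\<in>UNIV. real (z $ j) * 1)" for z :: "nat ^ 'd"
    note int1 = expectation_linear_offspring[OF fm, of _ "\<lambda>j. 1"]
    have rint: "integrable (measure_pmf (\<mu> i)) r" for i
      unfolding r_def using int1(1)[of i] by auto
    have Er: "measure_pmf.expectation (\<mu> i) r = 1 - (\<Sum>j\<in>UNIV. mean_matrix \<mu> $ i $ j * 1)" for i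
      unfolding r_def using int1[of i] by simp
    have r0: "0 \<le> r z" if "z \<in> set_pmf (\<mu> i)" for z i
    proof -
      have "real (\<Sum>j\<in>UNIV. z $ j) \<le> real 1" by (rule of_nat_mono) (rule le1[OF that])
      then show ?thesis by (simp add: r_def)
    qed
    have Er0: "0 \<le> measure_pmf.expectation (\<mu> i) r" for i
      by (rule integral_nonneg_AE) (simp add: AE_measure_pmf_iff r0)
    have "(\<Sum>i\<in>UNIV. a $ i * measure_pmf.expectation (\<mu> i) r) = 0"
      unfolding Er right_diff_distrib sum_subtractf left_eigenvector_sum[OF a(1)] by simp
    then have Erz: "measure_pmf.expectation (\<mu> i) r = 0" for i
      by (rule positive_weights_zero[OF a(2) Er0])
    have "(\<Sum>j\<in>UNIV. z $ j) = 1" if z: "z \<in> set_pmf (\<mu> i)" for i z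
    proof -
      have "AE z in measure_pmf (\<mu> i). r z = 0"
        using integral_nonneg_eq_0_iff_AE[OF rint[of i]] Erz[of i] r0 by (simp add: AE_measure_pmf_iff)
      then have "r z = 0" using z by (simp add: AE_measure_pmf_iff)
      then have "real (\<Sum>j\<in>UNIV. z $ j) = real 1" by (simp add: r_def)
      then show ?thesis by (simp only: of_nat_eq_iff)
    qed
    then have "measure_pmf.prob (\<mu> i) {z. (\<Sum>j\<in>UNIV. z $ j) \<noteq> 1} = 0" for i
      by (subst measure_pmf_zero_iff) auto
    then show False using nd by (simp add: nondegenerate_dist_def)
  qed
qed

text \<open>
  Otherwise 0 would be a second fixed point.
\<close>

lemma exists_childless_type:
  fixes \<mu> :: "'d::finite \<Rightarrow> (nat ^ 'd) pmf"
  assumes fm: "finite_means \<mu>" and irr: "irreducible_dist \<mu>" and nd: "nondegenerate_dist \<mu>"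
    and ab: "normalized_eigenvectors (mean_matrix \<mu>) a b"
  shows "\<exists>i. 0 \<in> set_pmf (\<mu> i)"
proof (rule ccontr)
  assume no: "\<not> ?thesis"
  have "(0::real) = measure_pmf.expectation (\<mu> i) (\<lambda>z. \<Prod>j\<in>UNIV. 0 ^ (z $ j))" for i
  proof -
    have "AE z in measure_pmf (\<mu> i). (\<Prod>j\<in>UNIV. (0::real) ^ (z $ j)) = 0"
    proof (simp only: AE_measure_pmf_iff, intro ballI)
      fix z assume "z \<in> set_pmf (\<mu> i)"
      then have "z \<noteq> 0" using no by auto
      then obtain j where "z $ j \<noteq> 0" by (auto simp: vec_eq_iff)
      then show "(\<Prod>j\<in>UNIV. (0::real) ^ (z $ j)) = 0"
        by (intro prod_zero bexI[of _ j]) auto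
    qed
    then show ?thesis by (simp add: integral_eq_zero_AE)
  qed
  from offspring_fixed_point_unique[OF fm irr nd ab _ this] show False by simp
qed

section \<open>The law of the total progeny\<close>

lemma progeny_gf_real:
  assumes x: "0 \<le> x" "x \<le> 1"
  shows "progeny_gf \<mu> x UNIV i = ennreal (enn2real (progeny_gf \<mu> x UNIV i))"
    and "0 \<le> enn2real (progeny_gf \<mu> x UNIV i)" "enn2real (progeny_gf \<mu> x UNIV i) \<le> 1"
proof -
  have "progeny_gf \<mu> x UNIV i < \<top>" using progeny_gf_le_1[OF x, of \<mu> i] by (simp add: le_less_trans)
  then show 1: "progeny_gf \<mu> x UNIV i = ennreal (enn2real (progeny_gf \<mu> x UNIV i))" by simp
  show "0 \<le> enn2real (progeny_gf \<mu> x UNIV i)" by simp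
  show "enn2real (progeny_gf \<mu> x UNIV i) \<le> 1"
    using progeny_gf_le_1[OF x, of \<mu> i] by (simp add: enn2real_leI)
qed

lemma progeny_gf_real_fixed_point:
  fixes \<mu> :: "'d::finite \<Rightarrow> (nat ^ 'd) pmf"
  assumes x: "0 \<le> x" "x \<le> 1"
  defines "G \<equiv> \<lambda>i. enn2real (progeny_gf \<mu> x UNIV i)"
  shows "G i = x * measure_pmf.expectation (\<mu> i) (\<lambda>z. \<Prod>j\<in>UNIV. G j ^ (z $ j))"
proof -
  have G: "progeny_gf \<mu> x UNIV j = ennreal (G j)" "0 \<le> G j" "G j \<le> 1" for j
    using progeny_gf_real[OF x, of \<mu> j] by (auto simp: G_def)
  have prod01: "0 \<le> (\<Prod>j\<in>UNIV. G j ^ (z $ j)) \<and> (\<Prod>j\<in>UNIV. G j ^ (z $ j)) \<le> 1" for z :: "nat ^ 'd"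
    using G(2,3) by (auto intro!: prod_nonneg prod_le_1 simp: power_le_one)
  have intp: "integrable (measure_pmf (\<mu> i)) (\<lambda>z. \<Prod>j\<in>UNIV. G j ^ (z $ j))"
    by (rule measure_pmf.integrable_const_bound[of _ 1]) (use prod01 in auto)
  have "ennreal (G i) = ennreal x * (\<integral>\<^sup>+z. (\<Prod>j\<in>UNIV. ennreal (G j) ^ (z $ j)) \<partial>measure_pmf (\<mu> i))"
    using progeny_gf_fixed_point[OF x(1), of \<mu> i] unfolding G(1) .
  also have "(\<integral>\<^sup>+z. (\<Prod>j\<in>UNIV. ennreal (G j) ^ (z $ j)) \<partial>measure_pmf (\<mu> i))
      = (\<integral>\<^sup>+z. ennreal (\<Prod>j\<in>UNIV. G j ^ (z $ j)) \<partial>measure_pmf (\<mu> i))"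
    using G(2) by (simp add: ennreal_power prod_ennreal)
  also have "\<dots> = ennreal (measure_pmf.expectation (\<mu> i) (\<lambda>z. \<Prod>j\<in>UNIV. G j ^ (z $ j)))"
    by (rule nn_integral_eq_integral[OF intp]) (use prod01 in auto)
  finally have "ennreal (G i) = ennreal (x * measure_pmf.expectation (\<mu> i) (\<lambda>z. \<Prod>j\<in>UNIV. G j ^ (z $ j)))"
    using x by (simp add: ennreal_mult')
  then show ?thesis
    using x G(2) prod01 by (subst (asm) ennreal_inj) (auto intro!: mult_nonneg_nonneg integral_nonneg_AE)
qed

text \<open>
  The masses of the laws on finite trees form a fixed point of the offspring generating functions, so they
  are 1: the trees are almost surely finite.
\<close>

lemma GW_tree_law_prob_space:
  fixes \<mu> :: "'d::finite \<Rightarrow> (nat ^ 'd) pmf"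
  assumes fm: "finite_means \<mu>" and irr: "irreducible_dist \<mu>" and nd: "nondegenerate_dist \<mu>"
    and ab: "normalized_eigenvectors (mean_matrix \<mu>) a b"
  shows "prob_space (GW_tree_law \<mu> i)"
proof
  define Q where "Q i = enn2real (progeny_gf \<mu> 1 UNIV i)" for i
  have "Q i = 1"
  proof (rule offspring_fixed_point_unique[OF fm irr nd ab])
    show "0 \<le> Q j \<and> Q j \<le> 1" for j using progeny_gf_real[of 1 \<mu> j] by (simp add: Q_def)
    show "Q i = measure_pmf.expectation (\<mu> i) (\<lambda>z. \<Prod>j\<in>UNIV. Q j ^ (z $ j))" for i
      using progeny_gf_real_fixed_point[of 1 \<mu> i] by (simp add: Q_def)
  qed
  then have "progeny_gf \<mu> 1 UNIV i = 1" using progeny_gf_real(1)[of 1 \<mu> i] by (simp add: Q_def)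
  then show "emeasure (GW_tree_law \<mu> i) (space (GW_tree_law \<mu> i)) = 1"
    using nn_integral_GW_tree_law[of 1 \<mu> i] by simp
qed

lemma integral_GW_tree_law:
  assumes "prob_space (GW_tree_law \<mu> i)" and x: "0 \<le> x" "x \<le> 1"
  shows "integrable (GW_tree_law \<mu> i) (\<lambda>t. x ^ card (dom t))"
    and "(\<integral>t. x ^ card (dom t) \<partial>GW_tree_law \<mu> i) = enn2real (progeny_gf \<mu> x UNIV i)"
proof -
  interpret prob_space "GW_tree_law \<mu> i" by fact
  have [measurable]: "(\<lambda>t. x ^ card (dom t)) \<in> borel_measurable (GW_tree_law \<mu> i)"
    by (simp add: GW_tree_law_def)
  show "integrable (GW_tree_law \<mu> i) (\<lambda>t. x ^ card (dom t))"
    by (rule integrable_const_bound[of _ 1]) (use x in \<open>auto simp: power_le_one\<close>)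
  show "(\<integral>t. x ^ card (dom t) \<partial>GW_tree_law \<mu> i) = enn2real (progeny_gf \<mu> x UNIV i)"
    using nn_integral_GW_tree_law[OF x(1), of \<mu> i] x
    by (subst integral_eq_nn_integral) auto
qed

section \<open>Asymptotics of the Laplace exponent of the total progeny\<close>

lemma Theta_bounds:
  assumes fin: "finite_measure L" and sets: "sets L = sets (restrict_space borel (sphere 0 1))"
    and \<alpha>: "0 \<le> \<alpha>"
  shows "0 \<le> Theta \<alpha> L s" and "norm s \<le> 1 \<Longrightarrow> Theta \<alpha> L s \<le> measure L (space L)"
    and "integrable L (\<lambda>y. \<bar>s \<bullet> y\<bar> powr \<alpha>)"
proof -
  interpret finite_measure L by fact
  have sp: "space L = sphere 0 1"
    using sets_eq_imp_space_eq[OF sets] by (simp add: space_restrict_space)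
  have meas: "(\<lambda>y. \<bar>s \<bullet> y\<bar> powr \<alpha>) \<in> borel_measurable L"
    unfolding measurable_cong_sets[OF sets refl] by (intro measurable_restrict_space1) measurable
  have bound: "\<bar>s \<bullet> y\<bar> powr \<alpha> \<le> norm s powr \<alpha>" if "y \<in> space L" for y
  proof -
    have "norm y = 1" using that sp by simp
    then have "\<bar>s \<bullet> y\<bar> \<le> norm s" using Cauchy_Schwarz_ineq2[of s y] by simp
    then show ?thesis using \<alpha> by (intro powr_mono2) auto
  qed
  show int: "integrable L (\<lambda>y. \<bar>s \<bullet> y\<bar> powr \<alpha>)"
    by (rule integrable_const_bound[of _ "norm s powr \<alpha>", OF _ meas]) (use bound in auto)
  show "0 \<le> Theta \<alpha> L s" unfolding Theta_def by (rule integral_nonneg_AE) simp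
  assume s: "norm s \<le> 1"
  have "\<bar>s \<bullet> y\<bar> powr \<alpha> \<le> 1" if "y \<in> space L" for y
  proof -
    have "norm s powr \<alpha> \<le> 1 powr \<alpha>" using s \<alpha> by (intro powr_mono2) auto
    then show ?thesis using bound[OF that] by simp
  qed
  then have "Theta \<alpha> L s \<le> (\<integral>y. 1 \<partial>L)"
    unfolding Theta_def by (intro integral_mono int) auto
  then show "Theta \<alpha> L s \<le> measure L (space L)" by simp
qed

lemma Theta_continuous:
  assumes fin: "finite_measure L" and sets: "sets L = sets (restrict_space borel (sphere 0 1))"
    and \<alpha>: "0 < \<alpha>" and u: "u \<longlonglongrightarrow> v" "\<And>n. norm (u n) \<le> 1"
  shows "(\<lambda>n. Theta \<alpha> L (u n)) \<longlonglongrightarrow> Theta \<alpha> L v"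
  unfolding Theta_def
proof (rule integral_dominated_convergence[where w = "\<lambda>_. 1"])
  interpret finite_measure L by fact
  have sp: "space L = sphere 0 1"
    using sets_eq_imp_space_eq[OF sets] by (simp add: space_restrict_space)
  have meas: "(\<lambda>y. \<bar>s \<bullet> y\<bar> powr \<alpha>) \<in> borel_measurable L" for s
    unfolding measurable_cong_sets[OF sets refl] by (intro measurable_restrict_space1) measurable
  show "(\<lambda>y. \<bar>v \<bullet> y\<bar> powr \<alpha>) \<in> borel_measurable L" by (rule meas)
  show "(\<lambda>y. \<bar>u n \<bullet> y\<bar> powr \<alpha>) \<in> borel_measurable L" for n by (rule meas)
  show "integrable L (\<lambda>_. 1 :: real)" by simp
  show "AE y in L. (\<lambda>n. \<bar>u n \<bullet> y\<bar> powr \<alpha>) \<longlonglongrightarrow> \<bar>v \<bullet> y\<bar> powr \<alpha>"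
    using \<alpha> by (intro always_eventually allI tendsto_powr' tendsto_intros u) auto
  show "AE y in L. norm (\<bar>u n \<bullet> y\<bar> powr \<alpha>) \<le> 1" for n
    using AE_space
  proof eventually_elim
    case (elim y)
    then have "norm y = 1" using sp by simp
    then have "\<bar>u n \<bullet> y\<bar> \<le> 1" using Cauchy_Schwarz_ineq2[of "u n" y] u(2)[of n] by simp
    then have "\<bar>u n \<bullet> y\<bar> powr \<alpha> \<le> 1 powr \<alpha>" using \<alpha> by (intro powr_mono2) auto
    then show ?case by simp
  qed
qed

lemma Theta_scaleR:
  assumes "0 < c" shows "Theta \<alpha> L (c *\<^sub>R s) = c powr \<alpha> * Theta \<alpha> L s"
  using assms by (simp add: Theta_def abs_mult powr_mult)

lemma powr_tendsto_zero:
  fixes N :: "nat \<Rightarrow> real"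
  assumes "N \<longlonglongrightarrow> 0" "\<And>n. 0 < N n" "0 < \<delta>" shows "(\<lambda>n. N n powr \<delta>) \<longlonglongrightarrow> 0"
  using tendsto_powr'[OF assms(1) tendsto_const[of \<delta>]] assms(2,3) by (simp add: less_imp_le)

locale offspring_asymptotics =
  fixes \<mu> :: "'d::finite \<Rightarrow> (nat ^ 'd) pmf" and \<Delta> :: "'d set" and \<alpha> :: "'d \<Rightarrow> real"
    and \<Lambda> :: "'d \<Rightarrow> (real ^ 'd) measure" and a b :: "real ^ 'd"
  assumes main: "main_assumptions \<mu> \<Delta> \<alpha> \<Lambda>"
    and eigen: "normalized_eigenvectors (mean_matrix \<mu>) a b"
begin

abbreviation "M \<equiv> mean_matrix \<mu>"
abbreviation "\<alpha>0 \<equiv> alpha_min \<alpha>"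
abbreviation "Th i \<equiv> Theta (\<alpha> i) (\<Lambda> i)"

lemma means_finite: "finite_means \<mu>" and irreducible: "irreducible_dist \<mu>" and nondegenerate: "nondegenerate_dist \<mu>"
  and \<Delta>: "\<Delta> \<noteq> {}"
  using main by (auto simp: main_assumptions_def)

lemma left_eigenvector: "a v* M = a" "\<And>j. 0 < a $ j" "(\<Sum>j\<in>UNIV. a $ j) = 1"
  and right_eigenvector: "M *v b = b" "\<And>j. 0 < b $ j"
  using eigen by (auto simp: normalized_eigenvectors_def inner_vec_def)

lemma Lambda_null:
  assumes "i \<notin> \<Delta>" shows "\<Lambda> i = null_measure (restrict_space borel (sphere 0 1))"
  using main assms unfolding main_assumptions_def by blast

lemma Lambda_fin: "finite_measure (\<Lambda> i)"
proof (cases "i \<in> \<Delta>")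
  case True
  then show ?thesis using main unfolding main_assumptions_def by blast
next
  case False
  then show ?thesis unfolding Lambda_null[OF False] by (intro finite_measureI) simp
qed

lemma Lambda_sets: "sets (\<Lambda> i) = sets (restrict_space borel (sphere 0 1))"
proof (cases "i \<in> \<Delta>")
  case True
  then show ?thesis using main unfolding main_assumptions_def by blast
next
  case False
  then show ?thesis unfolding Lambda_null[OF False] by simp
qed

lemma alpha_min_in: "\<exists>i\<in>\<Delta>. \<alpha> i = \<alpha>0"
proof -
  have "Min (\<alpha> ` \<Delta>) \<in> \<alpha> ` \<Delta>" using \<Delta> by (intro Min_in) auto
  then obtain i where i: "i \<in> \<Delta>" "\<alpha> i = Min (\<alpha> ` \<Delta>)" by (metis imageE)
  have "\<alpha> i \<le> \<alpha> j" for j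
  proof (cases "j \<in> \<Delta>")
    case True then show ?thesis using i by simp
  next
    case False then show ?thesis using i main by (simp add: main_assumptions_def)
  qed
  then have "\<alpha>0 = \<alpha> i" unfolding alpha_min_def by (intro Min_eqI) auto
  then show ?thesis using i by auto
qed

lemma alpha_min_le: "\<alpha>0 \<le> \<alpha> i"
  unfolding alpha_min_def by (rule Min_le) auto

lemma alpha_min_bounds: "1 < \<alpha>0" "\<alpha>0 \<le> 2"
  using alpha_min_in main by (auto simp: main_assumptions_def)

lemma alpha_bounds: "1 < \<alpha> i"
  using alpha_min_le[of i] alpha_min_bounds by simp

lemma Theta_nonneg: "0 \<le> Th i s" and Theta_le: "norm s \<le> 1 \<Longrightarrow> Th i s \<le> measure (\<Lambda> i) (space (\<Lambda> i))"
  using Theta_bounds[OF Lambda_fin Lambda_sets] alpha_bounds[of i] by auto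

text \<open>
  Types outside \<open>\<Delta>\<close> carry the null measure, for which \<open>\<Theta>\<close> vanishes, so one expansion covers all types.
\<close>

lemma psi_expansion:
  "(\<lambda>s. psi \<mu> i s - (M $ i \<bullet> s - norm s powr \<alpha> i * Th i (s /\<^sub>R norm s)))
    \<in> o[at 0 within nonneg_orthant](\<lambda>s. norm s powr \<alpha> i)"
proof (cases "i \<in> \<Delta>")
  case True then show ?thesis using main by (simp add: main_assumptions_def)
next
  case False
  have "Th i s = 0" for s by (simp add: Theta_def Lambda_null[OF False])
  moreover have "(\<lambda>s. psi \<mu> i s - M $ i \<bullet> s) \<in> o[at 0 within nonneg_orthant](\<lambda>s. norm s powr \<alpha> i)"
    using main False unfolding main_assumptions_def by blast
  ultimately show ?thesis by simp
qed

lemma psi_expansion_sequence: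
  fixes \<sigma> :: "nat \<Rightarrow> real ^ 'd"
  assumes \<sigma>: "\<sigma> \<longlonglongrightarrow> 0" "\<And>n j. 0 < \<sigma> n $ j"
  shows "(\<lambda>n. (psi \<mu> i (\<sigma> n) - (M $ i \<bullet> \<sigma> n - norm (\<sigma> n) powr \<alpha> i * Th i (\<sigma> n /\<^sub>R norm (\<sigma> n))))
    / norm (\<sigma> n) powr \<alpha> i) \<longlonglongrightarrow> 0"
proof -
  have nz: "\<sigma> n \<noteq> 0" for n using \<sigma>(2)[of n] by (metis less_irrefl zero_index)
  have lim: "filterlim \<sigma> (at 0 within nonneg_orthant) sequentially"
    unfolding filterlim_at using \<sigma> nz by (auto simp: nonneg_orthant_def less_imp_le)
  have "(\<lambda>n. psi \<mu> i (\<sigma> n) - (M $ i \<bullet> \<sigma> n - norm (\<sigma> n) powr \<alpha> i * Th i (\<sigma> n /\<^sub>R norm (\<sigma> n))))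
    \<in> o(\<lambda>n. norm (\<sigma> n) powr \<alpha> i)"
    by (rule landau_o.small.compose[OF psi_expansion lim])
  then show ?thesis by (rule smalloD_tendsto)
qed

text \<open>
  This makes \<open>c_bar\<close> positive. For \<open>\<alpha> < 2\<close> it holds because the spectral measures live on the
  nonnegative orthant. For \<open>\<alpha> = 2\<close> all indices are 2, and if \<open>\<Theta>\<close> vanished at \<open>b\<close> for all types, the
  variance of \<open>\<langle>z, b\<rangle>\<close> would vanish under all offspring laws. Then \<open>\<langle>z, b\<rangle> = b\<^sub>i > 0\<close> almost surely, and
  no type could be childless.
\<close>

lemma Theta_b_pos: "\<exists>i. \<alpha> i = \<alpha>0 \<and> 0 < Th i b"
proof (cases "\<alpha>0 < 2")
  case True
  obtain i where i: "i \<in> \<Delta>" "\<alpha> i = \<alpha>0" using alpha_min_in by blast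
  have ae: "AE y in \<Lambda> i. y \<in> nonneg_orthant" and ne: "emeasure (\<Lambda> i) (space (\<Lambda> i)) \<noteq> 0"
    using main i True by (auto simp: main_assumptions_def)
  have sp: "space (\<Lambda> i) = sphere 0 1"
    using sets_eq_imp_space_eq[OF Lambda_sets[of i]] by (simp add: space_restrict_space)
  have "Th i b \<noteq> 0"
  proof
    assume "Th i b = 0"
    moreover have "integrable (\<Lambda> i) (\<lambda>y. \<bar>b \<bullet> y\<bar> powr \<alpha> i)"
      by (rule Theta_bounds(3)[OF Lambda_fin Lambda_sets]) (use alpha_bounds[of i] in simp)
    ultimately have "AE y in \<Lambda> i. \<bar>b \<bullet> y\<bar> powr \<alpha> i = 0"
      using integral_nonneg_eq_0_iff_AE[of "\<Lambda> i" "\<lambda>y. \<bar>b \<bullet> y\<bar> powr \<alpha> i"] by (simp add: Theta_def)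
    then have "AE y in \<Lambda> i. False"
      using ae AE_space
    proof eventually_elim
      case (elim y)
      then have y: "b \<bullet> y = 0" "\<And>j. 0 \<le> y $ j" "y \<noteq> 0"
        using sp by (auto simp: nonneg_orthant_def)
      have "y $ j = 0" for j
        using positive_weights_zero[of b "\<lambda>j. y $ j" j] right_eigenvector(2) y by (simp add: inner_vec_def)
      then show ?case using y(3) by (simp add: vec_eq_iff)
    qed
    then have "ae_filter (\<Lambda> i) = bot" by (simp add: eventually_False)
    then have "emeasure (\<Lambda> i) (space (\<Lambda> i)) = 0"
      by (simp add: ae_filter_eq_bot_iff)
    then show False using ne by simp
  qed
  then show ?thesis using Theta_nonneg[of i b] i by (intro exI[of _ i]) simp
next
  case False
  then have \<alpha>2: "\<alpha> i = 2" for i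
  proof -
    have a02: "\<alpha>0 = 2" using False alpha_min_bounds by simp
    obtain j where j: "j \<in> \<Delta>" "\<alpha> j = \<alpha>0" using alpha_min_in by blast
    have "\<alpha> i \<le> 2"
    proof (cases "i \<in> \<Delta>")
      case True then show ?thesis using main by (auto simp: main_assumptions_def)
    next
      case False
      then have "\<alpha> i = Min (\<alpha> ` \<Delta>)" using main by (simp add: main_assumptions_def)
      also have "\<dots> \<le> \<alpha> j" by (rule Min_le) (use j(1) in auto)
      finally show ?thesis using j a02 by simp
    qed
    then show ?thesis using alpha_min_le[of i] a02 by simp
  qed
  show ?thesis
  proof (rule ccontr)
    assume no: "\<not> ?thesis"
    have a0: "\<alpha>0 = 2" using alpha_min_in \<alpha>2 by auto
    have Th0: "Th i b = 0" for i
      using no Theta_nonneg[of i b] \<alpha>2 a0 by (metis less_eq_real_def)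
    obtain i where "0 \<in> set_pmf (\<mu> i)" using exists_childless_type[OF means_finite irreducible nondegenerate eigen] by blast
    then have p: "0 < pmf (\<mu> i) 0" by (simp add: pmf_positive)
    define p0 where "p0 = pmf (\<mu> i) 0"
    define \<beta> where "\<beta> = b $ i"
    have \<beta>: "0 < \<beta>" using right_eigenvector(2) by (simp add: \<beta>_def)
    define X where "X z = (\<Sum>j\<in>UNIV. real (z $ j) * b $ j)" for z :: "nat ^ 'd"
    have X0: "0 \<le> X z" for z unfolding X_def using right_eigenvector(2) by (intro sum_nonneg mult_nonneg_nonneg) (auto simp: less_imp_le)
    have Xint: "integrable (measure_pmf (\<mu> i)) X" and EX: "measure_pmf.expectation (\<mu> i) X = \<beta>"
    proof -
      show "integrable (measure_pmf (\<mu> i)) X"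
        unfolding X_def by (rule expectation_linear_offspring(1)[OF means_finite])
      have "measure_pmf.expectation (\<mu> i) X = (M *v b) $ i"
        unfolding X_def expectation_linear_offspring(2)[OF means_finite] by (simp add: matrix_vector_mult_def)
      then show "measure_pmf.expectation (\<mu> i) X = \<beta>" by (simp add: right_eigenvector(1) \<beta>_def)
    qed
    \<comment> \<open>The second order Taylor term of the exponential is kept at the atom \<open>z = 0\<close> only.\<close>
    have lower: "p0 * (e * \<beta>)\<^sup>2 / 4 \<le> e * \<beta> - psi \<mu> i (e *\<^sub>R b)" if e: "0 < e" "e * \<beta> \<le> 1" for e
    proof -
      have sm: "0 \<le> 1 + e * \<beta> + (e * \<beta>)\<^sup>2 / 2" using e \<beta> by simp
      have "exp (- (e * \<beta>)) * (1 - e * (X z - \<beta>) + (e * \<beta>)\<^sup>2 / 2 * indicator {0} z) \<le> exp (- (e * X z))" for z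
      proof (cases "z = 0")
        case True
        have "1 + e * \<beta> + (e * \<beta>)\<^sup>2 / 2 \<le> exp (e * \<beta>)"
          using exp_lower_Taylor_quadratic[of "e * \<beta>"] e \<beta> by simp
        then have "exp (- (e * \<beta>)) * (1 + e * \<beta> + (e * \<beta>)\<^sup>2 / 2) \<le> exp (- (e * \<beta>)) * exp (e * \<beta>)"
          by (intro mult_left_mono) auto
        then show ?thesis using True by (simp add: X_def exp_minus_inverse mult_exp_exp)
      next
        case False
        have "1 + (- (e * (X z - \<beta>))) \<le> exp (- (e * (X z - \<beta>)))" by (rule exp_ge_add_one_self)
        then have "exp (- (e * \<beta>)) * (1 - e * (X z - \<beta>)) \<le> exp (- (e * \<beta>)) * exp (- (e * (X z - \<beta>)))"
          by (intro mult_left_mono) auto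
        also have "\<dots> = exp (- (e * X z))" by (simp add: mult_exp_exp algebra_simps)
        finally show ?thesis using False by simp
      qed
      note pw = this
      have expint: "integrable (measure_pmf (\<mu> i)) (\<lambda>z. exp (- (e * X z)))"
        by (rule measure_pmf.integrable_const_bound[of _ 1]) (use e X0 in auto)
      have indint: "integrable (measure_pmf (\<mu> i)) (\<lambda>z. indicator {0} z :: real)"
        by (rule measure_pmf.integrable_const_bound[of _ 1]) auto
      have "measure_pmf.expectation (\<mu> i) (\<lambda>z. exp (- (e * \<beta>)) * (1 - e * (X z - \<beta>) + (e * \<beta>)\<^sup>2 / 2 * indicator {0} z))
          \<le> measure_pmf.expectation (\<mu> i) (\<lambda>z. exp (- (e * X z)))"
        by (rule integral_mono[OF _ expint pw]) (use Xint indint in auto)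
      also have "measure_pmf.expectation (\<mu> i) (\<lambda>z. exp (- (e * \<beta>)) * (1 - e * (X z - \<beta>) + (e * \<beta>)\<^sup>2 / 2 * indicator {0} z))
          = exp (- (e * \<beta>)) * (1 + (e * \<beta>)\<^sup>2 / 2 * p0)"
      proof -
        have "measure_pmf.expectation (\<mu> i) (\<lambda>z. (1 - e * (X z - \<beta>) + (e * \<beta>)\<^sup>2 / 2 * indicator {0} z))
            = 1 - e * (\<beta> - \<beta>) + (e * \<beta>)\<^sup>2 / 2 * p0"
          using Xint indint EX by (simp add: p0_def measure_pmf_single)
        then show ?thesis by simp
      qed
      finally have ineq: "exp (- (e * \<beta>)) * (1 + (e * \<beta>)\<^sup>2 / 2 * p0)
          \<le> measure_pmf.expectation (\<mu> i) (\<lambda>z. exp (- (e * X z)))" .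
      have psi: "psi \<mu> i (e *\<^sub>R b) = - ln (measure_pmf.expectation (\<mu> i) (\<lambda>z. exp (- (e * X z))))"
        by (simp add: psi_def X_def sum_distrib_left mult_ac)
      define y where "y = (e * \<beta>)\<^sup>2 / 2 * p0"
      have y0: "0 < y" using e \<beta> p by (simp add: y_def p0_def)
      have "(e * \<beta>)\<^sup>2 \<le> 1" using e \<beta> by (simp add: power_le_one)
      moreover have "p0 \<le> 1" by (simp add: p0_def pmf_le_1)
      ultimately have "(e * \<beta>)\<^sup>2 * p0 \<le> 1 * 1" using p by (intro mult_mono) (auto simp: p0_def)
      then have y1: "y \<le> 1 / 2" by (simp add: y_def)
      have pos: "0 < exp (- (e * \<beta>)) * (1 + y)" using y0 by simp
      have "ln (exp (- (e * \<beta>)) * (1 + y)) \<le> ln (measure_pmf.expectation (\<mu> i) (\<lambda>z. exp (- (e * X z))))"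
        using ineq pos unfolding y_def[symmetric] by (subst ln_le_cancel_iff) auto
      then have "- (e * \<beta>) + ln (1 + y) \<le> - psi \<mu> i (e *\<^sub>R b)"
        unfolding psi using y0 by (simp add: ln_mult)
      moreover have "y - y\<^sup>2 \<le> ln (1 + y)" by (rule ln_one_plus_pos_lower_bound) (use y0 y1 in auto)
      moreover have "y\<^sup>2 \<le> y * (1 / 2)" unfolding power2_eq_square using y0 y1 by (intro mult_left_mono) auto
      ultimately have "y / 2 \<le> e * \<beta> - psi \<mu> i (e *\<^sub>R b)" by linarith
      then show ?thesis by (simp add: y_def mult.commute)
    qed
    define \<epsilon> where "\<epsilon> n = inverse (real (Suc n))" for n
    have \<epsilon>: "\<epsilon> \<longlonglongrightarrow> 0" "\<And>n. 0 < \<epsilon> n" unfolding \<epsilon>_def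
      by (rule LIMSEQ_inverse_real_of_nat) simp
    have nb: "norm b \<noteq> 0" using right_eigenvector(2) by (metis less_irrefl norm_eq_zero zero_index)
    have "(\<lambda>n. (psi \<mu> i (\<epsilon> n *\<^sub>R b) - (M $ i \<bullet> (\<epsilon> n *\<^sub>R b) - norm (\<epsilon> n *\<^sub>R b) powr \<alpha> i * Th i ((\<epsilon> n *\<^sub>R b) /\<^sub>R norm (\<epsilon> n *\<^sub>R b))))
      / norm (\<epsilon> n *\<^sub>R b) powr \<alpha> i) \<longlonglongrightarrow> 0"
      by (rule psi_expansion_sequence) (use \<epsilon> right_eigenvector(2) in \<open>auto intro!: tendsto_eq_intros\<close>)
    moreover have "Th i ((\<epsilon> n *\<^sub>R b) /\<^sub>R norm (\<epsilon> n *\<^sub>R b)) = 0" for n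
    proof -
      have "(\<epsilon> n *\<^sub>R b) /\<^sub>R norm (\<epsilon> n *\<^sub>R b) = (1 / norm b) *\<^sub>R b"
        using \<epsilon>(2)[of n] by (simp add: field_simps)
      then show ?thesis using nb by (simp add: Theta_scaleR Th0)
    qed
    moreover have "M $ i \<bullet> b = \<beta>"
    proof -
      have "M $ i \<bullet> b = (M *v b) $ i" by (simp add: matrix_vector_mult_def inner_vec_def)
      then show ?thesis by (simp add: right_eigenvector(1) \<beta>_def)
    qed
    moreover have "norm (\<epsilon> n *\<^sub>R b) powr \<alpha> i = (\<epsilon> n)\<^sup>2 * (norm b)\<^sup>2" for n
      using \<epsilon>(2)[of n] nb by (simp add: \<alpha>2 power_mult_distrib)
    ultimately have lim: "(\<lambda>n. (psi \<mu> i (\<epsilon> n *\<^sub>R b) - \<epsilon> n * \<beta>) / ((\<epsilon> n)\<^sup>2 * (norm b)\<^sup>2)) \<longlonglongrightarrow> 0"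
      by simp
    define c where "c = p0 * \<beta>\<^sup>2 / (4 * (norm b)\<^sup>2)"
    have c: "0 < c" using p \<beta> nb by (simp add: c_def p0_def)
    then have "\<forall>\<^sub>F n in sequentially. - c < (psi \<mu> i (\<epsilon> n *\<^sub>R b) - \<epsilon> n * \<beta>) / ((\<epsilon> n)\<^sup>2 * (norm b)\<^sup>2)"
      by (intro order_tendstoD(1)[OF lim]) simp
    moreover have "\<forall>\<^sub>F n in sequentially. \<epsilon> n < 1 / \<beta>"
      using \<epsilon>(1) by (rule order_tendstoD) (use \<beta> in simp)
    ultimately have "\<forall>\<^sub>F n in sequentially. False"
    proof eventually_elim
      case (elim n)
      have "\<epsilon> n * \<beta> \<le> 1" using elim(2) \<beta> by (simp add: field_simps)
      from lower[OF \<epsilon>(2) this]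
      have "psi \<mu> i (\<epsilon> n *\<^sub>R b) - \<epsilon> n * \<beta> \<le> - (c * ((\<epsilon> n)\<^sup>2 * (norm b)\<^sup>2))"
        using nb by (simp add: c_def power_mult_distrib field_simps)
      moreover have "- c * ((\<epsilon> n)\<^sup>2 * (norm b)\<^sup>2) < psi \<mu> i (\<epsilon> n *\<^sub>R b) - \<epsilon> n * \<beta>"
        using elim(1) \<epsilon>(2)[of n] nb by (simp add: pos_less_divide_eq)
      ultimately show ?case by simp
    qed
    then show False by simp
  qed
qed

text \<open>
  The limit of \<open>q / |s|\<^sup>\<alpha>\<close>; it is \<open>(c_bar / |b|)\<^sup>\<alpha>\<close> by homogeneity of \<open>\<Theta>\<close>.
\<close>

definition "kappa = (\<Sum>i | \<alpha> i = \<alpha>0. a $ i * Th i (b /\<^sub>R norm b))"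

lemma norm_b_pos: "0 < norm b"
  using right_eigenvector(2) by (metis less_irrefl norm_eq_zero zero_less_norm_iff zero_index)

lemma kappa_scaled: "(\<Sum>i | \<alpha> i = \<alpha>0. a $ i * Th i b) = norm b powr \<alpha>0 * kappa"
proof -
  have "Th i b = norm b powr \<alpha> i * Th i (b /\<^sub>R norm b)" for i
    using Theta_scaleR[OF norm_b_pos, of "\<alpha> i" "\<Lambda> i" "b /\<^sub>R norm b"] norm_b_pos by simp
  note Th_eq = this
  show ?thesis unfolding kappa_def sum_distrib_left
  proof (rule sum.cong[OF refl])
    fix i assume "i \<in> {i. \<alpha> i = \<alpha>0}"
    then have e: "\<alpha> i = \<alpha>0" by simp
    show "a $ i * Th i b = norm b powr \<alpha>0 * (a $ i * Th i (b /\<^sub>R norm b))"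
      using Th_eq[of i] unfolding e by simp
  qed
qed

lemma kappa_pos: "0 < kappa"
proof -
  obtain i where i: "\<alpha> i = \<alpha>0" "0 < Th i b" using Theta_b_pos by blast
  have "0 < a $ i * Th i b" using left_eigenvector(2) i by simp
  also have "\<dots> \<le> (\<Sum>i | \<alpha> i = \<alpha>0. a $ i * Th i b)"
  proof (rule member_le_sum)
    show "0 \<le> a $ j * Th j b" for j using left_eigenvector(2)[of j] Theta_nonneg[of j b] by simp
  qed (use i in auto)
  finally show ?thesis unfolding kappa_scaled using norm_b_pos by (simp add: zero_less_mult_iff)
qed

lemma c_bar_eq: "c_bar \<alpha> \<Lambda> a b = norm b * kappa powr (1 / \<alpha>0)"
  unfolding c_bar_def kappa_scaled
  using alpha_min_bounds kappa_pos norm_b_pos by (simp add: powr_mult powr_powr)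

lemma c_bar_pos: "0 < c_bar \<alpha> \<Lambda> a b"
  unfolding c_bar_eq using norm_b_pos kappa_pos by simp

text \<open>
  The analytic core. With \<open>w\<^sub>i\<close> the nonlinear part of the \<open>i\<close>-th equation, pairing with the left
  eigenvector yields \<open>q = \<Sum>\<^sub>i a\<^sub>i w\<^sub>i\<close>, where \<open>w\<^sub>i\<close> is of the order \<open>|\<sigma>|\<^sup>\<alpha>\<^sup>i\<close>. Hence \<open>q\<close> and \<open>w\<^sub>i\<close> are negligible
  against \<open>|\<sigma>|\<close>, and the directions \<open>u = \<sigma>/|\<sigma>|\<close> are asymptotically fixed by the mean matrix. By
  compactness of the sphere they converge to the only nonnegative fixed direction \<open>v = b/|b|\<close>. Insertion
  into the identity for \<open>q\<close> gives the order of \<open>|\<sigma>|\<close>.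
\<close>

lemma fixed_point_asymptotics:
  fixes \<sigma> :: "nat \<Rightarrow> real ^ 'd" and q :: "nat \<Rightarrow> real"
  assumes \<sigma>: "\<sigma> \<longlonglongrightarrow> 0" "\<And>n j. 0 < \<sigma> n $ j" and q: "\<And>n. 0 < q n"
    and eq: "\<And>n i. \<sigma> n $ i = q n + psi \<mu> i (\<sigma> n)"
  shows "(\<lambda>n. \<sigma> n $ i / q n powr (1 / \<alpha>0)) \<longlonglongrightarrow> b $ i / c_bar \<alpha> \<Lambda> a b"
proof -
  define Nn where "Nn n = norm (\<sigma> n)" for n
  define u where "u n = \<sigma> n /\<^sub>R Nn n" for n
  define R where "R i n = psi \<mu> i (\<sigma> n) - (M $ i \<bullet> \<sigma> n - Nn n powr \<alpha> i * Th i (u n))" for i n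
  have nz: "\<sigma> n \<noteq> 0" for n using \<sigma>(2)[of n] by (metis less_irrefl zero_index)
  have N0: "0 < Nn n" for n using nz by (simp add: Nn_def)
  have Nlim: "Nn \<longlonglongrightarrow> 0" unfolding Nn_def using tendsto_norm[OF \<sigma>(1)] by simp
  have u1: "norm (u n) = 1" for n using N0[of n] by (simp add: u_def Nn_def)
  have u0: "0 \<le> u n $ j" for n j using \<sigma>(2)[of n j] N0[of n] by (simp add: u_def less_imp_le)
  have \<sigma>u: "\<sigma> n $ j = Nn n * u n $ j" for n j using N0[of n] by (simp add: u_def)
  have Rlim: "(\<lambda>n. R i n / Nn n powr \<alpha> i) \<longlonglongrightarrow> 0" for i
    using psi_expansion_sequence[OF \<sigma>, of i] by (simp add: R_def u_def Nn_def)
  have eqR: "\<sigma> n $ i = q n + (M $ i \<bullet> \<sigma> n - Nn n powr \<alpha> i * Th i (u n) + R i n)" for n i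
    using eq[of n i] by (simp add: R_def)
  define w where "w i n = Nn n powr \<alpha> i * Th i (u n) - R i n" for i n
  have q_eq: "q n = (\<Sum>i\<in>UNIV. a $ i * w i n)" for n
  proof -
    have "(\<Sum>i\<in>UNIV. a $ i * \<sigma> n $ i) = (\<Sum>i\<in>UNIV. a $ i * q n + a $ i * (\<Sum>j\<in>UNIV. M $ i $ j * \<sigma> n $ j) - a $ i * w i n)"
    proof (rule sum.cong[OF refl])
      fix i
      have "\<sigma> n $ i = q n + (\<Sum>j\<in>UNIV. M $ i $ j * \<sigma> n $ j) - w i n"
        using eqR[of n i] by (simp add: w_def inner_vec_def)
      from arg_cong[OF this, of "\<lambda>x. a $ i * x"]
      show "a $ i * \<sigma> n $ i = a $ i * q n + a $ i * (\<Sum>j\<in>UNIV. M $ i $ j * \<sigma> n $ j) - a $ i * w i n"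
        by (simp add: algebra_simps)
    qed
    also have "\<dots> = (\<Sum>i\<in>UNIV. a $ i) * q n + (\<Sum>j\<in>UNIV. a $ j * \<sigma> n $ j) - (\<Sum>i\<in>UNIV. a $ i * w i n)"
      by (simp add: sum_subtractf sum.distrib sum_distrib_right left_eigenvector_sum[OF left_eigenvector(1)])
    finally show ?thesis using left_eigenvector(3) by simp
  qed
  have N_ratio: "(\<lambda>n. Nn n powr (\<alpha> i - \<alpha>0)) \<longlonglongrightarrow> (if \<alpha> i = \<alpha>0 then 1 else 0)" for i
  proof (cases "\<alpha> i = \<alpha>0")
    case True
    have "Nn n powr 0 = 1" for n using N0[of n] by simp
    then show ?thesis using True by simp
  next
    case False
    then show ?thesis using powr_tendsto_zero[OF Nlim N0, of "\<alpha> i - \<alpha>0"] alpha_min_le[of i] by simp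
  qed
  have split: "w i n / Nn n powr \<alpha>0 = Nn n powr (\<alpha> i - \<alpha>0) * (Th i (u n) - R i n / Nn n powr \<alpha> i)" for i n
  proof -
    have "w i n = Nn n powr \<alpha> i * (Th i (u n) - R i n / Nn n powr \<alpha> i)"
      using N0[of n] by (simp add: w_def right_diff_distrib)
    then show ?thesis by (simp add: powr_diff)
  qed
  have Th_bounded: "\<exists>K. \<forall>n. \<bar>Th i (u n)\<bar> \<le> K" for i
    using Theta_nonneg[of i] Theta_le[of _ i] u1 by (intro exI[of _ "measure (\<Lambda> i) (space (\<Lambda> i))"]) auto
  have small: "(\<lambda>n. w i n / Nn n) \<longlonglongrightarrow> 0" for i
  proof -
    obtain K where K: "\<And>n. \<bar>Th i (u n)\<bar> \<le> K" using Th_bounded by blast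
    have 1: "(\<lambda>n. Nn n powr (\<alpha> i - 1)) \<longlonglongrightarrow> 0"
      by (rule powr_tendsto_zero[OF Nlim N0]) (use alpha_bounds[of i] in simp)
    have "w i n / Nn n = Nn n powr (\<alpha> i - 1) * (Th i (u n) - R i n / Nn n powr \<alpha> i)" for n
    proof -
      have "w i n = Nn n powr \<alpha> i * (Th i (u n) - R i n / Nn n powr \<alpha> i)"
        using N0[of n] by (simp add: w_def right_diff_distrib)
      then show ?thesis using N0[of n] by (simp add: powr_diff)
    qed
    moreover have "(\<lambda>n. Nn n powr (\<alpha> i - 1) * Th i (u n)) \<longlonglongrightarrow> 0"
    proof (rule tendsto_0_le[where K = K, OF 1])
      show "\<forall>\<^sub>F n in sequentially. norm (Nn n powr (\<alpha> i - 1) * Th i (u n)) \<le> norm (Nn n powr (\<alpha> i - 1)) * K"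
        using K by (intro always_eventually allI) (simp add: abs_mult mult_left_mono)
    qed
    ultimately show ?thesis
      using tendsto_diff[OF _ tendsto_mult[OF 1 Rlim[of i]], of "\<lambda>n. Nn n powr (\<alpha> i - 1) * Th i (u n)" 0]
      by (simp add: right_diff_distrib)
  qed
  have q_small: "(\<lambda>n. q n / Nn n) \<longlonglongrightarrow> 0"
  proof -
    have "(\<lambda>n. \<Sum>i\<in>UNIV. a $ i * (w i n / Nn n)) \<longlonglongrightarrow> (\<Sum>i\<in>UNIV. a $ i * 0)"
      by (intro tendsto_intros small)
    then show ?thesis by (simp add: q_eq sum_divide_distrib)
  qed
  have Mu: "(\<lambda>n. (M *v u n) $ i - u n $ i) \<longlonglongrightarrow> 0" for i
  proof -
    have "(M *v u n) $ i - u n $ i = w i n / Nn n - q n / Nn n" for n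
    proof -
      have "\<sigma> n $ i = q n + M $ i \<bullet> \<sigma> n - w i n" using eqR[of n i] by (simp add: w_def)
      moreover have "M $ i \<bullet> \<sigma> n = Nn n * (M *v u n) $ i"
        by (simp add: matrix_vector_mult_def inner_vec_def sum_distrib_left \<sigma>u mult_ac)
      ultimately have "Nn n * ((M *v u n) $ i - u n $ i) = w i n - q n" by (simp add: \<sigma>u algebra_simps)
      then have "(M *v u n) $ i - u n $ i = (w i n - q n) / Nn n"
        using N0[of n] by (metis nonzero_mult_div_cancel_left less_irrefl)
      then show ?thesis by (simp add: diff_divide_distrib)
    qed
    then show ?thesis using tendsto_diff[OF small[of i] q_small] by simp
  qed
  define v where "v = b /\<^sub>R norm b"
  have ulim: "u \<longlonglongrightarrow> v"
  proof (rule ccontr)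
    assume "\<not> u \<longlonglongrightarrow> v"
    then obtain e where e: "0 < e" "\<not> (\<forall>\<^sub>F n in sequentially. dist (u n) v < e)"
      unfolding tendsto_iff by blast
    obtain r :: "nat \<Rightarrow> nat" where r: "strict_mono r" "\<And>n. \<not> dist (u (r n)) v < e"
      using not_eventually_sequentiallyD[OF e(2)] by auto
    have "compact (sphere (0 :: real ^ 'd) 1)" by simp
    moreover have "\<forall>n. u (r n) \<in> sphere 0 1" using u1 by simp
    ultimately obtain l s where l: "l \<in> sphere 0 1" "strict_mono s" "((\<lambda>n. u (r n)) \<circ> s) \<longlonglongrightarrow> l"
      unfolding compact_def by meson
    have l': "(\<lambda>n. u (r (s n))) \<longlonglongrightarrow> l" using l(3) by (simp add: o_def)
    have comp: "(\<lambda>n. u (r (s n)) $ j) \<longlonglongrightarrow> l $ j" for j by (rule tendsto_vec_nth[OF l'])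
    have l0: "0 \<le> l $ j" for j
      by (rule LIMSEQ_le_const[OF comp]) (use u0 in auto)
    have "M *v l = l"
    proof (rule vec_eq_iff[THEN iffD2], rule allI)
      fix i
      have "strict_mono (r \<circ> s)" using r(1) l(2) by (rule strict_mono_o)
      from LIMSEQ_subseq_LIMSEQ[OF Mu[of i] this]
      have 1: "(\<lambda>n. (M *v u (r (s n))) $ i - u (r (s n)) $ i) \<longlonglongrightarrow> 0" by (simp add: o_def)
      have 2: "(\<lambda>n. (M *v u (r (s n))) $ i - u (r (s n)) $ i) \<longlonglongrightarrow> (M *v l) $ i - l $ i"
        unfolding matrix_vector_mult_def by (simp, intro tendsto_intros comp)
      show "(M *v l) $ i = l $ i" using LIMSEQ_unique[OF 1 2] by simp
    qed
    then obtain c where c: "0 \<le> c" "l = c *\<^sub>R b"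
      using irreducible_fixed_proportional[OF irreducible _ right_eigenvector(1) l0 right_eigenvector(2)] by blast
    have "c * norm b = 1" using l(1) c by simp
    then have "c = 1 / norm b" using norm_b_pos by (simp add: field_simps)
    then have "l = v" using c by (simp add: v_def divide_inverse)
    then have "\<forall>\<^sub>F n in sequentially. dist (u (r (s n))) v < e" using tendstoD[OF l' e(1)] by simp
    then show False using r(2) by (simp add: eventually_sequentially)
  qed
  have Thlim: "(\<lambda>n. Th i (u n)) \<longlonglongrightarrow> Th i v" for i
    by (rule Theta_continuous[OF Lambda_fin Lambda_sets _ ulim]) (use alpha_bounds[of i] u1 in auto)
  have qlim: "(\<lambda>n. q n / Nn n powr \<alpha>0) \<longlonglongrightarrow> kappa"
  proof -
    have "(\<lambda>n. \<Sum>i\<in>UNIV. a $ i * (Nn n powr (\<alpha> i - \<alpha>0) * (Th i (u n) - R i n / Nn n powr \<alpha> i)))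
        \<longlonglongrightarrow> (\<Sum>i\<in>UNIV. a $ i * ((if \<alpha> i = \<alpha>0 then 1 else 0) * (Th i v - 0)))"
      by (intro tendsto_intros N_ratio Thlim Rlim)
    moreover have "(\<Sum>i\<in>UNIV. a $ i * ((if \<alpha> i = \<alpha>0 then 1 else 0) * (Th i v - 0))) = kappa"
    proof -
      have "(\<Sum>i\<in>UNIV. a $ i * ((if \<alpha> i = \<alpha>0 then 1 else 0) * (Th i v - 0)))
          = (\<Sum>i\<in>UNIV. if \<alpha> i = \<alpha>0 then a $ i * Th i v else 0)" by (rule sum.cong) auto
      then show ?thesis unfolding kappa_def v_def by (simp add: sum.If_cases)
    qed
    ultimately show ?thesis by (simp add: q_eq sum_divide_distrib split[symmetric])
  qed
  have "(\<lambda>n. u n $ i * (q n / Nn n powr \<alpha>0) powr (- (1 / \<alpha>0))) \<longlonglongrightarrow> v $ i * kappa powr (- (1 / \<alpha>0))"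
    by (intro tendsto_mult tendsto_vec_nth[OF ulim] tendsto_powr[OF qlim tendsto_const]) (use kappa_pos in simp)
  moreover have "u n $ i * (q n / Nn n powr \<alpha>0) powr (- (1 / \<alpha>0)) = \<sigma> n $ i / q n powr (1 / \<alpha>0)" for n
  proof -
    have "(q n / Nn n powr \<alpha>0) powr (1 / \<alpha>0) = q n powr (1 / \<alpha>0) / Nn n"
      using q[of n] N0[of n] alpha_min_bounds by (simp add: powr_divide powr_powr)
    then have "(q n / Nn n powr \<alpha>0) powr (- (1 / \<alpha>0)) = Nn n / q n powr (1 / \<alpha>0)"
      by (simp add: powr_minus_divide)
    then show ?thesis by (simp add: \<sigma>u)
  qed
  moreover have "v $ i * kappa powr (- (1 / \<alpha>0)) = b $ i / c_bar \<alpha> \<Lambda> a b"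
    by (simp add: v_def c_bar_eq powr_minus_divide divide_inverse)
  ultimately show ?thesis by simp
qed

definition progeny_laplace :: "'d \<Rightarrow> real \<Rightarrow> real" where
  "progeny_laplace i q = (\<integral>t. exp (- q * real (card (dom t))) \<partial>GW_tree_law \<mu> i)"

lemma tree_prob: "prob_space (GW_tree_law \<mu> i)"
  by (rule GW_tree_law_prob_space[OF means_finite irreducible nondegenerate eigen])

lemma progeny_laplace_gf:
  assumes "0 \<le> q" shows "progeny_laplace i q = enn2real (progeny_gf \<mu> (exp (- q)) UNIV i)"
proof -
  have "exp (- q * real n) = exp (- q) ^ n" for n
    using exp_of_nat2_mult[of "- q" n] by simp
  then have "progeny_laplace i q = (\<integral>t. exp (- q) ^ card (dom t) \<partial>GW_tree_law \<mu> i)"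
    unfolding progeny_laplace_def by simp
  then show ?thesis using integral_GW_tree_law(2)[OF tree_prob, of "exp (- q)" i] assms by simp
qed

lemma progeny_laplace_0: "progeny_laplace i 0 = 1"
  unfolding progeny_laplace_def using prob_space.prob_space[OF tree_prob] by simp

lemma progeny_laplace_measurable: "(\<lambda>t. exp (- q * real (card (dom t)))) \<in> borel_measurable (GW_tree_law \<mu> i)"
  by (simp add: GW_tree_law_def)

lemma progeny_laplace_pos:
  assumes "0 \<le> q" shows "0 < progeny_laplace i q"
proof -
  interpret prob_space "GW_tree_law \<mu> i" by (rule tree_prob)
  have int: "integrable (GW_tree_law \<mu> i) (\<lambda>t. exp (- q * real (card (dom t))))"
    by (rule integrable_const_bound[of _ 1, OF _ progeny_laplace_measurable]) (use assms in auto)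
  have "progeny_laplace i q \<noteq> 0"
  proof
    assume "progeny_laplace i q = 0"
    then have "AE t in GW_tree_law \<mu> i. exp (- q * real (card (dom t))) = 0"
      using integral_nonneg_eq_0_iff_AE[OF int] by (simp add: progeny_laplace_def)
    then show False by simp
  qed
  moreover have "0 \<le> progeny_laplace i q" unfolding progeny_laplace_def by (rule integral_nonneg_AE) simp
  ultimately show ?thesis by simp
qed

lemma progeny_laplace_tendsto_1:
  assumes q: "q \<longlonglongrightarrow> 0" "\<And>n. 0 \<le> q n" shows "(\<lambda>n. progeny_laplace i (q n)) \<longlonglongrightarrow> 1"
proof -
  interpret prob_space "GW_tree_law \<mu> i" by (rule tree_prob)
  have "(\<lambda>n. \<integral>t. exp (- q n * real (card (dom t))) \<partial>GW_tree_law \<mu> i) \<longlonglongrightarrow> (\<integral>t. 1 \<partial>GW_tree_law \<mu> i)"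
  proof (rule integral_dominated_convergence[where w = "\<lambda>_. 1"])
    show "AE t in GW_tree_law \<mu> i. (\<lambda>n. exp (- q n * real (card (dom t)))) \<longlonglongrightarrow> 1"
      using q(1) by (intro always_eventually allI) (auto intro!: tendsto_eq_intros)
    show "AE t in GW_tree_law \<mu> i. norm (exp (- q n * real (card (dom t)))) \<le> 1" for n
      using q(2)[of n] by (intro always_eventually allI) simp
  qed (use progeny_laplace_measurable in simp_all)
  then show ?thesis by (simp add: progeny_laplace_def prob_space)
qed

text \<open>
  The exponents tend to 0 as the trees are almost surely finite, and they satisfy the fixed point
  equation by the branching property at \<open>x = exp(-q)\<close>.
\<close>

lemma progeny_laplace_asymptotics:
  assumes q: "q \<longlonglongrightarrow> 0" "\<And>n. 0 < q n"
  shows "(\<lambda>n. - ln (progeny_laplace i (q n)) / q n powr (1 / \<alpha>0)) \<longlonglongrightarrow> b $ i / c_bar \<alpha> \<Lambda> a b"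
proof -
  define \<sigma> where "\<sigma> n = (\<chi> j. - ln (progeny_laplace j (q n)))" for n
  have q0: "0 \<le> q n" for n using q(2)[of n] by simp
  note Lpos = progeny_laplace_pos[OF q0]
  have Lexp: "progeny_laplace j (q n) = exp (- (\<sigma> n $ j))" for j n using Lpos by (simp add: \<sigma>_def)
  have fixp: "progeny_laplace j (q n) = exp (- q n) * measure_pmf.expectation (\<mu> j) (\<lambda>z. exp (- (\<Sum>k\<in>UNIV. real (z $ k) * \<sigma> n $ k)))" for j n
  proof -
    have "progeny_laplace j (q n) = exp (- q n) * measure_pmf.expectation (\<mu> j) (\<lambda>z. \<Prod>k\<in>UNIV. progeny_laplace k (q n) ^ (z $ k))"
      using progeny_gf_real_fixed_point[of "exp (- q n)" \<mu> j] q0[of n] by (simp add: progeny_laplace_gf)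
    moreover have "(\<Prod>k\<in>UNIV. progeny_laplace k (q n) ^ (z $ k)) = exp (- (\<Sum>k\<in>UNIV. real (z $ k) * \<sigma> n $ k))" for z :: "nat ^ 'd"
      unfolding Lexp by (simp add: exp_of_nat_mult[symmetric] exp_sum[symmetric] sum_negf)
    ultimately show ?thesis by simp
  qed
  have Epos: "0 < measure_pmf.expectation (\<mu> j) (\<lambda>z. exp (- (\<Sum>k\<in>UNIV. real (z $ k) * \<sigma> n $ k)))" for j n
    using Lpos[of j n] unfolding fixp[of j n] by (simp add: zero_less_mult_iff)
  have eq: "\<sigma> n $ j = q n + psi \<mu> j (\<sigma> n)" for n j
  proof -
    have "\<sigma> n $ j = - ln (exp (- q n) * measure_pmf.expectation (\<mu> j) (\<lambda>z. exp (- (\<Sum>k\<in>UNIV. real (z $ k) * \<sigma> n $ k))))"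
      using fixp[of j n] by (simp add: \<sigma>_def)
    then show ?thesis using Epos[of j n] by (simp add: ln_mult psi_def)
  qed
  have \<sigma>0: "0 \<le> \<sigma> n $ j" for n j
  proof -
    have "progeny_laplace j (q n) \<le> 1"
      using progeny_gf_real(3)[of "exp (- q n)" \<mu> j] q0[of n] by (simp add: progeny_laplace_gf)
    then show ?thesis using Lpos[of j n] by (simp add: \<sigma>_def)
  qed
  have \<sigma>pos: "0 < \<sigma> n $ j" for n j
  proof -
    have "exp (- (\<Sum>k\<in>UNIV. real (z $ k) * \<sigma> n $ k)) \<le> 1" for z :: "nat ^ 'd"
      using \<sigma>0 by (simp add: sum_nonneg)
    then have "measure_pmf.expectation (\<mu> j) (\<lambda>z. exp (- (\<Sum>k\<in>UNIV. real (z $ k) * \<sigma> n $ k))) \<le> 1"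
      by (intro measure_pmf.integral_le_const measure_pmf.integrable_const_bound[of _ 1]) auto
    then have "0 \<le> psi \<mu> j (\<sigma> n)" using Epos[of j n] by (simp add: psi_def)
    then show ?thesis using eq[of n j] q(2)[of n] by linarith
  qed
  have \<sigma>lim: "\<sigma> \<longlonglongrightarrow> 0"
  proof (rule vec_tendstoI)
    fix j
    have "(\<lambda>n. - ln (progeny_laplace j (q n))) \<longlonglongrightarrow> - ln 1"
      by (intro tendsto_intros progeny_laplace_tendsto_1 q q0) simp
    then show "(\<lambda>n. \<sigma> n $ j) \<longlonglongrightarrow> 0 $ j" by (simp add: \<sigma>_def)
  qed
  from fixed_point_asymptotics[OF \<sigma>lim \<sigma>pos q(2) eq, of i] show ?thesis by (simp add: \<sigma>_def)
qed

end

section \<open>Depth-first order\<close>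

abbreviation dfs_less :: "nat list \<Rightarrow> nat list \<Rightarrow> bool" where
  "dfs_less v u \<equiv> (v, u) \<in> lexord less_than"

abbreviation dfs_preds :: "nat list set \<Rightarrow> nat list \<Rightarrow> nat list set" where
  "dfs_preds f u \<equiv> {v \<in> f. dfs_less v u}"

lemma dfs_less_linear: "dfs_less u v \<or> u = v \<or> dfs_less v u"
  by (rule lexord_linear) (auto simp: less_than_iff)

lemma dfs_less_irrefl: "\<not> dfs_less u u"
  by (rule lexord_irreflexive) simp

lemma dfs_less_trans: "dfs_less u v \<Longrightarrow> dfs_less v w \<Longrightarrow> dfs_less u w"
  by (rule lexord_trans[OF _ _ trans_less_than])

lemma card_dfs_preds_strict_mono:
  assumes u: "u \<in> f" and uv: "dfs_less u v" and fin: "finite (dfs_preds f v)"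
  shows "card (dfs_preds f u) < card (dfs_preds f v)"
proof (rule psubset_card_mono[OF fin])
  have "dfs_preds f u \<subseteq> dfs_preds f v" using dfs_less_trans[OF _ uv] by auto
  moreover have "u \<in> dfs_preds f v" "u \<notin> dfs_preds f u" using u uv dfs_less_irrefl by auto
  ultimately show "dfs_preds f u \<subset> dfs_preds f v" by blast
qed

lemma dfs_rank_unique:
  assumes "u \<in> f" "finite (dfs_preds f u)" "card (dfs_preds f u) = n"
    and "v \<in> f" "finite (dfs_preds f v)" "card (dfs_preds f v) = n"
  shows "u = v"
  using dfs_less_linear[of u v] card_dfs_preds_strict_mono[of u f v] card_dfs_preds_strict_mono[of v f u] assms
  by auto

lemma depth_first_vertex_eq:
  assumes "u \<in> f" "finite (dfs_preds f u)" "card (dfs_preds f u) = n"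
  shows "depth_first_vertex f n = u"
  unfolding depth_first_vertex_def
  by (rule the_equality) (use assms dfs_rank_unique in blast)+

text \<open>
  Ranks in a finite totally ordered set are distinct and smaller than its size, so all of them occur.
\<close>

lemma exists_dfs_rank:
  assumes fin: "finite A" and n: "n < card A"
  shows "\<exists>u\<in>A. card (dfs_preds A u) = n"
proof -
  have fp: "finite (dfs_preds A u)" for u using fin by simp
  have inj: "inj_on (\<lambda>u. card (dfs_preds A u)) A"
  proof (rule inj_onI)
    fix u v assume uv: "u \<in> A" "v \<in> A" "card (dfs_preds A u) = card (dfs_preds A v)"
    show "u = v" by (rule dfs_rank_unique[OF uv(1) fp uv(3) uv(2) fp refl])
  qed
  have "card (dfs_preds A u) < card A" if "u \<in> A" for u
    by (rule psubset_card_mono[OF fin]) (use that dfs_less_irrefl in auto)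
  then have "(\<lambda>u. card (dfs_preds A u)) ` A \<subseteq> {..<card A}" by auto
  moreover have "card ((\<lambda>u. card (dfs_preds A u)) ` A) = card {..<card A}"
    using card_image[OF inj] by simp
  ultimately have "(\<lambda>u. card (dfs_preds A u)) ` A = {..<card A}"
    by (intro card_subset_eq) auto
  then have "n \<in> (\<lambda>u. card (dfs_preds A u)) ` A" using n by simp
  then show ?thesis by (rule imageE) blast
qed

section \<open>The component index of a forest\<close>

definition progeny_sum :: "(nat \<Rightarrow> nat list \<rightharpoonup> 'd) \<Rightarrow> nat \<Rightarrow> nat" where
  "progeny_sum T k = (\<Sum>l\<in>{1..k}. card (dom (T l)))"

context
  fixes T :: "nat \<Rightarrow> nat list \<rightharpoonup> 'd"
  assumes T: "\<And>k. 1 \<le> k \<Longrightarrow> T k \<in> typed_trees"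
begin

lemma finite_dom_component: "1 \<le> k \<Longrightarrow> finite (dom (T k))"
  using T by (auto simp: typed_trees_def planar_tree_def)

lemma card_dom_component: "1 \<le> k \<Longrightarrow> 1 \<le> card (dom (T k))"
  using T finite_dom_component[of k] planar_tree_Nil[of "dom (T k)"]
  by (auto simp: typed_trees_def Suc_le_eq card_gt_0_iff)

lemma progeny_sum_0: "progeny_sum T 0 = 0" by (simp add: progeny_sum_def)

lemma progeny_sum_Suc: "progeny_sum T (Suc k) = progeny_sum T k + card (dom (T (Suc k)))"
  by (simp add: progeny_sum_def)

lemma progeny_sum_ge: "k \<le> progeny_sum T k"
proof (induction k)
  case (Suc k)
  then show ?case using card_dom_component[of "Suc k"] by (simp add: progeny_sum_Suc)
qed simp

lemma progeny_sum_mono: "k \<le> l \<Longrightarrow> progeny_sum T k \<le> progeny_sum T l"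
  unfolding progeny_sum_def by (intro sum_mono2) auto

lemma dom_forest_of: "dom (forest_of T) = (\<Union>k\<in>{1..}. (#) k ` dom (T k))"
proof (rule set_eqI)
  fix w show "w \<in> dom (forest_of T) \<longleftrightarrow> w \<in> (\<Union>k\<in>{1..}. (#) k ` dom (T k))"
    by (cases w) (auto simp: forest_of_def domIff split: if_splits)
qed

lemma dfs_preds_forest:
  assumes k: "1 \<le> k"
  shows "dfs_preds (dom (forest_of T)) (k # u)
    = (\<Union>l\<in>{1..<k}. (#) l ` dom (T l)) \<union> (#) k ` dfs_preds (dom (T k)) u"
proof (rule set_eqI)
  fix w
  show "w \<in> dfs_preds (dom (forest_of T)) (k # u)
    \<longleftrightarrow> w \<in> (\<Union>l\<in>{1..<k}. (#) l ` dom (T l)) \<union> (#) k ` dfs_preds (dom (T k)) u"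
  proof (cases w)
    case Nil
    have "forest_of T [] = None" by (simp add: forest_of_def)
    then show ?thesis using Nil by auto
  next
    case (Cons l v)
    have mem: "w \<in> dom (forest_of T) \<longleftrightarrow> 1 \<le> l \<and> v \<in> dom (T l)"
      by (simp add: Cons forest_of_def domIff)
    have img: "w \<in> (#) m ` S \<longleftrightarrow> m = l \<and> v \<in> S" for m S using Cons by auto
    show ?thesis
      unfolding Un_iff UN_iff img mem_Collect_eq mem using k by (auto simp: Cons)
  qed
qed

lemma card_dfs_preds_forest:
  assumes k: "1 \<le> k"
  shows "finite (dfs_preds (dom (forest_of T)) (k # u))"
    and "card (dfs_preds (dom (forest_of T)) (k # u)) = progeny_sum T (k - 1) + card (dfs_preds (dom (T k)) u)"
proof -
  have fin: "finite (\<Union>l\<in>{1..<k}. (#) l ` dom (T l))" "finite ((#) k ` dfs_preds (dom (T k)) u)"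
    using finite_dom_component k by auto
  show "finite (dfs_preds (dom (forest_of T)) (k # u))" unfolding dfs_preds_forest[OF k] using fin by simp
  have "card (\<Union>l\<in>{1..<k}. (#) l ` dom (T l)) = (\<Sum>l\<in>{1..<k}. card ((#) l ` dom (T l)))"
    by (rule card_UN_disjoint) (use finite_dom_component in auto)
  also have "\<dots> = progeny_sum T (k - 1)"
    unfolding progeny_sum_def using k by (intro sum.cong) (auto simp: card_image)
  finally have 1: "card (\<Union>l\<in>{1..<k}. (#) l ` dom (T l)) = progeny_sum T (k - 1)" .
  have "card (dfs_preds (dom (forest_of T)) (k # u))
      = card (\<Union>l\<in>{1..<k}. (#) l ` dom (T l)) + card ((#) k ` dfs_preds (dom (T k)) u)"
    unfolding dfs_preds_forest[OF k] by (rule card_Un_disjoint[OF fin]) auto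
  then show "card (dfs_preds (dom (forest_of T)) (k # u)) = progeny_sum T (k - 1) + card (dfs_preds (dom (T k)) u)"
    unfolding 1 by (simp add: card_image)
qed

lemma infinite_dom_forest: "infinite (dom (forest_of T))"
proof
  assume "finite (dom (forest_of T))"
  then have "finite (hd ` dom (forest_of T))" by simp
  moreover have "{1..} \<subseteq> hd ` dom (forest_of T)"
  proof
    fix k :: nat assume k: "k \<in> {1..}"
    then have "[] \<in> dom (T k)" using T[of k] planar_tree_Nil by (auto simp: typed_trees_def)
    then have "[k] \<in> dom (forest_of T)" unfolding dom_forest_of using k by auto
    then show "k \<in> hd ` dom (forest_of T)" by (metis image_eqI list.sel(1))
  qed
  ultimately show False using infinite_Ici finite_subset by blast
qed

lemma component_index_forest:
  "component_index (forest_of T) n = (LEAST k. n < progeny_sum T k)"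
proof -
  define k where "k = (LEAST k. n < progeny_sum T k)"
  have "n < progeny_sum T (Suc n)" using progeny_sum_ge[of "Suc n"] by simp
  then have nk: "n < progeny_sum T k" unfolding k_def by (rule LeastI)
  then have k1: "1 \<le> k" using progeny_sum_0 by (cases k) auto
  have "\<not> n < progeny_sum T (k - 1)" using k1 not_less_Least[of "k - 1" "\<lambda>k. n < progeny_sum T k"] by (simp add: k_def)
  then have lo: "progeny_sum T (k - 1) \<le> n" by simp
  define j where "j = n - progeny_sum T (k - 1)"
  have "progeny_sum T k = progeny_sum T (k - 1) + card (dom (T k))"
    using progeny_sum_Suc[of "k - 1"] k1 by simp
  then have "j < card (dom (T k))" using nk lo by (simp add: j_def)
  then obtain u where u: "u \<in> dom (T k)" "card (dfs_preds (dom (T k)) u) = j"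
    using exists_dfs_rank[OF finite_dom_component[OF k1]] by blast
  have "depth_first_vertex (dom (forest_of T)) n = k # u"
  proof (rule depth_first_vertex_eq)
    show "k # u \<in> dom (forest_of T)" unfolding dom_forest_of using k1 u(1) by auto
    show "finite (dfs_preds (dom (forest_of T)) (k # u))" by (rule card_dfs_preds_forest(1)[OF k1])
    show "card (dfs_preds (dom (forest_of T)) (k # u)) = n"
      unfolding card_dfs_preds_forest(2)[OF k1] u(2) using lo by (simp add: j_def)
  qed
  then show ?thesis using infinite_dom_forest by (simp add: component_index_def k_def)
qed

text \<open>
  A vertex lies beyond the first \<open>K\<close> components exactly when all their vertices precede it, as the
  depth-first order exhausts the components one after the other and ranks start from 0.
\<close>

lemma less_component_index_iff:
  "K < component_index (forest_of T) n \<longleftrightarrow> progeny_sum T K \<le> n"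
proof -
  have ex: "n < progeny_sum T (Suc n)" using progeny_sum_ge[of "Suc n"] by simp
  show ?thesis unfolding component_index_forest
  proof
    assume "K < (LEAST k. n < progeny_sum T k)"
    from not_less_Least[OF this] show "progeny_sum T K \<le> n" by simp
  next
    assume "progeny_sum T K \<le> n"
    moreover have "n < progeny_sum T (LEAST k. n < progeny_sum T k)" using ex by (rule LeastI)
    ultimately show "K < (LEAST k. n < progeny_sum T k)"
      using progeny_sum_mono[of "LEAST k. n < progeny_sum T k" K] by (meson leD le_less_trans not_le)
  qed
qed

lemma component_index_forest_mono:
  assumes "m \<le> n" shows "component_index (forest_of T) m \<le> component_index (forest_of T) n"
proof (rule ccontr)
  assume "\<not> ?thesis"
  then have "component_index (forest_of T) n < component_index (forest_of T) m" by simp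
  then have "progeny_sum T (component_index (forest_of T) n) \<le> m"
    unfolding less_component_index_iff .
  also note assms
  finally have "component_index (forest_of T) n < component_index (forest_of T) n"
    unfolding less_component_index_iff .
  then show False by simp
qed

end

text \<open>
  The rescaled component index as a path, for every assignment of types to words and not only for forests.
\<close>

definition index_path :: "real \<Rightarrow> (nat list \<rightharpoonup> 'd) \<Rightarrow> nat \<Rightarrow> real \<Rightarrow> real" where
  "index_path \<beta> f n = step_path n (\<lambda>m. 1 / real n powr \<beta> * real (component_index f m))"

lemma index_path_increasing:
  assumes "\<And>m. component_index f m \<le> component_index f (Suc m)"
  shows "index_path \<beta> f n \<in> increasing_paths"
proof -
  have mono: "component_index f l \<le> component_index f m" if "l \<le> m" for l m
    using lift_Suc_mono_le[of "component_index f", OF assms that] .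
  have "mono_on {0..} (index_path \<beta> f n)"
  proof (rule mono_onI)
    fix s t :: real assume st: "s \<in> {0..}" "t \<in> {0..}" "s \<le> t"
    then have "real n * s \<le> real n * t" by (simp add: mult_left_mono)
    then have "nat \<lfloor>real n * s\<rfloor> \<le> nat \<lfloor>real n * t\<rfloor>" by (intro nat_mono floor_mono)
    from mono[OF this] show "index_path \<beta> f n s \<le> index_path \<beta> f n t"
      using st by (simp add: index_path_def step_path_def divide_right_mono)
  qed
  then show ?thesis
    unfolding increasing_paths_def
    by (auto simp: index_path_def step_path_in_skorohod) (simp add: step_path_def)
qed

text \<open>
  Passage of the rescaled component index above \<open>x\<close> happens at the time at which the first
  \<open>\<lfloor>x n\<^sup>\<beta>\<rfloor>\<close> components are exhausted, exactly and not only asymptotically.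
\<close>

lemma passage_index_path:
  assumes T: "\<And>k. 1 \<le> k \<Longrightarrow> T k \<in> typed_trees" and n: "0 < n"
  shows "passage (index_path \<beta> (forest_of T) n) r
    = exp (- (real (progeny_sum T (nat \<lfloor>level r * real n powr \<beta>\<rfloor>)) / real n))"
proof -
  define K where "K = nat \<lfloor>level r * real n powr \<beta>\<rfloor>"
  define \<tau> where "\<tau> = real (progeny_sum T K) / real n"
  have np: "0 < real n powr \<beta>" using n by simp
  have lp: "0 \<le> level r * real n powr \<beta>" by simp
  have iff: "level r < index_path \<beta> (forest_of T) n s \<longleftrightarrow> \<tau> \<le> s" if s: "0 \<le> s" for s
  proof -
    let ?m = "nat \<lfloor>real n * s\<rfloor>"
    have "level r < index_path \<beta> (forest_of T) n s \<longleftrightarrow> level r * real n powr \<beta> < real (component_index (forest_of T) ?m)"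
      using s np by (simp add: index_path_def step_path_def pos_less_divide_eq)
    also have "\<dots> \<longleftrightarrow> K < component_index (forest_of T) ?m"
      using lp unfolding K_def by linarith
    also have "\<dots> \<longleftrightarrow> progeny_sum T K \<le> ?m" by (rule less_component_index_iff[OF T])
    also have "\<dots> \<longleftrightarrow> real (progeny_sum T K) \<le> real n * s"
    proof -
      have "0 \<le> real n * s" using s by simp
      then show ?thesis by linarith
    qed
    also have "\<dots> \<longleftrightarrow> \<tau> \<le> s" using n by (simp add: \<tau>_def pos_divide_le_eq mult.commute)
    finally show ?thesis .
  qed
  have \<tau>0: "0 \<le> \<tau>" by (simp add: \<tau>_def)
  have "passage (index_path \<beta> (forest_of T) n) r = exp (- \<tau>)"
  proof (rule antisym)
    show "passage (index_path \<beta> (forest_of T) n) r \<le> exp (- \<tau>)"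
      by (rule passage_le) (use iff in auto)
    show "exp (- \<tau>) \<le> passage (index_path \<beta> (forest_of T) n) r"
      by (rule passage_ge[OF \<tau>0]) (use iff \<tau>0 in auto)
  qed
  then show ?thesis by (simp add: \<tau>_def K_def)
qed

section \<open>Measurability of the component index\<close>

lemma measurable_vertex [measurable]: "Measurable.pred (forest_space :: (nat list \<rightharpoonup> 'd::finite) measure) (\<lambda>f. u \<in> dom f)"
proof -
  have "(\<lambda>f. f u) \<in> (forest_space :: (nat list \<rightharpoonup> 'd) measure) \<rightarrow>\<^sub>M count_space UNIV"
    unfolding forest_space_def by (rule measurable_component_singleton) simp
  then have "Measurable.pred (forest_space :: (nat list \<rightharpoonup> 'd) measure) (\<lambda>f. f u \<noteq> None)"
    by (rule measurable_compose) simp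
  then show ?thesis by (simp add: domIff)
qed

lemma countable_finite_sets: "countable {A :: nat list set. finite A \<and> P A}"
  by (rule countable_subset[OF _ countable_Collect_finite]) auto

lemma pred_bex_finite_set:
  assumes "\<And>A. Measurable.pred M (R A)"
  shows "Measurable.pred M (\<lambda>f. \<exists>A\<in>{A :: nat list set. finite A \<and> P A}. R A f)"
proof -
  have "{f \<in> space M. R A f} \<in> sets M" for A using assms by (rule predE)
  then have "(\<Union>A\<in>{A. finite A \<and> P A}. {f \<in> space M. R A f}) \<in> sets M"
    by (intro sets.countable_UN'[OF countable_finite_sets]) auto
  moreover have "{f \<in> space M. \<exists>A\<in>{A. finite A \<and> P A}. R A f}
      = (\<Union>A\<in>{A. finite A \<and> P A}. {f \<in> space M. R A f})" by auto
  ultimately show ?thesis unfolding pred_def by simp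
qed

text \<open>
  The component index has to be measurable as a function of an arbitrary partial map, even where no vertex
  has the required rank. The definite description then is applied to the constantly false
  predicate, and so takes one fixed value on that set.
\<close>

lemma measurable_component_index:
  "(\<lambda>f. component_index f n) \<in> (forest_space :: (nat list \<rightharpoonup> 'd::finite) measure) \<rightarrow>\<^sub>M count_space UNIV"
proof -
  let ?S = "forest_space :: (nat list \<rightharpoonup> 'd) measure"
  define small where "small f \<longleftrightarrow> finite (dom f) \<and> card (dom f) \<le> n" for f :: "nat list \<rightharpoonup> 'd"
  define P where "P u f \<longleftrightarrow> u \<in> dom f \<and> finite (dfs_preds (dom f) u) \<and> card (dfs_preds (dom f) u) = n"
    for u and f :: "nat list \<rightharpoonup> 'd"
  have dom_eq [measurable]: "Measurable.pred ?S (\<lambda>f. dom f = A)" for A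
  proof -
    have "Measurable.pred ?S (\<lambda>f. \<forall>u. u \<in> dom f \<longleftrightarrow> u \<in> A)" by measurable
    then show ?thesis by (simp add: set_eq_iff)
  qed
  have small_meas [measurable]: "Measurable.pred ?S (\<lambda>f. small f \<and> Q (dom f))" for Q
  proof -
    have "Measurable.pred ?S (\<lambda>f. \<exists>A\<in>{A. finite A \<and> (card A \<le> n \<and> Q A)}. dom f = A)"
      by (rule pred_bex_finite_set) (rule dom_eq)
    then show ?thesis by (rule measurable_cong[THEN iffD1, rotated]) (auto simp: small_def)
  qed
  have [measurable]: "Measurable.pred ?S small" using small_meas[of "\<lambda>_. True"] by simp
  have P_meas [measurable]: "Measurable.pred ?S (P u)" for u
  proof -
    have eq: "Measurable.pred ?S (\<lambda>f. \<forall>v. (v \<in> dom f \<and> dfs_less v u) \<longleftrightarrow> v \<in> A)" for A by measurable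
    have "Measurable.pred ?S (\<lambda>f. \<exists>A\<in>{A. finite A \<and> card A = n}. \<forall>v. (v \<in> dom f \<and> dfs_less v u) \<longleftrightarrow> v \<in> A)"
      by (rule pred_bex_finite_set) (rule eq)
    then have "Measurable.pred ?S (\<lambda>f. u \<in> dom f \<and> (\<exists>A\<in>{A. finite A \<and> card A = n}. \<forall>v. (v \<in> dom f \<and> dfs_less v u) \<longleftrightarrow> v \<in> A))"
      by measurable
    moreover have "(u \<in> dom f \<and> (\<exists>A\<in>{A. finite A \<and> card A = n}. \<forall>v. (v \<in> dom f \<and> dfs_less v u) \<longleftrightarrow> v \<in> A)) \<longleftrightarrow> P u f" for f :: "nat list \<rightharpoonup> 'd"
    proof -
      have "(\<forall>v. (v \<in> dom f \<and> dfs_less v u) \<longleftrightarrow> v \<in> A) \<longleftrightarrow> A = dfs_preds (dom f) u" for A by auto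
      then show ?thesis by (auto simp: P_def)
    qed
    ultimately show ?thesis by simp
  qed
  have dfv: "depth_first_vertex (dom f) n = u \<longleftrightarrow> P u f \<or> (\<forall>v. \<not> P v f) \<and> (THE u. False) = u" for f u
  proof (cases "\<exists>v. P v f")
    case True
    then obtain v where v: "P v f" by blast
    then have "depth_first_vertex (dom f) n = v" by (intro depth_first_vertex_eq) (auto simp: P_def)
    moreover have "P u f \<longleftrightarrow> u = v" using v dfs_rank_unique[of u "dom f" n v] by (auto simp: P_def)
    ultimately show ?thesis using v by auto
  next
    case False
    have "depth_first_vertex (dom f) n = (THE u. P u f)" by (simp add: depth_first_vertex_def P_def)
    also have "(\<lambda>u. P u f) = (\<lambda>u. False)" using False by auto
    finally show ?thesis using False by simp
  qed
  have "Measurable.pred ?S (\<lambda>f. component_index f n = k)" for k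
  proof -
    have "Measurable.pred ?S (\<lambda>f. (small f \<and> card (hd ` dom f) = k)
      \<or> (\<not> small f \<and> (\<exists>u. (P u f \<or> (\<forall>v. \<not> P v f) \<and> (THE u. False) = u) \<and> hd u = k)))"
      using small_meas[of "\<lambda>A. card (hd ` A) = k"] by measurable
    moreover have "((small f \<and> card (hd ` dom f) = k)
      \<or> (\<not> small f \<and> (\<exists>u. (P u f \<or> (\<forall>v. \<not> P v f) \<and> (THE u. False) = u) \<and> hd u = k)))
      \<longleftrightarrow> component_index f n = k" for f
      unfolding dfv[symmetric] by (auto simp: component_index_def small_def)
    ultimately show ?thesis by simp
  qed
  then have "{f \<in> space ?S. component_index f n = k} \<in> sets ?S" for k by (rule predE)
  moreover have "(\<lambda>f. component_index f n) -` {k} \<inter> space ?S = {f \<in> space ?S. component_index f n = k}" for k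
    by auto
  ultimately show ?thesis unfolding measurable_count_space_eq2_countable by simp
qed

lemma measurable_index_path:
  assumes "0 \<le> t"
  shows "(\<lambda>f. index_path \<beta> f n t) \<in> borel_measurable (forest_space :: (nat list \<rightharpoonup> 'd::finite) measure)"
proof -
  have [measurable]: "(\<lambda>f. component_index f m) \<in> (forest_space :: (nat list \<rightharpoonup> 'd) measure) \<rightarrow>\<^sub>M count_space UNIV" for m
    by (rule measurable_component_index)
  show ?thesis unfolding index_path_def step_path_def using assms by simp
qed

lemma measurable_passage_index_path:
  "(\<lambda>f. passage (index_path \<beta> f n) r) \<in> borel_measurable (forest_space :: (nat list \<rightharpoonup> 'd::finite) measure)"
  by (rule measurable_passage)
     (use step_path_in_skorohod measurable_index_path in \<open>auto simp: index_path_def skorohod_space_def\<close>)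

section \<open>Expectations over the Galton--Watson forest\<close>

lemma space_GW_tree_law: "space (GW_tree_law \<mu> i) = typed_trees"
  by (simp add: GW_tree_law_def)

lemma measurable_GW_tree_law: "f \<in> space (GW_tree_law \<mu> i) \<rightarrow> space K \<Longrightarrow> f \<in> GW_tree_law \<mu> i \<rightarrow>\<^sub>M K"
  by (simp add: GW_tree_law_def)

lemma space_PiM_GW_tree_law:
  "T \<in> space (Pi\<^sub>M {1..} (\<lambda>k. GW_tree_law \<mu> (x k))) \<Longrightarrow> 1 \<le> k \<Longrightarrow> T k \<in> typed_trees"
  by (auto simp: space_PiM PiE_def Pi_def space_GW_tree_law)

lemma measurable_forest_of:
  "forest_of \<in> Pi\<^sub>M {1..} (\<lambda>k. GW_tree_law \<mu> (x k)) \<rightarrow>\<^sub>M (forest_space :: (nat list \<rightharpoonup> 'd::finite) measure)"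
proof -
  let ?P = "Pi\<^sub>M {1..} (\<lambda>k. GW_tree_law \<mu> (x k))"
  have "(\<lambda>T w. forest_of T w) \<in> ?P \<rightarrow>\<^sub>M (forest_space :: (nat list \<rightharpoonup> 'd) measure)"
    unfolding forest_space_def
  proof (rule measurable_PiM_single')
    fix w :: "nat list"
    show "(\<lambda>T. forest_of T w) \<in> ?P \<rightarrow>\<^sub>M count_space (UNIV :: 'd option set)"
    proof (cases w)
      case Nil
      then show ?thesis by (simp add: forest_of_def)
    next
      case (Cons k u)
      show ?thesis
      proof (cases "1 \<le> k")
        case True
        have "(\<lambda>T. T k) \<in> ?P \<rightarrow>\<^sub>M GW_tree_law \<mu> (x k)"
          by (rule measurable_component_singleton) (use True in simp)
        moreover have "(\<lambda>t. t u) \<in> GW_tree_law \<mu> (x k) \<rightarrow>\<^sub>M count_space UNIV"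
          by (rule measurable_GW_tree_law) simp
        ultimately have "(\<lambda>T. T k u) \<in> ?P \<rightarrow>\<^sub>M count_space UNIV" by (rule measurable_compose)
        then show ?thesis using Cons True by (simp add: forest_of_def)
      next
        case False
        then show ?thesis using Cons by (simp add: forest_of_def)
      qed
    qed
  qed auto
  then show ?thesis by simp
qed

lemma GW_forest_expectation:
  fixes \<Psi> :: "(nat list \<rightharpoonup> 'd::finite) \<Rightarrow> real"
  assumes F: "F \<in> M \<rightarrow>\<^sub>M forest_space" and law: "distr M forest_space F = GW_forest_law \<mu> x"
    and \<Psi>: "\<Psi> \<in> borel_measurable forest_space"
  shows "(\<integral>\<omega>. \<Psi> (F \<omega>) \<partial>M) = (\<integral>T. \<Psi> (forest_of T) \<partial>Pi\<^sub>M {1..} (\<lambda>k. GW_tree_law \<mu> (x k)))"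
proof -
  have "(\<integral>\<omega>. \<Psi> (F \<omega>) \<partial>M) = (\<integral>f. \<Psi> f \<partial>GW_forest_law \<mu> x)"
    unfolding law[symmetric] by (rule integral_distr[OF F \<Psi>, symmetric])
  also have "\<dots> = (\<integral>T. \<Psi> (forest_of T) \<partial>Pi\<^sub>M {1..} (\<lambda>k. GW_tree_law \<mu> (x k)))"
    unfolding GW_forest_law_def by (rule integral_distr[OF measurable_forest_of \<Psi>])
  finally show ?thesis .
qed

lemma GW_forest_AE_increasing:
  fixes F :: "'w \<Rightarrow> (nat list \<rightharpoonup> 'd::finite)"
  assumes F: "F \<in> M \<rightarrow>\<^sub>M forest_space" and law: "distr M forest_space F = GW_forest_law \<mu> x"
  shows "AE \<omega> in M. index_path \<beta> (F \<omega>) n \<in> increasing_paths"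
proof -
  define P where "P f \<longleftrightarrow> (\<forall>m. component_index f m \<le> component_index f (Suc m))" for f :: "nat list \<rightharpoonup> 'd"
  have [measurable]: "(\<lambda>f. component_index f m) \<in> (forest_space :: (nat list \<rightharpoonup> 'd) measure) \<rightarrow>\<^sub>M count_space UNIV" for m
    by (rule measurable_component_index)
  have P: "{f \<in> space forest_space. P f} \<in> sets (forest_space :: (nat list \<rightharpoonup> 'd) measure)"
    unfolding P_def by measurable
  have "AE f in GW_forest_law \<mu> x. P f"
    unfolding GW_forest_law_def AE_distr_iff[OF measurable_forest_of P]
  proof (rule AE_I2)
    fix T assume "T \<in> space (Pi\<^sub>M {1..} (\<lambda>k. GW_tree_law \<mu> (x k)))"
    then have T: "\<And>k. 1 \<le> k \<Longrightarrow> T k \<in> typed_trees" by (rule space_PiM_GW_tree_law)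
    show "P (forest_of T)" unfolding P_def using component_index_forest_mono[of T, OF T] by simp
  qed
  then have "AE \<omega> in M. P (F \<omega>)" unfolding law[symmetric] AE_distr_iff[OF F P] .
  then show ?thesis by eventually_elim (auto simp: P_def intro: index_path_increasing)
qed

section \<open>Joint Laplace transforms of the partial sums\<close>

text \<open>
  At step \<open>k\<close> of the walk, the levels with \<open>k \<le> K j\<close> are upward closed; exchanging the sums counts each
  level \<open>K j\<close> times.
\<close>

lemma sum_over_multiplicities:
  fixes h :: "nat \<Rightarrow> real" and K :: "nat \<Rightarrow> nat"
  assumes K: "mono_on {..<r} K" "\<And>j. j < r \<Longrightarrow> K j \<le> m" and h: "h 0 = 0"
  shows "(\<Sum>k\<in>{1..m}. h (card {j\<in>{..<r}. k \<le> K j})) = (\<Sum>j<r. real (K j) * (h (r - j) - h (r - Suc j)))"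
proof -
  have "(\<Sum>k\<in>{1..m}. h (card {j\<in>{..<r}. k \<le> K j}))
      = (\<Sum>k\<in>{1..m}. \<Sum>j<r. if k \<le> K j then h (r - j) - h (r - Suc j) else 0)"
  proof (rule sum.cong[OF refl])
    fix k
    have "(\<Sum>j\<in>{j\<in>{..<r}. k \<le> K j}. h (r - j) - h (r - Suc j)) = h (card {j\<in>{..<r}. k \<le> K j}) - h 0"
    proof (rule sum_tail_increments)
      fix i j assume ij: "i \<in> {j\<in>{..<r}. k \<le> K j}" "i \<le> j" "j < r"
      then have "K i \<le> K j" using K(1) by (auto simp: mono_on_def)
      then show "j \<in> {j\<in>{..<r}. k \<le> K j}" using ij by auto
    qed auto
    then show "h (card {j\<in>{..<r}. k \<le> K j}) = (\<Sum>j<r. if k \<le> K j then h (r - j) - h (r - Suc j) else 0)"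
      using sum.inter_filter[of "{..<r}" "\<lambda>j. h (r - j) - h (r - Suc j)" "\<lambda>j. k \<le> K j"] h by simp
  qed
  also have "\<dots> = (\<Sum>j<r. \<Sum>k\<in>{1..m}. if k \<le> K j then h (r - j) - h (r - Suc j) else 0)" by (rule sum.swap)
  also have "\<dots> = (\<Sum>j<r. real (K j) * (h (r - j) - h (r - Suc j)))"
  proof (rule sum.cong[OF refl])
    fix j assume "j \<in> {..<r}"
    then have "{k \<in> {1..m}. k \<le> K j} = {1..K j}" using K(2)[of j] by auto
    then show "(\<Sum>k\<in>{1..m}. if k \<le> K j then h (r - j) - h (r - Suc j) else 0) = real (K j) * (h (r - j) - h (r - Suc j))"
      using sum.inter_filter[of "{1..m}" "\<lambda>_. h (r - j) - h (r - Suc j)" "\<lambda>k. k \<le> K j"] by simp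
  qed
  finally show ?thesis .
qed

context offspring_asymptotics
begin

text \<open>
  The \<open>k\<close>-th tree contributes to the partial sums that contain it, so their joint Laplace transform is a
  product over the independent trees.
\<close>

lemma progeny_sums_laplace:
  fixes r m :: nat
  assumes \<theta>: "0 \<le> \<theta>" and K: "\<And>j. j < r \<Longrightarrow> K j \<le> m"
  shows "(\<integral>T. (\<Prod>j<r. exp (- (\<theta> * real (progeny_sum T (K j))))) \<partial>Pi\<^sub>M {1..} (\<lambda>_. GW_tree_law \<mu> i))
    = (\<Prod>k\<in>{1..m}. progeny_laplace i (\<theta> * real (card {j\<in>{..<r}. k \<le> K j})))"
proof -
  interpret P: product_prob_space "\<lambda>_. GW_tree_law \<mu> i" "{1..} :: nat set"
    by (rule product_prob_spaceI) (rule tree_prob)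
  define c where "c k = card {j\<in>{..<r}. k \<le> K j}" for k
  define H where "H x = (\<Prod>k\<in>{1..m}. exp (- (\<theta> * real (c k)) * real (card (dom (x k)))))"
    for x :: "nat \<Rightarrow> (nat list \<rightharpoonup> 'd)"
  have cardm: "(\<lambda>x. exp (- q * real (card (dom (x k))))) \<in> borel_measurable (Pi\<^sub>M {1..m} (\<lambda>_. GW_tree_law \<mu> i))"
    if "k \<in> {1..m}" for k q
    by (rule measurable_compose[OF measurable_component_singleton[OF that] progeny_laplace_measurable])
  have Hm: "H \<in> borel_measurable (Pi\<^sub>M {1..m} (\<lambda>_. GW_tree_law \<mu> i))"
    unfolding H_def by (intro borel_measurable_prod cardm)
  have eq: "(\<Prod>j<r. exp (- (\<theta> * real (progeny_sum T (K j))))) = H (restrict T {1..m})" for T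
  proof -
    have "(\<Sum>j<r. \<theta> * real (progeny_sum T (K j))) = (\<Sum>j<r. \<Sum>k\<in>{1..m}. if k \<le> K j then \<theta> * real (card (dom (T k))) else 0)"
    proof (rule sum.cong[OF refl])
      fix j assume "j \<in> {..<r}"
      then have "{k \<in> {1..m}. k \<le> K j} = {1..K j}" using K[of j] by auto
      then show "\<theta> * real (progeny_sum T (K j)) = (\<Sum>k\<in>{1..m}. if k \<le> K j then \<theta> * real (card (dom (T k))) else 0)"
        using sum.inter_filter[of "{1..m}" "\<lambda>k. \<theta> * real (card (dom (T k)))" "\<lambda>k. k \<le> K j"]
        by (simp add: progeny_sum_def sum_distrib_left)
    qed
    also have "\<dots> = (\<Sum>k\<in>{1..m}. \<Sum>j<r. if k \<le> K j then \<theta> * real (card (dom (T k))) else 0)" by (rule sum.swap)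
    also have "\<dots> = (\<Sum>k\<in>{1..m}. \<theta> * real (c k) * real (card (dom (T k))))"
    proof (rule sum.cong[OF refl])
      fix k
      show "(\<Sum>j<r. if k \<le> K j then \<theta> * real (card (dom (T k))) else 0) = \<theta> * real (c k) * real (card (dom (T k)))"
        using sum.inter_filter[of "{..<r}" "\<lambda>_. \<theta> * real (card (dom (T k)))" "\<lambda>j. k \<le> K j"] by (simp add: c_def mult_ac)
    qed
    finally have "(\<Sum>j<r. \<theta> * real (progeny_sum T (K j))) = (\<Sum>k\<in>{1..m}. \<theta> * real (c k) * real (card (dom (T k))))" .
    then show ?thesis by (simp add: H_def exp_sum[symmetric] sum_negf)
  qed
  have "(\<integral>T. H (restrict T {1..m}) \<partial>Pi\<^sub>M {1..} (\<lambda>_. GW_tree_law \<mu> i))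
      = (\<integral>x. H x \<partial>distr (Pi\<^sub>M {1..} (\<lambda>_. GW_tree_law \<mu> i)) (Pi\<^sub>M {1..m} (\<lambda>_. GW_tree_law \<mu> i)) (\<lambda>x. restrict x {1..m}))"
    by (rule integral_distr[OF measurable_restrict_subset Hm, symmetric]) auto
  also have "\<dots> = (\<integral>x. H x \<partial>Pi\<^sub>M {1..m} (\<lambda>_. GW_tree_law \<mu> i))"
    by (subst P.distr_PiM_restrict_finite) auto
  also have "\<dots> = (\<Prod>k\<in>{1..m}. \<integral>t. exp (- (\<theta> * real (c k)) * real (card (dom t))) \<partial>GW_tree_law \<mu> i)"
    unfolding H_def
  proof (rule P.product_integral_prod)
    note fin = prob_space.finite_measure[OF tree_prob[of i]]
    show "integrable (GW_tree_law \<mu> i) (\<lambda>t. exp (- (\<theta> * real (c k)) * real (card (dom t))))" for k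
      by (rule finite_measure.integrable_const_bound[OF fin, of _ 1, OF _ progeny_laplace_measurable]) (use \<theta> in auto)
  qed simp
  finally show ?thesis unfolding eq by (simp add: progeny_laplace_def c_def)
qed

text \<open>
  The same in logarithmic form, resummed over the levels. The limit is taken in each of the \<open>r\<close> terms.
\<close>

lemma progeny_sums_laplace_exp:
  fixes r :: nat
  assumes \<theta>: "0 \<le> \<theta>" and K: "mono_on {..<r} K"
  shows "(\<integral>T. (\<Prod>j<r. exp (- (\<theta> * real (progeny_sum T (K j))))) \<partial>Pi\<^sub>M {1..} (\<lambda>_. GW_tree_law \<mu> i))
    = exp (- (\<Sum>j<r. real (K j) * (- ln (progeny_laplace i (\<theta> * real (r - j)))
        - (- ln (progeny_laplace i (\<theta> * real (r - Suc j)))))))"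
proof -
  define m where "m = (\<Sum>j<r. K j)"
  have Km: "K j \<le> m" if "j < r" for j unfolding m_def using that by (intro member_le_sum) auto
  define h where "h c = - ln (progeny_laplace i (\<theta> * real c))" for c
  have "progeny_laplace i (\<theta> * real c) = exp (- h c)" for c
    using progeny_laplace_pos[of "\<theta> * real c" i] \<theta> by (simp add: h_def)
  note L = this
  have "(\<integral>T. (\<Prod>j<r. exp (- (\<theta> * real (progeny_sum T (K j))))) \<partial>Pi\<^sub>M {1..} (\<lambda>_. GW_tree_law \<mu> i))
      = (\<Prod>k\<in>{1..m}. progeny_laplace i (\<theta> * real (card {j\<in>{..<r}. k \<le> K j})))"
    by (rule progeny_sums_laplace[OF \<theta>]) (rule Km)
  also have "\<dots> = exp (- (\<Sum>k\<in>{1..m}. h (card {j\<in>{..<r}. k \<le> K j})))"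
    unfolding L by (simp only: exp_sum[OF finite_atLeastAtMost, symmetric] sum_negf)
  also have "(\<Sum>k\<in>{1..m}. h (card {j\<in>{..<r}. k \<le> K j})) = (\<Sum>j<r. real (K j) * (h (r - j) - h (r - Suc j)))"
    by (rule sum_over_multiplicities[OF K Km]) (simp_all add: h_def progeny_laplace_0)
  finally show ?thesis by (simp add: h_def)
qed

lemma floor_scaling_limit:
  assumes x: "0 \<le> x" and \<beta>: "0 < \<beta>"
  shows "(\<lambda>n. real (nat \<lfloor>x * real n powr \<beta>\<rfloor>) / real n powr \<beta>) \<longlonglongrightarrow> x"
proof -
  have inv: "(\<lambda>n. 1 / real n powr \<beta>) \<longlonglongrightarrow> 0"
  proof -
    have "(\<lambda>n. real n powr (- \<beta>)) \<longlonglongrightarrow> 0"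
      by (rule tendsto_neg_powr[OF _ filterlim_real_sequentially]) (use \<beta> in simp)
    then show ?thesis by (simp add: powr_minus_divide)
  qed
  have lo: "(\<lambda>n. x - 1 / real n powr \<beta>) \<longlonglongrightarrow> x" using tendsto_diff[OF tendsto_const inv] by simp
  have ev: "\<forall>\<^sub>F n in sequentially. x - 1 / real n powr \<beta> \<le> real (nat \<lfloor>x * real n powr \<beta>\<rfloor>) / real n powr \<beta>
      \<and> real (nat \<lfloor>x * real n powr \<beta>\<rfloor>) / real n powr \<beta> \<le> x"
    using eventually_gt_at_top[of 0]
  proof eventually_elim
    case (elim n)
    define y where "y = real n powr \<beta>"
    have y: "0 < y" using elim by (simp add: y_def)
    have "0 \<le> x * y" using x y by simp
    then have f: "x * y - 1 \<le> real (nat \<lfloor>x * y\<rfloor>)" "real (nat \<lfloor>x * y\<rfloor>) \<le> x * y" by linarith+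
    have "(x * y - 1) / y \<le> real (nat \<lfloor>x * y\<rfloor>) / y" using f(1) y by (intro divide_right_mono) auto
    moreover have "real (nat \<lfloor>x * y\<rfloor>) / y \<le> x" using f(2) y by (simp add: pos_divide_le_eq)
    ultimately show ?case using y unfolding y_def[symmetric] by (simp add: diff_divide_distrib)
  qed
  show ?thesis
    by (rule tendsto_sandwich[OF _ _ lo tendsto_const]) (use ev in \<open>auto elim: eventually_mono\<close>)
qed

lemma laplace_scaling_limit:
  "(\<lambda>n. real n powr (1 / \<alpha>0) * (- ln (progeny_laplace i (1 / real n * real c))))
    \<longlonglongrightarrow> b $ i / c_bar \<alpha> \<Lambda> a b * real c powr (1 / \<alpha>0)"
proof (cases "c = 0")
  case True
  then show ?thesis by (simp add: progeny_laplace_0)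
next
  case False
  define q where "q n = 1 / real (Suc n) * real c" for n
  have q0: "0 < q n" for n using False by (simp add: q_def)
  have "(\<lambda>n. inverse (real (Suc n)) * real c) \<longlonglongrightarrow> 0 * real c"
    by (intro tendsto_mult LIMSEQ_inverse_real_of_nat tendsto_const)
  then have "q \<longlonglongrightarrow> 0" by (simp add: q_def[abs_def] inverse_eq_divide)
  from tendsto_mult[OF progeny_laplace_asymptotics[OF this q0, of i] tendsto_const[of "real c powr (1 / \<alpha>0)"]]
  have "(\<lambda>n. - ln (progeny_laplace i (q n)) / q n powr (1 / \<alpha>0) * real c powr (1 / \<alpha>0))
      \<longlonglongrightarrow> b $ i / c_bar \<alpha> \<Lambda> a b * real c powr (1 / \<alpha>0)" .
  moreover have "- ln (progeny_laplace i (q n)) / q n powr (1 / \<alpha>0) * real c powr (1 / \<alpha>0)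
      = real (Suc n) powr (1 / \<alpha>0) * (- ln (progeny_laplace i (1 / real (Suc n) * real c)))" for n
  proof -
    have "q n powr (1 / \<alpha>0) = real c powr (1 / \<alpha>0) / real (Suc n) powr (1 / \<alpha>0)"
      unfolding q_def by (simp add: powr_divide del: of_nat_Suc)
    moreover have "real c powr (1 / \<alpha>0) \<noteq> 0" using False by simp
    ultimately show ?thesis by (simp add: q_def field_simps del: of_nat_Suc)
  qed
  ultimately have "(\<lambda>n. real (Suc n) powr (1 / \<alpha>0) * (- ln (progeny_laplace i (1 / real (Suc n) * real c))))
      \<longlonglongrightarrow> b $ i / c_bar \<alpha> \<Lambda> a b * real c powr (1 / \<alpha>0)" by (simp only:)
  then show ?thesis by (rule LIMSEQ_imp_Suc)
qed

lemma passage_laplace_limit: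
  assumes x: "\<And>j. j < r \<Longrightarrow> 0 \<le> x j" "mono_on {..<r} x"
  shows "(\<lambda>n. \<integral>T. (\<Prod>j<r. exp (- (real (progeny_sum T (nat \<lfloor>x j * real n powr (1 / \<alpha>0)\<rfloor>)) / real n)))
      \<partial>Pi\<^sub>M {1..} (\<lambda>_. GW_tree_law \<mu> i))
    \<longlonglongrightarrow> exp (- (\<Sum>j<r. ((real (r - j) powr (1 / \<alpha>0) - real (r - Suc j) powr (1 / \<alpha>0)) * (b $ i / c_bar \<alpha> \<Lambda> a b * x j))))"
proof -
  let ?\<beta> = "1 / \<alpha>0"
  have \<beta>: "0 < ?\<beta>" using alpha_min_bounds by simp
  define C where "C = b $ i / c_bar \<alpha> \<Lambda> a b"
  define K where "K n j = nat \<lfloor>x j * real n powr ?\<beta>\<rfloor>" for n j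
  define l where "l n c = - ln (progeny_laplace i (1 / real n * real c))" for n c
  have Kmono: "mono_on {..<r} (K n)" for n
  proof (rule mono_onI)
    fix j k assume "j \<in> {..<r}" "k \<in> {..<r}" "j \<le> k"
    then have "x j * real n powr ?\<beta> \<le> x k * real n powr ?\<beta>"
      using x(2) by (intro mult_right_mono) (auto simp: mono_on_def)
    then show "K n j \<le> K n k" unfolding K_def by (intro nat_mono floor_mono)
  qed
  have eq: "(\<integral>T. (\<Prod>j<r. exp (- (real (progeny_sum T (K n j)) / real n))) \<partial>Pi\<^sub>M {1..} (\<lambda>_. GW_tree_law \<mu> i))
      = exp (- (\<Sum>j<r. real (K n j) * (l n (r - j) - l n (r - Suc j))))" for n
    using progeny_sums_laplace_exp[where \<theta> = "1 / real n" and i = i, OF _ Kmono[of n]] by (simp add: l_def)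
  have lim: "(\<lambda>n. real (K n j) * l n c) \<longlonglongrightarrow> x j * (C * real c powr ?\<beta>)" if "j < r" for j c
  proof -
    have "(\<lambda>n. (real (K n j) / real n powr ?\<beta>) * (real n powr ?\<beta> * l n c)) \<longlonglongrightarrow> x j * (C * real c powr ?\<beta>)"
      unfolding K_def l_def C_def
      by (intro tendsto_mult[OF floor_scaling_limit[OF x(1)[OF that] \<beta>] laplace_scaling_limit])
    moreover have "\<forall>\<^sub>F n in sequentially. (real (K n j) / real n powr ?\<beta>) * (real n powr ?\<beta> * l n c) = real (K n j) * l n c"
      using eventually_gt_at_top[of 0] by eventually_elim simp
    ultimately show ?thesis by (rule Lim_transform_eventually)
  qed
  have "(\<lambda>n. exp (- (\<Sum>j<r. real (K n j) * (l n (r - j) - l n (r - Suc j)))))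
      \<longlonglongrightarrow> exp (- (\<Sum>j<r. x j * (C * real (r - j) powr ?\<beta>) - x j * (C * real (r - Suc j) powr ?\<beta>)))"
    unfolding right_diff_distrib by (intro tendsto_intros lim) auto
  also have "(\<Sum>j<r. x j * (C * real (r - j) powr ?\<beta>) - x j * (C * real (r - Suc j) powr ?\<beta>))
      = (\<Sum>j<r. (real (r - j) powr ?\<beta> - real (r - Suc j) powr ?\<beta>) * (C * x j))"
    by (rule sum.cong) (auto simp: algebra_simps)
  finally show ?thesis unfolding eq[symmetric] unfolding K_def C_def .
qed

end

section \<open>The running infimum of a cadlag path\<close>

lemma oscillation_chain_bounded:
  assumes "oscillation_chain y \<epsilon> b" shows "\<exists>B. \<forall>t\<in>{0..<b}. \<bar>y t\<bar> \<le> B"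
  using assms
proof (induction rule: oscillation_chain.induct)
  case (extend a b)
  then obtain B where B: "\<And>t. t \<in> {0..<a} \<Longrightarrow> \<bar>y t\<bar> \<le> B" by blast
  have "\<bar>y t\<bar> \<le> max B (\<bar>y a\<bar> + \<epsilon>)" if t: "t \<in> {0..<b}" for t
  proof (cases "t < a")
    case True
    then show ?thesis using B[of t] t by simp
  next
    case False
    then have "\<bar>y t - y a\<bar> \<le> \<epsilon>" using extend.hyps t by auto
    then show ?thesis by simp
  qed
  then show ?case by blast
qed simp

lemma cadlag_bounded_below:
  assumes "cadlag y" shows "bdd_below (y ` {0..s})"
proof -
  obtain b where b: "b > s" "oscillation_chain y 1 b"
    using cadlag_oscillation_chain[OF assms, of 1 s] by auto
  obtain B where B: "\<And>t. t \<in> {0..<b} \<Longrightarrow> \<bar>y t\<bar> \<le> B" using oscillation_chain_bounded[OF b(2)] by blast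
  show ?thesis
  proof (rule bdd_belowI2[of _ "- B"])
    fix t assume "t \<in> {0..s}"
    then show "- B \<le> y t" using B[of t] b(1) by auto
  qed
qed

lemma cadlag_of_nondecreasing:
  assumes mono: "\<And>s t. 0 \<le> s \<Longrightarrow> s \<le> t \<Longrightarrow> z s \<le> (z t :: real)"
    and right: "\<And>t. 0 \<le> t \<Longrightarrow> (z \<longlongrightarrow> z t) (at_right t)"
  shows "cadlag z"
proof -
  have "\<exists>l. (z \<longlongrightarrow> l) (at_left t)" if t: "0 < t" for t
  proof -
    let ?l = "SUP s\<in>{0..<t}. z s"
    have bdd: "bdd_above (z ` {0..<t})" by (rule bdd_aboveI2[of _ _ "z t"]) (use mono in auto)
    have "(z \<longlongrightarrow> ?l) (at_left t)"
    proof (rule order_tendstoI)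
      fix a assume "a < ?l"
      then obtain s where s: "s \<in> {0..<t}" "a < z s"
        using less_cSUP_iff[of "{0..<t}" z a] bdd t by auto
      show "\<forall>\<^sub>F u in at_left t. a < z u"
      proof (rule eventually_at_leftI[of s])
        fix u assume "u \<in> {s<..<t}"
        then have "z s \<le> z u" using s(1) by (intro mono) auto
        then show "a < z u" using s(2) by simp
      qed (use s(1) in simp)
    next
      fix a assume a: "?l < a"
      show "\<forall>\<^sub>F u in at_left t. z u < a"
      proof (rule eventually_at_leftI[of 0])
        fix u assume "u \<in> {0<..<t}"
        then have "z u \<le> ?l" by (intro cSUP_upper bdd) auto
        then show "z u < a" using a by simp
      qed (rule t)
    qed
    then show ?thesis by blast
  qed
  then show ?thesis using right by (auto simp: cadlag_def continuous_within)
qed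

definition path_infimum :: "(real \<Rightarrow> real) \<Rightarrow> real \<Rightarrow> real" where
  "path_infimum y s = (INF r\<in>{0..s}. y r)"

context
  fixes y :: "real \<Rightarrow> real"
  assumes y: "cadlag y"
begin

lemma path_infimum_le: "0 \<le> r \<Longrightarrow> r \<le> s \<Longrightarrow> path_infimum y s \<le> y r"
  unfolding path_infimum_def by (rule cINF_lower[OF cadlag_bounded_below[OF y]]) auto

lemma path_infimum_ge: "0 \<le> s \<Longrightarrow> (\<And>r. 0 \<le> r \<Longrightarrow> r \<le> s \<Longrightarrow> c \<le> y r) \<Longrightarrow> c \<le> path_infimum y s"
  unfolding path_infimum_def by (rule cINF_greatest) auto

lemma path_infimum_antimono: "0 \<le> s \<Longrightarrow> s \<le> t \<Longrightarrow> path_infimum y t \<le> path_infimum y s"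
  by (rule path_infimum_ge) (auto intro: path_infimum_le)

lemma path_infimum_less_iff:
  assumes "0 \<le> s" shows "path_infimum y s < c \<longleftrightarrow> (\<exists>r. 0 \<le> r \<and> r \<le> s \<and> y r < c)"
  unfolding path_infimum_def
  using cINF_less_iff[OF _ cadlag_bounded_below[OF y], of s c] assms by auto

lemma path_infimum_right_continuous:
  assumes t: "0 \<le> t" shows "(path_infimum y \<longlongrightarrow> path_infimum y t) (at_right t)"
proof (rule order_tendstoI)
  fix a assume a: "a < path_infimum y t"
  define c where "c = (a + path_infimum y t) / 2"
  have c: "a < c" "c < path_infimum y t" using a by (auto simp: c_def)
  have "c < y t" using c(2) path_infimum_le[OF t order_refl] by simp
  then have "\<forall>\<^sub>F u in at_right t. c < y u" using cadlag_right[OF y t] by (intro order_tendstoD(1))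
  then obtain b where b: "t < b" "\<And>u. t < u \<Longrightarrow> u < b \<Longrightarrow> c < y u"
    unfolding eventually_at_right_field by blast
  show "\<forall>\<^sub>F u in at_right t. a < path_infimum y u"
  proof (rule eventually_at_rightI[OF _ b(1)])
    fix u assume u: "u \<in> {t<..<b}"
    have "c \<le> path_infimum y u"
    proof (rule path_infimum_ge)
      fix r assume r: "0 \<le> r" "r \<le> u"
      show "c \<le> y r"
      proof (cases "r \<le> t")
        case True
        then show ?thesis using path_infimum_le[OF r(1) True] c(2) by simp
      next
        case False
        then show ?thesis using b(2)[of r] r u by auto
      qed
    qed (use u t in auto)
    then show "a < path_infimum y u" using c(1) by simp
  qed
next
  fix a assume a: "path_infimum y t < a"
  show "\<forall>\<^sub>F u in at_right t. path_infimum y u < a"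
    using eventually_at_right_less[of t]
  proof eventually_elim
    case (elim u)
    then show ?case using path_infimum_antimono[OF t, of u] a by simp
  qed
qed

text \<open>
  Left-continuity is where the absence of negative jumps enters: a path that is at least \<open>a\<close> before \<open>t\<close> has
  a left limit at least \<open>a\<close>, and its value at \<open>t\<close> is not smaller.
\<close>

lemma path_infimum_continuous:
  assumes jumps: "\<forall>t>0. \<forall>l. (y \<longlongrightarrow> l) (at_left t) \<longrightarrow> l \<le> y t"
  shows "continuous_on {0..} (path_infimum y)"
  unfolding continuous_on_def
proof (rule ballI)
  fix t :: real assume "t \<in> {0..}"
  then have t: "0 \<le> t" by simp
  have left: "(path_infimum y \<longlongrightarrow> path_infimum y t) (at_left t)" if t0: "0 < t"
  proof (rule order_tendstoI)
    fix a assume a: "a < path_infimum y t"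
    show "\<forall>\<^sub>F u in at_left t. a < path_infimum y u"
    proof (rule eventually_at_leftI[OF _ t0])
      fix u assume "u \<in> {0<..<t}"
      then show "a < path_infimum y u" using path_infimum_antimono[of u t] a by auto
    qed
  next
    fix a assume a: "path_infimum y t < a"
    have "\<exists>s. 0 \<le> s \<and> s < t \<and> y s < a"
    proof (rule ccontr)
      assume "\<not> ?thesis"
      then have above: "a \<le> y s" if "0 \<le> s" "s < t" for s using that by (meson not_le)
      obtain l where l: "(y \<longlongrightarrow> l) (at_left t)" using y t0 by (auto simp: cadlag_def)
      have "\<forall>\<^sub>F s in at_left t. a \<le> y s" by (rule eventually_at_leftI[OF _ t0]) (auto intro: above)
      then have "a \<le> l" by (intro tendsto_lowerbound[OF l]) auto
      then have "a \<le> y t" using jumps t0 l by force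
      then have "a \<le> path_infimum y t" using above t by (intro path_infimum_ge) (auto simp: le_less)
      then show False using a by simp
    qed
    then obtain s where s: "0 \<le> s" "s < t" "y s < a" by blast
    show "\<forall>\<^sub>F u in at_left t. path_infimum y u < a"
    proof (rule eventually_at_leftI[OF _ s(2)])
      fix u assume "u \<in> {s<..<t}"
      then show "path_infimum y u < a" using path_infimum_le[OF s(1), of u] s(3) by auto
    qed
  qed
  show "(path_infimum y \<longlongrightarrow> path_infimum y t) (at t within {0..})"
  proof (cases "t = 0")
    case True
    have "at t within {0..} = at_right t" unfolding True by (rule at_within_Ici_at_right)
    then show ?thesis using path_infimum_right_continuous[OF t] by simp
  next
    case False
    then have "0 < t" using t by simp
    then have "(path_infimum y \<longlongrightarrow> path_infimum y t) (at t)"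
      using left path_infimum_right_continuous[OF t] by (simp add: filterlim_at_split)
    then show ?thesis by (rule tendsto_within_subset) simp
  qed
qed

lemma path_infimum_eq_rational:
  assumes s: "0 \<le> s" shows "path_infimum y s = (INF r\<in>insert s (\<rat> \<inter> {0..s}). y r)"
proof (rule antisym)
  have sub: "insert s (\<rat> \<inter> {0..s}) \<subseteq> {0..s}" using s by auto
  have bdd: "bdd_below (y ` insert s (\<rat> \<inter> {0..s}))"
    by (rule bdd_below_mono[OF cadlag_bounded_below[OF y] image_mono[OF sub]])
  show "path_infimum y s \<le> (INF r\<in>insert s (\<rat> \<inter> {0..s}). y r)"
    by (rule cINF_greatest) (use s path_infimum_le in auto)
  show "(INF r\<in>insert s (\<rat> \<inter> {0..s}). y r) \<le> path_infimum y s"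
  proof (rule path_infimum_ge[OF s])
    fix r assume r: "0 \<le> r" "r \<le> s"
    show "(INF r\<in>insert s (\<rat> \<inter> {0..s}). y r) \<le> y r"
    proof (cases "r = s")
      case True then show ?thesis by (intro cINF_lower bdd) simp
    next
      case False
      show ?thesis
      proof (rule dense_ge)
        fix c assume "y r < c"
        then have "\<forall>\<^sub>F u in at_right r. y u < c" using cadlag_right[OF y r(1)] by (intro order_tendstoD(2))
        then obtain b where b: "r < b" "\<And>u. r < u \<Longrightarrow> u < b \<Longrightarrow> y u < c"
          unfolding eventually_at_right_field by blast
        obtain u where u: "u \<in> \<rat>" "r < u" "u < min b s"
          using Rats_dense_in_real[of r "min b s"] b(1) r False by auto
        have "(INF r\<in>insert s (\<rat> \<inter> {0..s}). y r) \<le> y u" by (intro cINF_lower bdd) (use u r in auto)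
        then show "(INF r\<in>insert s (\<rat> \<inter> {0..s}). y r) \<le> c" using b(2)[of u] u by simp
      qed
    qed
  qed
qed

text \<open>
  The running infimum is below \<open>-x\<close> from the first time on at which the path is. Thus passage times of
  the limit process are hitting times of the stable process.
\<close>

lemma passage_scaled_infimum:
  assumes \<kappa>: "0 < \<kappa>"
  shows "passage (\<lambda>s\<in>{0..}. - \<kappa> * path_infimum y s) r = hit_discount y (level r / \<kappa>)"
proof -
  have iff: "level r < (\<lambda>s\<in>{0..}. - \<kappa> * path_infimum y s) s \<longleftrightarrow> (\<exists>u. 0 \<le> u \<and> u \<le> s \<and> y u < - (level r / \<kappa>))"
    if "0 \<le> s" for s
  proof -
    have "level r < - \<kappa> * path_infimum y s \<longleftrightarrow> path_infimum y s < - (level r / \<kappa>)"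
    proof -
      have "path_infimum y s < - (level r / \<kappa>) \<longleftrightarrow> path_infimum y s * \<kappa> < - level r"
        using pos_less_divide_eq[OF \<kappa>, of "path_infimum y s" "- level r"] by simp
      then show ?thesis by (simp add: mult.commute) linarith
    qed
    then show ?thesis using path_infimum_less_iff[OF that] that by simp
  qed
  have ge: "exp (- s) \<le> hit_discount y x" if "0 \<le> s" "y s < - x" for s x
    unfolding hit_discount_def by (rule cSUP_upper2[where x = s, OF hit_discount_bdd]) (use that in auto)
  have nn: "0 \<le> hit_discount y x" for x
    unfolding hit_discount_def by (rule cSUP_upper2[where x = 0, OF hit_discount_bdd]) auto
  show ?thesis
  proof (rule antisym)
    show "passage (\<lambda>s\<in>{0..}. - \<kappa> * path_infimum y s) r \<le> hit_discount y (level r / \<kappa>)"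
    proof (rule passage_le[OF nn])
      fix s :: real assume s: "0 \<le> s" "level r < (\<lambda>s\<in>{0..}. - \<kappa> * path_infimum y s) s"
      then obtain u where u: "0 \<le> u" "u \<le> s" "y u < - (level r / \<kappa>)" using iff by blast
      have "exp (- s) \<le> exp (- u)" using u by simp
      also have "\<dots> \<le> hit_discount y (level r / \<kappa>)" by (rule ge[OF u(1,3)])
      finally show "exp (- s) \<le> hit_discount y (level r / \<kappa>)" .
    qed
    show "hit_discount y (level r / \<kappa>) \<le> passage (\<lambda>s\<in>{0..}. - \<kappa> * path_infimum y s) r"
      unfolding hit_discount_def
    proof (rule cSUP_least)
      fix s :: real assume s: "s \<in> {0..}"
      show "(if y s < - (level r / \<kappa>) then exp (- s) else 0) \<le> passage (\<lambda>s\<in>{0..}. - \<kappa> * path_infimum y s) r"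
        using passage_unit[of "\<lambda>s\<in>{0..}. - \<kappa> * path_infimum y s" r] s iff[of s]
        by (auto intro!: passage_ge)
    qed simp
  qed
qed

lemma scaled_infimum_skorohod:
  assumes \<kappa>: "0 < \<kappa>"
  shows "(\<lambda>s\<in>{0..}. - \<kappa> * path_infimum y s) \<in> skorohod_space"
proof -
  have "cadlag (\<lambda>s\<in>{0..}. - \<kappa> * path_infimum y s)"
  proof (rule cadlag_of_nondecreasing)
    fix s t :: real assume st: "0 \<le> s" "s \<le> t"
    then have "\<kappa> * path_infimum y t \<le> \<kappa> * path_infimum y s"
      using path_infimum_antimono[OF st] \<kappa> by (intro mult_left_mono) auto
    then show "(\<lambda>s\<in>{0..}. - \<kappa> * path_infimum y s) s \<le> (\<lambda>s\<in>{0..}. - \<kappa> * path_infimum y s) t" using st by simp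
  next
    fix t :: real assume t: "0 \<le> t"
    have "((\<lambda>s. - \<kappa> * path_infimum y s) \<longlongrightarrow> - \<kappa> * path_infimum y t) (at_right t)"
      by (intro tendsto_intros path_infimum_right_continuous t)
    moreover have "\<forall>\<^sub>F s in at_right t. - \<kappa> * path_infimum y s = (\<lambda>s\<in>{0..}. - \<kappa> * path_infimum y s) s"
      using eventually_at_right_less[of t] by eventually_elim (use t in simp)
    ultimately show "((\<lambda>s\<in>{0..}. - \<kappa> * path_infimum y s) \<longlongrightarrow> (\<lambda>s\<in>{0..}. - \<kappa> * path_infimum y s) t) (at_right t)"
      using t by (auto elim: Lim_transform_eventually)
  qed
  then show ?thesis by (simp add: skorohod_space_def)
qed

end

lemma measurable_path_infimum:
  assumes Y: "\<And>t. 0 \<le> t \<Longrightarrow> (\<lambda>\<omega>. Y t \<omega>) \<in> borel_measurable N"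
    and cadlag: "\<And>\<omega>. \<omega> \<in> space N \<Longrightarrow> cadlag (\<lambda>t. Y t \<omega>)" and s: "0 \<le> s"
  shows "(\<lambda>\<omega>. path_infimum (\<lambda>t. Y t \<omega>) s) \<in> borel_measurable N"
proof -
  have "(\<lambda>\<omega>. INF r\<in>insert s (\<rat> \<inter> {0..s}). Y r \<omega>) \<in> borel_measurable N"
  proof (rule borel_measurable_cINF)
    show "countable (insert s (\<rat> \<inter> {0..s}))" by (simp add: countable_rat)
    show "Y r \<in> borel_measurable N" if "r \<in> insert s (\<rat> \<inter> {0..s})" for r
      using that s by (intro Y) auto
    show "bdd_below ((\<lambda>r. Y r \<omega>) ` insert s (\<rat> \<inter> {0..s}))" if "\<omega> \<in> space N" for \<omega>
      by (rule bdd_below_mono[OF cadlag_bounded_below[OF cadlag[OF that], of s]]) (use s in auto)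
  qed
  then show ?thesis
    by (rule measurable_cong[THEN iffD1, rotated]) (rule path_infimum_eq_rational[OF cadlag s, symmetric])
qed

section \<open>Convergence of the component index\<close>

theorem theorem2:
  fixes \<mu> :: "'d::finite \<Rightarrow> (nat ^ 'd) pmf"
    and \<Delta> :: "'d set" and \<alpha> :: "'d \<Rightarrow> real" and \<Lambda> :: "'d \<Rightarrow> (real ^ 'd) measure"
    and a b :: "real ^ 'd" and i :: 'd
    and M :: "'w measure" and F :: "'w \<Rightarrow> (nat list \<rightharpoonup> 'd)"
    and N :: "'v measure" and Y :: "real \<Rightarrow> 'v \<Rightarrow> real"
  assumes "main_assumptions \<mu> \<Delta> \<alpha> \<Lambda>"
    and "normalized_eigenvectors (mean_matrix \<mu>) a b"
    and "prob_space M"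
    and "F \<in> M \<rightarrow>\<^sub>M forest_space"
    and "distr M forest_space F = GW_forest_law \<mu> (\<lambda>_. i)"
    and "stable_spectrally_positive_process N Y (alpha_min \<alpha>)"
  shows "converges_in_distribution skorohod_topology
    M (\<lambda>n \<omega>. \<lambda>s\<in>{0..}.
        1 / real n powr (1 / alpha_min \<alpha>) * real (component_index (F \<omega>) (nat \<lfloor>real n * s\<rfloor>)))
    N (\<lambda>\<omega>. \<lambda>s\<in>{0..}. - (c_bar \<alpha> \<Lambda> a b / b $ i) * running_infimum Y s \<omega>)"
proof -
  interpret O: offspring_asymptotics \<mu> \<Delta> \<alpha> \<Lambda> a b
    by standard (fact assms(1,2))+
  interpret S: stable_process N Y "alpha_min \<alpha>"
    by standard (use assms(6) O.alpha_min_bounds in auto)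
  define \<beta> where "\<beta> = 1 / alpha_min \<alpha>"
  define \<kappa> where "\<kappa> = c_bar \<alpha> \<Lambda> a b / b $ i"
  have \<kappa>: "0 < \<kappa>" using O.c_bar_pos O.right_eigenvector(2) by (simp add: \<kappa>_def)
  define Z where "Z \<omega> = (\<lambda>s\<in>{0..}. - \<kappa> * path_infimum (\<lambda>t. Y t \<omega>) s)" for \<omega>
  have Z_sk: "Z \<omega> \<in> skorohod_space" if "\<omega> \<in> space N" for \<omega>
    unfolding Z_def by (rule scaled_infimum_skorohod[OF S.Y_cadlag[OF that] \<kappa>])
  have Z_meas: "(\<lambda>\<omega>. Z \<omega> t) \<in> borel_measurable N" if "0 \<le> t" for t
    using measurable_path_infimum[OF S.Y_measurable S.Y_cadlag that] that by (simp add: Z_def)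
  have Z_passage: "passage (Z \<omega>) r = hit_discount (\<lambda>t. Y t \<omega>) (level r / \<kappa>)" if "\<omega> \<in> space N" for \<omega> r
    unfolding Z_def by (rule passage_scaled_infimum[OF S.Y_cadlag[OF that] \<kappa>])
  have Z_path: "AE \<omega> in N. Z \<omega> \<in> increasing_paths \<and> continuous_on {0..} (Z \<omega>) \<and> Z \<omega> 0 = 0"
    using S.Y_0 S.Y_no_negative_jumps AE_space
  proof eventually_elim
    case (elim \<omega>)
    note y = S.Y_cadlag[OF elim(3)]
    let ?I = "path_infimum (\<lambda>t. Y t \<omega>)"
    have Z0: "Z \<omega> 0 = 0" using elim(1) by (simp add: Z_def path_infimum_def)
    have mono: "Z \<omega> s \<le> Z \<omega> t" if "0 \<le> s" "s \<le> t" for s t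
    proof -
      have "\<kappa> * ?I t \<le> \<kappa> * ?I s" using path_infimum_antimono[OF y that] \<kappa> by (intro mult_left_mono) auto
      then show ?thesis using that by (simp add: Z_def)
    qed
    have "Z \<omega> \<in> increasing_paths"
      using Z_sk[OF elim(3)] mono mono[of 0] Z0 by (auto simp: increasing_paths_def mono_on_def)
    moreover have "continuous_on {0..} (\<lambda>s. - \<kappa> * ?I s)"
      by (intro continuous_intros path_infimum_continuous[OF y elim(2)])
    then have "continuous_on {0..} (Z \<omega>)"
      by (rule continuous_on_cong[THEN iffD1, rotated 2]) (simp_all add: Z_def)
    ultimately show ?case using Z0 by blast
  qed
  have lim: "(\<lambda>n. \<integral>\<omega>. prod_list (map (passage (index_path \<beta> (F \<omega>) n)) js) \<partial>M)
      \<longlonglongrightarrow> (\<integral>\<omega>. prod_list (map (passage (Z \<omega>)) js) \<partial>N)" for js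
  proof -
    \<comment> \<open>The monomial is symmetric, and the Laplace transforms are stated for sorted levels.\<close>
    define ls where "ls = sort_key level js"
    define r where "r = length ls"
    define x where "x j = level (ls ! j)" for j
    have x0: "0 \<le> x j" for j by (simp add: x_def)
    have xmono: "mono_on {..<r} x"
    proof (rule mono_onI)
      fix j k assume jk: "j \<in> {..<r}" "k \<in> {..<r}" "j \<le> k"
      have "sorted (map level ls)" by (simp add: ls_def)
      from sorted_nth_mono[OF this jk(3)] show "x j \<le> x k" using jk by (simp add: x_def r_def)
    qed
    have prod_sort: "prod_list (map u js) = (\<Prod>j<r. u (ls ! j))" for u :: "rat \<Rightarrow> real"
    proof -
      have "prod_list (map u js) = prod_list (map u ls)"
        unfolding ls_def by (simp flip: prod_mset_prod_list)
      also have "\<dots> = (\<Prod>j<r. u (ls ! j))"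
        unfolding r_def by (induction ls) (auto simp: prod.lessThan_Suc_shift simp del: prod.lessThan_Suc)
      finally show ?thesis .
    qed
    define L where "L = exp (- (\<Sum>j<r. power_increment \<beta> r j * (x j / \<kappa>)))"
    have "(\<lambda>n. \<integral>T. (\<Prod>j<r. exp (- (real (progeny_sum T (nat \<lfloor>x j * real n powr \<beta>\<rfloor>)) / real n)))
        \<partial>Pi\<^sub>M {1..} (\<lambda>_. GW_tree_law \<mu> i)) \<longlonglongrightarrow> L"
      using O.passage_laplace_limit[OF x0 xmono, of i]
      by (simp add: L_def \<beta>_def \<kappa>_def power_increment_def mult.commute)
    moreover have "\<forall>\<^sub>F n in sequentially.
        (\<integral>T. (\<Prod>j<r. exp (- (real (progeny_sum T (nat \<lfloor>x j * real n powr \<beta>\<rfloor>)) / real n))) \<partial>Pi\<^sub>M {1..} (\<lambda>_. GW_tree_law \<mu> i))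
        = (\<integral>\<omega>. prod_list (map (passage (index_path \<beta> (F \<omega>) n)) js) \<partial>M)"
      using eventually_gt_at_top[of 0]
    proof eventually_elim
      case (elim n)
      have "(\<integral>\<omega>. (\<Prod>j<r. passage (index_path \<beta> (F \<omega>) n) (ls ! j)) \<partial>M)
          = (\<integral>T. (\<Prod>j<r. passage (index_path \<beta> (forest_of T) n) (ls ! j)) \<partial>Pi\<^sub>M {1..} (\<lambda>_. GW_tree_law \<mu> i))"
        by (rule GW_forest_expectation[OF assms(4,5)])
           (intro borel_measurable_prod measurable_passage_index_path)
      also have "\<dots> = (\<integral>T. (\<Prod>j<r. exp (- (real (progeny_sum T (nat \<lfloor>x j * real n powr \<beta>\<rfloor>)) / real n))) \<partial>Pi\<^sub>M {1..} (\<lambda>_. GW_tree_law \<mu> i))"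
      proof (rule Bochner_Integration.integral_cong[OF refl])
        fix T :: "nat \<Rightarrow> nat list \<rightharpoonup> 'd"
        assume "T \<in> space (Pi\<^sub>M {1..} (\<lambda>_. GW_tree_law \<mu> i))"
        then have T: "\<And>k. 1 \<le> k \<Longrightarrow> T k \<in> typed_trees" by (rule space_PiM_GW_tree_law)
        show "(\<Prod>j<r. passage (index_path \<beta> (forest_of T) n) (ls ! j))
          = (\<Prod>j<r. exp (- (real (progeny_sum T (nat \<lfloor>x j * real n powr \<beta>\<rfloor>)) / real n)))"
          unfolding x_def by (intro prod.cong refl passage_index_path[OF T elim])
      qed
      finally show ?case by (simp add: prod_sort)
    qed
    ultimately have "(\<lambda>n. \<integral>\<omega>. prod_list (map (passage (index_path \<beta> (F \<omega>) n)) js) \<partial>M) \<longlonglongrightarrow> L"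
      by (rule Lim_transform_eventually)
    moreover have "(\<integral>\<omega>. prod_list (map (passage (Z \<omega>)) js) \<partial>N) = L"
    proof -
      have "(\<integral>\<omega>. prod_list (map (passage (Z \<omega>)) js) \<partial>N) = (\<integral>\<omega>. (\<Prod>j<r. hit_discount (\<lambda>t. Y t \<omega>) (x j / \<kappa>)) \<partial>N)"
        by (rule Bochner_Integration.integral_cong[OF refl]) (simp add: prod_sort Z_passage x_def)
      also have "\<dots> = L"
        unfolding L_def \<beta>_def
      proof (rule S.hitting_times_laplace)
        show "0 \<le> x j / \<kappa>" for j using x0[of j] \<kappa> by simp
        show "mono_on {..<r} (\<lambda>j. x j / \<kappa>)"
          using xmono \<kappa> by (auto simp: mono_on_def divide_right_mono)
        fix j
        have "(\<lambda>\<omega>. passage (Z \<omega>) (ls ! j)) \<in> borel_measurable N"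
          by (rule measurable_passage) (use Z_sk Z_meas in \<open>auto simp: skorohod_space_def\<close>)
        then show "(\<lambda>\<omega>. hit_discount (\<lambda>t. Y t \<omega>) (x j / \<kappa>)) \<in> borel_measurable N"
          by (rule measurable_cong[THEN iffD1, rotated]) (simp add: Z_passage x_def)
      qed
      finally show ?thesis .
    qed
    ultimately show ?thesis by simp
  qed
  have "converges_in_distribution skorohod_topology M (\<lambda>n \<omega>. index_path \<beta> (F \<omega>) n) N Z"
  proof (rule converges_in_distribution_passage[OF assms(3) S.prob_space_axioms _ _ _ Z_sk Z_meas Z_path lim])
    show "index_path \<beta> (F \<omega>) n \<in> skorohod_space" for n \<omega>
      by (simp add: index_path_def step_path_in_skorohod)
    show "(\<lambda>\<omega>. index_path \<beta> (F \<omega>) n t) \<in> borel_measurable M" if "0 \<le> t" for n t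
      by (rule measurable_compose[OF assms(4) measurable_index_path[OF that]])
    show "AE \<omega> in M. index_path \<beta> (F \<omega>) n \<in> increasing_paths" for n
      by (rule GW_forest_AE_increasing[OF assms(4,5)])
  qed
  then show ?thesis
    by (simp add: index_path_def[abs_def] step_path_def Z_def[abs_def] \<beta>_def \<kappa>_def path_infimum_def running_infimum_def)
qed

end
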